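(* Let $k$ be a $\Gamma$-graded field, $\Gamma=\mathbb R_{>0}$, such that the field $k_1$ has characteristic $p>0$. Let $n\ge 1$, $\ell=k^{p^{-n}}$, $r\in\Gamma$ and $B=k[r^{-1}T]$. (1) Let $s\in\rho(\ell^\times)r$, and let $$f(T_1)=a_0T_1+a_1T_1^p+\cdots+a_mT_1^{p^m}\in k[r^{-p^n}T_1]$$ be a $p$-polynomial which is homogeneous of degree $s^{p^n}$, with $a_0\ne 0$. Then the graded Hopf $k$-algebra $$A:=k[r^{-p^n}T_1,s^{-1}T_2]/(T_2^{p^n}-f(T_1))$$ is a graded form of $B$ with respect to $\ell/k$. (2) Conversely, any graded Hopf $k$-algebra which is a graded form of $B$ with respect to $\ell/k$ is of this type, i.e. is isomorphic as a graded Hopf $k$-algebra to an algebra $A$ as in (1) for some $s$ and $f$ as in (1).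
   Context: $\Gamma=\mathbb R_{>0}$ as a multiplicative group; all graded rings are commutative and $\Gamma$-graded, $A=\bigoplus_{\gamma\in\Gamma}A_\gamma$, and graded homomorphisms have degree $1$ (i.e. map $A_\gamma$ to $B_\gamma$). For a graded ring $A$, $A^\times$ is the group of invertible homogeneous elements, and $\rho$ sends a nonzero homogeneous element to its degree. A graded field is a nonzero graded ring in which every nonzero homogeneous element is invertible. For $r_1,\dots,r_N\in\Gamma$, $A[r_1^{-1}T_1,\dots,r_N^{-1}T_N]$ is the polynomial ring $A[T_1,\dots,T_N]$ graded so that elements of $A$ keep their degree and $T_i$ is homogeneous of degree $r_i$. Let $\bar k$ be a graded algebraic closure of $k$. Then $\ell=k^{p^{-n}}$ is the graded subfield of $\bar k$ consisting of all $x\in\bar k$ with $x^{p^n}\in k$ (a purely inseparable, possibly infinite, extension of graded fields). A graded form of $B$ with respect to $\ell/k$ is a graded $k$-algebra $A$ such that $\ell\otimes_kA\cong\ell\otimes_kB$ as graded $\ell$-algebras (tensor product gradings, degree $1$ isomorphism). A graded Hopf $k$-algebra is a graded $k$-algebra which is a (commutative) Hopf algebra over the ring $k$ in the usual sense and whose comultiplication, inverse (antipode) and augmentation (counit) are graded homomorphisms of degree $1$. The algebra $A$ in (1) carries the Hopf structure inherited from the two-dimensional additive group with unit element $T_1=T_2=0$, i.e. $c(T_i)=1\otimes T_i+T_i\otimes 1$, antipode $T_i\mapsto -T_i$, augmentation $T_i\mapsto 0$ for $i=1,2$. *)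

theory Defs
  imports Complex_Main "HOL-Algebra.Free_Abelian_Groups" "HOL-Algebra.QuotRing" "HOL-Algebra.UnivPoly"
begin

section \<open>Graded rings and graded algebras\<close>

text \<open>
  The grading group is the multiplicative group of positive reals. A grading is a family
  \<^term>\<open>G :: real \<Rightarrow> 'a set\<close> of which only the values at positive reals matter.
\<close>

definition graded_ring :: "('a, 'm) ring_scheme \<Rightarrow> (real \<Rightarrow> 'a set) \<Rightarrow> bool" where
  "graded_ring R G \<longleftrightarrow>
     cring R \<and>
     (\<forall>\<gamma>>0. additive_subgroup (G \<gamma>) R) \<and>
     (\<forall>\<alpha>>0. \<forall>\<beta>>0. \<forall>x\<in>G \<alpha>. \<forall>y\<in>G \<beta>. x \<otimes>\<^bsub>R\<^esub> y \<in> G (\<alpha> * \<beta>)) \<and>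
     (\<forall>x\<in>carrier R. \<exists>!c. (\<forall>\<gamma>>0. c \<gamma> \<in> G \<gamma>) \<and> (\<forall>\<gamma>\<le>0. c \<gamma> = \<zero>\<^bsub>R\<^esub>) \<and>
        finite {\<gamma>. c \<gamma> \<noteq> \<zero>\<^bsub>R\<^esub>} \<and> x = finsum R c {\<gamma>. c \<gamma> \<noteq> \<zero>\<^bsub>R\<^esub>})"

definition graded_field :: "('a, 'm) ring_scheme \<Rightarrow> (real \<Rightarrow> 'a set) \<Rightarrow> bool" where
  "graded_field R G \<longleftrightarrow>
     graded_ring R G \<and> \<one>\<^bsub>R\<^esub> \<noteq> \<zero>\<^bsub>R\<^esub> \<and> (\<forall>\<gamma>>0. \<forall>x\<in>G \<gamma>. x \<noteq> \<zero>\<^bsub>R\<^esub> \<longrightarrow> x \<in> Units R)"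

text \<open>The group of degrees of invertible homogeneous elements.\<close>

definition unit_degrees :: "('a, 'm) ring_scheme \<Rightarrow> (real \<Rightarrow> 'a set) \<Rightarrow> real set" where
  "unit_degrees R G = {\<gamma>. \<gamma> > 0 \<and> G \<gamma> \<inter> Units R \<noteq> {}}"

definition has_characteristic :: "('a, 'm) ring_scheme \<Rightarrow> nat \<Rightarrow> bool" where
  "has_characteristic R p \<longleftrightarrow> (\<forall>m::nat. [m] \<cdot>\<^bsub>R\<^esub> \<one>\<^bsub>R\<^esub> = \<zero>\<^bsub>R\<^esub> \<longleftrightarrow> p dvd m)"

definition graded_algebra ::
  "('k, 'm) ring_scheme \<Rightarrow> (real \<Rightarrow> 'k set) \<Rightarrow> ('k, 'a, 'n) module_scheme \<Rightarrow> (real \<Rightarrow> 'a set) \<Rightarrow> bool"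
where
  "graded_algebra R GR A GA \<longleftrightarrow>
     graded_ring R GR \<and> graded_ring A GA \<and> algebra R A \<and>
     (\<forall>\<alpha>>0. \<forall>\<beta>>0. \<forall>c\<in>GR \<alpha>. \<forall>x\<in>GA \<beta>. c \<odot>\<^bsub>A\<^esub> x \<in> GA (\<alpha> * \<beta>))"

definition graded_algebra_hom ::
  "('k, 'm) ring_scheme \<Rightarrow> ('k, 'a, 'n) module_scheme \<Rightarrow> (real \<Rightarrow> 'a set) \<Rightarrow>
   ('k, 'b, 'o) module_scheme \<Rightarrow> (real \<Rightarrow> 'b set) \<Rightarrow> ('a \<Rightarrow> 'b) set"
where
  "graded_algebra_hom R A GA B GB =
     {h \<in> ring_hom A B. (\<forall>c\<in>carrier R. \<forall>x\<in>carrier A. h (c \<odot>\<^bsub>A\<^esub> x) = c \<odot>\<^bsub>B\<^esub> h x) \<and>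
        (\<forall>\<gamma>>0. h ` GA \<gamma> \<subseteq> GB \<gamma>)}"

text \<open>The inverse of a bijective homomorphism of degree one is automatically of degree one.\<close>

definition graded_algebra_iso ::
  "('k, 'm) ring_scheme \<Rightarrow> ('k, 'a, 'n) module_scheme \<Rightarrow> (real \<Rightarrow> 'a set) \<Rightarrow>
   ('k, 'b, 'o) module_scheme \<Rightarrow> (real \<Rightarrow> 'b set) \<Rightarrow> ('a \<Rightarrow> 'b) set"
where
  "graded_algebra_iso R A GA B GB =
     {h \<in> graded_algebra_hom R A GA B GB. bij_betw h (carrier A) (carrier B)}"

definition with_scalars ::
  "('a, 'm) ring_scheme \<Rightarrow> ('k \<Rightarrow> 'a \<Rightarrow> 'a) \<Rightarrow> ('k, 'a) module" where
  "with_scalars R \<sigma> = \<lparr>carrier = carrier R, mult = mult R, one = one R, zero = zero R,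
     add = add R, smult = \<sigma>\<rparr>"

definition self_algebra :: "('k, 'm) ring_scheme \<Rightarrow> ('k, 'k) module" where
  "self_algebra R = with_scalars R (mult R)"

definition quotient_algebra :: "('k, 'a, 'n) module_scheme \<Rightarrow> 'a set \<Rightarrow> ('k, 'a set) module" where
  "quotient_algebra A I = with_scalars (A Quot I)
     (\<lambda>c X. (I +>\<^bsub>A\<^esub> (c \<odot>\<^bsub>A\<^esub> \<one>\<^bsub>A\<^esub>)) \<otimes>\<^bsub>A Quot I\<^esub> X)"

definition quotient_grading ::
  "('a, 'm) ring_scheme \<Rightarrow> 'a set \<Rightarrow> (real \<Rightarrow> 'a set) \<Rightarrow> real \<Rightarrow> 'a set set" where
  "quotient_grading A I G \<gamma> = (\<lambda>x. I +>\<^bsub>A\<^esub> x) ` G \<gamma>"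

text \<open>The grading of \<open>R[r\<^sup>-\<^sup>1 T]\<close>: the variable is homogeneous of degree \<open>r\<close>.\<close>

definition poly_grading ::
  "('a, 'm) ring_scheme \<Rightarrow> (real \<Rightarrow> 'a set) \<Rightarrow> real \<Rightarrow> real \<Rightarrow> (nat \<Rightarrow> 'a) set" where
  "poly_grading R G r \<gamma> = {f \<in> carrier (UP R). \<forall>i. coeff (UP R) f i \<in> G (\<gamma> / r ^ i)}"


section \<open>Graded algebraic closures and \<open>p\<close>-power roots\<close>

definition graded_algebraically_closed ::
  "('a, 'm) ring_scheme \<Rightarrow> (real \<Rightarrow> 'a set) \<Rightarrow> bool" where
  "graded_algebraically_closed K G \<longleftrightarrow>
     (\<forall>r>0. \<forall>d>0. \<forall>f\<in>poly_grading K G r d.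
        deg K f > 0 \<longrightarrow> (\<exists>x\<in>G r. eval K K (\<lambda>c. c) x f = \<zero>\<^bsub>K\<^esub>))"

definition graded_algebraic_over ::
  "('k, 'm) ring_scheme \<Rightarrow> (real \<Rightarrow> 'k set) \<Rightarrow> ('k, 'a, 'n) module_scheme \<Rightarrow> (real \<Rightarrow> 'a set) \<Rightarrow> bool"
where
  "graded_algebraic_over k Gk K G \<longleftrightarrow>
     (\<forall>\<gamma>>0. \<forall>x\<in>G \<gamma>. \<exists>d>0. \<exists>f\<in>poly_grading k Gk \<gamma> d.
        f \<noteq> \<zero>\<^bsub>UP k\<^esub> \<and> eval k K (\<lambda>c. c \<odot>\<^bsub>K\<^esub> \<one>\<^bsub>K\<^esub>) x f = \<zero>\<^bsub>K\<^esub>)"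

definition graded_algebraic_closure ::
  "('k, 'm) ring_scheme \<Rightarrow> (real \<Rightarrow> 'k set) \<Rightarrow> ('k, 'a, 'n) module_scheme \<Rightarrow> (real \<Rightarrow> 'a set) \<Rightarrow> bool"
where
  "graded_algebraic_closure k Gk K G \<longleftrightarrow>
     graded_algebra k Gk K G \<and> graded_field K G \<and>
     graded_algebraic_over k Gk K G \<and> graded_algebraically_closed K G"

text \<open>The elements of \<open>K\<close> whose \<open>q\<close>-th power lies in (the image of) \<open>k\<close>, as a \<open>k\<close>-algebra.\<close>

definition root_subfield ::
  "('k, 'm) ring_scheme \<Rightarrow> ('k, 'a) module \<Rightarrow> nat \<Rightarrow> ('k, 'a) module" where
  "root_subfield k K q =
     K\<lparr>carrier := {x \<in> carrier K. \<exists>c\<in>carrier k. x [^]\<^bsub>K\<^esub> q = c \<odot>\<^bsub>K\<^esub> \<one>\<^bsub>K\<^esub>}\<rparr>"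

definition root_subfield_grading ::
  "('k, 'm) ring_scheme \<Rightarrow> ('k, 'a) module \<Rightarrow> (real \<Rightarrow> 'a set) \<Rightarrow> nat \<Rightarrow> real \<Rightarrow> 'a set" where
  "root_subfield_grading k K G q \<gamma> = G \<gamma> \<inter> carrier (root_subfield k K q)"


section \<open>Tensor products of algebras\<close>

text \<open>
  \<open>A \<otimes>\<^sub>k B\<close> is the free abelian group on \<open>carrier A \<times> carrier B\<close> modulo the usual
  bilinearity relations. The free abelian group is made into a ring (the integral monoid ring of
  the multiplicative monoid \<open>A \<times> B\<close>); the subgroup generated by the relations is then already
  an ideal, so that taking the generated ideal does not impose further relations.
\<close>

definition tensor_free ::
  "('a, 'm) ring_scheme \<Rightarrow> ('b, 'n) ring_scheme \<Rightarrow> ('a \<times> 'b \<Rightarrow>\<^sub>0 int) ring" where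
  "tensor_free A B = \<lparr>
     carrier = {u. Poly_Mapping.keys u \<subseteq> carrier A \<times> carrier B},
     mult = (\<lambda>u v. frag_extend (\<lambda>(a, b). frag_extend
               (\<lambda>(a', b'). frag_of (a \<otimes>\<^bsub>A\<^esub> a', b \<otimes>\<^bsub>B\<^esub> b')) v) u),
     one = frag_of (\<one>\<^bsub>A\<^esub>, \<one>\<^bsub>B\<^esub>),
     zero = 0,
     add = (+)\<rparr>"

definition tensor_relations ::
  "('k, 'm) ring_scheme \<Rightarrow> ('k, 'a, 'n) module_scheme \<Rightarrow> ('k, 'b, 'o) module_scheme \<Rightarrow>
   ('a \<times> 'b \<Rightarrow>\<^sub>0 int) set" where
  "tensor_relations k A B =
     {frag_of (x \<oplus>\<^bsub>A\<^esub> x', y) - frag_of (x, y) - frag_of (x', y) | x x' y.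
        x \<in> carrier A \<and> x' \<in> carrier A \<and> y \<in> carrier B} \<union>
     {frag_of (x, y \<oplus>\<^bsub>B\<^esub> y') - frag_of (x, y) - frag_of (x, y') | x y y'.
        x \<in> carrier A \<and> y \<in> carrier B \<and> y' \<in> carrier B} \<union>
     {frag_of (c \<odot>\<^bsub>A\<^esub> x, y) - frag_of (x, c \<odot>\<^bsub>B\<^esub> y) | c x y.
        c \<in> carrier k \<and> x \<in> carrier A \<and> y \<in> carrier B}"

definition tensor_ideal ::
  "('k, 'm) ring_scheme \<Rightarrow> ('k, 'a, 'n) module_scheme \<Rightarrow> ('k, 'b, 'o) module_scheme \<Rightarrow>
   ('a \<times> 'b \<Rightarrow>\<^sub>0 int) set" where
  "tensor_ideal k A B = Idl\<^bsub>tensor_free A B\<^esub> (tensor_relations k A B)"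

definition tensor_ring ::
  "('k, 'm) ring_scheme \<Rightarrow> ('k, 'a, 'n) module_scheme \<Rightarrow> ('k, 'b, 'o) module_scheme \<Rightarrow>
   ('a \<times> 'b \<Rightarrow>\<^sub>0 int) set ring" where
  "tensor_ring k A B = tensor_free A B Quot tensor_ideal k A B"

definition pure_tensor ::
  "('k, 'm) ring_scheme \<Rightarrow> ('k, 'a, 'n) module_scheme \<Rightarrow> ('k, 'b, 'o) module_scheme \<Rightarrow>
   'a \<Rightarrow> 'b \<Rightarrow> ('a \<times> 'b \<Rightarrow>\<^sub>0 int) set" where
  "pure_tensor k A B x y = tensor_ideal k A B +>\<^bsub>tensor_free A B\<^esub> frag_of (x, y)"

definition tensor_grading ::
  "('k, 'm) ring_scheme \<Rightarrow> ('k, 'a, 'n) module_scheme \<Rightarrow> (real \<Rightarrow> 'a set) \<Rightarrow>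
   ('k, 'b, 'o) module_scheme \<Rightarrow> (real \<Rightarrow> 'b set) \<Rightarrow> real \<Rightarrow> ('a \<times> 'b \<Rightarrow>\<^sub>0 int) set set" where
  "tensor_grading k A GA B GB \<gamma> = generate (add_monoid (tensor_ring k A B))
     {pure_tensor k A B x y | x y. \<exists>\<alpha>>0. \<exists>\<beta>>0. \<alpha> * \<beta> = \<gamma> \<and> x \<in> GA \<alpha> \<and> y \<in> GB \<beta>}"

definition tensor_algebra ::
  "('k, 'm) ring_scheme \<Rightarrow> ('k, 'a, 'n) module_scheme \<Rightarrow> ('k, 'b, 'o) module_scheme \<Rightarrow>
   ('k, ('a \<times> 'b \<Rightarrow>\<^sub>0 int) set) module" where
  "tensor_algebra k A B = with_scalars (tensor_ring k A B)
     (\<lambda>c t. pure_tensor k A B (c \<odot>\<^bsub>A\<^esub> \<one>\<^bsub>A\<^esub>) \<one>\<^bsub>B\<^esub> \<otimes>\<^bsub>tensor_ring k A B\<^esub> t)"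

text \<open>The same ring \<open>L \<otimes>\<^sub>k A\<close>, but as an \<open>L\<close>-algebra through the left factor.\<close>

definition base_change ::
  "('k, 'm) ring_scheme \<Rightarrow> ('k, 'l, 'n) module_scheme \<Rightarrow> ('k, 'a, 'o) module_scheme \<Rightarrow>
   ('l, ('l \<times> 'a \<Rightarrow>\<^sub>0 int) set) module" where
  "base_change k L A = with_scalars (tensor_ring k L A)
     (\<lambda>x t. pure_tensor k L A x \<one>\<^bsub>A\<^esub> \<otimes>\<^bsub>tensor_ring k L A\<^esub> t)"

text \<open>
  The additive map \<open>x \<otimes> y \<mapsto> \<phi> x y\<close> into \<open>P\<close> induced by a balanced biadditive \<open>\<phi>\<close>: the linear
  extension of \<open>\<phi>\<close> is then constant on each residue class \<open>X\<close>.
\<close>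

definition tensor_lift ::
  "('c, 'm) ring_scheme \<Rightarrow> ('a \<Rightarrow> 'b \<Rightarrow> 'c) \<Rightarrow> ('a \<times> 'b \<Rightarrow>\<^sub>0 int) set \<Rightarrow> 'c" where
  "tensor_lift P \<phi> X = the_elem ((\<lambda>u. \<Oplus>\<^bsub>P\<^esub>z\<in>Poly_Mapping.keys u.
     [Poly_Mapping.lookup u z] \<cdot>\<^bsub>P\<^esub> \<phi> (fst z) (snd z)) ` X)"

text \<open>\<open>f \<otimes> g\<close> with values in \<open>A \<otimes>\<^sub>k B\<close>.\<close>

definition tensor_map ::
  "('k, 'm) ring_scheme \<Rightarrow> ('k, 'a, 'n) module_scheme \<Rightarrow> ('k, 'b, 'o) module_scheme \<Rightarrow>
   ('c \<Rightarrow> 'a) \<Rightarrow> ('d \<Rightarrow> 'b) \<Rightarrow> ('c \<times> 'd \<Rightarrow>\<^sub>0 int) set \<Rightarrow> ('a \<times> 'b \<Rightarrow>\<^sub>0 int) set" where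
  "tensor_map k A B f g = tensor_lift (tensor_ring k A B) (\<lambda>x y. pure_tensor k A B (f x) (g y))"

text \<open>The associator \<open>(A \<otimes> B) \<otimes> C \<rightarrow> A \<otimes> (B \<otimes> C)\<close>.\<close>

definition tensor_assoc ::
  "('k, 'm) ring_scheme \<Rightarrow> ('k, 'a, 'n) module_scheme \<Rightarrow> ('k, 'b, 'o) module_scheme \<Rightarrow>
   ('k, 'c, 'p) module_scheme \<Rightarrow> (('a \<times> 'b \<Rightarrow>\<^sub>0 int) set \<times> 'c \<Rightarrow>\<^sub>0 int) set \<Rightarrow>
   ('a \<times> ('b \<times> 'c \<Rightarrow>\<^sub>0 int) set \<Rightarrow>\<^sub>0 int) set" where
  "tensor_assoc k A B C =
     (let P = tensor_ring k A (tensor_algebra k B C) in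
      tensor_lift P (\<lambda>t z. tensor_lift P
        (\<lambda>x y. pure_tensor k A (tensor_algebra k B C) x (pure_tensor k B C y z)) t))"


section \<open>Graded forms and graded Hopf algebras\<close>

definition graded_form ::
  "('k, 'm) ring_scheme \<Rightarrow> (real \<Rightarrow> 'k set) \<Rightarrow> ('k, 'l, 'n) module_scheme \<Rightarrow> (real \<Rightarrow> 'l set) \<Rightarrow>
   ('k, 'b, 'o) module_scheme \<Rightarrow> (real \<Rightarrow> 'b set) \<Rightarrow>
   ('k, 'a, 'p) module_scheme \<Rightarrow> (real \<Rightarrow> 'a set) \<Rightarrow> bool" where
  "graded_form k Gk L GL B GB A GA \<longleftrightarrow>
     graded_algebra k Gk A GA \<and>
     graded_algebra_iso L
       (base_change k L A) (tensor_grading k L GL A GA)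
       (base_change k L B) (tensor_grading k L GL B GB) \<noteq> {}"

record ('k, 'a) hopf = "('k, 'a) module" +
  comult :: "'a \<Rightarrow> ('a \<times> 'a \<Rightarrow>\<^sub>0 int) set"
  antipode :: "'a \<Rightarrow> 'a"
  counit :: "'a \<Rightarrow> 'k"

definition graded_hopf_algebra ::
  "('k, 'm) ring_scheme \<Rightarrow> (real \<Rightarrow> 'k set) \<Rightarrow> ('k, 'a) hopf \<Rightarrow> (real \<Rightarrow> 'a set) \<Rightarrow> bool" where
  "graded_hopf_algebra k Gk H GH \<longleftrightarrow>
     graded_algebra k Gk H GH \<and>
     comult H \<in> graded_algebra_hom k H GH (tensor_algebra k H H) (tensor_grading k H GH H GH) \<and>
     antipode H \<in> graded_algebra_hom k H GH H GH \<and>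
     counit H \<in> graded_algebra_hom k H GH (self_algebra k) Gk \<and>
     (\<forall>x\<in>carrier H.
        tensor_assoc k H H H (tensor_map k (tensor_algebra k H H) H (comult H) id (comult H x)) =
        tensor_map k H (tensor_algebra k H H) id (comult H) (comult H x)) \<and>
     (\<forall>x\<in>carrier H.
        tensor_lift H (\<lambda>y z. counit H y \<odot>\<^bsub>H\<^esub> z) (comult H x) = x \<and>
        tensor_lift H (\<lambda>y z. counit H z \<odot>\<^bsub>H\<^esub> y) (comult H x) = x) \<and>
     (\<forall>x\<in>carrier H.
        tensor_lift H (\<lambda>y z. antipode H y \<otimes>\<^bsub>H\<^esub> z) (comult H x) = counit H x \<odot>\<^bsub>H\<^esub> \<one>\<^bsub>H\<^esub> \<and>
        tensor_lift H (\<lambda>y z. y \<otimes>\<^bsub>H\<^esub> antipode H z) (comult H x) = counit H x \<odot>\<^bsub>H\<^esub> \<one>\<^bsub>H\<^esub>)"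

definition graded_hopf_iso ::
  "('k, 'm) ring_scheme \<Rightarrow> ('k, 'a) hopf \<Rightarrow> (real \<Rightarrow> 'a set) \<Rightarrow>
   ('k, 'b) hopf \<Rightarrow> (real \<Rightarrow> 'b set) \<Rightarrow> ('a \<Rightarrow> 'b) set" where
  "graded_hopf_iso k H GH H' GH' =
     {h \<in> graded_algebra_iso k H GH H' GH'. \<forall>x\<in>carrier H.
        comult H' (h x) = tensor_map k H' H' h h (comult H x) \<and>
        antipode H' (h x) = h (antipode H x) \<and>
        counit H' (h x) = counit H x}"


section \<open>The algebras \<open>k[T\<^sub>1, T\<^sub>2] / (T\<^sub>2\<^sup>q - f(T\<^sub>1))\<close>\<close>

text \<open>
  Homogeneous elements of degree \<open>d\<close> of \<open>k[r\<^sup>-\<^sup>1 T]\<close> of the form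
  \<open>a\<^sub>0 T + a\<^sub>1 T\<^sup>p + \<dots> + a\<^sub>m T\<^bsup>p^m\<^esup>\<close> with \<open>a\<^sub>0 \<noteq> 0\<close>.
\<close>

definition homogeneous_p_polys ::
  "('k, 'm) ring_scheme \<Rightarrow> (real \<Rightarrow> 'k set) \<Rightarrow> nat \<Rightarrow> real \<Rightarrow> real \<Rightarrow> (nat \<Rightarrow> 'k) set" where
  "homogeneous_p_polys k Gk p r d =
     {f \<in> poly_grading k Gk r d. \<exists>m a. (\<forall>j\<le>m. a j \<in> carrier k) \<and> a 0 \<noteq> \<zero>\<^bsub>k\<^esub> \<and>
        f = (\<Oplus>\<^bsub>UP k\<^esub>j\<in>{..m}. monom (UP k) (a j) (p ^ j))}"

text \<open>
  \<open>k[T\<^sub>1, T\<^sub>2]\<close> is \<open>k[T\<^sub>1][T\<^sub>2]\<close>, that is, \<^term>\<open>UP (UP k)\<close> with \<open>T\<^sub>1\<close> the inner and \<open>T\<^sub>2\<close> the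
  outer variable; its grading is the iterated polynomial grading.
\<close>

definition plane :: "('k, 'm) ring_scheme \<Rightarrow> ('k, nat \<Rightarrow> nat \<Rightarrow> 'k) module" where
  "plane k = with_scalars (UP (UP k)) (\<lambda>c P. monom (UP k) c 0 \<odot>\<^bsub>UP (UP k)\<^esub> P)"

definition plane_grading ::
  "('k, 'm) ring_scheme \<Rightarrow> (real \<Rightarrow> 'k set) \<Rightarrow> real \<Rightarrow> real \<Rightarrow> real \<Rightarrow> (nat \<Rightarrow> nat \<Rightarrow> 'k) set" where
  "plane_grading k Gk r1 r2 = poly_grading (UP k) (poly_grading k Gk r1) r2"

definition plane_T1 :: "('k, 'm) ring_scheme \<Rightarrow> nat \<Rightarrow> nat \<Rightarrow> 'k" where
  "plane_T1 k = monom (UP (UP k)) (monom (UP k) \<one>\<^bsub>k\<^esub> 1) 0"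

definition plane_T2 :: "('k, 'm) ring_scheme \<Rightarrow> nat \<Rightarrow> nat \<Rightarrow> 'k" where
  "plane_T2 k = monom (UP (UP k)) \<one>\<^bsub>UP k\<^esub> 1"

definition plane_eval ::
  "('k, 'm) ring_scheme \<Rightarrow> ('k, 'a, 'n) module_scheme \<Rightarrow> 'a \<Rightarrow> 'a \<Rightarrow> (nat \<Rightarrow> nat \<Rightarrow> 'k) \<Rightarrow> 'a" where
  "plane_eval k S x1 x2 = eval (UP k) S (eval k S (\<lambda>c. c \<odot>\<^bsub>S\<^esub> \<one>\<^bsub>S\<^esub>) x1) x2"

definition curve_ideal ::
  "('k, 'm) ring_scheme \<Rightarrow> nat \<Rightarrow> (nat \<Rightarrow> 'k) \<Rightarrow> (nat \<Rightarrow> nat \<Rightarrow> 'k) set" where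
  "curve_ideal k q f =
     PIdl\<^bsub>plane k\<^esub> (plane_T2 k [^]\<^bsub>plane k\<^esub> q \<ominus>\<^bsub>plane k\<^esub> monom (UP (UP k)) f 0)"

definition curve_algebra ::
  "('k, 'm) ring_scheme \<Rightarrow> nat \<Rightarrow> (nat \<Rightarrow> 'k) \<Rightarrow> ('k, (nat \<Rightarrow> nat \<Rightarrow> 'k) set) module" where
  "curve_algebra k q f = quotient_algebra (plane k) (curve_ideal k q f)"

definition curve_T1 ::
  "('k, 'm) ring_scheme \<Rightarrow> nat \<Rightarrow> (nat \<Rightarrow> 'k) \<Rightarrow> (nat \<Rightarrow> nat \<Rightarrow> 'k) set" where
  "curve_T1 k q f = curve_ideal k q f +>\<^bsub>plane k\<^esub> plane_T1 k"

definition curve_T2 ::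
  "('k, 'm) ring_scheme \<Rightarrow> nat \<Rightarrow> (nat \<Rightarrow> 'k) \<Rightarrow> (nat \<Rightarrow> nat \<Rightarrow> 'k) set" where
  "curve_T2 k q f = curve_ideal k q f +>\<^bsub>plane k\<^esub> plane_T2 k"

text \<open>
  The structure inherited from the two-dimensional additive group. Each structure map evaluates a
  polynomial at the prescribed images of \<open>T\<^sub>1, T\<^sub>2\<close>; for a \<open>p\<close>-polynomial \<open>f\<close> (in characteristic
  \<open>p\<close>, with \<open>q\<close> a power of \<open>p\<close>) this evaluation kills \<open>T\<^sub>2\<^sup>q - f(T\<^sub>1)\<close>, hence is constant on
  residue classes and descends to the quotient.
\<close>

definition curve_hopf ::
  "('k, 'm) ring_scheme \<Rightarrow> nat \<Rightarrow> (nat \<Rightarrow> 'k) \<Rightarrow> ('k, (nat \<Rightarrow> nat \<Rightarrow> 'k) set) hopf" where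
  "curve_hopf k q f =
    (let A = curve_algebra k q f;
         t1 = curve_T1 k q f;
         t2 = curve_T2 k q f;
         AA = tensor_algebra k A A;
         primitive = (\<lambda>t. pure_tensor k A A \<one>\<^bsub>A\<^esub> t \<oplus>\<^bsub>AA\<^esub> pure_tensor k A A t \<one>\<^bsub>A\<^esub>)
     in module.extend A (hopf.fields
          (\<lambda>X. the_elem (plane_eval k AA (primitive t1) (primitive t2) ` X))
          (\<lambda>X. the_elem (plane_eval k A (\<ominus>\<^bsub>A\<^esub> t1) (\<ominus>\<^bsub>A\<^esub> t2) ` X))
          (\<lambda>X. the_elem (plane_eval k (self_algebra k) \<zero>\<^bsub>k\<^esub> \<zero>\<^bsub>k\<^esub> ` X))))"

definition curve_grading ::
  "('k, 'm) ring_scheme \<Rightarrow> (real \<Rightarrow> 'k set) \<Rightarrow> nat \<Rightarrow> (nat \<Rightarrow> 'k) \<Rightarrow> real \<Rightarrow> real \<Rightarrow>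
   real \<Rightarrow> (nat \<Rightarrow> nat \<Rightarrow> 'k) set set" where
  "curve_grading k Gk q f r1 r2 =
     quotient_grading (plane k) (curve_ideal k q f) (plane_grading k Gk r1 r2)"

end

theory Submission
  imports Defs "HOL-Algebra.Multiplicative_Group" "HOL-Algebra.Exponent"
begin

text \<open>
  Write \<open>q = p\<^sup>n\<close>. The coefficients \<open>a\<^sub>j\<close> of \<open>f\<close> have homogeneous \<open>q\<close>-th roots \<open>b\<^sub>j\<close> in \<open>\<ell>\<close>. With
  \<open>g = \<Sum> b\<^sub>j T\<^bsup>p^j\<^esup>\<close> the assignment \<open>T\<^sub>1 \<mapsto> T\<^sup>q\<close>, \<open>T\<^sub>2 \<mapsto> g\<close> induces \<open>\<ell> \<otimes> A \<rightarrow> \<ell>[T]\<close>; it is bijective because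
  \<open>b\<^sub>0\<close> is a unit, so that a \<open>q\<close>-th root of \<open>T\<^sub>1\<close> can be extracted from \<open>T\<^sub>2\<close> one Frobenius at a time.

  Conversely, let \<open>\<ell> \<otimes> H\<close> be \<open>\<ell>[T]\<close>. Translations of the group are automorphisms of the affine line,
  hence affine; after moving the unit element to \<open>0\<close>, the group law is addition of coordinates. Expand
  \<open>T = \<Sum> x\<^sub>i \<otimes> h\<^sub>i\<close> with as few terms as possible. Then all \<open>h\<^sub>i\<close> are primitive, and some \<open>h\<^sub>i\<close> has a
  nonzero linear term as a polynomial in \<open>T\<close>. A suitable homogeneous component \<open>t\<^sub>2\<close> of it is an additive
  polynomial \<open>g\<close> as above. Moreover \<open>T\<^sup>q\<close> is an element \<open>t\<^sub>1\<close> of \<open>H\<close>, since \<open>q\<close>-th powers of \<open>\<ell>\<close> lie in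
  \<open>k\<close>, and \<open>t\<^sub>2\<^sup>q = f(t\<^sub>1)\<close>. The resulting map \<open>A \<rightarrow> H\<close> is bijective after base change to \<open>\<ell>\<close> by the first
  part, and therefore bijective, because \<open>k\<close> is a direct summand of \<open>\<ell>\<close>.
\<close>

section \<open>The universal property of the tensor product\<close>

text \<open>Three obstacles shape the proof. A graded field is in general only a domain: its nonzero
  homogeneous elements are invertible, the others need not be. Linear algebra over k therefore uses
  graded subspaces, with linear forms obtained from Zorn's lemma; these also stand in for flatness
  of L over k, whose degree may be infinite. Secondly, Frobenius can be cancelled in the domain
  L[T], but not in L tensor A before A is known to be a form. Thirdly, no Hopf structure on L tensor
  H is built. Algebra maps from H to an L-algebra S are multiplied by convolution and correspond to
  elements of S, so that the group law is one polynomial F in T1 and T2. Inverses and associativity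
  make F, as a polynomial in T2 over the domain L[T1], invertible under composition: it has degree
  one and its leading coefficient is a unit of L[T1], hence constant. The two unit laws then leave
  only T2 + T1. Thus primitive elements are additive polynomials, whose exponents in characteristic
  p are powers of p. The degree s arises as r times the degree of a homogeneous part of the linear
  coefficient.\<close>

definition frag_ext :: "('c, 'm) ring_scheme \<Rightarrow> ('z \<Rightarrow> 'c) \<Rightarrow> ('z \<Rightarrow>\<^sub>0 int) \<Rightarrow> 'c" where
  "frag_ext P f u = (\<Oplus>\<^bsub>P\<^esub>z\<in>Poly_Mapping.keys u. [Poly_Mapping.lookup u z] \<cdot>\<^bsub>P\<^esub> f z)"

context abelian_group begin

lemma frag_ext_closed:
  assumes "f \<in> S \<rightarrow> carrier G" "Poly_Mapping.keys u \<subseteq> S"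
  shows "frag_ext G f u \<in> carrier G"
  unfolding frag_ext_def using assms by (intro finsum_closed) auto

text \<open>Extra indices carry coefficient 0. The supports of \<open>u\<close>, \<open>v\<close>
  and \<open>u + v\<close> differ, since terms may cancel, and this puts all three sums over one
  common index set.\<close>

lemma frag_ext_superset:
  assumes "f \<in> S \<rightarrow> carrier G" "Poly_Mapping.keys u \<subseteq> K" "K \<subseteq> S" "finite K"
  shows "frag_ext G f u = (\<Oplus>z\<in>K. [Poly_Mapping.lookup u z] \<cdot> f z)"
proof -
  have z: "[(0::int)] \<cdot> x = \<zero>" for x
    by (simp add: add_pow_def)
  show ?thesis
    unfolding frag_ext_def using assms
    by (intro add.finprod_mono_neutral_cong_left) (auto simp: in_keys_iff z)
qed

lemma frag_ext_add:
  assumes f: "f \<in> S \<rightarrow> carrier G" and u: "Poly_Mapping.keys u \<subseteq> S" and v: "Poly_Mapping.keys v \<subseteq> S"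
  shows "frag_ext G f (u + v) = frag_ext G f u \<oplus> frag_ext G f v"
proof -
  let ?K = "Poly_Mapping.keys u \<union> Poly_Mapping.keys v"
  have K: "?K \<subseteq> S" "finite ?K" "Poly_Mapping.keys (u + v) \<subseteq> ?K"
    using u v keys_add[of u v] by auto
  have fK: "f z \<in> carrier G" if "z \<in> ?K" for z using f K that by auto
  have "frag_ext G f (u + v) = (\<Oplus>z\<in>?K. [Poly_Mapping.lookup (u + v) z] \<cdot> f z)"
    by (rule frag_ext_superset[OF f K(3,1,2)])
  also have "\<dots> = (\<Oplus>z\<in>?K. [Poly_Mapping.lookup u z] \<cdot> f z \<oplus> [Poly_Mapping.lookup v z] \<cdot> f z)"
    by (rule finsum_cong') (use fK in \<open>auto simp: lookup_add add.int_pow_mult\<close>)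
  also have "\<dots> = (\<Oplus>z\<in>?K. [Poly_Mapping.lookup u z] \<cdot> f z) \<oplus> (\<Oplus>z\<in>?K. [Poly_Mapping.lookup v z] \<cdot> f z)"
    by (rule finsum_addf) (use fK in auto)
  also have "\<dots> = frag_ext G f u \<oplus> frag_ext G f v"
    using frag_ext_superset[OF f _ K(1,2)] by simp
  finally show ?thesis .
qed

lemma frag_ext_of:
  assumes "f z \<in> carrier G" shows "frag_ext G f (frag_of z) = f z"
  using assms frag_ext_superset[of f "{z}" "frag_of z" "{z}"] by auto

lemma frag_ext_zero: "frag_ext G f 0 = \<zero>"
  by (simp add: frag_ext_def)

lemma frag_ext_minus:
  assumes f: "f \<in> S \<rightarrow> carrier G" and u: "Poly_Mapping.keys u \<subseteq> S"
  shows "frag_ext G f (- u) = \<ominus> frag_ext G f u"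
proof -
  have "frag_ext G f (- u) \<oplus> frag_ext G f u = \<zero>"
    using frag_ext_add[OF f, of "-u" u] u by (simp add: frag_ext_zero)
  then show ?thesis
    using frag_ext_closed[OF f u] frag_ext_closed[OF f, of "-u"] u by (simp add: minus_equality)
qed

lemma frag_ext_diff:
  assumes f: "f \<in> S \<rightarrow> carrier G" and u: "Poly_Mapping.keys u \<subseteq> S" and v: "Poly_Mapping.keys v \<subseteq> S"
  shows "frag_ext G f (u - v) = frag_ext G f u \<ominus> frag_ext G f v"
  using frag_ext_add[OF f u, of "-v"] frag_ext_minus[OF f v] v by (simp add: minus_eq)

end

locale tensor_prod = A: algebra k A + B: algebra k B
  for k :: "('k, 'm) ring_scheme" and A :: "('k, 'a, 'n) module_scheme"
  and B :: "('k, 'b, 'o) module_scheme"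
begin

abbreviation "F \<equiv> tensor_free A B"
abbreviation "T \<equiv> tensor_ring k A B"
abbreviation "J \<equiv> tensor_ideal k A B"
abbreviation "pure \<equiv> pure_tensor k A B"

lemma frag_cmul_diff2: "frag_cmul c (a - b) = frag_cmul c a - frag_cmul c b"
  by (simp add: right_diff_distrib lookup_minus poly_mapping_eqI)

lemma frag_extend_diff_fun:
  "frag_extend (\<lambda>z. f z - g z) u = frag_extend f u - frag_extend g (u :: 'x \<Rightarrow>\<^sub>0 int)"
  by (simp add: frag_extend_def sum_subtractf frag_cmul_diff2)

lemma F_carrier [simp]: "carrier F = {u. Poly_Mapping.keys u \<subseteq> carrier A \<times> carrier B}"
  and F_add [simp]: "add F = (+)" and F_zero [simp]: "zero F = 0"
  and F_one [simp]: "one F = frag_of (\<one>\<^bsub>A\<^esub>, \<one>\<^bsub>B\<^esub>)"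
  by (simp_all add: tensor_free_def)

lemma F_mult_of [simp]:
  "frag_of (a, b) \<otimes>\<^bsub>F\<^esub> frag_of (a', b') = frag_of (a \<otimes>\<^bsub>A\<^esub> a', b \<otimes>\<^bsub>B\<^esub> b')"
  by (simp add: tensor_free_def)

lemma F_mult_diff_left: "(u - u') \<otimes>\<^bsub>F\<^esub> v = u \<otimes>\<^bsub>F\<^esub> v - u' \<otimes>\<^bsub>F\<^esub> v"
  by (simp add: tensor_free_def frag_extend_diff)

lemma F_mult_diff_right: "u \<otimes>\<^bsub>F\<^esub> (v - v') = u \<otimes>\<^bsub>F\<^esub> v - u \<otimes>\<^bsub>F\<^esub> v'"
  by (simp add: tensor_free_def frag_extend_diff case_prod_unfold frag_extend_diff_fun)

lemma F_mult_zero [simp]: "0 \<otimes>\<^bsub>F\<^esub> v = 0" "v \<otimes>\<^bsub>F\<^esub> 0 = 0"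
  using F_mult_diff_left[of 0 0 v] F_mult_diff_right[of v 0 0] by simp_all

lemma F_mult_minus_left: "(- u) \<otimes>\<^bsub>F\<^esub> v = - (u \<otimes>\<^bsub>F\<^esub> v)"
  and F_mult_minus_right: "v \<otimes>\<^bsub>F\<^esub> (- u) = - (v \<otimes>\<^bsub>F\<^esub> u)"
  using F_mult_diff_left[of 0 u v] F_mult_diff_right[of v 0 u] by simp_all

lemma F_mult_add_left: "(u + u') \<otimes>\<^bsub>F\<^esub> v = u \<otimes>\<^bsub>F\<^esub> v + u' \<otimes>\<^bsub>F\<^esub> v"
  and F_mult_add_right: "v \<otimes>\<^bsub>F\<^esub> (u + u') = v \<otimes>\<^bsub>F\<^esub> u + v \<otimes>\<^bsub>F\<^esub> u'"
  using F_mult_diff_left[of u "-u'" v] F_mult_diff_right[of v u "-u'"]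
  by (simp_all add: F_mult_minus_left F_mult_minus_right)

text \<open>Forming differences covers sums and negatives in one case. Since multiplication in
  \<open>F\<close> is biadditive, each ring law reduces to generators, where it is a law of
  \<open>A\<close> and \<open>B\<close>.\<close>

lemma F_induct [consumes 1, case_names zero diff of]:
  assumes "u \<in> carrier F" "P 0"
    "\<And>u v. u \<in> carrier F \<Longrightarrow> v \<in> carrier F \<Longrightarrow> P u \<Longrightarrow> P v \<Longrightarrow> P (u - v)"
    "\<And>a b. a \<in> carrier A \<Longrightarrow> b \<in> carrier B \<Longrightarrow> P (frag_of (a, b))"
  shows "P u"
proof -
  have u: "Poly_Mapping.keys u \<subseteq> carrier A \<times> carrier B" using assms(1) by simp
  show ?thesis
    by (rule free_Abelian_group_induct[OF u]) (use assms in auto)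
qed

lemma F_diff_closed: "u \<in> carrier F \<Longrightarrow> v \<in> carrier F \<Longrightarrow> u - v \<in> carrier F"
  using keys_diff[of u v] by auto

lemma F_add_closed: "u \<in> carrier F \<Longrightarrow> v \<in> carrier F \<Longrightarrow> u + v \<in> carrier F"
  using keys_add[of u v] by auto

lemma F_mult_closed: "u \<in> carrier F \<Longrightarrow> v \<in> carrier F \<Longrightarrow> u \<otimes>\<^bsub>F\<^esub> v \<in> carrier F"
proof (induction u rule: F_induct)
  case (diff u u')
  then show ?case by (metis F_diff_closed F_mult_diff_left)
next
  case (of a b)
  note ab = of(1,2)
  from of(3) show ?case
  proof (induction v rule: F_induct)
    case (diff u u')
    then show ?case by (metis F_diff_closed F_mult_diff_right)
  qed (use ab in simp_all)
qed simp

lemma F_mult_comm: "u \<in> carrier F \<Longrightarrow> v \<in> carrier F \<Longrightarrow> u \<otimes>\<^bsub>F\<^esub> v = v \<otimes>\<^bsub>F\<^esub> u"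
proof (induction u rule: F_induct)
  case (diff u u')
  then show ?case by (simp only: F_mult_diff_left F_mult_diff_right)
next
  case (of a b)
  note ab = of(1,2)
  from of(3) show ?case
  proof (induction v rule: F_induct)
    case (diff u u')
    then show ?case by (simp only: F_mult_diff_left F_mult_diff_right)
  qed (use ab in \<open>simp_all add: A.m_comm B.m_comm\<close>)
qed simp

lemma F_mult_assoc: "u \<in> carrier F \<Longrightarrow> v \<in> carrier F \<Longrightarrow> w \<in> carrier F \<Longrightarrow>
    (u \<otimes>\<^bsub>F\<^esub> v) \<otimes>\<^bsub>F\<^esub> w = u \<otimes>\<^bsub>F\<^esub> (v \<otimes>\<^bsub>F\<^esub> w)"
proof (induction u rule: F_induct)
  case (diff u u')
  then show ?case by (simp only: F_mult_diff_left F_mult_diff_right)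
next
  case (of a b)
  note ab = of(1,2)
  from of(3,4) show ?case
  proof (induction v rule: F_induct)
    case (diff u u')
    then show ?case by (simp only: F_mult_diff_left F_mult_diff_right)
  next
    case (of a' b')
    note ab' = of(1,2)
    from of(3) show ?case
    proof (induction w rule: F_induct)
      case (diff u u')
      then show ?case by (simp only: F_mult_diff_left F_mult_diff_right)
    qed (use ab ab' in \<open>simp_all add: A.m_assoc B.m_assoc\<close>)
  qed simp
qed simp

lemma F_one_mult: "u \<in> carrier F \<Longrightarrow> \<one>\<^bsub>F\<^esub> \<otimes>\<^bsub>F\<^esub> u = u"
proof (induction u rule: F_induct)
  case (diff u u')
  then show ?case by (simp only: F_mult_diff_left F_mult_diff_right)
qed simp_all

lemma F_cring: "cring F"
proof (rule cringI)
  show "abelian_group F"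
  proof (rule abelian_groupI)
    fix x assume "x \<in> carrier F"
    then show "\<exists>y\<in>carrier F. y \<oplus>\<^bsub>F\<^esub> x = \<zero>\<^bsub>F\<^esub>" by (intro bexI[of _ "-x"]) auto
  qed (use F_add_closed in \<open>simp_all add: add.assoc add.commute\<close>)
  show "comm_monoid F"
    by (rule comm_monoidI)
       (use F_mult_closed F_mult_assoc F_mult_comm F_one_mult in \<open>simp_all\<close>)
  show "(x \<oplus>\<^bsub>F\<^esub> y) \<otimes>\<^bsub>F\<^esub> z = x \<otimes>\<^bsub>F\<^esub> z \<oplus>\<^bsub>F\<^esub> y \<otimes>\<^bsub>F\<^esub> z" for x y z
    by (simp add: F_mult_add_left)
qed

sublocale F: cring F by (rule F_cring)

lemma F_minus: "u \<in> carrier F \<Longrightarrow> \<ominus>\<^bsub>F\<^esub> u = - u"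
  by (rule F.minus_equality) auto

lemma F_minus_eq: "u \<in> carrier F \<Longrightarrow> v \<in> carrier F \<Longrightarrow> u \<ominus>\<^bsub>F\<^esub> v = u - v"
  by (simp add: F.minus_eq F_minus del: F_carrier)

lemma relations_subset: "tensor_relations k A B \<subseteq> carrier F"
proof
  fix u assume "u \<in> tensor_relations k A B"
  moreover have of: "frag_of (x, y) \<in> carrier F" if "x \<in> carrier A" "y \<in> carrier B" for x y
    using that by simp
  ultimately show "u \<in> carrier F"
    unfolding tensor_relations_def
    by (auto simp del: F_carrier intro!: F_diff_closed of)
qed

sublocale J: ideal J F
  unfolding tensor_ideal_def by (rule F.genideal_ideal[OF relations_subset])

lemma T_cring: "cring T"
  unfolding tensor_ring_def by (rule J.quotient_is_cring[OF F_cring])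

sublocale T: cring T by (rule T_cring)

definition cls where "cls u = J +>\<^bsub>F\<^esub> u"

lemma cls_hom: "cls \<in> ring_hom F T"
  unfolding tensor_ring_def using J.rcos_ring_hom by (simp add: cls_def[abs_def])

lemma cls_of: "cls (frag_of (x, y)) = pure x y"
  by (simp add: cls_def pure_tensor_def)

lemma carrier_T: "carrier T = cls ` carrier F"
  by (auto simp: tensor_ring_def FactRing_def A_RCOSETS_def' cls_def)

lemma cls_closed: "u \<in> carrier F \<Longrightarrow> cls u \<in> carrier T"
  using cls_hom ring_hom_closed by metis

lemma cls_add: "u \<in> carrier F \<Longrightarrow> v \<in> carrier F \<Longrightarrow> cls (u + v) = cls u \<oplus>\<^bsub>T\<^esub> cls v"
  using ring_hom_add[OF cls_hom, of u v] by simp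

lemma cls_diff: "u \<in> carrier F \<Longrightarrow> v \<in> carrier F \<Longrightarrow> cls (u - v) = cls u \<ominus>\<^bsub>T\<^esub> cls v"
proof -
  interpret h: ring_hom_cring F T cls
    by (rule UnivPoly.ring_hom_cringI[OF F_cring T_cring cls_hom])
  assume "u \<in> carrier F" "v \<in> carrier F"
  then show ?thesis
    using h.hom_add[of u "\<ominus>\<^bsub>F\<^esub> v"] h.hom_a_inv[of v] F_minus_eq[of u v] by (simp add: F.minus_eq T.minus_eq del: F_carrier)
qed

lemma cls_eq_zero: "u \<in> J \<Longrightarrow> cls u = \<zero>\<^bsub>T\<^esub>"
  by (simp add: cls_def tensor_ring_def FactRing_def F.a_rcos_zero J.ideal_axioms)

lemma pure_closed [simp, intro]: "x \<in> carrier A \<Longrightarrow> y \<in> carrier B \<Longrightarrow> pure x y \<in> carrier T"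
  using cls_closed[of "frag_of (x, y)"] by (simp add: cls_of)

lemma T_one: "\<one>\<^bsub>T\<^esub> = pure \<one>\<^bsub>A\<^esub> \<one>\<^bsub>B\<^esub>"
  using ring_hom_one[OF cls_hom] by (simp add: cls_of)

lemma pure_mult:
  assumes "x \<in> carrier A" "x' \<in> carrier A" "y \<in> carrier B" "y' \<in> carrier B"
  shows "pure x y \<otimes>\<^bsub>T\<^esub> pure x' y' = pure (x \<otimes>\<^bsub>A\<^esub> x') (y \<otimes>\<^bsub>B\<^esub> y')"
  using ring_hom_mult[OF cls_hom, of "frag_of (x, y)" "frag_of (x', y')"] assms by (simp add: cls_of)

lemma relation_in_J: "u \<in> tensor_relations k A B \<Longrightarrow> u \<in> J"
  unfolding tensor_ideal_def using F.genideal_self[OF relations_subset] by auto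

lemma cls_rel:
  assumes "u - v \<in> tensor_relations k A B" "u \<in> carrier F" "v \<in> carrier F"
  shows "cls u = cls v"
  using cls_eq_zero[OF relation_in_J[OF assms(1)]] cls_diff[OF assms(2,3)] cls_closed[OF assms(2)] cls_closed[OF assms(3)]
  by (metis T.r_right_minus_eq)

lemma of_in_F: "x \<in> carrier A \<Longrightarrow> y \<in> carrier B \<Longrightarrow> frag_of (x, y) \<in> carrier F"
  by simp

lemma pure_add_left:
  assumes "x \<in> carrier A" "x' \<in> carrier A" "y \<in> carrier B"
  shows "pure (x \<oplus>\<^bsub>A\<^esub> x') y = pure x y \<oplus>\<^bsub>T\<^esub> pure x' y"
proof -
  have "frag_of (x \<oplus>\<^bsub>A\<^esub> x', y) - (frag_of (x, y) + frag_of (x', y)) \<in> tensor_relations k A B"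
    unfolding tensor_relations_def using assms by (auto simp: algebra_simps)
  from cls_rel[OF this] show ?thesis
    using assms by (simp add: of_in_F F_add_closed cls_add cls_of del: F_carrier)
qed

lemma pure_add_right:
  assumes "x \<in> carrier A" "y' \<in> carrier B" "y \<in> carrier B"
  shows "pure x (y \<oplus>\<^bsub>B\<^esub> y') = pure x y \<oplus>\<^bsub>T\<^esub> pure x y'"
proof -
  have "frag_of (x, y \<oplus>\<^bsub>B\<^esub> y') - (frag_of (x, y) + frag_of (x, y')) \<in> tensor_relations k A B"
    unfolding tensor_relations_def using assms by (auto simp: algebra_simps)
  from cls_rel[OF this] show ?thesis
    using assms by (simp add: of_in_F F_add_closed cls_add cls_of del: F_carrier)
qed

lemma pure_smult:
  assumes "c \<in> carrier k" "x \<in> carrier A" "y \<in> carrier B"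
  shows "pure (c \<odot>\<^bsub>A\<^esub> x) y = pure x (c \<odot>\<^bsub>B\<^esub> y)"
proof -
  have "frag_of (c \<odot>\<^bsub>A\<^esub> x, y) - frag_of (x, c \<odot>\<^bsub>B\<^esub> y) \<in> tensor_relations k A B"
    unfolding tensor_relations_def using assms by blast
  from cls_rel[OF this] show ?thesis
    using assms by (simp add: of_in_F cls_of del: F_carrier)
qed

lemma pure_zero_left: "y \<in> carrier B \<Longrightarrow> pure \<zero>\<^bsub>A\<^esub> y = \<zero>\<^bsub>T\<^esub>"
  using pure_add_left[of "\<zero>\<^bsub>A\<^esub>" "\<zero>\<^bsub>A\<^esub>" y] T.add.l_cancel_one[of "pure \<zero>\<^bsub>A\<^esub> y" "pure \<zero>\<^bsub>A\<^esub> y"] by auto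

lemma pure_zero_right: "x \<in> carrier A \<Longrightarrow> pure x \<zero>\<^bsub>B\<^esub> = \<zero>\<^bsub>T\<^esub>"
  using pure_add_right[of x "\<zero>\<^bsub>B\<^esub>" "\<zero>\<^bsub>B\<^esub>"] T.add.l_cancel_one[of "pure x \<zero>\<^bsub>B\<^esub>" "pure x \<zero>\<^bsub>B\<^esub>"] by auto

lemma pure_minus_left: "x \<in> carrier A \<Longrightarrow> y \<in> carrier B \<Longrightarrow> pure (\<ominus>\<^bsub>A\<^esub> x) y = \<ominus>\<^bsub>T\<^esub> pure x y"
  using pure_add_left[of "\<ominus>\<^bsub>A\<^esub> x" x y] pure_zero_left[of y]
  by (metis A.M.a_inv_closed A.M.l_neg T.minus_equality pure_closed)

text \<open>Negatives need no case of their own because the sign of a pure tensor can be moved into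
  its left factor.\<close>

lemma tensor_induct [consumes 1, case_names pure add]:
  assumes "t \<in> carrier T"
    and pure: "\<And>x y. x \<in> carrier A \<Longrightarrow> y \<in> carrier B \<Longrightarrow> P (pure x y)"
    and add: "\<And>s t. s \<in> carrier T \<Longrightarrow> t \<in> carrier T \<Longrightarrow> P s \<Longrightarrow> P t \<Longrightarrow> P (s \<oplus>\<^bsub>T\<^esub> t)"
  shows "P t"
proof -
  obtain u where u: "u \<in> carrier F" "t = cls u" using assms(1) carrier_T by auto
  \<comment> \<open>\<open>F_induct\<close> produces differences while \<open>P\<close> is only
    known to be stable under sums, so the claim for the negative is carried along.\<close>
  have "P (cls u) \<and> P (\<ominus>\<^bsub>T\<^esub> cls u)" using u(1)
  proof (induction u rule: F_induct)
    case zero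
    have "P \<zero>\<^bsub>T\<^esub>" using pure[of "\<zero>\<^bsub>A\<^esub>" "\<zero>\<^bsub>B\<^esub>"] pure_zero_left by simp
    then show ?case using cls_eq_zero[of 0] J.zero_closed by simp
  next
    case (diff u v)
    then have c: "cls u \<in> carrier T" "cls v \<in> carrier T" by (simp_all add: cls_closed del: F_carrier)
    have "\<ominus>\<^bsub>T\<^esub> cls (u - v) = cls v \<oplus>\<^bsub>T\<^esub> \<ominus>\<^bsub>T\<^esub> cls u"
      using diff c by (simp add: cls_diff T.minus_eq T.minus_add T.a_comm del: F_carrier)
    moreover have "cls (u - v) = cls u \<oplus>\<^bsub>T\<^esub> \<ominus>\<^bsub>T\<^esub> cls v"
      using diff c by (simp add: cls_diff T.minus_eq del: F_carrier)
    ultimately show ?case using diff c add by (metis T.a_inv_closed)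
  next
    case (of a b)
    then show ?case using pure[of a b] pure[of "\<ominus>\<^bsub>A\<^esub> a" b] pure_minus_left by (simp add: cls_of)
  qed
  then show ?thesis using u by simp
qed

definition balanced where
  "balanced P \<phi> \<longleftrightarrow>
     (\<forall>x\<in>carrier A. \<forall>y\<in>carrier B. \<phi> x y \<in> carrier P) \<and>
     (\<forall>x\<in>carrier A. \<forall>x'\<in>carrier A. \<forall>y\<in>carrier B. \<phi> (x \<oplus>\<^bsub>A\<^esub> x') y = \<phi> x y \<oplus>\<^bsub>P\<^esub> \<phi> x' y) \<and>
     (\<forall>x\<in>carrier A. \<forall>y\<in>carrier B. \<forall>y'\<in>carrier B. \<phi> x (y \<oplus>\<^bsub>B\<^esub> y') = \<phi> x y \<oplus>\<^bsub>P\<^esub> \<phi> x y') \<and>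
     (\<forall>c\<in>carrier k. \<forall>x\<in>carrier A. \<forall>y\<in>carrier B. \<phi> (c \<odot>\<^bsub>A\<^esub> x) y = \<phi> x (c \<odot>\<^bsub>B\<^esub> y))"

lemma balancedI:
  assumes "\<And>x y. x \<in> carrier A \<Longrightarrow> y \<in> carrier B \<Longrightarrow> \<phi> x y \<in> carrier P"
    "\<And>x x' y. x \<in> carrier A \<Longrightarrow> x' \<in> carrier A \<Longrightarrow> y \<in> carrier B \<Longrightarrow> \<phi> (x \<oplus>\<^bsub>A\<^esub> x') y = \<phi> x y \<oplus>\<^bsub>P\<^esub> \<phi> x' y"
    "\<And>x y y'. x \<in> carrier A \<Longrightarrow> y \<in> carrier B \<Longrightarrow> y' \<in> carrier B \<Longrightarrow> \<phi> x (y \<oplus>\<^bsub>B\<^esub> y') = \<phi> x y \<oplus>\<^bsub>P\<^esub> \<phi> x y'"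
    "\<And>c x y. c \<in> carrier k \<Longrightarrow> x \<in> carrier A \<Longrightarrow> y \<in> carrier B \<Longrightarrow> \<phi> (c \<odot>\<^bsub>A\<^esub> x) y = \<phi> x (c \<odot>\<^bsub>B\<^esub> y)"
  shows "balanced P \<phi>"
  unfolding balanced_def using assms by simp

context
  fixes P :: "('c, 'q) ring_scheme" and \<phi> :: "'a \<Rightarrow> 'b \<Rightarrow> 'c"
  assumes P: "abelian_group P" and bal: "balanced P \<phi>"
begin

private abbreviation "ext \<equiv> frag_ext P (\<lambda>z. \<phi> (fst z) (snd z))"

interpretation P: abelian_group P by (rule P)

private lemma fP: "(\<lambda>z. \<phi> (fst z) (snd z)) \<in> carrier A \<times> carrier B \<rightarrow> carrier P"
  using bal by (auto simp: balanced_def)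

private lemma ext_closed: "u \<in> carrier F \<Longrightarrow> ext u \<in> carrier P"
  by (rule P.frag_ext_closed[OF fP]) simp

private lemma ext_diff: "u \<in> carrier F \<Longrightarrow> v \<in> carrier F \<Longrightarrow> ext (u - v) = ext u \<ominus>\<^bsub>P\<^esub> ext v"
  by (rule P.frag_ext_diff[OF fP]) simp_all

private lemma ext_add: "u \<in> carrier F \<Longrightarrow> v \<in> carrier F \<Longrightarrow> ext (u + v) = ext u \<oplus>\<^bsub>P\<^esub> ext v"
  by (rule P.frag_ext_add[OF fP]) simp_all

private lemma ext_of: "x \<in> carrier A \<Longrightarrow> y \<in> carrier B \<Longrightarrow> ext (frag_of (x, y)) = \<phi> x y"
  using P.frag_ext_of[of "\<lambda>z. \<phi> (fst z) (snd z)" "(x,y)"] bal by (simp add: balanced_def)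

text \<open>The kernel of the extension of \<open>\<phi>\<close> need not be an ideal; the elements all of whose
  multiples lie in the kernel form one.\<close>

private definition "K = {u \<in> carrier F. \<forall>v\<in>carrier F. ext (v \<otimes>\<^bsub>F\<^esub> u) = \<zero>\<^bsub>P\<^esub>}"

private lemma K_ideal: "ideal K F"
proof (rule idealI)
  show "ring F" by (rule F.ring_axioms)
  show "subgroup K (add_monoid F)"
  proof (rule F.add.subgroupI)
    show "K \<subseteq> carrier F" by (auto simp: K_def)
    have "0 \<in> K" by (auto simp: K_def P.frag_ext_zero)
    then show "K \<noteq> {}" by auto
    show "a_inv F u \<in> K" if "u \<in> K" for u
    proof -
      have u: "u \<in> carrier F" "- u \<in> carrier F" using that by (auto simp: K_def)
      have "ext (v \<otimes>\<^bsub>F\<^esub> (- u)) = \<zero>\<^bsub>P\<^esub>" if "v \<in> carrier F" for v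
      proof -
        have "v \<otimes>\<^bsub>F\<^esub> (- u) = 0 - v \<otimes>\<^bsub>F\<^esub> u" by (simp add: F_mult_minus_right)
        moreover have "ext (0 - v \<otimes>\<^bsub>F\<^esub> u) = ext 0 \<ominus>\<^bsub>P\<^esub> ext (v \<otimes>\<^bsub>F\<^esub> u)"
          by (rule ext_diff) (use F_mult_closed[OF that u(1)] in auto)
        ultimately show ?thesis using \<open>u \<in> K\<close> that by (simp add: K_def P.frag_ext_zero P.minus_eq)
      qed
      then show ?thesis using u by (simp add: K_def F_minus)
    qed
    show "u \<oplus>\<^bsub>F\<^esub> w \<in> K" if "u \<in> K" "w \<in> K" for u w
      using that F_add_closed
      by (simp add: K_def F_mult_add_right ext_add F_mult_closed del: F_carrier)
  qed
  show "x \<otimes>\<^bsub>F\<^esub> u \<in> K" if "u \<in> K" "x \<in> carrier F" for u x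
    using that by (auto simp: K_def F.m_assoc[symmetric] simp del: F_carrier)
  show "u \<otimes>\<^bsub>F\<^esub> x \<in> K" if "u \<in> K" "x \<in> carrier F" for u x
  proof -
    have "u \<otimes>\<^bsub>F\<^esub> x = x \<otimes>\<^bsub>F\<^esub> u" using that by (auto simp: K_def F.m_comm simp del: F_carrier)
    then show ?thesis using that by (auto simp: K_def F.m_assoc[symmetric] simp del: F_carrier)
  qed
qed

private lemma K_I:
  assumes u: "u \<in> carrier F"
    and "\<And>a b. a \<in> carrier A \<Longrightarrow> b \<in> carrier B \<Longrightarrow> ext (frag_of (a, b) \<otimes>\<^bsub>F\<^esub> u) = \<zero>\<^bsub>P\<^esub>"
  shows "u \<in> K"
proof -
  have "ext (v \<otimes>\<^bsub>F\<^esub> u) = \<zero>\<^bsub>P\<^esub>" if "v \<in> carrier F" for v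
    using that
  proof (induction v rule: F_induct)
    case (diff v w)
    then show ?case using u
      by (simp add: F_mult_diff_left ext_diff F_mult_closed P.minus_eq del: F_carrier)
  qed (use assms in \<open>simp_all add: P.frag_ext_zero\<close>)
  then show ?thesis using u by (simp add: K_def)
qed

text \<open>A generator times a bilinearity relation is again a relation of the same shape, with the
  entries multiplied. So not only the relations but all their multiples are killed by
  \<open>ext\<close>.\<close>

private lemma relations_K: "tensor_relations k A B \<subseteq> K"
proof
  fix u assume u: "u \<in> tensor_relations k A B"
  show "u \<in> K"
  proof (rule K_I)
    show "u \<in> carrier F" using u relations_subset by auto
    fix a b assume ab: "a \<in> carrier A" "b \<in> carrier B"
    have of: "frag_of (x, y) \<in> carrier F" if "x \<in> carrier A" "y \<in> carrier B" for x y
      using that by simp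
    have bal': "\<phi> x y \<in> carrier P" if "x \<in> carrier A" "y \<in> carrier B" for x y
      using bal that by (simp add: balanced_def)
    have z: "p \<oplus>\<^bsub>P\<^esub> q \<ominus>\<^bsub>P\<^esub> p \<ominus>\<^bsub>P\<^esub> q = \<zero>\<^bsub>P\<^esub>" if "p \<in> carrier P" "q \<in> carrier P" for p q
    proof -
      have "p \<oplus>\<^bsub>P\<^esub> q \<ominus>\<^bsub>P\<^esub> p \<ominus>\<^bsub>P\<^esub> q = (p \<oplus>\<^bsub>P\<^esub> \<ominus>\<^bsub>P\<^esub> p) \<oplus>\<^bsub>P\<^esub> (q \<oplus>\<^bsub>P\<^esub> \<ominus>\<^bsub>P\<^esub> q)"
        using that by (simp add: P.minus_eq P.a_ac del: P.r_neg P.l_neg)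
      then show ?thesis using that by (simp add: P.r_neg)
    qed
    have z': "p \<ominus>\<^bsub>P\<^esub> p = \<zero>\<^bsub>P\<^esub>" if "p \<in> carrier P" for p
      using that by (simp add: P.minus_eq P.r_neg)
    have sm: "a \<otimes>\<^bsub>A\<^esub> (c \<odot>\<^bsub>A\<^esub> x) = c \<odot>\<^bsub>A\<^esub> (a \<otimes>\<^bsub>A\<^esub> x)" if "c \<in> carrier k" "x \<in> carrier A" for c x
      using that ab A.smult_assoc2 A.m_comm A.smult_closed by metis
    have sm': "b \<otimes>\<^bsub>B\<^esub> (c \<odot>\<^bsub>B\<^esub> x) = c \<odot>\<^bsub>B\<^esub> (b \<otimes>\<^bsub>B\<^esub> x)" if "c \<in> carrier k" "x \<in> carrier B" for c x
      using that ab B.smult_assoc2 B.m_comm B.smult_closed by metis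
    from u consider
      (1) x x' y where "u = frag_of (x \<oplus>\<^bsub>A\<^esub> x', y) - frag_of (x, y) - frag_of (x', y)"
         "x \<in> carrier A" "x' \<in> carrier A" "y \<in> carrier B"
    | (2) x y y' where "u = frag_of (x, y \<oplus>\<^bsub>B\<^esub> y') - frag_of (x, y) - frag_of (x, y')"
         "x \<in> carrier A" "y \<in> carrier B" "y' \<in> carrier B"
    | (3) c x y where "u = frag_of (c \<odot>\<^bsub>A\<^esub> x, y) - frag_of (x, c \<odot>\<^bsub>B\<^esub> y)"
         "c \<in> carrier k" "x \<in> carrier A" "y \<in> carrier B"
      unfolding tensor_relations_def by blast
    then show "ext (frag_of (a, b) \<otimes>\<^bsub>F\<^esub> u) = \<zero>\<^bsub>P\<^esub>"
    proof cases
      case 1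
      then show ?thesis using ab bal
        by (simp add: F_mult_diff_right ext_diff ext_of of F_diff_closed A.r_distr z bal' balanced_def
            del: F_carrier)
    next
      case 2
      then show ?thesis using ab bal
        by (simp add: F_mult_diff_right ext_diff ext_of of F_diff_closed B.r_distr z bal' balanced_def
            del: F_carrier)
    next
      case 3
      then show ?thesis using ab bal
        by (simp add: F_mult_diff_right ext_diff ext_of of F_diff_closed sm sm' z' bal' balanced_def
            del: F_carrier)
    qed
  qed
qed

private lemma ext_J: "u \<in> J \<Longrightarrow> ext u = \<zero>\<^bsub>P\<^esub>"
proof -
  assume "u \<in> J"
  then have "u \<in> K"
    using F.genideal_minimal[OF K_ideal relations_K] by (auto simp: tensor_ideal_def)
  \<comment> \<open>Membership in \<open>K\<close> speaks of all multiples of \<open>u\<close>; the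
    multiple by one gives \<open>u\<close> itself.\<close>
  then have "ext (\<one>\<^bsub>F\<^esub> \<otimes>\<^bsub>F\<^esub> u) = \<zero>\<^bsub>P\<^esub>" unfolding K_def using F.one_closed by blast
  then show ?thesis using \<open>u \<in> K\<close> F_one_mult by (simp add: K_def)
qed

text \<open>\<open>tensor_lift\<close> takes \<open>the_elem\<close> of the image of a coset. The
  elements of \<open>J\<close> are killed, so this image is a singleton and the value can be read
  off from any representative.\<close>

private lemma tensor_lift_cls: "u \<in> carrier F \<Longrightarrow> tensor_lift P \<phi> (cls u) = ext u"
proof -
  assume u: "u \<in> carrier F"
  have "ext w = ext u" if "w \<in> cls u" for w
  proof -
    have "w \<in> (\<Union>h\<in>J. {h \<oplus>\<^bsub>F\<^esub> u})" using that unfolding cls_def a_r_coset_def' .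
    then obtain v where v: "v \<in> J" "w = v + u" unfolding F_add by (elim UN_E singletonE)
    have "v \<in> carrier F" using v(1) J.a_subset by auto
    then show ?thesis using v u ext_add ext_J ext_closed by (simp del: F_carrier)
  qed
  moreover have "u \<in> cls u" unfolding cls_def by (rule J.a_rcos_self[OF u])
  ultimately have "ext ` cls u = {ext u}" by blast
  then show ?thesis by (simp add: tensor_lift_def frag_ext_def[abs_def])
qed

lemma tensor_lift_pure: "x \<in> carrier A \<Longrightarrow> y \<in> carrier B \<Longrightarrow> tensor_lift P \<phi> (pure x y) = \<phi> x y"
  using tensor_lift_cls[of "frag_of (x, y)"] by (simp add: cls_of ext_of)

lemma tensor_lift_closed: "t \<in> carrier T \<Longrightarrow> tensor_lift P \<phi> t \<in> carrier P"
  using tensor_lift_cls ext_closed carrier_T by auto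

lemma tensor_lift_add:
  assumes "s \<in> carrier T" "t \<in> carrier T"
  shows "tensor_lift P \<phi> (s \<oplus>\<^bsub>T\<^esub> t) = tensor_lift P \<phi> s \<oplus>\<^bsub>P\<^esub> tensor_lift P \<phi> t"
proof -
  obtain u v where "u \<in> carrier F" "s = cls u" "v \<in> carrier F" "t = cls v"
    using assms carrier_T by auto
  then show ?thesis
    by (simp add: tensor_lift_cls ext_add F_add_closed del: F_carrier flip: cls_add)
qed

end

lemma tensor_lift_ring_hom:
  assumes P: "ring P" and bal: "balanced P \<phi>"
    and mult: "\<And>x x' y y'. x \<in> carrier A \<Longrightarrow> x' \<in> carrier A \<Longrightarrow> y \<in> carrier B \<Longrightarrow> y' \<in> carrier B \<Longrightarrow>
       \<phi> (x \<otimes>\<^bsub>A\<^esub> x') (y \<otimes>\<^bsub>B\<^esub> y') = \<phi> x y \<otimes>\<^bsub>P\<^esub> \<phi> x' y'"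
    and one: "\<phi> \<one>\<^bsub>A\<^esub> \<one>\<^bsub>B\<^esub> = \<one>\<^bsub>P\<^esub>"
  shows "tensor_lift P \<phi> \<in> ring_hom T P"
proof -
  interpret P: ring P by (rule P)
  note Pa = P.abelian_group_axioms
  note lift = tensor_lift_pure[OF Pa bal] tensor_lift_add[OF Pa bal] tensor_lift_closed[OF Pa bal]
  have bal': "\<phi> x y \<in> carrier P" if "x \<in> carrier A" "y \<in> carrier B" for x y
    using bal that by (simp add: balanced_def)
  have m: "tensor_lift P \<phi> (s \<otimes>\<^bsub>T\<^esub> t) = tensor_lift P \<phi> s \<otimes>\<^bsub>P\<^esub> tensor_lift P \<phi> t"
    if "s \<in> carrier T" "t \<in> carrier T" for s t
    using that
  proof (induction s rule: tensor_induct)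
    case (pure x y)
    from pure(3) show ?case
    proof (induction t rule: tensor_induct)
      case (pure x' y')
      then show ?case using \<open>x \<in> carrier A\<close> \<open>y \<in> carrier B\<close> by (simp add: pure_mult lift mult)
    next
      case (add s t)
      then show ?case using \<open>x \<in> carrier A\<close> \<open>y \<in> carrier B\<close>
        by (simp add: T.r_distr lift P.r_distr bal')
    qed
  next
    case (add s' s)
    then show ?case by (simp add: T.l_distr lift P.l_distr)
  qed
  show ?thesis
    by (rule ring_hom_memI) (use m lift one in \<open>simp_all add: T_one\<close>)
qed

lemma tensor_eqI:
  assumes "t \<in> carrier T"
    and "\<And>x y. x \<in> carrier A \<Longrightarrow> y \<in> carrier B \<Longrightarrow> f (pure x y) = g (pure x y)"
    and "\<And>s t. s \<in> carrier T \<Longrightarrow> t \<in> carrier T \<Longrightarrow> f (s \<oplus>\<^bsub>T\<^esub> t) = f s \<oplus>\<^bsub>P\<^esub> f t"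
    and "\<And>s t. s \<in> carrier T \<Longrightarrow> t \<in> carrier T \<Longrightarrow> g (s \<oplus>\<^bsub>T\<^esub> t) = g s \<oplus>\<^bsub>P\<^esub> g t"
  shows "f t = g t"
  using assms(1) by (induction t rule: tensor_induct) (use assms in auto)

end

section \<open>Algebra homomorphisms, and transfer between records with the same ring
  operations\<close>

definition alg_hom ::
  "('k, 'm) ring_scheme \<Rightarrow> ('k, 'a, 'n) module_scheme \<Rightarrow> ('k, 'b, 'o) module_scheme \<Rightarrow> ('a \<Rightarrow> 'b) set"
where
  "alg_hom k A B =
     {h \<in> ring_hom A B. \<forall>c\<in>carrier k. \<forall>x\<in>carrier A. h (c \<odot>\<^bsub>A\<^esub> x) = c \<odot>\<^bsub>B\<^esub> h x}"

lemma alg_homI: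
  assumes "h \<in> ring_hom A B"
    "\<And>c x. c \<in> carrier k \<Longrightarrow> x \<in> carrier A \<Longrightarrow> h (c \<odot>\<^bsub>A\<^esub> x) = c \<odot>\<^bsub>B\<^esub> h x"
  shows "h \<in> alg_hom k A B"
  using assms by (simp add: alg_hom_def)

lemma alg_hom_ring_hom: "h \<in> alg_hom k A B \<Longrightarrow> h \<in> ring_hom A B"
  by (simp add: alg_hom_def)

lemma alg_hom_smult:
  "h \<in> alg_hom k A B \<Longrightarrow> c \<in> carrier k \<Longrightarrow> x \<in> carrier A \<Longrightarrow> h (c \<odot>\<^bsub>A\<^esub> x) = c \<odot>\<^bsub>B\<^esub> h x"
  by (simp add: alg_hom_def)

lemmas alg_hom_closed = ring_hom_closed[OF alg_hom_ring_hom]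
lemmas alg_hom_add = ring_hom_add[OF alg_hom_ring_hom]
lemmas alg_hom_mult = ring_hom_mult[OF alg_hom_ring_hom]
lemmas alg_hom_one = ring_hom_one[OF alg_hom_ring_hom]

lemma alg_hom_comp: "f \<in> alg_hom k A B \<Longrightarrow> g \<in> alg_hom k B C \<Longrightarrow> g \<circ> f \<in> alg_hom k A C"
  by (rule alg_homI)
     (auto simp: alg_hom_smult alg_hom_closed dest: alg_hom_ring_hom intro: ring_hom_trans)

lemma alg_hom_id: "id \<in> alg_hom k A A"
  by (rule alg_homI) auto

text \<open>A scalar acts as multiplication by its multiple of one, so linearity of a ring
  homomorphism can be tested on the image of the scalars.\<close>

lemma alg_hom_unit_smult:
  assumes "algebra k A" "algebra k B" "h \<in> ring_hom A B"
    and "\<And>c. c \<in> carrier k \<Longrightarrow> h (c \<odot>\<^bsub>A\<^esub> \<one>\<^bsub>A\<^esub>) = c \<odot>\<^bsub>B\<^esub> \<one>\<^bsub>B\<^esub>"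
  shows "h \<in> alg_hom k A B"
proof (rule alg_homI[OF assms(3)])
  interpret A: algebra k A by (rule assms)
  interpret B: algebra k B by (rule assms)
  fix c x assume c: "c \<in> carrier k" and x: "x \<in> carrier A"
  have "c \<odot>\<^bsub>A\<^esub> x = (c \<odot>\<^bsub>A\<^esub> \<one>\<^bsub>A\<^esub>) \<otimes>\<^bsub>A\<^esub> x" using c x by (simp add: A.smult_assoc2)
  then have "h (c \<odot>\<^bsub>A\<^esub> x) = (c \<odot>\<^bsub>B\<^esub> \<one>\<^bsub>B\<^esub>) \<otimes>\<^bsub>B\<^esub> h x"
    using c x assms(4) ring_hom_mult[OF assms(3), of "c \<odot>\<^bsub>A\<^esub> \<one>\<^bsub>A\<^esub>" x] by simp
  also have "\<dots> = c \<odot>\<^bsub>B\<^esub> h x"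
    using c x ring_hom_closed[OF assms(3) x] by (simp add: B.smult_assoc2)
  finally show "h (c \<odot>\<^bsub>A\<^esub> x) = c \<odot>\<^bsub>B\<^esub> h x" .
qed

lemma algebra_unit_hom:
  assumes "algebra k A" shows "(\<lambda>c. c \<odot>\<^bsub>A\<^esub> \<one>\<^bsub>A\<^esub>) \<in> ring_hom k A"
proof -
  interpret A: algebra k A by (rule assms)
  show ?thesis
    by (rule ring_hom_memI) (auto simp: A.smult_assoc1 A.smult_assoc2 A.smult_l_distr)
qed

lemma algebra_smult_unit:
  assumes "algebra k A" "c \<in> carrier k" "x \<in> carrier A"
  shows "c \<odot>\<^bsub>A\<^esub> x = (c \<odot>\<^bsub>A\<^esub> \<one>\<^bsub>A\<^esub>) \<otimes>\<^bsub>A\<^esub> x"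
proof -
  interpret A: algebra k A by (rule assms)
  show ?thesis using assms by (simp add: A.smult_assoc2)
qed

text \<open>Most of the records below differ only in their scalar multiplication or in further fields.\<close>

lemma abelian_group_transfer:
  assumes "abelian_group R" "carrier S = carrier R" "zero S = zero R" "add S = add R"
  shows "abelian_group S"
proof -
  interpret R: abelian_group R by fact
  show ?thesis
    by (rule abelian_groupI) (use assms R.a_assoc R.a_comm in \<open>auto intro: R.add.l_inv_ex[simplified]\<close>)
qed

lemma cring_transfer:
  assumes "cring R" "carrier S = carrier R" "monoid.mult S = monoid.mult R" "one S = one R" "zero S = zero R" "add S = add R"
  shows "cring S"
proof -
  interpret R: cring R by fact
  show ?thesis
  proof (rule cringI)
    show "abelian_group S"
      by (rule abelian_group_transfer[OF R.abelian_group_axioms]) (use assms in simp_all)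
    show "comm_monoid S"
      by (rule comm_monoidI) (use assms R.m_assoc R.m_comm in auto)
  qed (use assms R.l_distr in auto)
qed

lemma algebra_transfer:
  assumes "algebra k A" "carrier B = carrier A" "monoid.mult B = monoid.mult A" "one B = one A" "zero B = zero A"
    "add B = add A" "\<And>c x. c \<in> carrier k \<Longrightarrow> x \<in> carrier A \<Longrightarrow> c \<odot>\<^bsub>B\<^esub> x = c \<odot>\<^bsub>A\<^esub> x"
  shows "algebra k B"
proof -
  interpret A: algebra k A by fact
  show ?thesis
    by (rule algebraI)
       (use assms cring_transfer[OF A.M_cring assms(2-6)] A.R_cring in
         \<open>auto simp: A.smult_l_distr A.smult_r_distr A.smult_assoc1 A.smult_assoc2\<close>)
qed

lemma nat_pow_transfer:
  assumes "monoid.mult S = monoid.mult R" "one S = one R" shows "x [^]\<^bsub>S\<^esub> (n::nat) = x [^]\<^bsub>R\<^esub> n"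
  using assms by (induction n) (simp_all add: nat_pow_def)

lemma a_inv_transfer:
  assumes "carrier S = carrier R" "zero S = zero R" "add S = add R" shows "\<ominus>\<^bsub>S\<^esub> x = \<ominus>\<^bsub>R\<^esub> x"
  using assms by (simp add: a_inv_def m_inv_def)

lemma finsum_transfer:
  assumes "carrier S = carrier R" "zero S = zero R" "add S = add R" shows "finsum S f K = finsum R f K"
  using assms by (simp add: finsum_def finprod_def)

lemma with_scalars_simps [simp]:
  "carrier (with_scalars R \<sigma>) = carrier R" "monoid.mult (with_scalars R \<sigma>) = monoid.mult R"
  "one (with_scalars R \<sigma>) = one R" "zero (with_scalars R \<sigma>) = zero R"
  "add (with_scalars R \<sigma>) = add R" "smult (with_scalars R \<sigma>) = \<sigma>"
  by (simp_all add: with_scalars_def)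

lemma with_scalars_pow [simp]: "x [^]\<^bsub>with_scalars R \<sigma>\<^esub> (n::nat) = x [^]\<^bsub>R\<^esub> n"
  by (rule nat_pow_transfer) simp_all

lemma with_scalars_a_inv [simp]: "\<ominus>\<^bsub>with_scalars R \<sigma>\<^esub> x = \<ominus>\<^bsub>R\<^esub> x"
  by (rule a_inv_transfer) simp_all

text \<open>Scalars acting through a ring homomorphism are the common source of the algebra
  structures below: tensor products, base change, the plane, its quotients, and restriction of
  scalars.\<close>

lemma with_scalars_algebra:
  assumes "cring k" "cring S" "h \<in> ring_hom k S"
  shows "algebra k (with_scalars S (\<lambda>c x. h c \<otimes>\<^bsub>S\<^esub> x))"
proof -
  interpret S: cring S by fact
  note h = ring_hom_closed[OF assms(3)] ring_hom_mult[OF assms(3)] ring_hom_add[OF assms(3)] ring_hom_one[OF assms(3)]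
  show ?thesis
    by (rule algebraI)
       (use assms in \<open>auto simp: h S.l_distr S.r_distr S.m_assoc intro: cring_transfer[OF assms(2)]\<close>)
qed

section \<open>Binomial theorem and Frobenius\<close>

context cring begin

lemma binomial:
  assumes x: "x \<in> carrier R" and y: "y \<in> carrier R"
  shows "(x \<oplus> y) [^] (n::nat) = (\<Oplus>i\<in>{..n}. [(n choose i)] \<cdot> (x [^] i \<otimes> y [^] (n - i)))"
proof (induction n)
  case 0
  show ?case by (simp add: x y)
next
  case (Suc n)
  let ?f = "\<lambda>i. [(n choose i)] \<cdot> (x [^] i \<otimes> y [^] (n - i))"
  let ?g = "\<lambda>i. [(n choose i)] \<cdot> (x [^] i \<otimes> y [^] (Suc n - i))"
  \<comment> \<open>\<open>?h\<close> is the sum multiplied by \<open>x\<close> after the index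
    shift. The value 0 at \<open>i = 0\<close> stands for "n choose -1", which makes Pascal's rule
    valid at the lower end; at the upper end \<open>?g\<close> is extended by the vanishing
    coefficient "n choose n+1".\<close>
  let ?h = "\<lambda>i. [(if i = 0 then 0 else n choose (i - 1))] \<cdot> (x [^] i \<otimes> y [^] (Suc n - i))"
  have "(x \<oplus> y) [^] Suc n = (\<Oplus>i\<in>{..n}. ?f i) \<otimes> x \<oplus> (\<Oplus>i\<in>{..n}. ?f i) \<otimes> y"
    by (simp add: Suc x y r_distr)
  also have "(\<Oplus>i\<in>{..n}. ?f i) \<otimes> x = (\<Oplus>i\<in>{..n}. ?f i \<otimes> x)"
    by (rule finsum_ldistr) (auto simp: x y)
  also have "\<dots> = (\<Oplus>i\<in>{..n}. ?h (Suc i))"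
  proof (rule finsum_cong')
    fix i
    have "x [^] i \<otimes> y [^] (n - i) \<otimes> x = x [^] Suc i \<otimes> y [^] (n - i)"
      using x y by (simp add: m_ac)
    then show "?f i \<otimes> x = ?h (Suc i)" by (simp add: x y add_pow_ldistr)
  qed (auto simp: x y)
  also have "\<dots> = (\<Oplus>i\<in>{..Suc n}. ?h i)"
    by (subst finsum_Suc2) (auto simp: x y)
  also have "(\<Oplus>i\<in>{..n}. ?f i) \<otimes> y = (\<Oplus>i\<in>{..n}. ?f i \<otimes> y)"
    by (rule finsum_ldistr) (auto simp: x y)
  also have "\<dots> = (\<Oplus>i\<in>{..n}. ?g i)"
  proof (rule finsum_cong')
    fix i assume "i \<in> {..n}"
    then have "y [^] (Suc n - i) = y [^] (n - i) \<otimes> y" by (simp add: Suc_diff_le)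
    then show "?f i \<otimes> y = ?g i" by (simp add: x y add_pow_ldistr m_assoc)
  qed (auto simp: x y)
  also have "\<dots> = (\<Oplus>i\<in>{..Suc n}. ?g i)"
    by (simp add: x y binomial_eq_0)
  also have "(\<Oplus>i\<in>{..Suc n}. ?h i) \<oplus> (\<Oplus>i\<in>{..Suc n}. ?g i) = (\<Oplus>i\<in>{..Suc n}. ?h i \<oplus> ?g i)"
    by (rule finsum_addf[symmetric]) (auto simp: x y)
  also have "\<dots> = (\<Oplus>i\<in>{..Suc n}. [(Suc n choose i)] \<cdot> (x [^] i \<otimes> y [^] (Suc n - i)))"
  proof (rule finsum_cong')
    fix i assume "i \<in> {..Suc n}"
    have "(if i = 0 then 0 else n choose (i - 1)) + (n choose i) = (Suc n choose i)"
      by (cases i) auto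
    then show "?h i \<oplus> ?g i = [(Suc n choose i)] \<cdot> (x [^] i \<otimes> y [^] (Suc n - i))"
      using x y add.nat_pow_mult[of "x [^] i \<otimes> y [^] (Suc n - i)"] by simp
  qed (auto simp: x y)
  finally show ?case .
qed

lemma char_multiple_zero:
  assumes "[p] \<cdot> \<one> = \<zero>" "p dvd (m::nat)" "x \<in> carrier R" shows "[m] \<cdot> x = \<zero>"
proof -
  obtain t where "m = p * t" using assms(2) by auto
  then have "[m] \<cdot> \<one> = [t] \<cdot> ([p] \<cdot> \<one>)" by (simp add: add.nat_pow_pow)
  then have "[m] \<cdot> \<one> = \<zero>" by (simp add: assms(1))
  then show ?thesis using add_pow_ldistr[of \<one> x m] assms(3) by simp
qed

lemma frobenius_add:
  assumes p: "prime (p::nat)" and char: "[p] \<cdot> \<one> = \<zero>" and x: "x \<in> carrier R" and y: "y \<in> carrier R"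
  shows "(x \<oplus> y) [^] p = x [^] p \<oplus> y [^] p"
proof -
  let ?f = "\<lambda>i. [(p choose i)] \<cdot> (x [^] i \<otimes> y [^] (p - i))"
  have p2: "p \<ge> 2" using p by (simp add: prime_ge_2_nat)
  have "(x \<oplus> y) [^] p = (\<Oplus>i\<in>{..p}. ?f i)" by (rule binomial[OF x y])
  also have "\<dots> = (\<Oplus>i\<in>{0,p}. ?f i)"
  proof (rule add.finprod_mono_neutral_cong_right)
    fix i assume "i \<in> {..p} - {0, p}"
    then have "p dvd (p choose i)" by (intro dvd_choose_prime p) auto
    then show "?f i = \<zero>" by (rule char_multiple_zero[OF char]) (simp add: x y)
  qed (auto simp: x y)
  also have "\<dots> = x [^] p \<oplus> y [^] p"
    using p2 by (simp add: x y a_comm)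
  finally show ?thesis .
qed

lemma frobenius_power_add:
  assumes p: "prime (p::nat)" and char: "[p] \<cdot> \<one> = \<zero>" and x: "x \<in> carrier R" and y: "y \<in> carrier R"
  shows "(x \<oplus> y) [^] (p ^ n) = x [^] (p ^ n) \<oplus> y [^] (p ^ n)"
proof (induction n)
  case (Suc n)
  have "(x \<oplus> y) [^] (p ^ Suc n) = ((x \<oplus> y) [^] (p ^ n)) [^] p"
    by (simp add: nat_pow_pow x y mult.commute)
  also have "\<dots> = x [^] (p ^ Suc n) \<oplus> y [^] (p ^ Suc n)"
    by (simp add: Suc frobenius_add[OF p char] x y nat_pow_pow mult.commute)
  finally show ?case .
qed (simp add: x y)

lemma frobenius_power_sum:
  assumes p: "prime (p::nat)" and char: "[p] \<cdot> \<one> = \<zero>" and "f \<in> I \<rightarrow> carrier R"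
  shows "(\<Oplus>i\<in>I. f i) [^] (p ^ n) = (\<Oplus>i\<in>I. f i [^] (p ^ n))"
  using assms(3)
proof (induction I rule: infinite_finite_induct)
  case (insert i I)
  then show ?case
    by (simp add: frobenius_power_add[OF p char] Pi_def)
\<comment> \<open>For an infinite index set both sums are zero by convention, and the power of zero
  is zero because the exponent is positive.\<close>
qed (use p in \<open>simp_all add: nat_pow_zero prime_gt_0_nat\<close>)

lemma frobenius_power_minus:
  assumes p: "prime (p::nat)" and char: "[p] \<cdot> \<one> = \<zero>" and x: "x \<in> carrier R"
  shows "(\<ominus> x) [^] (p ^ n) = \<ominus> (x [^] (p ^ n))"
proof -
  have "(\<ominus> x) [^] (p ^ n) \<oplus> x [^] (p ^ n) = \<zero>"
    using frobenius_power_add[OF p char, of "\<ominus> x" x n] x p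
    by (simp add: l_neg nat_pow_zero prime_gt_0_nat)
  then show ?thesis using x by (simp add: minus_equality)
qed

lemma frobenius_power_diff:
  assumes p: "prime (p::nat)" and char: "[p] \<cdot> \<one> = \<zero>" and x: "x \<in> carrier R" and y: "y \<in> carrier R"
  shows "(x \<ominus> y) [^] (p ^ n) = x [^] (p ^ n) \<ominus> y [^] (p ^ n)"
  using assms by (simp add: minus_eq frobenius_power_add[OF p char] frobenius_power_minus[OF p char])

end

lemma (in "domain") nat_pow_eq_zero:
  "x \<in> carrier R \<Longrightarrow> x [^] (n::nat) = \<zero> \<Longrightarrow> x = \<zero>"
  by (induction n) (auto dest: integral)

lemma (in "domain") frobenius_power_inj:
  assumes p: "prime (p::nat)" and char: "[p] \<cdot> \<one> = \<zero>" and x: "x \<in> carrier R" and y: "y \<in> carrier R"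
    and eq: "x [^] (p ^ n) = y [^] (p ^ n)"
  shows "x = y"
proof -
  have "(x \<ominus> y) [^] (p ^ n) = \<zero>"
    using frobenius_power_diff[OF p char x y, of n] eq x y by simp
  then have "x \<ominus> y = \<zero>" using x y nat_pow_eq_zero[of "x \<ominus> y"] by simp
  then show ?thesis using x y by simp
qed

lemma char_transfer_hom:
  assumes "cring R" "cring S" "h \<in> ring_hom R S" "[(p::nat)] \<cdot>\<^bsub>R\<^esub> \<one>\<^bsub>R\<^esub> = \<zero>\<^bsub>R\<^esub>"
  shows "[p] \<cdot>\<^bsub>S\<^esub> \<one>\<^bsub>S\<^esub> = \<zero>\<^bsub>S\<^esub>"
proof -
  interpret h: ring_hom_cring R S h by (rule UnivPoly.ring_hom_cringI[OF assms(1-3)])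
  have "h ([m] \<cdot>\<^bsub>R\<^esub> \<one>\<^bsub>R\<^esub>) = [m] \<cdot>\<^bsub>S\<^esub> \<one>\<^bsub>S\<^esub>" for m :: nat
    by (induction m) auto
  then show ?thesis using assms(4) h.hom_zero by metis
qed

section \<open>Graded rings\<close>

text \<open>A decomposition into homogeneous terms in a loose form: zero terms are allowed and
  \<open>c\<close> is arbitrary outside \<open>K\<close>. Such decompositions can be added and
  compared freely, unlike the normalised family in \<open>graded_ring\<close>.\<close>

definition hsum :: "('a, 'm) ring_scheme \<Rightarrow> (real \<Rightarrow> 'a set) \<Rightarrow> 'a \<Rightarrow> (real \<Rightarrow> 'a) \<Rightarrow> real set \<Rightarrow> bool" where
  "hsum R G x c K \<longleftrightarrow> finite K \<and> K \<subseteq> {0<..} \<and> (\<forall>\<gamma>\<in>K. c \<gamma> \<in> G \<gamma>) \<and> x = finsum R c K"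

definition hcomp :: "('a, 'm) ring_scheme \<Rightarrow> (real \<Rightarrow> 'a set) \<Rightarrow> real \<Rightarrow> 'a \<Rightarrow> 'a" where
  "hcomp R G \<gamma> x = (THE c. (\<forall>\<gamma>>0. c \<gamma> \<in> G \<gamma>) \<and> (\<forall>\<gamma>\<le>0. c \<gamma> = \<zero>\<^bsub>R\<^esub>) \<and>
        finite {\<gamma>. c \<gamma> \<noteq> \<zero>\<^bsub>R\<^esub>} \<and> x = finsum R c {\<gamma>. c \<gamma> \<noteq> \<zero>\<^bsub>R\<^esub>}) \<gamma>"

text \<open>Only the closure properties of a grading. \<open>tensor_grading\<close>, generated by
  pure tensors, provides these without any argument about independence of its pieces.\<close>

locale pregraded = cring R for R :: "('a, 'm) ring_scheme" (structure) +
  fixes G :: "real \<Rightarrow> 'a set"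
  assumes G_subgroup: "\<gamma> > 0 \<Longrightarrow> additive_subgroup (G \<gamma>) R"
    and G_mult: "\<alpha> > 0 \<Longrightarrow> \<beta> > 0 \<Longrightarrow> x \<in> G \<alpha> \<Longrightarrow> y \<in> G \<beta> \<Longrightarrow> x \<otimes> y \<in> G (\<alpha> * \<beta>)"
begin

lemma G_carrier: "\<gamma> > 0 \<Longrightarrow> x \<in> G \<gamma> \<Longrightarrow> x \<in> carrier R"
  using additive_subgroup.a_subset[OF G_subgroup] by auto

lemma G_zero [simp]: "\<gamma> > 0 \<Longrightarrow> \<zero> \<in> G \<gamma>"
  using additive_subgroup.zero_closed[OF G_subgroup] by simp

lemma G_add: "\<gamma> > 0 \<Longrightarrow> x \<in> G \<gamma> \<Longrightarrow> y \<in> G \<gamma> \<Longrightarrow> x \<oplus> y \<in> G \<gamma>"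
  using additive_subgroup.a_closed[OF G_subgroup] by simp

lemma G_minus: "\<gamma> > 0 \<Longrightarrow> x \<in> G \<gamma> \<Longrightarrow> \<ominus> x \<in> G \<gamma>"
  using additive_subgroup.a_inv_closed[OF G_subgroup] G_carrier by simp

lemma G_finsum: "\<gamma> > 0 \<Longrightarrow> (\<And>i. i \<in> I \<Longrightarrow> f i \<in> G \<gamma>) \<Longrightarrow> finsum R f I \<in> G \<gamma>"
proof (induction I rule: infinite_finite_induct)
  case (insert i I)
  then have "f \<in> I \<rightarrow> carrier R" "f i \<in> carrier R" using G_carrier by auto
  then show ?case using insert by (auto intro: G_add)
qed simp_all

lemma G_power:
  assumes "\<one> \<in> G 1" shows "\<gamma> > 0 \<Longrightarrow> x \<in> G \<gamma> \<Longrightarrow> x [^] (n::nat) \<in> G (\<gamma> ^ n)"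
proof (induction n)
  case (Suc n)
  then show ?case using G_mult[of "\<gamma> ^ n" \<gamma> "x [^] n" x] by (simp add: mult.commute)
qed (simp add: assms)

end

locale graded =
  fixes R :: "('a, 'm) ring_scheme" (structure) and G :: "real \<Rightarrow> 'a set"
  assumes graded: "graded_ring R G"
begin

sublocale pregraded R G
  using graded by (intro pregraded.intro pregraded_axioms.intro) (simp_all add: graded_ring_def)

lemma hcomp_props:
  assumes "x \<in> carrier R"
  shows "\<gamma> > 0 \<Longrightarrow> hcomp R G \<gamma> x \<in> G \<gamma>" and "\<gamma> \<le> 0 \<Longrightarrow> hcomp R G \<gamma> x = \<zero>"
    and "finite {\<gamma>. hcomp R G \<gamma> x \<noteq> \<zero>}"
    and "x = (\<Oplus>\<gamma>\<in>{\<gamma>. hcomp R G \<gamma> x \<noteq> \<zero>}. hcomp R G \<gamma> x)"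
proof -
  let ?P = "\<lambda>c. (\<forall>\<gamma>>0. c \<gamma> \<in> G \<gamma>) \<and> (\<forall>\<gamma>\<le>0. c \<gamma> = \<zero>) \<and>
        finite {\<gamma>. c \<gamma> \<noteq> \<zero>} \<and> x = finsum R c {\<gamma>. c \<gamma> \<noteq> \<zero>}"
  have "\<exists>!c. ?P c" using graded assms by (simp add: graded_ring_def)
  from theI'[OF this] have "?P (\<lambda>\<gamma>. hcomp R G \<gamma> x)" by (simp add: hcomp_def)
  then show "\<gamma> > 0 \<Longrightarrow> hcomp R G \<gamma> x \<in> G \<gamma>" "\<gamma> \<le> 0 \<Longrightarrow> hcomp R G \<gamma> x = \<zero>"
    "finite {\<gamma>. hcomp R G \<gamma> x \<noteq> \<zero>}"
    "x = (\<Oplus>\<gamma>\<in>{\<gamma>. hcomp R G \<gamma> x \<noteq> \<zero>}. hcomp R G \<gamma> x)" by blast+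
qed

lemma hcomp_closed [simp]: "x \<in> carrier R \<Longrightarrow> hcomp R G \<gamma> x \<in> carrier R"
  using hcomp_props(1,2)[of x \<gamma>] G_carrier by (cases "\<gamma> > 0") auto

lemma hcomp_unique:
  assumes "hsum R G x c K"
  shows "hcomp R G \<gamma> x = (if \<gamma> \<in> K then c \<gamma> else \<zero>)"
proof -
  let ?P = "\<lambda>c. (\<forall>\<gamma>>0. c \<gamma> \<in> G \<gamma>) \<and> (\<forall>\<gamma>\<le>0. c \<gamma> = \<zero>) \<and>
        finite {\<gamma>. c \<gamma> \<noteq> \<zero>} \<and> x = finsum R c {\<gamma>. c \<gamma> \<noteq> \<zero>}"
  have K: "finite K" "K \<subseteq> {0<..}" "\<And>\<gamma>. \<gamma> \<in> K \<Longrightarrow> c \<gamma> \<in> G \<gamma>" "x = finsum R c K"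
    using assms by (auto simp: hsum_def)
  have cK: "c \<in> K \<rightarrow> carrier R" using K G_carrier by fastforce
  \<comment> \<open>Cutting \<open>c\<close> off outside \<open>K\<close> gives the normalised
    family to which the uniqueness in \<open>graded_ring\<close> applies.\<close>
  let ?c = "\<lambda>\<gamma>. if \<gamma> \<in> K then c \<gamma> else \<zero>"
  have x: "x \<in> carrier R" using K(4) cK by simp
  have ex: "\<exists>!c. ?P c" using graded x by (simp add: graded_ring_def)
  have "finsum R c K = finsum R ?c {\<gamma>. ?c \<gamma> \<noteq> \<zero>}"
    by (rule add.finprod_mono_neutral_cong_right) (use K cK in auto)
  then have e: "x = finsum R ?c {\<gamma>. ?c \<gamma> \<noteq> \<zero>}" using K(4) by (rule trans[rotated])
  have "finite {\<gamma>. ?c \<gamma> \<noteq> \<zero>}" by (rule finite_subset[OF _ K(1)]) auto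
  moreover have "\<forall>\<gamma>>0. ?c \<gamma> \<in> G \<gamma>" "\<forall>\<gamma>\<le>0. ?c \<gamma> = \<zero>" using K(2,3) by auto
  ultimately have "?P ?c" using e by blast
  then have "(THE c. ?P c) = ?c" using ex by (rule the1_equality[rotated])
  then show ?thesis unfolding hcomp_def by metis
qed

lemma hsum_hcomp: "x \<in> carrier R \<Longrightarrow> hsum R G x (\<lambda>\<gamma>. hcomp R G \<gamma> x) {\<gamma>. hcomp R G \<gamma> x \<noteq> \<zero>}"
  unfolding hsum_def using hcomp_props[of x] by (auto simp: not_le[symmetric])

lemma hcomp_homog: "\<delta> > 0 \<Longrightarrow> x \<in> G \<delta> \<Longrightarrow> hcomp R G \<gamma> x = (if \<gamma> = \<delta> then x else \<zero>)"
  using hcomp_unique[of x "\<lambda>_. x" "{\<delta>}" \<gamma>] G_carrier by (auto simp: hsum_def)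

lemma hcomp_superset:
  assumes "x \<in> carrier R" "finite K" "{\<gamma>. hcomp R G \<gamma> x \<noteq> \<zero>} \<subseteq> K"
  shows "x = (\<Oplus>\<gamma>\<in>K. hcomp R G \<gamma> x)"
proof -
  have "(\<Oplus>\<gamma>\<in>{\<gamma>. hcomp R G \<gamma> x \<noteq> \<zero>}. hcomp R G \<gamma> x) = (\<Oplus>\<gamma>\<in>K. hcomp R G \<gamma> x)"
    by (rule add.finprod_mono_neutral_cong_left) (use assms in auto)
  then show ?thesis using hcomp_props(4)[OF assms(1)] by simp
qed

lemma hcomp_add:
  assumes "x \<in> carrier R" "y \<in> carrier R"
  shows "hcomp R G \<gamma> (x \<oplus> y) = hcomp R G \<gamma> x \<oplus> hcomp R G \<gamma> y"
proof -
  let ?K = "{\<gamma>. hcomp R G \<gamma> x \<noteq> \<zero>} \<union> {\<gamma>. hcomp R G \<gamma> y \<noteq> \<zero>}"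
  have fin: "finite ?K" and pos: "?K \<subseteq> {0<..}"
    using hcomp_props(2,3)[of x] hcomp_props(2,3)[of y] assms by (auto simp: not_le[symmetric])
  have "x \<oplus> y = (\<Oplus>\<gamma>\<in>?K. hcomp R G \<gamma> x) \<oplus> (\<Oplus>\<gamma>\<in>?K. hcomp R G \<gamma> y)"
    using hcomp_superset[OF assms(1) fin] hcomp_superset[OF assms(2) fin] by simp
  also have "\<dots> = (\<Oplus>\<gamma>\<in>?K. hcomp R G \<gamma> x \<oplus> hcomp R G \<gamma> y)"
    by (rule finsum_addf[symmetric]) (use assms in auto)
  finally have "hsum R G (x \<oplus> y) (\<lambda>\<gamma>. hcomp R G \<gamma> x \<oplus> hcomp R G \<gamma> y) ?K"
    unfolding hsum_def using fin pos hcomp_props(1) assms by (auto intro!: G_add)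
  from hcomp_unique[OF this] show ?thesis using assms by auto
qed

lemma hcomp_zero [simp]: "hcomp R G \<gamma> \<zero> = \<zero>"
  using hcomp_homog[of 1 \<zero> \<gamma>] by simp

lemma hcomp_finsum:
  "finite I \<Longrightarrow> (\<And>i. i \<in> I \<Longrightarrow> f i \<in> carrier R) \<Longrightarrow> hcomp R G \<gamma> (finsum R f I) = (\<Oplus>i\<in>I. hcomp R G \<gamma> (f i))"
  by (induction I rule: finite_induct) (simp_all add: hcomp_add Pi_def)

lemma graded_induct [consumes 1, case_names homog add]:
  assumes "x \<in> carrier R"
    and homog: "\<And>\<gamma> x. \<gamma> > 0 \<Longrightarrow> x \<in> G \<gamma> \<Longrightarrow> P x"
    and add: "\<And>x y. x \<in> carrier R \<Longrightarrow> y \<in> carrier R \<Longrightarrow> P x \<Longrightarrow> P y \<Longrightarrow> P (x \<oplus> y)"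
  shows "P x"
proof -
  have "P (finsum R c K) \<and> finsum R c K \<in> carrier R"
    if "finite K" "K \<subseteq> {0<..}" "\<forall>\<gamma>\<in>K. c \<gamma> \<in> G \<gamma>" for c K
    using that
  proof (induction K rule: finite_induct)
    case empty
    then show ?case using homog[of 1 \<zero>] by simp
  next
    case (insert \<gamma> K)
    then have "c \<in> K \<rightarrow> carrier R" "c \<gamma> \<in> carrier R" "P (c \<gamma>)" using G_carrier homog by fastforce+
    then show ?case using insert add by simp
  qed
  then show ?thesis using hsum_hcomp[OF assms(1)] unfolding hsum_def by metis
qed

lemma homog_iff_hcomp: "\<gamma> > 0 \<Longrightarrow> x \<in> carrier R \<Longrightarrow> x \<in> G \<gamma> \<longleftrightarrow> (\<forall>\<delta>. \<delta> \<noteq> \<gamma> \<longrightarrow> hcomp R G \<delta> x = \<zero>)"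
proof
  assume "\<gamma> > 0" and x: "x \<in> carrier R" and z: "\<forall>\<delta>. \<delta> \<noteq> \<gamma> \<longrightarrow> hcomp R G \<delta> x = \<zero>"
  then have "x = (\<Oplus>\<delta>\<in>{\<gamma>}. hcomp R G \<delta> x)" by (intro hcomp_superset) auto
  then have "x = hcomp R G \<gamma> x" using x by simp
  then show "x \<in> G \<gamma>" using hcomp_props(1)[OF x \<open>\<gamma> > 0\<close>] by metis
qed (auto simp: hcomp_homog)

lemma eq_hcompI:
  assumes "x \<in> carrier R" "y \<in> carrier R" "\<And>\<gamma>. hcomp R G \<gamma> x = hcomp R G \<gamma> y"
  shows "x = y"
  by (subst hcomp_props(4)[OF assms(1)], subst hcomp_props(4)[OF assms(2)]) (simp only: assms(3))

lemma independent:
  assumes "finite K" "K \<subseteq> {0<..}" "\<And>\<gamma>. \<gamma> \<in> K \<Longrightarrow> c \<gamma> \<in> G \<gamma>" "finsum R c K = \<zero>" "\<gamma> \<in> K"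
  shows "c \<gamma> = \<zero>"
  using hcomp_unique[of \<zero> c K \<gamma>] assms by (auto simp: hsum_def)

lemma hcomp_mult_homog:
  assumes x: "x \<in> carrier R" and w: "w \<in> G \<delta>" "\<delta> > 0"
  shows "hcomp R G (\<gamma> * \<delta>) (x \<otimes> w) = hcomp R G \<gamma> x \<otimes> w"
  using x
proof (induction x rule: graded_induct)
  case (homog \<beta> x)
  then have "x \<otimes> w \<in> G (\<beta> * \<delta>)" using w by (intro G_mult)
  then show ?case using homog w G_carrier[OF w(2,1)]
    by (auto simp: hcomp_homog[of "\<beta> * \<delta>"] hcomp_homog[of \<beta>])
next
  case (add x y)
  then show ?case using G_carrier[OF w(2,1)] by (simp add: l_distr hcomp_add)
qed

text \<open>\<open>graded_ring\<close> does not postulate this. Comparing degrees in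
  \<open>1 * x = x\<close> for homogeneous \<open>x\<close> shows that the degree 1 part of one is
  already neutral, hence equal to one.\<close>

lemma one_homog: "\<one> \<in> G 1"
proof -
  let ?e = "hcomp R G 1 \<one>"
  have e: "?e \<in> G 1" using hcomp_props(1)[of \<one> 1] by simp
  have "?e \<otimes> x = x" if "x \<in> carrier R" for x
    using that
  proof (induction x rule: graded_induct)
    case (homog \<gamma> x)
    then show ?case using hcomp_mult_homog[of \<one> x \<gamma> 1] G_carrier[of \<gamma> x] by (simp add: hcomp_homog)
  qed (simp add: r_distr)
  from this[of \<one>] have "?e = \<one>" by simp
  then show ?thesis using e by simp
qed

lemmas G_pow = G_power[OF one_homog]

end

lemma gradedI: "graded_ring R G \<Longrightarrow> graded R G"
  by unfold_locales

lemma graded_ring_transfer: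
  assumes R: "graded_ring R G" and S: "carrier S = carrier R" "monoid.mult S = monoid.mult R" "one S = one R"
    "zero S = zero R" "add S = add R"
  shows "graded_ring S G"
proof -
  interpret graded R G by (rule gradedI[OF R])
  have "additive_subgroup (G \<gamma>) S" if "\<gamma> > 0" for \<gamma>
  proof -
    have "m_inv (add_monoid S) x = m_inv (add_monoid R) x" for x
      using S by (simp add: m_inv_def)
    then show ?thesis using G_subgroup[OF that] S
      by (simp add: additive_subgroup_def subgroup_def)
  qed
  then show ?thesis using R cring_transfer[OF cring_axioms S] S
    by (simp add: graded_ring_def finsum_transfer[OF S(1,4,5)])
qed

text \<open>The shift \<open>d\<close> lets the same lemma serve homomorphisms
  (\<open>d = 1\<close>), scalar multiples of a fixed homogeneous element, and passage to the i-th
  coefficient of a polynomial, which changes degrees by \<open>1 / r ^ i\<close>.\<close>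

lemma graded_map_hcomp:
  assumes R: "graded_ring R G" and S: "graded_ring S G'" and x: "x \<in> carrier R"
    and cl: "\<And>x. x \<in> carrier R \<Longrightarrow> h x \<in> carrier S"
    and add: "\<And>x y. x \<in> carrier R \<Longrightarrow> y \<in> carrier R \<Longrightarrow> h (x \<oplus>\<^bsub>R\<^esub> y) = h x \<oplus>\<^bsub>S\<^esub> h y"
    and deg: "\<And>\<gamma> x. \<gamma> > 0 \<Longrightarrow> x \<in> G \<gamma> \<Longrightarrow> h x \<in> G' (\<gamma> * d)" and d: "d > 0"
  shows "hcomp S G' (\<gamma> * d) (h x) = h (hcomp R G \<gamma> x)"
proof -
  interpret R: graded R G by unfold_locales (rule R)
  interpret S: graded S G' by unfold_locales (rule S)
  have z: "h \<zero>\<^bsub>R\<^esub> = \<zero>\<^bsub>S\<^esub>"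
    using add[of "\<zero>\<^bsub>R\<^esub>" "\<zero>\<^bsub>R\<^esub>"] cl[of "\<zero>\<^bsub>R\<^esub>"] by simp
  from x show ?thesis
  proof (induction x rule: R.graded_induct)
    case (homog \<beta> x)
    then show ?case using deg[of \<beta> x] d z by (auto simp: S.hcomp_homog[of "\<beta> * d"] R.hcomp_homog[of \<beta>])
  next
    case (add x y)
    then show ?case by (simp add: assms(5) R.hcomp_add S.hcomp_add cl)
  qed
qed

text \<open>The parts of \<open>x\<close> of other degrees have image zero, so they vanish. In this
  way degrees known in L or in L[T] are pulled back to k and to H.\<close>

lemma graded_inj_reflects:
  assumes R: "graded_ring R G" and S: "graded_ring S G'" and x: "x \<in> carrier R" and h: "h \<in> ring_hom R S"
    and inj: "inj_on h (carrier R)"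
    and deg: "\<And>\<gamma> x. \<gamma> > 0 \<Longrightarrow> x \<in> G \<gamma> \<Longrightarrow> h x \<in> G' \<gamma>"
    and \<gamma>: "\<gamma> > 0" "h x \<in> G' \<gamma>"
  shows "x \<in> G \<gamma>"
proof -
  interpret R: graded R G by unfold_locales (rule R)
  interpret S: graded S G' by unfold_locales (rule S)
  interpret h: ring_hom_cring R S h
    by (rule UnivPoly.ring_hom_cringI[OF R.cring_axioms S.cring_axioms h])
  have "hcomp R G \<delta> x = \<zero>\<^bsub>R\<^esub>" if "\<delta> \<noteq> \<gamma>" for \<delta>
  proof -
    have "h (hcomp R G \<delta> x) = hcomp S G' (\<delta> * 1) (h x)"
      by (rule graded_map_hcomp[OF R S x, symmetric]) (use deg in auto)
    also have "\<dots> = h \<zero>\<^bsub>R\<^esub>" using that \<gamma> by (simp add: S.hcomp_homog[of \<gamma>])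
    finally show ?thesis using inj_onD[OF inj] x by (metis R.hcomp_closed R.zero_closed)
  qed
  then show ?thesis using R.homog_iff_hcomp[OF \<gamma>(1) x] by simp
qed

text \<open>Trades unique existence for spanning and independence: two normalised decompositions of
  one element differ by a decomposition of zero over the union of their supports.\<close>

lemma graded_ringI:
  fixes R (structure)
  assumes cring: "cring R"
    and sub: "\<And>\<gamma>. \<gamma> > 0 \<Longrightarrow> additive_subgroup (G \<gamma>) R"
    and mult: "\<And>\<alpha> \<beta> x y. \<alpha> > 0 \<Longrightarrow> \<beta> > 0 \<Longrightarrow> x \<in> G \<alpha> \<Longrightarrow> y \<in> G \<beta> \<Longrightarrow> x \<otimes> y \<in> G (\<alpha> * \<beta>)"
    and span: "\<And>x. x \<in> carrier R \<Longrightarrow> \<exists>c K. hsum R G x c K"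
    and indep: "\<And>c K \<gamma>. hsum R G \<zero> c K \<Longrightarrow> \<gamma> \<in> K \<Longrightarrow> c \<gamma> = \<zero>"
  shows "graded_ring R G"
  unfolding graded_ring_def
proof (intro conjI allI impI ballI)
  interpret cring R by (rule cring)
  have carr: "x \<in> carrier R" if "\<gamma> > 0" "x \<in> G \<gamma>" for x \<gamma>
    using additive_subgroup.a_subset[OF sub] that by auto
  have zero: "\<zero> \<in> G \<gamma>" if "\<gamma> > 0" for \<gamma>
    using additive_subgroup.zero_closed[OF sub] that by auto
  fix x assume "x \<in> carrier R"
  from span[OF this] obtain c K where K: "finite K" "K \<subseteq> {0<..}" "\<And>\<gamma>. \<gamma> \<in> K \<Longrightarrow> c \<gamma> \<in> G \<gamma>" "x = finsum R c K"
    unfolding hsum_def by blast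
  have cK: "c \<in> K \<rightarrow> carrier R" using K carr by fastforce
  let ?P = "\<lambda>c. (\<forall>\<gamma>>0. c \<gamma> \<in> G \<gamma>) \<and> (\<forall>\<gamma>\<le>0. c \<gamma> = \<zero>) \<and>
        finite {\<gamma>. c \<gamma> \<noteq> \<zero>} \<and> x = finsum R c {\<gamma>. c \<gamma> \<noteq> \<zero>}"
  let ?c = "\<lambda>\<gamma>. if \<gamma> \<in> K then c \<gamma> else \<zero>"
  show "\<exists>!c. ?P c"
  proof (rule ex1I[of _ ?c])
    have "finsum R c K = finsum R ?c {\<gamma>. ?c \<gamma> \<noteq> \<zero>}"
      by (rule add.finprod_mono_neutral_cong_right) (use K cK in auto)
    then have e: "x = finsum R ?c {\<gamma>. ?c \<gamma> \<noteq> \<zero>}" using K(4) by (rule trans[rotated])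
    have "finite {\<gamma>. ?c \<gamma> \<noteq> \<zero>}" by (rule finite_subset[OF _ K(1)]) auto
    moreover have "\<forall>\<gamma>>0. ?c \<gamma> \<in> G \<gamma>" "\<forall>\<gamma>\<le>0. ?c \<gamma> = \<zero>" using K(2,3) zero by auto
    ultimately show "?P ?c" using e by blast
  next
    fix b assume b: "?P b"
    have bc: "b \<gamma> \<in> carrier R" for \<gamma> using b carr by (cases "\<gamma> > 0") (auto simp: not_less)
    have cc: "?c \<gamma> \<in> carrier R" for \<gamma> using cK by auto
    let ?L = "K \<union> {\<gamma>. b \<gamma> \<noteq> \<zero>}"
    have L: "finite ?L" "?L \<subseteq> {0<..}" using b K by (auto simp: not_le[symmetric])
    have xb: "x = (\<Oplus>\<gamma>\<in>?L. b \<gamma>)"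
    proof -
      have "finsum R b {\<gamma>. b \<gamma> \<noteq> \<zero>} = finsum R b ?L"
        by (rule add.finprod_mono_neutral_cong_left) (use L bc in auto)
      then show ?thesis using b by simp
    qed
    have xc: "x = (\<Oplus>\<gamma>\<in>?L. ?c \<gamma>)"
    proof -
      have "finsum R c K = finsum R ?c ?L"
        by (rule add.finprod_mono_neutral_cong_left) (use L cK in auto)
      then show ?thesis using K by simp
    qed
    have "(\<Oplus>\<gamma>\<in>?L. b \<gamma> \<oplus> \<ominus> ?c \<gamma>) = (\<Oplus>\<gamma>\<in>?L. b \<gamma>) \<oplus> (\<Oplus>\<gamma>\<in>?L. \<ominus> ?c \<gamma>)"
      by (rule finsum_addf) (use bc cc in blast)+
    moreover have "(\<Oplus>\<gamma>\<in>?L. ?c \<gamma> \<oplus> \<ominus> ?c \<gamma>) = (\<Oplus>\<gamma>\<in>?L. ?c \<gamma>) \<oplus> (\<Oplus>\<gamma>\<in>?L. \<ominus> ?c \<gamma>)"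
      by (rule finsum_addf) (use cc in blast)+
    moreover have "(\<Oplus>\<gamma>\<in>?L. ?c \<gamma> \<oplus> \<ominus> ?c \<gamma>) = \<zero>"
      by (rule add.finprod_one_eqI) (use cc in \<open>blast intro: r_neg\<close>)
    ultimately have "(\<Oplus>\<gamma>\<in>?L. b \<gamma> \<oplus> \<ominus> ?c \<gamma>) = \<zero>" using xb xc by metis
    moreover have "b \<gamma> \<oplus> \<ominus> ?c \<gamma> \<in> G \<gamma>" if "\<gamma> \<in> ?L" for \<gamma>
    proof -
      have \<gamma>: "\<gamma> > 0" using that L by auto
      interpret additive_subgroup "G \<gamma>" R by (rule sub[OF \<gamma>])
      have "?c \<gamma> \<in> G \<gamma>" "b \<gamma> \<in> G \<gamma>" using \<gamma> K(3) b by auto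
      then show ?thesis by (intro a_closed) (simp_all del: if_split add: a_inv_closed)
    qed
    ultimately have "hsum R G \<zero> (\<lambda>\<gamma>. b \<gamma> \<oplus> \<ominus> ?c \<gamma>) ?L" using L by (simp add: hsum_def)
    note ind = indep[OF this]
    show "b = ?c"
    proof
      fix \<gamma> show "b \<gamma> = ?c \<gamma>"
      proof (cases "\<gamma> \<in> ?L")
        case True
        from ind[OF True] have "b \<gamma> \<ominus> ?c \<gamma> = \<zero>" unfolding a_minus_def .
        then show ?thesis by (rule r_right_minus_eq[OF bc cc, THEN iffD1])
      qed auto
    qed
  qed
qed (use assms in auto)

lemma hsum_homog:
  assumes "cring R" "\<gamma> > 0" "x \<in> G \<gamma>" "x \<in> carrier R" shows "\<exists>c K. hsum R G x c K"
proof -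
  interpret cring R by fact
  have "hsum R G x (\<lambda>_. x) {\<gamma>}" using assms by (auto simp: hsum_def)
  then show ?thesis by blast
qed

lemma hsum_add:
  assumes R: "cring R" and sub: "\<And>\<gamma>. \<gamma> > 0 \<Longrightarrow> additive_subgroup (G \<gamma>) R"
    and "\<exists>c K. hsum R G x c K" "\<exists>c K. hsum R G y c K"
  shows "\<exists>c K. hsum R G (x \<oplus>\<^bsub>R\<^esub> y) c K"
proof -
  interpret cring R by fact
  have carr: "x \<in> carrier R" if "\<gamma> > 0" "x \<in> G \<gamma>" for x \<gamma>
    using additive_subgroup.a_subset[OF sub] that by auto
  have zero: "\<zero>\<^bsub>R\<^esub> \<in> G \<gamma>" if "\<gamma> > 0" for \<gamma>
    using additive_subgroup.zero_closed[OF sub] that by auto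
  obtain c K d L where K: "finite K" "K \<subseteq> {0<..}" "\<And>\<gamma>. \<gamma> \<in> K \<Longrightarrow> c \<gamma> \<in> G \<gamma>" "x = finsum R c K"
    and L: "finite L" "L \<subseteq> {0<..}" "\<And>\<gamma>. \<gamma> \<in> L \<Longrightarrow> d \<gamma> \<in> G \<gamma>" "y = finsum R d L"
    using assms(3,4) unfolding hsum_def by blast
  let ?c = "\<lambda>\<gamma>. if \<gamma> \<in> K then c \<gamma> else \<zero>\<^bsub>R\<^esub>" and ?d = "\<lambda>\<gamma>. if \<gamma> \<in> L then d \<gamma> else \<zero>\<^bsub>R\<^esub>"
  have G: "?c \<gamma> \<in> G \<gamma>" "?d \<gamma> \<in> G \<gamma>" if "\<gamma> \<in> K \<union> L" for \<gamma>
    using that K(2,3) L(2,3) zero by (auto simp: subset_iff)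
  have cc: "?c \<gamma> \<in> carrier R" "?d \<gamma> \<in> carrier R" if "\<gamma> \<in> K \<union> L" for \<gamma>
    using G[OF that] that K(2) L(2) carr[of \<gamma>] by blast+
  have cK: "c \<in> K \<rightarrow> carrier R" "d \<in> L \<rightarrow> carrier R" using K L carr by fastforce+
  have "x = finsum R ?c (K \<union> L)"
    unfolding K(4) by (rule add.finprod_mono_neutral_cong_left) (use K(1) L(1) cK in auto)
  moreover have "y = finsum R ?d (K \<union> L)"
    unfolding L(4) by (rule add.finprod_mono_neutral_cong_left) (use K(1) L(1) cK in auto)
  ultimately have "x \<oplus>\<^bsub>R\<^esub> y = finsum R (\<lambda>\<gamma>. ?c \<gamma> \<oplus>\<^bsub>R\<^esub> ?d \<gamma>) (K \<union> L)"
proof -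
    have "finsum R (\<lambda>\<gamma>. ?c \<gamma> \<oplus>\<^bsub>R\<^esub> ?d \<gamma>) (K \<union> L) = finsum R ?c (K \<union> L) \<oplus>\<^bsub>R\<^esub> finsum R ?d (K \<union> L)"
      by (rule finsum_addf) (use cc in blast)+
    then show ?thesis if "x = finsum R ?c (K \<union> L)" "y = finsum R ?d (K \<union> L)" using that by metis
  qed
  moreover have "?c \<gamma> \<oplus>\<^bsub>R\<^esub> ?d \<gamma> \<in> G \<gamma>" if "\<gamma> \<in> K \<union> L" for \<gamma>
    using additive_subgroup.a_closed[OF sub G[OF that]] that K L by blast
  ultimately have "hsum R G (x \<oplus>\<^bsub>R\<^esub> y) (\<lambda>\<gamma>. ?c \<gamma> \<oplus>\<^bsub>R\<^esub> ?d \<gamma>) (K \<union> L)"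
    using K L by (simp only: hsum_def) auto
  then show ?thesis by blast
qed

text \<open>The grading group is ordered. If \<open>x\<close> and \<open>y\<close> are nonzero, the
  product of their parts of largest degree is the only contribution to that degree of
  \<open>x * y\<close>, and the top part of \<open>x\<close> is a unit.\<close>

lemma graded_field_domain:
  assumes "graded_field R G" shows "domain R"
proof -
  interpret graded R G by unfold_locales (use assms in \<open>simp add: graded_field_def\<close>)
  have unit: "x \<in> Units R" if "\<gamma> > 0" "x \<in> G \<gamma>" "x \<noteq> \<zero>\<^bsub>R\<^esub>" for x \<gamma>
    using assms that by (simp add: graded_field_def)
  show ?thesis
  proof (rule domainI)
    show "cring R" by (rule cring_axioms)
    show "\<one>\<^bsub>R\<^esub> \<noteq> \<zero>\<^bsub>R\<^esub>" using assms by (simp add: graded_field_def)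
    fix x y assume xy: "x \<otimes>\<^bsub>R\<^esub> y = \<zero>\<^bsub>R\<^esub>" "x \<in> carrier R" "y \<in> carrier R"
    show "x = \<zero>\<^bsub>R\<^esub> \<or> y = \<zero>\<^bsub>R\<^esub>"
    proof (rule ccontr)
      assume nz: "\<not> (x = \<zero>\<^bsub>R\<^esub> \<or> y = \<zero>\<^bsub>R\<^esub>)"
      define X where "X = {\<gamma>. hcomp R G \<gamma> x \<noteq> \<zero>\<^bsub>R\<^esub>}"
      define Y where "Y = {\<gamma>. hcomp R G \<gamma> y \<noteq> \<zero>\<^bsub>R\<^esub>}"
      have fin: "finite X" "finite Y" using hcomp_props(3) xy by (auto simp: X_def Y_def)
      have pos: "X \<subseteq> {0<..}" "Y \<subseteq> {0<..}" using hcomp_props(2) xy by (auto simp: X_def Y_def not_le[symmetric])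
      have ne: "X \<noteq> {}" "Y \<noteq> {}"
        using hcomp_props(4)[of x] hcomp_props(4)[of y] nz xy unfolding X_def[symmetric] Y_def[symmetric] by (metis finsum_empty)+
      define a b where "a = Max X" "b = Max Y"
      have ab: "a \<in> X" "b \<in> Y" "\<And>\<gamma>. \<gamma> \<in> X \<Longrightarrow> \<gamma> \<le> a" "\<And>\<gamma>. \<gamma> \<in> Y \<Longrightarrow> \<gamma> \<le> b"
        using fin ne by (simp_all add: a_b_def)
      have abp: "a > 0" "b > 0" using ab pos by auto
      have "x \<otimes>\<^bsub>R\<^esub> y = x \<otimes>\<^bsub>R\<^esub> (\<Oplus>\<^bsub>R\<^esub>\<gamma>\<in>Y. hcomp R G \<gamma> y)"
        using hcomp_props(4)[of y] xy unfolding Y_def by metis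
      also have "\<dots> = (\<Oplus>\<^bsub>R\<^esub>\<gamma>\<in>Y. x \<otimes>\<^bsub>R\<^esub> hcomp R G \<gamma> y)"
        by (rule finsum_rdistr) (use fin xy in auto)
      finally have "hcomp R G (a * b) (x \<otimes>\<^bsub>R\<^esub> y) = (\<Oplus>\<^bsub>R\<^esub>\<gamma>\<in>Y. hcomp R G (a * b) (x \<otimes>\<^bsub>R\<^esub> hcomp R G \<gamma> y))"
        using fin xy hcomp_finsum[of Y "\<lambda>\<gamma>. x \<otimes>\<^bsub>R\<^esub> hcomp R G \<gamma> y"] by simp
      also have "\<dots> = (\<Oplus>\<^bsub>R\<^esub>\<gamma>\<in>Y. hcomp R G (a * b / \<gamma>) x \<otimes>\<^bsub>R\<^esub> hcomp R G \<gamma> y)"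
      proof (rule finsum_cong')
        fix \<gamma> assume "\<gamma> \<in> Y"
        then have "\<gamma> > 0" using pos by auto
        then show "hcomp R G (a * b) (x \<otimes>\<^bsub>R\<^esub> hcomp R G \<gamma> y) = hcomp R G (a * b / \<gamma>) x \<otimes>\<^bsub>R\<^esub> hcomp R G \<gamma> y"
          using hcomp_mult_homog[of x "hcomp R G \<gamma> y" \<gamma> "a * b / \<gamma>"] hcomp_props(1)[of y \<gamma>] xy by simp
      qed (use xy in auto)
      also have "\<dots> = (\<Oplus>\<^bsub>R\<^esub>\<gamma>\<in>{b}. hcomp R G (a * b / \<gamma>) x \<otimes>\<^bsub>R\<^esub> hcomp R G \<gamma> y)"
      proof (rule add.finprod_mono_neutral_cong_right)
          fix \<gamma> assume "\<gamma> \<in> Y - {b}"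
          then have "\<gamma> < b" "\<gamma> > 0" using ab(4)[of \<gamma>] pos by auto
          \<comment> \<open>A term of \<open>y\<close> below the top degree would have to meet a
            term of \<open>x\<close> above the top degree of \<open>x\<close>.\<close>
          then have "a * b / \<gamma> > a" using abp by (simp add: field_simps)
          then have "a * b / \<gamma> \<notin> X" using ab(3) by force
          then show "hcomp R G (a * b / \<gamma>) x \<otimes>\<^bsub>R\<^esub> hcomp R G \<gamma> y = \<zero>\<^bsub>R\<^esub>" using xy by (simp add: X_def)
      qed (use ab fin xy in auto)
      also have "\<dots> = hcomp R G a x \<otimes>\<^bsub>R\<^esub> hcomp R G b y" using abp xy by simp
      finally have z: "hcomp R G a x \<otimes>\<^bsub>R\<^esub> hcomp R G b y = \<zero>\<^bsub>R\<^esub>" using xy by simp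
      have u: "hcomp R G a x \<in> Units R"
        using unit[OF abp(1), of "hcomp R G a x"] hcomp_props(1)[of x a] ab abp xy by (simp add: X_def)
      have "hcomp R G b y = \<zero>\<^bsub>R\<^esub>"
        using z u xy Units_l_cancel[OF u, of "hcomp R G b y" "\<zero>\<^bsub>R\<^esub>"] by simp
      then show False using ab by (simp add: Y_def)
    qed
  qed
qed

section \<open>Polynomial rings\<close>

lemma cring_UP: "cring R \<Longrightarrow> cring (UP R)"
  using UP_cring.UP_cring[of R] by (simp add: UP_cring_def)

lemma UP_cringI: "cring R \<Longrightarrow> UP_cring R"
  by (simp add: UP_cring_def)

lemma UP_pre_univI: "cring R \<Longrightarrow> cring S \<Longrightarrow> h \<in> ring_hom R S \<Longrightarrow> UP_pre_univ_prop R S h"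
  by (simp add: UP_pre_univ_prop_def UP_cring_def UnivPoly.ring_hom_cringI)

lemma UP_induct [consumes 2, case_names monom add]:
  assumes R: "cring R" and f: "f \<in> carrier (UP R)"
    and monom: "\<And>c i. c \<in> carrier R \<Longrightarrow> P (monom (UP R) c i)"
    and add: "\<And>f g. f \<in> carrier (UP R) \<Longrightarrow> g \<in> carrier (UP R) \<Longrightarrow> P f \<Longrightarrow> P g \<Longrightarrow> P (f \<oplus>\<^bsub>UP R\<^esub> g)"
  shows "P f"
proof -
  interpret UP_cring R "UP R" by (rule UP_cringI[OF R]) simp
  have "P (\<Oplus>\<^bsub>UP R\<^esub>i\<in>{..n}. monom (UP R) (coeff (UP R) f i) i)" for n :: nat
  proof (induction n)
    case 0
    then show ?case using f monom by simp
  next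
    case (Suc n)
    then show ?case using f monom by (simp add: add)
  qed
  then show ?thesis using up_repr[OF f] by metis
qed

context
  fixes R :: "('a, 'm) ring_scheme" and S :: "('b, 'n) ring_scheme" and h
  assumes R: "cring R" and S: "cring S" and h: "h \<in> ring_hom R S"
begin

interpretation UP_pre_univ_prop R S h "UP R" by (rule UP_pre_univI[OF R S h]) simp

lemma eval_hom: "s \<in> carrier S \<Longrightarrow> eval R S h s \<in> ring_hom (UP R) S"
  by (rule eval_ring_hom)

lemma eval_of_const: "s \<in> carrier S \<Longrightarrow> c \<in> carrier R \<Longrightarrow> eval R S h s (monom (UP R) c 0) = h c"
  by (rule eval_const)

lemma eval_of_T: "s \<in> carrier S \<Longrightarrow> eval R S h s (monom (UP R) \<one>\<^bsub>R\<^esub> 1) = s"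
  by (rule eval_monom1)

lemma eval_of_monom: "s \<in> carrier S \<Longrightarrow> c \<in> carrier R \<Longrightarrow>
    eval R S h s (monom (UP R) c i) = h c \<otimes>\<^bsub>S\<^esub> s [^]\<^bsub>S\<^esub> i"
  by (rule eval_monom)

end

lemma UP_hom_eqI:
  assumes R: "cring R" and S: "cring S" and f: "f \<in> ring_hom (UP R) S" and g: "g \<in> ring_hom (UP R) S"
    and c: "\<And>c. c \<in> carrier R \<Longrightarrow> f (monom (UP R) c 0) = g (monom (UP R) c 0)"
    and T: "f (monom (UP R) \<one>\<^bsub>R\<^esub> 1) = g (monom (UP R) \<one>\<^bsub>R\<^esub> 1)"
    and P: "P \<in> carrier (UP R)"
  shows "f P = g P"
proof -
  interpret UP_cring R "UP R" by (rule UP_cringI[OF R]) simp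
  interpret f: ring_hom_cring "UP R" S f by (rule UnivPoly.ring_hom_cringI[OF cring_UP[OF R] S f])
  interpret g: ring_hom_cring "UP R" S g by (rule UnivPoly.ring_hom_cringI[OF cring_UP[OF R] S g])
  from R P show ?thesis
  proof (induction P rule: UP_induct)
    case (monom a i)
    have "monom (UP R) a i = monom (UP R) a 0 \<otimes>\<^bsub>UP R\<^esub> monom (UP R) \<one>\<^bsub>R\<^esub> 1 [^]\<^bsub>UP R\<^esub> i"
      using monom by (simp del: monom_mult add: monom_mult [THEN sym] monom_pow)
    then show ?case using monom c T by simp
  qed simp
qed

abbreviation peval :: "('k, 'm) ring_scheme \<Rightarrow> ('k, 'a, 'n) module_scheme \<Rightarrow> 'a \<Rightarrow> (nat \<Rightarrow> 'k) \<Rightarrow> 'a" where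
  "peval k S \<equiv> eval k S (\<lambda>c. c \<odot>\<^bsub>S\<^esub> \<one>\<^bsub>S\<^esub>)"

lemma UP_algebra: "cring R \<Longrightarrow> algebra R (UP R)"
  using UP_cring.UP_algebra[of R] by (simp add: UP_cring_def)

lemma UP_smult_unit:
  assumes "cring R" "c \<in> carrier R" shows "c \<odot>\<^bsub>UP R\<^esub> \<one>\<^bsub>UP R\<^esub> = monom (UP R) c 0"
proof -
  interpret UP_cring R "UP R" by (rule UP_cringI) (use assms in simp_all)
  show ?thesis using monom_mult_smult[of c "\<one>\<^bsub>R\<^esub>" 0] assms(2) by (simp add: monom_one)
qed

context
  fixes k :: "('k, 'm) ring_scheme" and S :: "('k, 'a, 'n) module_scheme"
  assumes S: "algebra k S"
begin

interpretation S: algebra k S by (rule S)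

lemma peval_alg_hom: "x \<in> carrier S \<Longrightarrow> peval k S x \<in> alg_hom k (UP k) S"
proof (rule alg_hom_unit_smult[OF UP_algebra S])
  assume x: "x \<in> carrier S"
  show "peval k S x \<in> ring_hom (UP k) S"
    by (rule eval_hom[OF S.R_cring S.M_cring algebra_unit_hom[OF S] x])
  fix c assume "c \<in> carrier k"
  then show "peval k S x (c \<odot>\<^bsub>UP k\<^esub> \<one>\<^bsub>UP k\<^esub>) = c \<odot>\<^bsub>S\<^esub> \<one>\<^bsub>S\<^esub>"
    using eval_of_const[OF S.R_cring S.M_cring algebra_unit_hom[OF S] x, of c]
    by (simp add: UP_smult_unit[OF S.R_cring])
qed (rule S.R_cring)

lemma peval_T: "x \<in> carrier S \<Longrightarrow> peval k S x (monom (UP k) \<one>\<^bsub>k\<^esub> 1) = x"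
  by (rule eval_of_T[OF S.R_cring S.M_cring algebra_unit_hom[OF S]])

lemma peval_monom: "x \<in> carrier S \<Longrightarrow> c \<in> carrier k \<Longrightarrow> peval k S x (monom (UP k) c i) = c \<odot>\<^bsub>S\<^esub> x [^]\<^bsub>S\<^esub> i"
  using eval_of_monom[OF S.R_cring S.M_cring algebra_unit_hom[OF S], of x c i] by (simp add: S.smult_assoc2)

lemma UP_alg_hom_eqI:
  assumes f: "f \<in> alg_hom k (UP k) S" and g: "g \<in> alg_hom k (UP k) S"
    and T: "f (monom (UP k) \<one>\<^bsub>k\<^esub> 1) = g (monom (UP k) \<one>\<^bsub>k\<^esub> 1)" and P: "P \<in> carrier (UP k)"
  shows "f P = g P"
proof (rule UP_hom_eqI[OF S.R_cring S.M_cring alg_hom_ring_hom[OF f] alg_hom_ring_hom[OF g] _ T P])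
  interpret UP_cring k "UP k" by (rule UP_cringI[OF S.R_cring]) simp
  fix c assume c: "c \<in> carrier k"
  show "f (monom (UP k) c 0) = g (monom (UP k) c 0)"
    using alg_hom_smult[OF f c, of "\<one>\<^bsub>UP k\<^esub>"] alg_hom_smult[OF g c, of "\<one>\<^bsub>UP k\<^esub>"] alg_hom_one[OF f] alg_hom_one[OF g]
    by (simp add: UP_smult_unit[OF S.R_cring c])
qed

end

lemma alg_hom_peval:
  assumes S: "algebra k S" and S': "algebra k S'" and g: "g \<in> alg_hom k S S'" and x: "x \<in> carrier S"
    and P: "P \<in> carrier (UP k)"
  shows "g (peval k S x P) = peval k S' (g x) P"
proof -
  have gx: "g x \<in> carrier S'" by (rule alg_hom_closed[OF g x])
  have "(g \<circ> peval k S x) P = peval k S' (g x) P"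
    by (rule UP_alg_hom_eqI[OF S' alg_hom_comp[OF peval_alg_hom[OF S x] g] peval_alg_hom[OF S' gx] _ P])
       (simp only: comp_apply peval_T[OF S x] peval_T[OF S' gx])
  then show ?thesis by simp
qed

lemma (in graded) UP_graded:
  assumes r: "r > 0" shows "graded_ring (UP R) (poly_grading R G r)"
proof -
  interpret P: UP_cring R "UP R" by (rule UP_cringI[OF cring_axioms]) simp
  have memI: "f \<in> poly_grading R G r \<gamma>"
    if "f \<in> carrier (UP R)" "\<And>i. coeff (UP R) f i \<in> G (\<gamma> / r ^ i)" for f \<gamma>
    using that by (simp add: poly_grading_def)
  have memD: "f \<in> carrier (UP R)" "coeff (UP R) f i \<in> G (\<gamma> / r ^ i)"
    if "f \<in> poly_grading R G r \<gamma>" for f \<gamma> i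
    using that by (simp_all add: poly_grading_def)
  have monom: "monom (UP R) a i \<in> poly_grading R G r (\<alpha> * r ^ i)" if "a \<in> G \<alpha>" "\<alpha> > 0" for a i \<alpha>
    using that r G_carrier[of \<alpha> a] by (intro memI) auto
  have sub: "additive_subgroup (poly_grading R G r \<gamma>) (UP R)" if "\<gamma> > 0" for \<gamma>
  proof (intro additive_subgroupI P.P.add.subgroupI)
    have pos: "\<gamma> / r ^ i > 0" for i using that r by simp
    show "poly_grading R G r \<gamma> \<subseteq> carrier (UP R)" by (auto dest: memD)
    have "\<zero>\<^bsub>UP R\<^esub> \<in> poly_grading R G r \<gamma>" using pos by (intro memI) auto
    then show "poly_grading R G r \<gamma> \<noteq> {}" by auto
    show "\<ominus>\<^bsub>UP R\<^esub> f \<in> poly_grading R G r \<gamma>" if "f \<in> poly_grading R G r \<gamma>" for f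
      using memD[OF that] pos by (intro memI) (auto intro: G_minus)
    show "f \<oplus>\<^bsub>UP R\<^esub> g \<in> poly_grading R G r \<gamma>" if "f \<in> poly_grading R G r \<gamma>" "g \<in> poly_grading R G r \<gamma>" for f g
      using memD[OF that(1)] memD[OF that(2)] pos by (intro memI) (auto intro: G_add)
  qed
  show ?thesis
  proof (rule graded_ringI[OF P.UP_cring sub])
    fix \<alpha> \<beta> f g assume pos: "\<alpha> > 0" "\<beta> > 0"
      and f: "f \<in> poly_grading R G r \<alpha>" and g: "g \<in> poly_grading R G r \<beta>"
    have "coeff (UP R) f j \<otimes> coeff (UP R) g (i - j) \<in> G (\<alpha> * \<beta> / r ^ i)" if "j \<le> i" for i j
    proof -
      have "r ^ i = r ^ j * r ^ (i - j)" using that by (simp flip: power_add)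
      then show ?thesis using G_mult[OF _ _ memD(2)[OF f] memD(2)[OF g], of j "i - j"] pos r by simp
    qed
    then show "f \<otimes>\<^bsub>UP R\<^esub> g \<in> poly_grading R G r (\<alpha> * \<beta>)"
      using memD(1)[OF f] memD(1)[OF g] pos r by (intro memI) (auto intro!: G_finsum)
  next
    fix f assume "f \<in> carrier (UP R)"
    with cring_axioms show "\<exists>c K. hsum (UP R) (poly_grading R G r) f c K"
    proof (induction f rule: UP_induct)
      case (monom a i)
      then show ?case
      proof (induction a rule: graded_induct)
        case (homog \<gamma> a)
        then show ?case
          using monom r G_carrier[of \<gamma> a] by (intro hsum_homog[OF P.UP_cring, of "\<gamma> * r ^ i"]) (auto intro: \<open>\<And>a i \<alpha>. a \<in> G \<alpha> \<Longrightarrow> \<alpha> > 0 \<Longrightarrow> monom (UP R) a i \<in> poly_grading R G r (\<alpha> * r ^ i)\<close>)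
      next
        case (add a b)
        then show ?case using hsum_add[OF P.UP_cring sub] by simp
      qed
    next
      case (add f g)
      then show ?case by (intro hsum_add[OF P.UP_cring sub])
    qed
  next
    fix c K \<gamma> assume h: "hsum (UP R) (poly_grading R G r) \<zero>\<^bsub>UP R\<^esub> c K" and \<gamma>: "\<gamma> \<in> K"
    then have K: "finite K" "K \<subseteq> {0<..}" "\<And>\<gamma>. \<gamma> \<in> K \<Longrightarrow> c \<gamma> \<in> poly_grading R G r \<gamma>"
      "\<zero>\<^bsub>UP R\<^esub> = finsum (UP R) c K" by (auto simp: hsum_def)
    have cK: "c \<in> K \<rightarrow> carrier (UP R)" using K(3) memD(1) by auto
    have "coeff (UP R) (c \<gamma>) i = \<zero>" for i
    proof -
      \<comment> \<open>For a fixed exponent \<open>i\<close> the degree of a coefficient determines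
        the degree of the polynomial it comes from, so independence in \<open>R\<close> can be
        applied to the i-th coefficients after reindexing.\<close>
      have inj: "inj_on (\<lambda>\<gamma>. \<gamma> / r ^ i) K" using r by (auto simp: inj_on_def)
      have "(\<Oplus>\<gamma>\<in>K. coeff (UP R) (c \<gamma>) i) = coeff (UP R) (finsum (UP R) c K) i"
        using P.coeff_finsum[OF K(1) cK] by simp
      also have "\<dots> = \<zero>" using K(4) P.coeff_zero by metis
      finally have "(\<Oplus>\<delta>\<in>(\<lambda>\<gamma>. \<gamma> / r ^ i) ` K. coeff (UP R) (c (\<delta> * r ^ i)) i) = \<zero>"
        using r by (subst add.finprod_reindex[OF _ inj]) (use memD(1)[OF K(3)] in auto)
      then have "coeff (UP R) (c (\<gamma> / r ^ i * r ^ i)) i = \<zero>"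
        by (rule independent[rotated 3, where \<gamma> = "\<gamma> / r ^ i" and c = "\<lambda>\<delta>. coeff (UP R) (c (\<delta> * r ^ i)) i"])
           (use K r \<gamma> memD(2)[OF K(3)] in auto)
      then show ?thesis using r by simp
    qed
    then show "c \<gamma> = \<zero>\<^bsub>UP R\<^esub>" using cK \<gamma> by (intro P.up_eqI) auto
  qed
qed

lemma monom_homog:
  assumes "graded_ring R G" "r > 0" "\<alpha> > 0" "a \<in> G \<alpha>"
  shows "monom (UP R) a i \<in> poly_grading R G r (\<alpha> * r ^ i)"
proof -
  interpret graded R G by (rule gradedI) fact
  interpret UP_cring R "UP R" by (rule UP_cringI[OF cring_axioms]) simp
  show ?thesis using assms G_carrier[OF assms(3,4)] by (auto simp: poly_grading_def)
qed

text \<open>Homogeneity of evaluation, for targets in which uniqueness of homogeneous components need not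
  be known.\<close>

lemma eval_homog:
  assumes R: "graded_ring R G" and S: "pregraded S G'" and one: "\<one>\<^bsub>S\<^esub> \<in> G' 1" and h: "h \<in> ring_hom R S"
    and deg: "\<And>\<gamma> x. \<gamma> > 0 \<Longrightarrow> x \<in> G \<gamma> \<Longrightarrow> h x \<in> G' \<gamma>"
    and r: "r > 0" and s: "s \<in> G' r" and \<gamma>: "\<gamma> > 0" and f: "f \<in> poly_grading R G r \<gamma>"
  shows "eval R S h s f \<in> G' \<gamma>"
proof -
  interpret R: graded R G by (rule gradedI) fact
  interpret S: pregraded S G' by fact
  have sS: "s \<in> carrier S" using S.G_carrier r s by auto
  have f': "f \<in> carrier (UP R)" "\<And>i. coeff (UP R) f i \<in> G (\<gamma> / r ^ i)" using f by (auto simp: poly_grading_def)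
  have "h (coeff (UP R) f i) \<otimes>\<^bsub>S\<^esub> s [^]\<^bsub>S\<^esub> i \<in> G' \<gamma>" for i
    using S.G_mult[OF _ _ deg[OF _ f'(2)] S.G_power[OF one r s, of i], of i] \<gamma> r by simp
  then show ?thesis unfolding eval_def using f' \<gamma> by (auto intro: S.G_finsum)
qed

lemma UP_domain_of: "domain R \<Longrightarrow> domain (UP R)"
  using UP_domain.UP_domain[of R] by (simp add: UP_domain_def)

section \<open>Tensor products of algebras\<close>

lemma tensor_algebra_simps [simp]:
  "carrier (tensor_algebra k A B) = carrier (tensor_ring k A B)"
  "monoid.mult (tensor_algebra k A B) = monoid.mult (tensor_ring k A B)"
  "one (tensor_algebra k A B) = one (tensor_ring k A B)"
  "zero (tensor_algebra k A B) = zero (tensor_ring k A B)"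
  "add (tensor_algebra k A B) = add (tensor_ring k A B)"
  by (simp_all add: tensor_algebra_def)

lemma base_change_simps [simp]:
  "carrier (base_change k A B) = carrier (tensor_ring k A B)"
  "monoid.mult (base_change k A B) = monoid.mult (tensor_ring k A B)"
  "one (base_change k A B) = one (tensor_ring k A B)"
  "zero (base_change k A B) = zero (tensor_ring k A B)"
  "add (base_change k A B) = add (tensor_ring k A B)"
  by (simp_all add: base_change_def)

context tensor_prod
begin

abbreviation "TA \<equiv> tensor_algebra k A B"

lemma inl_hom: "(\<lambda>x. pure x \<one>\<^bsub>B\<^esub>) \<in> ring_hom A T"
  by (rule ring_hom_memI) (auto simp: pure_mult pure_add_left T_one)

lemma inr_hom: "(\<lambda>y. pure \<one>\<^bsub>A\<^esub> y) \<in> ring_hom B T"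
  by (rule ring_hom_memI) (auto simp: pure_mult pure_add_right T_one)

lemma TA_algebra: "algebra k TA"
  unfolding tensor_algebra_def
  by (rule with_scalars_algebra[OF A.R_cring T_cring])
     (use ring_hom_trans[OF algebra_unit_hom[OF A.algebra_axioms] inl_hom] in \<open>simp add: comp_def\<close>)

lemma base_change_algebra: "algebra A (base_change k A B)"
  unfolding base_change_def
  by (rule with_scalars_algebra[OF A.M_cring T_cring inl_hom])

lemma TA_smult: "c \<odot>\<^bsub>TA\<^esub> t = pure (c \<odot>\<^bsub>A\<^esub> \<one>\<^bsub>A\<^esub>) \<one>\<^bsub>B\<^esub> \<otimes>\<^bsub>T\<^esub> t"
  by (simp add: tensor_algebra_def)

lemma TA_smult_pure:
  assumes "c \<in> carrier k" "x \<in> carrier A" "y \<in> carrier B"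
  shows "c \<odot>\<^bsub>TA\<^esub> pure x y = pure (c \<odot>\<^bsub>A\<^esub> x) y"
  using assms by (simp add: TA_smult pure_mult A.smult_assoc2)

lemma inl_alg_hom: "(\<lambda>x. pure x \<one>\<^bsub>B\<^esub>) \<in> alg_hom k A TA"
  by (rule alg_homI) (use inl_hom in \<open>auto simp: ring_hom_def TA_smult_pure\<close>)

lemma inr_alg_hom: "(\<lambda>y. pure \<one>\<^bsub>A\<^esub> y) \<in> alg_hom k B TA"
  by (rule alg_homI) (use inr_hom in \<open>auto simp: ring_hom_def TA_smult_pure pure_smult\<close>)

lemma pure_split:
  "x \<in> carrier A \<Longrightarrow> y \<in> carrier B \<Longrightarrow> pure x y = pure x \<one>\<^bsub>B\<^esub> \<otimes>\<^bsub>T\<^esub> pure \<one>\<^bsub>A\<^esub> y"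
  by (simp add: pure_mult)

lemma tensor_hom_eqI:
  assumes f: "f \<in> ring_hom T S" and g: "g \<in> ring_hom T S"
    and l: "\<And>x. x \<in> carrier A \<Longrightarrow> f (pure x \<one>\<^bsub>B\<^esub>) = g (pure x \<one>\<^bsub>B\<^esub>)"
    and r: "\<And>y. y \<in> carrier B \<Longrightarrow> f (pure \<one>\<^bsub>A\<^esub> y) = g (pure \<one>\<^bsub>A\<^esub> y)"
    and t: "t \<in> carrier T"
  shows "f t = g t"
  using t
proof (rule tensor_eqI)
  fix x y assume "x \<in> carrier A" "y \<in> carrier B"
  then show "f (pure x y) = g (pure x y)"
    using ring_hom_mult[OF f, of "pure x \<one>\<^bsub>B\<^esub>" "pure \<one>\<^bsub>A\<^esub> y"] ring_hom_mult[OF g, of "pure x \<one>\<^bsub>B\<^esub>" "pure \<one>\<^bsub>A\<^esub> y"]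
      l[of x] r[of y] by (simp flip: pure_split)
qed (use ring_hom_add[OF f] ring_hom_add[OF g] in auto)

text \<open>\<open>P\<close> and \<open>S\<close> have the same ring operations and may differ as
  records: the lifts in use take values in a bare \<open>tensor_ring\<close>, or in an L-algebra,
  while linearity over k refers to the k-structure of \<open>S\<close>.\<close>

lemma tensor_lift_alg_hom:
  assumes S: "algebra k S"
    and P: "carrier P = carrier S" "monoid.mult P = monoid.mult S" "one P = one S" "zero P = zero S" "add P = add S"
    and f: "f \<in> alg_hom k A S" and g: "g \<in> alg_hom k B S"
    and \<phi>: "\<And>x y. x \<in> carrier A \<Longrightarrow> y \<in> carrier B \<Longrightarrow> \<phi> x y = f x \<otimes>\<^bsub>S\<^esub> g y"
  shows "tensor_lift P \<phi> \<in> alg_hom k TA S"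
    and "\<And>x y. x \<in> carrier A \<Longrightarrow> y \<in> carrier B \<Longrightarrow> tensor_lift P \<phi> (pure x y) = f x \<otimes>\<^bsub>S\<^esub> g y"
proof -
  interpret S: algebra k S by fact
  have Pc: "cring P" by (rule cring_transfer[OF S.M_cring P])
  interpret P: cring P by (rule Pc)
  note fg = alg_hom_closed[OF f] alg_hom_closed[OF g] alg_hom_add[OF f] alg_hom_add[OF g] alg_hom_mult[OF f]
    alg_hom_mult[OF g] alg_hom_one[OF f] alg_hom_one[OF g] alg_hom_smult[OF f] alg_hom_smult[OF g]
  have bal: "balanced P \<phi>"
  proof (rule balancedI)
    fix c x y assume c: "c \<in> carrier k" "x \<in> carrier A" "y \<in> carrier B"
    then have "f x \<otimes>\<^bsub>S\<^esub> (c \<odot>\<^bsub>S\<^esub> g y) = (c \<odot>\<^bsub>S\<^esub> f x) \<otimes>\<^bsub>S\<^esub> g y"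
      using fg(1,2) S.smult_assoc2[of c "g y" "f x"] S.smult_assoc2[of c "f x" "g y"]
      by (simp add: S.m_comm)
    then show "\<phi> (c \<odot>\<^bsub>A\<^esub> x) y = \<phi> x (c \<odot>\<^bsub>B\<^esub> y)" using c by (simp add: \<phi> fg)
  qed (use P in \<open>simp_all add: \<phi> fg S.l_distr S.r_distr\<close>)
  show pure: "tensor_lift P \<phi> (pure x y) = f x \<otimes>\<^bsub>S\<^esub> g y" if "x \<in> carrier A" "y \<in> carrier B" for x y
    using tensor_lift_pure[OF P.abelian_group_axioms bal that] that by (simp add: \<phi>)
  have hom: "tensor_lift P \<phi> \<in> ring_hom T P"
    by (rule tensor_lift_ring_hom[OF P.ring_axioms bal]) (use P in \<open>auto simp: \<phi> fg S.m_ac\<close>)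
  show "tensor_lift P \<phi> \<in> alg_hom k TA S"
  proof (rule alg_hom_unit_smult[OF TA_algebra S])
    show "tensor_lift P \<phi> \<in> ring_hom TA S" using hom P by (simp add: ring_hom_def)
    fix c assume "c \<in> carrier k"
    then show "tensor_lift P \<phi> (c \<odot>\<^bsub>TA\<^esub> \<one>\<^bsub>TA\<^esub>) = c \<odot>\<^bsub>S\<^esub> \<one>\<^bsub>S\<^esub>"
      by (simp add: T_one TA_smult_pure pure fg)
  qed
qed

lemma tensor_alg_hom_eqI:
  assumes "f \<in> alg_hom k TA S" "g \<in> alg_hom k TA S"
    and "\<And>x. x \<in> carrier A \<Longrightarrow> f (pure x \<one>\<^bsub>B\<^esub>) = g (pure x \<one>\<^bsub>B\<^esub>)"
    and "\<And>y. y \<in> carrier B \<Longrightarrow> f (pure \<one>\<^bsub>A\<^esub> y) = g (pure \<one>\<^bsub>A\<^esub> y)"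
    and "t \<in> carrier T"
  shows "f t = g t"
proof -
  have "f \<in> ring_hom T S" "g \<in> ring_hom T S"
    using assms(1,2) by (simp_all add: alg_hom_def ring_hom_def)
  then show ?thesis by (rule tensor_hom_eqI) (use assms in auto)
qed

end

lemma tensor_map_alg_hom:
  assumes "algebra k A" "algebra k B" "algebra k C" "algebra k D"
    and f: "f \<in> alg_hom k C A" and g: "g \<in> alg_hom k D B"
  shows "tensor_map k A B f g \<in> alg_hom k (tensor_algebra k C D) (tensor_algebra k A B)"
    and "\<And>x y. x \<in> carrier C \<Longrightarrow> y \<in> carrier D \<Longrightarrow>
      tensor_map k A B f g (pure_tensor k C D x y) = pure_tensor k A B (f x) (g y)"
proof -
  interpret AB: tensor_prod k A B using assms by (simp add: tensor_prod_def)
  interpret CD: tensor_prod k C D using assms by (simp add: tensor_prod_def)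
  note fg = alg_hom_closed[OF f] alg_hom_closed[OF g]
  note 1 = CD.tensor_lift_alg_hom[OF AB.TA_algebra, where P = "tensor_ring k A B",
      OF _ _ _ _ _ alg_hom_comp[OF f AB.inl_alg_hom] alg_hom_comp[OF g AB.inr_alg_hom],
      where \<phi> = "\<lambda>x y. pure_tensor k A B (f x) (g y)"]
  show "tensor_map k A B f g \<in> alg_hom k (tensor_algebra k C D) (tensor_algebra k A B)"
    unfolding tensor_map_def by (rule 1(1)) (use fg in \<open>simp_all flip: AB.pure_split\<close>)
  show "tensor_map k A B f g (pure_tensor k C D x y) = pure_tensor k A B (f x) (g y)"
    if "x \<in> carrier C" "y \<in> carrier D" for x y
    unfolding tensor_map_def using 1(2)[of x y] fg that by (simp flip: AB.pure_split)
qed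

text \<open>The associator is a lift inside a lift. For fixed \<open>z\<close> the inner one equals
  an algebra homomorphism times the constant \<open>?g z\<close>; this product form is what
  \<open>tensor_lift_alg_hom\<close> accepts for the outer one.\<close>

lemma tensor_assoc_alg_hom:
  assumes A: "algebra k A" and B: "algebra k B" and C: "algebra k C"
  shows "tensor_assoc k A B C \<in> alg_hom k (tensor_algebra k (tensor_algebra k A B) C) (tensor_algebra k A (tensor_algebra k B C))"
    and "\<And>x y z. x \<in> carrier A \<Longrightarrow> y \<in> carrier B \<Longrightarrow> z \<in> carrier C \<Longrightarrow>
      tensor_assoc k A B C (pure_tensor k (tensor_algebra k A B) C (pure_tensor k A B x y) z) =
      pure_tensor k A (tensor_algebra k B C) x (pure_tensor k B C y z)"
proof -
  interpret AB: tensor_prod k A B using assms by (simp add: tensor_prod_def)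
  interpret BC: tensor_prod k B C using assms by (simp add: tensor_prod_def)
  interpret AB_C: tensor_prod k "tensor_algebra k A B" C using C AB.TA_algebra by (simp add: tensor_prod_def)
  interpret A_BC: tensor_prod k A "tensor_algebra k B C" using A BC.TA_algebra by (simp add: tensor_prod_def)
  let ?P = "tensor_ring k A (tensor_algebra k B C)"
  let ?f = "tensor_lift ?P (\<lambda>x y. A_BC.pure x (BC.pure y \<one>\<^bsub>C\<^esub>))"
  let ?g = "\<lambda>z. A_BC.pure \<one>\<^bsub>A\<^esub> (BC.pure \<one>\<^bsub>B\<^esub> z)"
  let ?\<phi> = "\<lambda>z. tensor_lift ?P (\<lambda>x y. A_BC.pure x (BC.pure y z))"
  have split: "A_BC.pure x (BC.pure y z) = A_BC.pure x (BC.pure y \<one>\<^bsub>C\<^esub>) \<otimes>\<^bsub>?P\<^esub> ?g z"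
    if "x \<in> carrier A" "y \<in> carrier B" "z \<in> carrier C" for x y z
    using that by (simp add: A_BC.pure_mult BC.pure_mult)
  have f: "?f \<in> alg_hom k (tensor_algebra k A B) (tensor_algebra k A (tensor_algebra k B C))"
    "x \<in> carrier A \<Longrightarrow> y \<in> carrier B \<Longrightarrow> ?f (AB.pure x y) = A_BC.pure x (BC.pure y \<one>\<^bsub>C\<^esub>)" for x y
  proof -
    note 1 = AB.tensor_lift_alg_hom[OF A_BC.TA_algebra, where P = ?P,
      OF _ _ _ _ _ A_BC.inl_alg_hom alg_hom_comp[OF BC.inl_alg_hom A_BC.inr_alg_hom],
      where \<phi> = "\<lambda>x y. A_BC.pure x (BC.pure y \<one>\<^bsub>C\<^esub>)"]
    show "?f \<in> alg_hom k (tensor_algebra k A B) (tensor_algebra k A (tensor_algebra k B C))"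
      by (rule 1(1)) (simp_all add: A_BC.pure_mult BC.T_one BC.pure_mult)
    show "?f (AB.pure x y) = A_BC.pure x (BC.pure y \<one>\<^bsub>C\<^esub>)" if "x \<in> carrier A" "y \<in> carrier B"
      using 1(2)[of x y] that by (simp add: A_BC.pure_mult BC.T_one BC.pure_mult)
  qed
  have g: "?g \<in> alg_hom k C (tensor_algebra k A (tensor_algebra k B C))"
    using alg_hom_comp[OF BC.inr_alg_hom A_BC.inr_alg_hom] by (simp add: comp_def)
  have bal: "AB.balanced ?P (\<lambda>x y. A_BC.pure x (BC.pure y z))" if "z \<in> carrier C" for z
    by (rule AB.balancedI)
       (use that in \<open>simp_all add: A_BC.pure_add_left BC.pure_add_left A_BC.pure_smult BC.TA_smult_pure A_BC.pure_add_right[of _ "BC.pure y z" "BC.pure y' z" for y y', simplified]\<close>)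
  \<comment> \<open>Both sides are additive in \<open>t\<close>. The inner lift by itself is not
    multiplicative unless \<open>z\<close> is one, hence the comparison of additive maps on pure
    tensors.\<close>
  have \<phi>: "?\<phi> z t = ?f t \<otimes>\<^bsub>?P\<^esub> ?g z" if "t \<in> carrier AB.T" "z \<in> carrier C" for t z
    using that(1)
  proof (rule AB.tensor_eqI)
    fix x y assume xy: "x \<in> carrier A" "y \<in> carrier B"
    have "?\<phi> z (AB.pure x y) = A_BC.pure x (BC.pure y z)"
      by (rule AB.tensor_lift_pure[OF A_BC.T.abelian_group_axioms bal[OF that(2)] xy])
    then show "?\<phi> z (AB.pure x y) = ?f (AB.pure x y) \<otimes>\<^bsub>?P\<^esub> ?g z"
      using split[OF xy that(2)] f(2)[OF xy] by simp
  next
    fix s t assume st: "s \<in> carrier AB.T" "t \<in> carrier AB.T"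
    show "?\<phi> z (s \<oplus>\<^bsub>AB.T\<^esub> t) = ?\<phi> z s \<oplus>\<^bsub>?P\<^esub> ?\<phi> z t"
      by (rule AB.tensor_lift_add[OF A_BC.T.abelian_group_axioms bal[OF that(2)] st])
    show "?f (s \<oplus>\<^bsub>AB.T\<^esub> t) \<otimes>\<^bsub>?P\<^esub> ?g z = ?f s \<otimes>\<^bsub>?P\<^esub> ?g z \<oplus>\<^bsub>?P\<^esub> ?f t \<otimes>\<^bsub>?P\<^esub> ?g z"
      using alg_hom_add[OF f(1), of s t] alg_hom_closed[OF f(1)] alg_hom_closed[OF g] st that
      by (simp add: A_BC.T.l_distr)
  qed
  have \<phi>': "?\<phi> z t = ?f t \<otimes>\<^bsub>A_BC.TA\<^esub> ?g z" if "t \<in> carrier AB.TA" "z \<in> carrier C" for t z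
    using that unfolding tensor_algebra_simps by (rule \<phi>)
  note 1 = AB_C.tensor_lift_alg_hom[OF A_BC.TA_algebra, where P = ?P, OF _ _ _ _ _ f(1) g \<phi>']
  show "tensor_assoc k A B C \<in> alg_hom k AB_C.TA A_BC.TA"
    unfolding tensor_assoc_def Let_def by (rule 1(1)) simp_all
  show "tensor_assoc k A B C (AB_C.pure (AB.pure x y) z) = A_BC.pure x (BC.pure y z)"
    if "x \<in> carrier A" "y \<in> carrier B" "z \<in> carrier C" for x y z
  proof -
    have "tensor_assoc k A B C (AB_C.pure (AB.pure x y) z) = ?f (AB.pure x y) \<otimes>\<^bsub>A_BC.TA\<^esub> ?g z"
      unfolding tensor_assoc_def Let_def by (rule 1(2)) (use that in simp_all)
    then show ?thesis using split[OF that] f(2)[OF that(1,2)] by simp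
  qed
qed

section \<open>Gradings on tensor products\<close>

locale graded_tensor = tensor_prod +
  fixes Gk GA GB
  assumes A_graded: "graded_algebra k Gk A GA" and B_graded: "graded_algebra k Gk B GB"
begin

sublocale GA: graded A GA using A_graded by (intro gradedI) (simp add: graded_algebra_def)
sublocale GB: graded B GB using B_graded by (intro gradedI) (simp add: graded_algebra_def)

abbreviation "TG \<equiv> tensor_grading k A GA B GB"

lemma pure_homog:
  assumes "\<alpha> > 0" "\<beta> > 0" "x \<in> GA \<alpha>" "y \<in> GB \<beta>" "\<alpha> * \<beta> = \<gamma>" shows "pure x y \<in> TG \<gamma>"
  unfolding tensor_grading_def using assms by (intro generate.incl) blast

lemma TG_gen_subset: "\<gamma> > 0 \<Longrightarrow> {pure x y | x y. \<exists>\<alpha>>0. \<exists>\<beta>>0. \<alpha> * \<beta> = \<gamma> \<and> x \<in> GA \<alpha> \<and> y \<in> GB \<beta>} \<subseteq> carrier T"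
proof
  fix t assume "t \<in> {pure x y | x y. \<exists>\<alpha>>0. \<exists>\<beta>>0. \<alpha> * \<beta> = \<gamma> \<and> x \<in> GA \<alpha> \<and> y \<in> GB \<beta>}"
  then obtain x y \<alpha> \<beta> where "t = pure x y" "\<alpha> > 0" "\<beta> > 0" "x \<in> GA \<alpha>" "y \<in> GB \<beta>" by blast
  then show "t \<in> carrier T" using GA.G_carrier GB.G_carrier by simp
qed

lemma TG_subgroup: "\<gamma> > 0 \<Longrightarrow> additive_subgroup (TG \<gamma>) T"
  unfolding tensor_grading_def
  by (intro additive_subgroupI T.add.generate_is_subgroup TG_gen_subset)

lemma TG_induct [consumes 2, case_names pure add]:
  assumes "t \<in> TG \<gamma>" "\<gamma> > 0"
    and pure: "\<And>x y \<alpha> \<beta>. \<alpha> > 0 \<Longrightarrow> \<beta> > 0 \<Longrightarrow> \<alpha> * \<beta> = \<gamma> \<Longrightarrow> x \<in> GA \<alpha> \<Longrightarrow> y \<in> GB \<beta> \<Longrightarrow> P (pure x y)"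
    and add: "\<And>s t. s \<in> TG \<gamma> \<Longrightarrow> t \<in> TG \<gamma> \<Longrightarrow> P s \<Longrightarrow> P t \<Longrightarrow> P (s \<oplus>\<^bsub>T\<^esub> t)"
  shows "P t"
  using assms(1) unfolding tensor_grading_def
proof (induction t rule: generate.induct)
  case one
  have "P (pure \<zero>\<^bsub>A\<^esub> \<zero>\<^bsub>B\<^esub>)" using assms(2) by (intro pure[of \<gamma> 1]) auto
  then show ?case by (simp add: pure_zero_left)
next
  case (incl h)
  then show ?case using pure by blast
next
  case (inv h)
  then obtain x y \<alpha> \<beta> where h: "h = pure x y" "\<alpha> > 0" "\<beta> > 0" "\<alpha> * \<beta> = \<gamma>" "x \<in> GA \<alpha>" "y \<in> GB \<beta>" by blast
  then have "\<ominus>\<^bsub>T\<^esub> h = pure (\<ominus>\<^bsub>A\<^esub> x) y"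
    using GA.G_carrier GB.G_carrier by (simp add: pure_minus_left)
  then have "P (\<ominus>\<^bsub>T\<^esub> h)" using pure[of \<alpha> \<beta> "\<ominus>\<^bsub>A\<^esub> x" y] h GA.G_minus by simp
  then show ?case by (simp add: a_inv_def)
next
  case (eng g h)
  then show ?case using add[of g h] by (simp add: tensor_grading_def)
qed

lemma TG_carrier: "\<gamma> > 0 \<Longrightarrow> t \<in> TG \<gamma> \<Longrightarrow> t \<in> carrier T"
  using additive_subgroup.a_subset[OF TG_subgroup] by auto

lemma TG_mult:
  assumes "\<alpha> > 0" "\<beta> > 0" "s \<in> TG \<alpha>" "t \<in> TG \<beta>"
  shows "s \<otimes>\<^bsub>T\<^esub> t \<in> TG (\<alpha> * \<beta>)"
proof -
  have p: "\<alpha> * \<beta> > 0" using assms by simp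
  interpret additive_subgroup "TG (\<alpha> * \<beta>)" T by (rule TG_subgroup[OF p])
  from assms(3,1) show ?thesis
  proof (induction s rule: TG_induct)
    case (pure x y a b)
    note s = pure
    have xy: "x \<in> carrier A" "y \<in> carrier B" using s GA.G_carrier GB.G_carrier by auto
    from assms(4,2) show ?case
    proof (induction t rule: TG_induct)
      case (pure x' y' a' b')
      have "x' \<in> carrier A" "y' \<in> carrier B" using pure GA.G_carrier GB.G_carrier by auto
      then have "pure x y \<otimes>\<^bsub>T\<^esub> pure x' y' = pure (x \<otimes>\<^bsub>A\<^esub> x') (y \<otimes>\<^bsub>B\<^esub> y')" using xy by (simp add: pure_mult)
      also have "\<dots> \<in> TG (\<alpha> * \<beta>)"
        by (rule pure_homog[of "a * a'" "b * b'"])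
           (use s pure GA.G_mult GB.G_mult in \<open>auto simp: mult.assoc mult.left_commute\<close>)
      finally show ?case .
    next
      case (add s t)
      then show ?case using TG_carrier[OF assms(2)] xy by (simp add: T.r_distr)
    qed
  next
    case (add s s')
    then show ?case using TG_carrier[OF assms(1)] TG_carrier[OF assms(2,4)] by (simp add: T.l_distr)
  qed
qed

lemma TG_pregraded: "pregraded T TG"
  by (intro pregraded.intro pregraded_axioms.intro T_cring TG_subgroup TG_mult)

lemma TG_one: "\<one>\<^bsub>T\<^esub> \<in> TG 1"
  unfolding T_one by (rule pure_homog[of 1 1]) (simp_all add: GA.one_homog GB.one_homog)

lemma TG_pregraded_TA: "pregraded TA TG" "\<one>\<^bsub>TA\<^esub> \<in> TG 1"
proof -
  have "additive_subgroup (TG \<gamma>) TA" if "\<gamma> > 0" for \<gamma>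
    using TG_subgroup[OF that] by (simp add: additive_subgroup_def subgroup_def m_inv_def)
  then show "pregraded TA TG"
    using TA_algebra[THEN algebra.M_cring] TG_mult
    by (intro pregraded.intro pregraded_axioms.intro) auto
qed (simp add: TG_one)

lemma tensor_graded_induct [consumes 1, case_names pure add]:
  assumes "t \<in> carrier T"
    and pure: "\<And>x y \<alpha> \<beta>. \<alpha> > 0 \<Longrightarrow> \<beta> > 0 \<Longrightarrow> x \<in> GA \<alpha> \<Longrightarrow> y \<in> GB \<beta> \<Longrightarrow> P (pure x y)"
    and add: "\<And>s t. s \<in> carrier T \<Longrightarrow> t \<in> carrier T \<Longrightarrow> P s \<Longrightarrow> P t \<Longrightarrow> P (s \<oplus>\<^bsub>T\<^esub> t)"
  shows "P t"
  using assms(1)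
proof (induction t rule: tensor_induct)
  case (pure x y)
  then show ?case
  proof (induction x rule: GA.graded_induct)
    case (homog \<alpha> x)
    from homog(3) show ?case
    proof (induction y rule: GB.graded_induct)
      case (homog \<beta> y)
      then show ?case using assms(2) \<open>\<alpha> > 0\<close> \<open>x \<in> GA \<alpha>\<close> by blast
    next
      case (add y y')
      then show ?case using assms(3) GA.G_carrier[OF \<open>\<alpha> > 0\<close> \<open>x \<in> GA \<alpha>\<close>] by (simp add: pure_add_right)
    qed
  next
    case (add x x')
    then show ?case using assms(3) by (simp add: pure_add_left)
  qed
qed (use assms(3) in auto)

end

lemma graded_tensorI:
  assumes "graded_algebra k Gk A GA" "graded_algebra k Gk B GB"
  shows "graded_tensor k A B Gk GA GB"
  using assms by (simp add: graded_tensor_def graded_tensor_axioms_def tensor_prod_def graded_algebra_def)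

section \<open>The plane and its curves\<close>

lemma plane_simps [simp]:
  "carrier (plane k) = carrier (UP (UP k))" "monoid.mult (plane k) = monoid.mult (UP (UP k))"
  "one (plane k) = one (UP (UP k))" "zero (plane k) = zero (UP (UP k))" "add (plane k) = add (UP (UP k))"
  by (simp_all add: plane_def)

context
  fixes k :: "('k, 'm) ring_scheme"
  assumes k: "cring k"
begin

interpretation U: UP_cring k "UP k" by (rule UP_cringI[OF k]) simp
interpretation UU: UP_cring "UP k" "UP (UP k)" by (rule UP_cringI[OF cring_UP[OF k]]) simp

lemma plane_const_hom: "(\<lambda>P. monom (UP (UP k)) P 0) \<in> ring_hom (UP k) (UP (UP k))"
  by (rule UU.const_ring_hom)

lemma plane_smult:
  assumes "c \<in> carrier k" "P \<in> carrier (UP (UP k))"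
  shows "c \<odot>\<^bsub>plane k\<^esub> P = monom (UP (UP k)) (monom (UP k) c 0) 0 \<otimes>\<^bsub>UP (UP k)\<^esub> P"
  using assms by (simp add: plane_def UU.monom_mult_is_smult)

lemma plane_algebra: "algebra k (plane k)"
proof (rule algebra_transfer)
  show "algebra k (with_scalars (UP (UP k)) (\<lambda>c P. monom (UP (UP k)) (monom (UP k) c 0) 0 \<otimes>\<^bsub>UP (UP k)\<^esub> P))"
    by (rule with_scalars_algebra[OF k UU.UP_cring])
       (use ring_hom_trans[OF U.const_ring_hom UU.const_ring_hom] in \<open>simp add: comp_def\<close>)
qed (simp_all add: plane_smult)

interpretation PL: algebra k "plane k" by (rule plane_algebra)

lemma plane_unit: "c \<in> carrier k \<Longrightarrow> c \<odot>\<^bsub>plane k\<^esub> \<one>\<^bsub>plane k\<^esub> = monom (UP (UP k)) (monom (UP k) c 0) 0"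
  by (simp add: plane_smult)

lemma plane_unit': "c \<in> carrier k \<Longrightarrow> c \<odot>\<^bsub>plane k\<^esub> \<one>\<^bsub>UP (UP k)\<^esub> = monom (UP (UP k)) (monom (UP k) c 0) 0"
  by (simp add: plane_smult)

lemma plane_const_alg_hom: "(\<lambda>P. monom (UP (UP k)) P 0) \<in> alg_hom k (UP k) (plane k)"
proof (rule alg_hom_unit_smult[OF UP_algebra[OF k] plane_algebra])
  show "(\<lambda>P. monom (UP (UP k)) P 0) \<in> ring_hom (UP k) (plane k)"
    using plane_const_hom by (simp add: ring_hom_def)
qed (simp add: plane_unit' UP_smult_unit[OF k])

lemma plane_T_closed: "plane_T1 k \<in> carrier (plane k)" "plane_T2 k \<in> carrier (plane k)"
  by (simp_all add: plane_T1_def plane_T2_def)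

lemma plane_const_peval: "P \<in> carrier (UP k) \<Longrightarrow> monom (UP (UP k)) P 0 = peval k (plane k) (plane_T1 k) P"
  by (rule UP_alg_hom_eqI[OF plane_algebra plane_const_alg_hom peval_alg_hom[OF plane_algebra plane_T_closed(1)]])
     (simp_all only: peval_T[OF plane_algebra plane_T_closed(1)], simp add: plane_T1_def)

context
  fixes S :: "('k, 'a, 'n) module_scheme" and x1 x2
  assumes S: "algebra k S" and x: "x1 \<in> carrier S" "x2 \<in> carrier S"
begin

interpretation S: algebra k S by (rule S)

lemma plane_eval_const: "P \<in> carrier (UP k) \<Longrightarrow> plane_eval k S x1 x2 (monom (UP (UP k)) P 0) = peval k S x1 P"
  unfolding plane_eval_def
  by (rule eval_of_const[OF U.UP_cring S.M_cring alg_hom_ring_hom[OF peval_alg_hom[OF S x(1)]] x(2)])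

lemma plane_eval_T2: "plane_eval k S x1 x2 (plane_T2 k) = x2"
  unfolding plane_eval_def plane_T2_def
  by (rule eval_of_T[OF U.UP_cring S.M_cring alg_hom_ring_hom[OF peval_alg_hom[OF S x(1)]] x(2)])

lemma plane_eval_T1: "plane_eval k S x1 x2 (plane_T1 k) = x1"
  unfolding plane_T1_def by (simp add: plane_eval_const peval_T[OF S x(1), simplified])

lemma plane_eval_alg_hom: "plane_eval k S x1 x2 \<in> alg_hom k (plane k) S"
proof (rule alg_hom_unit_smult[OF plane_algebra S])
  show "plane_eval k S x1 x2 \<in> ring_hom (plane k) S"
    using eval_hom[OF U.UP_cring S.M_cring alg_hom_ring_hom[OF peval_alg_hom[OF S x(1)]] x(2)]
    by (simp add: plane_eval_def ring_hom_def)
  fix c assume c: "c \<in> carrier k"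
  then show "plane_eval k S x1 x2 (c \<odot>\<^bsub>plane k\<^esub> \<one>\<^bsub>plane k\<^esub>) = c \<odot>\<^bsub>S\<^esub> \<one>\<^bsub>S\<^esub>"
    using peval_monom[OF S x(1) c, of 0] by (simp add: plane_unit' plane_eval_const)
qed

end

lemma plane_alg_hom_eqI:
  assumes S: "algebra k S" and f: "f \<in> alg_hom k (plane k) S" and g: "g \<in> alg_hom k (plane k) S"
    and T1: "f (plane_T1 k) = g (plane_T1 k)" and T2: "f (plane_T2 k) = g (plane_T2 k)"
    and P: "P \<in> carrier (plane k)"
  shows "f P = g P"
proof (rule UP_hom_eqI[OF U.UP_cring algebra.M_cring[OF S]])
  show "f \<in> ring_hom (UP (UP k)) S" "g \<in> ring_hom (UP (UP k)) S"
    using f g by (simp_all add: alg_hom_def ring_hom_def)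
  show "f (monom (UP (UP k)) \<one>\<^bsub>UP k\<^esub> 1) = g (monom (UP (UP k)) \<one>\<^bsub>UP k\<^esub> 1)"
    using T2 by (simp add: plane_T2_def)
  show "P \<in> carrier (UP (UP k))" using P by simp
  fix c assume c: "c \<in> carrier (UP k)"
  have "(f \<circ> (\<lambda>P. monom (UP (UP k)) P 0)) c = (g \<circ> (\<lambda>P. monom (UP (UP k)) P 0)) c"
    by (rule UP_alg_hom_eqI[OF S alg_hom_comp[OF plane_const_alg_hom f] alg_hom_comp[OF plane_const_alg_hom g] _ c])
       (use T1 in \<open>simp add: plane_T1_def\<close>)
  then show "f (monom (UP (UP k)) c 0) = g (monom (UP (UP k)) c 0)" by simp
qed

end

section \<open>The universal property of a curve in the plane\<close>

locale curve =
  fixes k :: "('k, 'm) ring_scheme" and q :: nat and f :: "nat \<Rightarrow> 'k"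
  assumes k: "cring k" and f: "f \<in> carrier (UP k)"
begin

abbreviation "PL \<equiv> plane k"
abbreviation "I \<equiv> curve_ideal k q f"
abbreviation "C \<equiv> curve_algebra k q f"
abbreviation "T1 \<equiv> curve_T1 k q f"
abbreviation "T2 \<equiv> curve_T2 k q f"

definition "w = plane_T2 k [^]\<^bsub>PL\<^esub> q \<ominus>\<^bsub>PL\<^esub> monom (UP (UP k)) f 0"

sublocale PL: algebra k PL by (rule plane_algebra[OF k])

lemma const_f: "monom (UP (UP k)) f 0 \<in> carrier PL"
  using alg_hom_closed[OF plane_const_alg_hom[OF k] f] by simp

lemma w_closed: "w \<in> carrier PL"
  unfolding w_def using plane_T_closed[OF k] const_f by (intro PL.minus_closed PL.nat_pow_closed) simp_all

sublocale I: ideal I PL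
  unfolding curve_ideal_def w_def[symmetric] by (rule PL.cgenideal_ideal[OF w_closed])

lemma I_mem: "x \<in> I \<longleftrightarrow> (\<exists>P\<in>carrier PL. x = P \<otimes>\<^bsub>PL\<^esub> w)"
  unfolding curve_ideal_def w_def[symmetric] cgenideal_def by auto

definition "proj P = I +>\<^bsub>PL\<^esub> P"

lemma C_fields:
  "carrier C = carrier (PL Quot I)" "monoid.mult C = monoid.mult (PL Quot I)" "one C = one (PL Quot I)"
  "zero C = zero (PL Quot I)" "add C = add (PL Quot I)"
  by (simp_all add: curve_algebra_def quotient_algebra_def)

lemma proj_ring_hom: "proj \<in> ring_hom PL (PL Quot I)"
  using I.rcos_ring_hom by (simp add: proj_def[abs_def])

lemma C_algebra: "algebra k C"
  unfolding curve_algebra_def quotient_algebra_def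
  by (rule with_scalars_algebra[OF k I.quotient_is_cring[OF PL.M_cring]])
     (use ring_hom_trans[OF algebra_unit_hom[OF PL.algebra_axioms] proj_ring_hom] in \<open>simp add: comp_def proj_def\<close>)

sublocale C: algebra k C by (rule C_algebra)

lemma proj_alg_hom: "proj \<in> alg_hom k PL C"
proof (rule alg_hom_unit_smult[OF PL.algebra_axioms C_algebra])
  show h: "proj \<in> ring_hom PL C" using proj_ring_hom C_fields by (simp add: ring_hom_def)
  fix c assume c: "c \<in> carrier k"
  have "proj (c \<odot>\<^bsub>PL\<^esub> \<one>\<^bsub>PL\<^esub>) \<in> carrier C"
    using c by (intro ring_hom_closed[OF h]) (intro PL.smult_closed PL.one_closed)
  then have "c \<odot>\<^bsub>C\<^esub> \<one>\<^bsub>C\<^esub> = proj (c \<odot>\<^bsub>PL\<^esub> \<one>\<^bsub>PL\<^esub>)"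
    using C.r_one[of "proj (c \<odot>\<^bsub>PL\<^esub> \<one>\<^bsub>PL\<^esub>)"]
    by (simp add: curve_algebra_def quotient_algebra_def proj_def)
  then show "proj (c \<odot>\<^bsub>PL\<^esub> \<one>\<^bsub>PL\<^esub>) = c \<odot>\<^bsub>C\<^esub> \<one>\<^bsub>C\<^esub>" by simp
qed

lemma C_carrier: "carrier C = proj ` carrier PL"
  by (auto simp: C_fields FactRing_def A_RCOSETS_def' proj_def)

lemma C_cases:
  assumes "X \<in> carrier C" obtains P where "P \<in> carrier PL" "X = proj P"
  using assms C_carrier by auto

lemma proj_T: "proj (plane_T1 k) = T1" "proj (plane_T2 k) = T2"
  by (simp_all add: proj_def curve_T1_def curve_T2_def)

lemma T_closed: "T1 \<in> carrier C" "T2 \<in> carrier C"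
  using plane_T_closed[OF k] C_carrier proj_T by blast+

lemma proj_zero_iff: "P \<in> carrier PL \<Longrightarrow> proj P = \<zero>\<^bsub>C\<^esub> \<longleftrightarrow> P \<in> I"
  using I.rcos_const_imp_mem PL.a_rcos_zero[OF I.ideal_axioms] by (auto simp: C_fields FactRing_def proj_def)

lemma curve_equation: "T2 [^]\<^bsub>C\<^esub> q = peval k C T1 f"
proof -
  interpret p: ring_hom_cring PL C proj
    by (rule UnivPoly.ring_hom_cringI[OF PL.M_cring C.M_cring alg_hom_ring_hom[OF proj_alg_hom]])
  have T: "plane_T1 k \<in> carrier PL" "plane_T2 k \<in> carrier PL" using plane_T_closed[OF k] by auto
  have "w \<in> I" using w_closed PL.l_one[OF w_closed] I_mem PL.one_closed by metis
  then have "proj w = \<zero>\<^bsub>C\<^esub>" using proj_zero_iff w_closed by simp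
  moreover have "proj w = proj (plane_T2 k) [^]\<^bsub>C\<^esub> q \<ominus>\<^bsub>C\<^esub> proj (monom (UP (UP k)) f 0)"
    unfolding w_def a_minus_def using T const_f by (simp only: p.hom_add p.hom_a_inv p.hom_pow PL.nat_pow_closed PL.a_inv_closed)
  moreover have "proj (monom (UP (UP k)) f 0) = peval k C T1 f"
    using alg_hom_peval[OF PL.algebra_axioms C_algebra proj_alg_hom T(1) f] plane_const_peval[OF k f] proj_T by simp
  moreover have "peval k C T1 f \<in> carrier C" by (rule alg_hom_closed[OF peval_alg_hom[OF C_algebra T_closed(1)] f])
  ultimately show ?thesis using proj_T T_closed by simp
qed

lemma C_alg_hom_eqI:
  assumes S: "algebra k S" and g: "g \<in> alg_hom k C S" and h: "h \<in> alg_hom k C S"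
    and "g T1 = h T1" "g T2 = h T2" and X: "X \<in> carrier C"
  shows "g X = h X"
proof -
  obtain P where P: "P \<in> carrier PL" "X = proj P" using X C_carrier by auto
  have "(g \<circ> proj) P = (h \<circ> proj) P"
    by (rule plane_alg_hom_eqI[OF k S alg_hom_comp[OF proj_alg_hom g] alg_hom_comp[OF proj_alg_hom h] _ _ P(1)])
       (simp_all add: proj_T assms)
  then show ?thesis using P by simp
qed

text \<open>The three structure maps of \<open>curve_hopf\<close> have this form, as do the maps to
  L[T] and to H constructed later, so well-definedness on residue classes is settled once.\<close>

definition "curve_lift S x1 x2 = (\<lambda>X. the_elem (plane_eval k S x1 x2 ` X))"

context
  fixes S :: "('k, 'a, 'n) module_scheme" and x1 x2
  assumes S: "algebra k S" and x: "x1 \<in> carrier S" "x2 \<in> carrier S"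
    and eqn: "x2 [^]\<^bsub>S\<^esub> q = peval k S x1 f"
begin

interpretation S: algebra k S by (rule S)

private lemma ev: "ring_hom_cring PL S (plane_eval k S x1 x2)"
  by (rule UnivPoly.ring_hom_cringI[OF PL.M_cring S.M_cring alg_hom_ring_hom[OF plane_eval_alg_hom[OF k S x]]])

private lemma ev_I: "P \<in> I \<Longrightarrow> plane_eval k S x1 x2 P = \<zero>\<^bsub>S\<^esub>"
proof -
  interpret e: ring_hom_cring PL S "plane_eval k S x1 x2" by (rule ev)
  have T: "plane_T1 k \<in> carrier PL" "plane_T2 k \<in> carrier PL" using plane_T_closed[OF k] by auto
  have "plane_eval k S x1 x2 w = x2 [^]\<^bsub>S\<^esub> q \<ominus>\<^bsub>S\<^esub> peval k S x1 f"
    unfolding w_def a_minus_def using T const_f plane_eval_T2[OF k S x] plane_eval_const[OF k S x f]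
    by (simp only: e.hom_add e.hom_a_inv e.hom_pow PL.nat_pow_closed PL.a_inv_closed)
  then have "plane_eval k S x1 x2 w = \<zero>\<^bsub>S\<^esub>"
    using eqn alg_hom_closed[OF peval_alg_hom[OF S x(1)] f] by simp
  moreover assume "P \<in> I"
  ultimately show ?thesis using I_mem w_closed e.hom_mult e.hom_closed S.r_null by metis
qed

lemma curve_lift_proj: "P \<in> carrier PL \<Longrightarrow> curve_lift S x1 x2 (proj P) = plane_eval k S x1 x2 P"
proof -
  interpret e: ring_hom_cring PL S "plane_eval k S x1 x2" by (rule ev)
  assume P: "P \<in> carrier PL"
  have "plane_eval k S x1 x2 Q = plane_eval k S x1 x2 P" if "Q \<in> proj P" for Q
  proof -
    have "Q \<in> (\<Union>h\<in>I. {h \<oplus>\<^bsub>PL\<^esub> P})" using that unfolding proj_def a_r_coset_def' .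
    then obtain h where h: "h \<in> I" "Q = h \<oplus>\<^bsub>PL\<^esub> P" by blast
    have "h \<in> carrier PL" using h(1) I.Icarr by blast
    then show ?thesis using h ev_I[OF h(1)] P e.hom_closed[OF P] by (simp only: h(2) e.hom_add S.l_zero)
  qed
  moreover have "P \<in> proj P" unfolding proj_def by (rule I.a_rcos_self[OF P])
  ultimately have "plane_eval k S x1 x2 ` proj P = {plane_eval k S x1 x2 P}" by blast
  then show ?thesis by (simp add: curve_lift_def)
qed

lemma curve_lift_alg_hom: "curve_lift S x1 x2 \<in> alg_hom k C S"
proof -
  note h = plane_eval_alg_hom[OF k S x] and p = proj_alg_hom
  show ?thesis
  proof (rule alg_homI)
    show "curve_lift S x1 x2 \<in> ring_hom C S"
    proof (rule ring_hom_memI)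
      show "curve_lift S x1 x2 \<one>\<^bsub>C\<^esub> = \<one>\<^bsub>S\<^esub>"
        using curve_lift_proj[OF PL.one_closed] alg_hom_one[OF p] alg_hom_one[OF h] by metis
      fix X Y assume "X \<in> carrier C" "Y \<in> carrier C"
      then obtain P Q where PQ: "P \<in> carrier PL" "X = proj P" "Q \<in> carrier PL" "Y = proj Q" unfolding C_carrier by blast
      show "curve_lift S x1 x2 (X \<otimes>\<^bsub>C\<^esub> Y) = curve_lift S x1 x2 X \<otimes>\<^bsub>S\<^esub> curve_lift S x1 x2 Y"
        using curve_lift_proj[OF PL.m_closed[OF PQ(1,3)]] alg_hom_mult[OF p PQ(1,3)] alg_hom_mult[OF h PQ(1,3)] PQ
        by (simp only: curve_lift_proj)
      show "curve_lift S x1 x2 (X \<oplus>\<^bsub>C\<^esub> Y) = curve_lift S x1 x2 X \<oplus>\<^bsub>S\<^esub> curve_lift S x1 x2 Y"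
        using curve_lift_proj[OF PL.M.a_closed[OF PQ(1,3)]] alg_hom_add[OF p PQ(1,3)] alg_hom_add[OF h PQ(1,3)] PQ
        by (simp only: curve_lift_proj)
    next
      fix X assume "X \<in> carrier C"
      then obtain P where "P \<in> carrier PL" "X = proj P" unfolding C_carrier by blast
      then show "curve_lift S x1 x2 X \<in> carrier S" using curve_lift_proj alg_hom_closed[OF h] by metis
    qed
    fix c X assume c: "c \<in> carrier k" and "X \<in> carrier C"
    then obtain P where P: "P \<in> carrier PL" "X = proj P" unfolding C_carrier by blast
    show "curve_lift S x1 x2 (c \<odot>\<^bsub>C\<^esub> X) = c \<odot>\<^bsub>S\<^esub> curve_lift S x1 x2 X"
      using curve_lift_proj[OF PL.smult_closed[OF c P(1)]] alg_hom_smult[OF p c P(1)] alg_hom_smult[OF h c P(1)] P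
      by (simp only: curve_lift_proj)
  qed
qed

lemma curve_lift_T: "curve_lift S x1 x2 T1 = x1" "curve_lift S x1 x2 T2 = x2"
  using curve_lift_proj[of "plane_T1 k"] curve_lift_proj[of "plane_T2 k"] plane_T_closed[OF k]
    plane_eval_T1[OF k S x] plane_eval_T2[OF k S x] proj_T by simp_all

end

end

locale graded_curve = curve k q f + k: graded k Gk
  for k :: "('k, 'm) ring_scheme" and Gk q f +
  fixes r1 r2 :: real
  assumes r: "r1 > 0" "r2 > 0" and f_homog: "f \<in> poly_grading k Gk r1 (r2 ^ q)"
begin

abbreviation "PG \<equiv> plane_grading k Gk r1 r2"
abbreviation "CG \<equiv> curve_grading k Gk q f r1 r2"

lemma U_graded: "graded_ring (UP k) (poly_grading k Gk r1)"
  by (rule k.UP_graded[OF r(1)])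

lemma UU_graded: "graded_ring (UP (UP k)) PG"
  unfolding plane_grading_def by (rule graded.UP_graded[OF gradedI[OF U_graded] r(2)])

lemma PL_graded: "graded_ring PL PG"
  by (rule graded_ring_transfer[OF UU_graded]) simp_all

sublocale PG: graded PL PG by (rule gradedI[OF PL_graded])

lemma plane_T_homog: "plane_T1 k \<in> PG r1" "plane_T2 k \<in> PG r2"
proof -
  interpret U: graded "UP k" "poly_grading k Gk r1" by (rule gradedI[OF U_graded])
  have "monom (UP k) \<one>\<^bsub>k\<^esub> 1 \<in> poly_grading k Gk r1 (1 * r1 ^ 1)"
    by (rule monom_homog[OF k.graded r(1) _ k.one_homog]) simp
  then show "plane_T1 k \<in> PG r1"
    unfolding plane_T1_def plane_grading_def
    using monom_homog[OF U_graded r(2), of r1 "monom (UP k) \<one>\<^bsub>k\<^esub> 1" 0] r by simp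
  show "plane_T2 k \<in> PG r2"
    unfolding plane_T2_def plane_grading_def
    using monom_homog[OF U_graded r(2), of 1 "\<one>\<^bsub>UP k\<^esub>" 1] U.one_homog by simp
qed

lemma plane_const_homog: "\<gamma> > 0 \<Longrightarrow> P \<in> poly_grading k Gk r1 \<gamma> \<Longrightarrow> monom (UP (UP k)) P 0 \<in> PG \<gamma>"
  unfolding plane_grading_def using monom_homog[OF U_graded r(2), of \<gamma> P 0] by simp

lemma w_homog: "w \<in> PG (r2 ^ q)"
  unfolding w_def a_minus_def using r plane_T_homog plane_const_homog[OF _ f_homog]
  by (intro PG.G_add PG.G_minus PG.G_pow) auto

lemma CG_eq: "CG \<gamma> = proj ` PG \<gamma>"
  by (simp add: curve_grading_def quotient_grading_def proj_def[abs_def])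

text \<open>The ideal is generated by the homogeneous \<open>w\<close>. If a sum of homogeneous
  \<open>d \<gamma>\<close> equals \<open>Q * w\<close>, then each \<open>d \<gamma>\<close> is the
  product of \<open>w\<close> with one homogeneous part of \<open>Q\<close>, so each term lies in
  the ideal.\<close>

lemma C_graded: "graded_ring C CG"
proof (rule graded_ringI)
  interpret p: ring_hom_cring PL C proj
    by (rule UnivPoly.ring_hom_cringI[OF PL.M_cring C.M_cring alg_hom_ring_hom[OF proj_alg_hom]])
  show "cring C" by (rule C.M_cring)
  show sub: "additive_subgroup (CG \<gamma>) C" if "\<gamma> > 0" for \<gamma>
  proof (intro additive_subgroupI C.M.add.subgroupI)
    show "CG \<gamma> \<subseteq> carrier C" unfolding CG_eq using PG.G_carrier[OF that] p.hom_closed by blast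
    show "CG \<gamma> \<noteq> {}" unfolding CG_eq using PG.G_zero[OF that] by blast
    fix X assume "X \<in> CG \<gamma>"
    then obtain P where P: "P \<in> PG \<gamma>" "X = proj P" unfolding CG_eq by blast
    show "\<ominus>\<^bsub>C\<^esub> X \<in> CG \<gamma>" unfolding CG_eq
      using P PG.G_minus[OF that P(1)] p.hom_a_inv[OF PG.G_carrier[OF that P(1)]] by blast
    fix Y assume "Y \<in> CG \<gamma>"
    then obtain Q where Q: "Q \<in> PG \<gamma>" "Y = proj Q" unfolding CG_eq by blast
    show "X \<oplus>\<^bsub>C\<^esub> Y \<in> CG \<gamma>" unfolding CG_eq
      using P Q PG.G_add[OF that P(1) Q(1)] p.hom_add[OF PG.G_carrier[OF that P(1)] PG.G_carrier[OF that Q(1)]] by blast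
  qed
  show "X \<otimes>\<^bsub>C\<^esub> Y \<in> CG (\<alpha> * \<beta>)" if pos: "\<alpha> > 0" "\<beta> > 0" and XY: "X \<in> CG \<alpha>" "Y \<in> CG \<beta>" for \<alpha> \<beta> X Y
  proof -
    obtain P Q where PQ: "P \<in> PG \<alpha>" "X = proj P" "Q \<in> PG \<beta>" "Y = proj Q" using XY unfolding CG_eq by blast
    then show ?thesis unfolding CG_eq
      using PG.G_mult[OF pos PQ(1,3)] p.hom_mult[OF PG.G_carrier[OF pos(1) PQ(1)] PG.G_carrier[OF pos(2) PQ(3)]] by blast
  qed
  show "\<exists>c K. hsum C CG X c K" if X: "X \<in> carrier C" for X
  proof -
    obtain P where P: "P \<in> carrier PL" "X = proj P" by (rule C_cases[OF X])
    have "\<exists>c K. hsum C CG (proj P) c K" using P(1)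
    proof (induction P rule: PG.graded_induct)
      case (homog \<gamma> P)
      then have "proj P \<in> CG \<gamma>" "proj P \<in> carrier C"
        unfolding CG_eq using PG.G_carrier[OF homog] p.hom_closed by blast+
      then show ?case by (intro hsum_homog[OF C.M_cring homog(1)])
    next
      case (add P Q)
      then show ?case using hsum_add[OF C.M_cring sub] p.hom_add[OF add(1,2)] by simp
    qed
    then show ?thesis using P by simp
  qed
  show "c \<gamma> = \<zero>\<^bsub>C\<^esub>" if h: "hsum C CG \<zero>\<^bsub>C\<^esub> c K" and \<gamma>: "\<gamma> \<in> K" for c K \<gamma>
  proof -
    have K: "finite K" "K \<subseteq> {0<..}" "\<And>\<gamma>. \<gamma> \<in> K \<Longrightarrow> c \<gamma> \<in> CG \<gamma>" "\<zero>\<^bsub>C\<^esub> = finsum C c K"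
      using h by (auto simp: hsum_def)
    have "\<forall>\<gamma>\<in>K. \<exists>P. P \<in> PG \<gamma> \<and> c \<gamma> = proj P" using K(3) unfolding CG_eq by blast
    then obtain d where d: "\<And>\<gamma>. \<gamma> \<in> K \<Longrightarrow> d \<gamma> \<in> PG \<gamma>" "\<And>\<gamma>. \<gamma> \<in> K \<Longrightarrow> c \<gamma> = proj (d \<gamma>)" by metis
    have dK: "d \<in> K \<rightarrow> carrier PL" using d(1) K(2) PG.G_carrier by fastforce
    define x where "x = finsum PL d K"
    have x: "x \<in> carrier PL" unfolding x_def using dK by (rule PL.M.finsum_closed)
    have "proj x = finsum C (proj \<circ> d) K" unfolding x_def by (rule p.hom_finsum[OF dK])
    also have "\<dots> = finsum C c K"
      by (rule C.M.finsum_cong') (use d dK p.hom_closed in \<open>auto simp: Pi_def\<close>)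
    finally have "x \<in> I" using K(4) proj_zero_iff[OF x] by simp
    then obtain Q where Q: "Q \<in> carrier PL" "x = Q \<otimes>\<^bsub>PL\<^esub> w" using I_mem by blast
    have "hsum PL PG x d K" using K d by (simp add: hsum_def x_def)
    then have "d \<gamma> = hcomp PL PG \<gamma> x" using PG.hcomp_unique \<gamma> by simp
    also have "\<dots> = hcomp PL PG (\<gamma> / r2 ^ q) Q \<otimes>\<^bsub>PL\<^esub> w"
      using PG.hcomp_mult_homog[OF Q(1) w_homog, of "\<gamma> / r2 ^ q"] r Q(2) by simp
    finally have "d \<gamma> \<in> I" using I_mem PG.hcomp_closed[OF Q(1)] by blast
    then show ?thesis using d(2)[OF \<gamma>] proj_zero_iff I.Icarr by blast
  qed
qed

sublocale CG: graded C CG by (rule gradedI[OF C_graded])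

lemma plane_unit_homog: "\<gamma> > 0 \<Longrightarrow> c \<in> Gk \<gamma> \<Longrightarrow> c \<odot>\<^bsub>PL\<^esub> \<one>\<^bsub>PL\<^esub> \<in> PG \<gamma>"
  using plane_const_homog[of \<gamma> "monom (UP k) c 0"] monom_homog[OF k.graded r(1), of \<gamma> c 0] k.G_carrier[of \<gamma> c]
  by (simp only: plane_unit[OF k] power_0 mult_1_right)

lemma C_graded_algebra: "graded_algebra k Gk C CG"
proof -
  have "c \<odot>\<^bsub>C\<^esub> X \<in> CG (\<alpha> * \<beta>)" if pos: "\<alpha> > 0" "\<beta> > 0" and c: "c \<in> Gk \<alpha>" and X: "X \<in> CG \<beta>" for \<alpha> \<beta> c X
  proof -
    have ck: "c \<in> carrier k" using k.G_carrier pos c by auto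
    have "proj (c \<odot>\<^bsub>PL\<^esub> \<one>\<^bsub>PL\<^esub>) \<in> CG \<alpha>" using plane_unit_homog[OF pos(1) c] unfolding CG_eq by blast
    moreover have "proj (c \<odot>\<^bsub>PL\<^esub> \<one>\<^bsub>PL\<^esub>) = c \<odot>\<^bsub>C\<^esub> \<one>\<^bsub>C\<^esub>"
      using alg_hom_smult[OF proj_alg_hom ck PL.one_closed] alg_hom_one[OF proj_alg_hom] by simp
    ultimately show ?thesis
      using CG.G_mult[OF pos _ X] algebra_smult_unit[OF C_algebra ck CG.G_carrier[OF pos(2) X]] by simp
  qed
  then show ?thesis by (simp add: graded_algebra_def k.graded C_graded C_algebra)
qed

lemma T_homog: "T1 \<in> CG r1" "T2 \<in> CG r2"
  using plane_T_homog proj_T unfolding CG_eq by blast+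

text \<open>The target is merely \<open>pregraded\<close>, because for the comultiplication it is a
  tensor product.\<close>

lemma curve_lift_homog:
  assumes S: "algebra k S" and eqn: "x2 [^]\<^bsub>S\<^esub> q = peval k S x1 f"
    and GS: "pregraded S GS" "\<one>\<^bsub>S\<^esub> \<in> GS 1"
    and scal: "\<And>\<gamma> c. \<gamma> > 0 \<Longrightarrow> c \<in> Gk \<gamma> \<Longrightarrow> c \<odot>\<^bsub>S\<^esub> \<one>\<^bsub>S\<^esub> \<in> GS \<gamma>"
    and x: "x1 \<in> GS r1" "x2 \<in> GS r2"
    and \<gamma>: "\<gamma> > 0" and X: "X \<in> CG \<gamma>"
  shows "curve_lift S x1 x2 X \<in> GS \<gamma>"
proof -
  interpret GS: pregraded S GS by fact
  have xc: "x1 \<in> carrier S" "x2 \<in> carrier S" using GS.G_carrier x r by auto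
  obtain P where P: "P \<in> PG \<gamma>" "X = proj P" using X unfolding CG_eq by blast
  have "peval k S x1 Q \<in> GS \<delta>" if "\<delta> > 0" "Q \<in> poly_grading k Gk r1 \<delta>" for \<delta> Q
    by (rule eval_homog[OF k.graded GS algebra_unit_hom[OF S] scal r(1) x(1) that])
  then have "plane_eval k S x1 x2 P \<in> GS \<gamma>"
    unfolding plane_eval_def using P(1) unfolding plane_grading_def
    by (intro eval_homog[OF U_graded GS alg_hom_ring_hom[OF peval_alg_hom[OF S xc(1)]] _ r(2) x(2) \<gamma>])
  then show ?thesis using curve_lift_proj[OF S xc eqn, of P] P PG.G_carrier[OF \<gamma> P(1)] by simp
qed

end

section \<open>Polynomials in powers of Frobenius\<close>

definition ppoly :: "('k, 'm) ring_scheme \<Rightarrow> nat \<Rightarrow> (nat \<Rightarrow> 'k) \<Rightarrow> nat \<Rightarrow> nat \<Rightarrow> 'k" where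
  "ppoly k p a m = (\<Oplus>\<^bsub>UP k\<^esub>j\<in>{..m}. monom (UP k) (a j) (p ^ j))"

lemma ppoly_closed:
  assumes "cring k" "\<And>j. j \<le> m \<Longrightarrow> a j \<in> carrier k"
  shows "ppoly k p a m \<in> carrier (UP k)"
proof -
  interpret UP_cring k "UP k" by (rule UP_cringI) (use assms in simp_all)
  show ?thesis unfolding ppoly_def using assms by (intro P.finsum_closed) auto
qed

text \<open>The bound on \<open>p\<close> makes the exponents \<open>p ^ j\<close> pairwise
  distinct, so that no two coefficients collide.\<close>

lemma coeff_ppoly:
  assumes "cring k" "\<And>j. j \<le> m \<Longrightarrow> a j \<in> carrier k" "p \<ge> 2"
  shows "j \<le> m \<Longrightarrow> coeff (UP k) (ppoly k p a m) (p ^ j) = a j"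
    and "i \<notin> (\<lambda>j. p ^ j) ` {..m} \<Longrightarrow> coeff (UP k) (ppoly k p a m) i = \<zero>\<^bsub>k\<^esub>"
proof -
  interpret UP_cring k "UP k" by (rule UP_cringI) (use assms in simp_all)
  have c: "coeff (UP k) (ppoly k p a m) i = (\<Oplus>\<^bsub>k\<^esub>j\<in>{..m}. if p ^ j = i then a j else \<zero>\<^bsub>k\<^esub>)" for i
    unfolding ppoly_def using assms(2) by (subst coeff_finsum) (auto intro!: R.finsum_cong')
  show "coeff (UP k) (ppoly k p a m) (p ^ j) = a j" if j: "j \<le> m"
  proof -
    have "(\<Oplus>\<^bsub>k\<^esub>i\<in>{..m}. if p ^ i = p ^ j then a i else \<zero>\<^bsub>k\<^esub>) = (\<Oplus>\<^bsub>k\<^esub>i\<in>{..m}. if j = i then a i else \<zero>\<^bsub>k\<^esub>)"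
      using assms by (intro R.finsum_cong') auto
    also have "\<dots> = a j" using R.finsum_singleton[of j "{..m}" a] j assms by (auto simp: Pi_def)
    finally show ?thesis by (simp add: c)
  qed
  show "coeff (UP k) (ppoly k p a m) i = \<zero>\<^bsub>k\<^esub>" if "i \<notin> (\<lambda>j. p ^ j) ` {..m}"
    unfolding c using that by (intro R.add.finprod_one_eqI) auto
qed

context
  fixes k :: "('k, 'm) ring_scheme" and S :: "('k, 'a, 'n) module_scheme" and a :: "nat \<Rightarrow> 'k" and m :: nat
  assumes S: "algebra k S" and a: "\<And>j. j \<le> m \<Longrightarrow> a j \<in> carrier k"
begin

interpretation S: algebra k S by (rule S)

lemma peval_ppoly:
  assumes x: "x \<in> carrier S"
  shows "peval k S x (ppoly k p a m) = (\<Oplus>\<^bsub>S\<^esub>j\<in>{..m}. a j \<odot>\<^bsub>S\<^esub> x [^]\<^bsub>S\<^esub> (p ^ j))"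
proof -
  interpret U: UP_cring k "UP k" by (rule UP_cringI[OF S.R_cring]) simp
  interpret h: ring_hom_cring "UP k" S "peval k S x"
    by (rule UnivPoly.ring_hom_cringI[OF U.UP_cring S.M_cring alg_hom_ring_hom[OF peval_alg_hom[OF S x]]])
  have "peval k S x (ppoly k p a m) = (\<Oplus>\<^bsub>S\<^esub>j\<in>{..m}. peval k S x (monom (UP k) (a j) (p ^ j)))"
    unfolding ppoly_def using a by (subst h.hom_finsum) (auto simp: comp_def)
  also have "\<dots> = (\<Oplus>\<^bsub>S\<^esub>j\<in>{..m}. a j \<odot>\<^bsub>S\<^esub> x [^]\<^bsub>S\<^esub> (p ^ j))"
    by (rule S.M.finsum_cong') (use a x in \<open>auto simp: peval_monom[OF S x]\<close>)
  finally show ?thesis .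
qed

lemma peval_ppoly_add:
  assumes p: "prime (p::nat)" "[p] \<cdot>\<^bsub>S\<^esub> \<one>\<^bsub>S\<^esub> = \<zero>\<^bsub>S\<^esub>" and x: "x \<in> carrier S" "y \<in> carrier S"
  shows "peval k S (x \<oplus>\<^bsub>S\<^esub> y) (ppoly k p a m) = peval k S x (ppoly k p a m) \<oplus>\<^bsub>S\<^esub> peval k S y (ppoly k p a m)"
proof -
  have "(\<Oplus>\<^bsub>S\<^esub>j\<in>{..m}. a j \<odot>\<^bsub>S\<^esub> (x \<oplus>\<^bsub>S\<^esub> y) [^]\<^bsub>S\<^esub> (p ^ j)) =
    (\<Oplus>\<^bsub>S\<^esub>j\<in>{..m}. a j \<odot>\<^bsub>S\<^esub> x [^]\<^bsub>S\<^esub> (p ^ j) \<oplus>\<^bsub>S\<^esub> a j \<odot>\<^bsub>S\<^esub> y [^]\<^bsub>S\<^esub> (p ^ j))"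
    by (rule S.M.finsum_cong') (use a x in \<open>auto simp: S.frobenius_power_add[OF p x] S.smult_r_distr\<close>)
  also have "\<dots> = (\<Oplus>\<^bsub>S\<^esub>j\<in>{..m}. a j \<odot>\<^bsub>S\<^esub> x [^]\<^bsub>S\<^esub> (p ^ j)) \<oplus>\<^bsub>S\<^esub> (\<Oplus>\<^bsub>S\<^esub>j\<in>{..m}. a j \<odot>\<^bsub>S\<^esub> y [^]\<^bsub>S\<^esub> (p ^ j))"
    by (rule S.M.finsum_addf) (use a x in auto)
  finally show ?thesis using x by (simp add: peval_ppoly)
qed

lemma peval_ppoly_zero:
  assumes "prime (p::nat)"
  shows "peval k S \<zero>\<^bsub>S\<^esub> (ppoly k p a m) = \<zero>\<^bsub>S\<^esub>"
proof -
  have "a j \<odot>\<^bsub>S\<^esub> \<zero>\<^bsub>S\<^esub> [^]\<^bsub>S\<^esub> (p ^ j) = \<zero>\<^bsub>S\<^esub>" if "j \<le> m" for j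
    using assms a[OF that] by (simp add: S.nat_pow_zero prime_gt_0_nat)
  then show ?thesis by (simp add: peval_ppoly) (auto intro!: S.add.finprod_one_eqI)
qed

lemma peval_ppoly_minus:
  assumes p: "prime (p::nat)" "[p] \<cdot>\<^bsub>S\<^esub> \<one>\<^bsub>S\<^esub> = \<zero>\<^bsub>S\<^esub>" and x: "x \<in> carrier S"
  shows "peval k S (\<ominus>\<^bsub>S\<^esub> x) (ppoly k p a m) = \<ominus>\<^bsub>S\<^esub> peval k S x (ppoly k p a m)"
proof -
  have cl: "peval k S y (ppoly k p a m) \<in> carrier S" if "y \<in> carrier S" for y
    by (rule alg_hom_closed[OF peval_alg_hom[OF S that] ppoly_closed[OF S.R_cring a]])
  have "peval k S (\<ominus>\<^bsub>S\<^esub> x) (ppoly k p a m) \<oplus>\<^bsub>S\<^esub> peval k S x (ppoly k p a m) = \<zero>\<^bsub>S\<^esub>"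
    using peval_ppoly_add[OF p, of "\<ominus>\<^bsub>S\<^esub> x" x] x peval_ppoly_zero[OF p(1)] by (simp add: S.M.l_neg)
  then show ?thesis using cl x by (intro S.M.minus_equality[symmetric]) auto
qed

end

section \<open>The Hopf algebra of a curve\<close>

text \<open>\<open>curve_hopf\<close> forms its tensor square from the plain algebra, whereas the
  Hopf axioms refer to the extended record. The constructions see only the ring operations and
  scalars, hence they coincide.\<close>

lemma tensor_cong:
  assumes "carrier A' = carrier A" "monoid.mult A' = monoid.mult A" "one A' = one A" "add A' = add A" "smult A' = smult A"
    "carrier B' = carrier B" "monoid.mult B' = monoid.mult B" "one B' = one B" "add B' = add B" "smult B' = smult B"
  shows "pure_tensor k A' B' = pure_tensor k A B" "tensor_algebra k A' B' = tensor_algebra k A B"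
proof -
  have F: "tensor_free A' B' = tensor_free A B" using assms by (simp add: tensor_free_def)
  have R: "tensor_relations k A' B' = tensor_relations k A B" using assms by (simp add: tensor_relations_def)
  show P: "pure_tensor k A' B' = pure_tensor k A B"
    by (intro ext) (simp add: pure_tensor_def tensor_ideal_def F R)
  show "tensor_algebra k A' B' = tensor_algebra k A B"
    using assms by (simp add: tensor_algebra_def P) (simp add: tensor_ring_def tensor_ideal_def F R)
qed

lemma self_algebra_algebra: "cring k \<Longrightarrow> algebra k (self_algebra k)"
  using with_scalars_algebra[of k k id] by (simp add: self_algebra_def)

lemma unit_alg_hom:
  assumes "algebra k S" shows "(\<lambda>c. c \<odot>\<^bsub>S\<^esub> \<one>\<^bsub>S\<^esub>) \<in> alg_hom k (self_algebra k) S"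
proof (rule alg_homI)
  interpret S: algebra k S by fact
  show "(\<lambda>c. c \<odot>\<^bsub>S\<^esub> \<one>\<^bsub>S\<^esub>) \<in> ring_hom (self_algebra k) S"
    using algebra_unit_hom[OF assms] by (simp add: ring_hom_def self_algebra_def)
qed (auto simp: self_algebra_def module.smult_assoc1[OF algebra.axioms(1)[OF assms]] algebra.M_cring[OF assms] cring.axioms(1) ring.is_monoid monoid.one_closed)

locale hopf_curve = graded_curve k Gk "p ^ n" f r1 r2
  for k :: "('k, 'm) ring_scheme" and Gk p n f r1 r2 +
  fixes a :: "nat \<Rightarrow> 'k" and m :: nat
  assumes p: "prime p" and char: "[p] \<cdot>\<^bsub>k\<^esub> \<one>\<^bsub>k\<^esub> = \<zero>\<^bsub>k\<^esub>"
    and a: "\<And>j. j \<le> m \<Longrightarrow> a j \<in> carrier k" and f_ppoly: "f = ppoly k p a m"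
begin

abbreviation "q \<equiv> p ^ n"
abbreviation "H \<equiv> curve_hopf k q f"

lemma H_fields [simp]:
  "carrier H = carrier C" "monoid.mult H = monoid.mult C" "one H = one C"
  "zero H = zero C" "add H = add C" "smult H = smult C"
  by (simp_all add: curve_hopf_def Let_def module.defs)

lemma HH: "tensor_algebra k C C = tensor_algebra k H H" "pure_tensor k C C = pure_tensor k H H"
  using tensor_cong[of H C H C k] by simp_all

lemma H_algebra: "algebra k H"
  by (rule algebra_transfer[OF C_algebra]) simp_all

lemma H_graded: "graded_ring H CG"
  by (rule graded_ring_transfer[OF C_graded]) simp_all

lemma H_graded_algebra: "graded_algebra k Gk H CG"
  using C_graded_algebra H_algebra H_graded by (simp add: graded_algebra_def)

sublocale H: algebra k H by (rule H_algebra)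
sublocale HH: graded_tensor k H H Gk CG CG by (rule graded_tensorI[OF H_graded_algebra H_graded_algebra])

lemma alg_hom_H: "alg_hom k H S = alg_hom k C S" "alg_hom k S H = alg_hom k S C"
  by (simp_all add: alg_hom_def ring_hom_def)

lemma curve_equation_H: "T2 [^]\<^bsub>H\<^esub> q = peval k H T1 f"
proof -
  have "id \<in> alg_hom k C H" using alg_hom_H alg_hom_id by metis
  then have "peval k C T1 f = peval k H T1 f"
    using alg_hom_peval[OF C_algebra H_algebra _ T_closed(1) f, of id] by simp
  then show ?thesis using curve_equation nat_pow_transfer[of H C T2 q] by simp
qed

lemma char_algebra: "algebra k S \<Longrightarrow> [p] \<cdot>\<^bsub>S\<^esub> \<one>\<^bsub>S\<^esub> = \<zero>\<^bsub>S\<^esub>"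
  by (rule char_transfer_hom[OF k _ algebra_unit_hom char]) (simp_all add: algebra.M_cring)

definition "prim t = HH.pure \<one>\<^bsub>H\<^esub> t \<oplus>\<^bsub>HH.T\<^esub> HH.pure t \<one>\<^bsub>H\<^esub>"

lemma prim_closed: "t \<in> carrier H \<Longrightarrow> prim t \<in> carrier HH.TA"
  by (simp add: prim_def del: H_fields)

lemma T_closed_H: "T1 \<in> carrier H" "T2 \<in> carrier H"
  using T_closed by simp_all

text \<open>The equation holds for the generators in the left and in the right factor separately.
  Frobenius is additive, and so is the p-polynomial \<open>f\<close>, hence the two equations may be
  added.\<close>

lemma prim_eqn: "prim T2 [^]\<^bsub>HH.TA\<^esub> q = peval k HH.TA (prim T1) f"
proof -
  interpret TA: algebra k HH.TA by (rule HH.TA_algebra)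
  note ch = char_algebra[OF HH.TA_algebra]
  have l: "(HH.pure T2 \<one>\<^bsub>H\<^esub>) [^]\<^bsub>HH.TA\<^esub> q = peval k HH.TA (HH.pure T1 \<one>\<^bsub>H\<^esub>) f"
  proof -
    interpret h: ring_hom_cring H HH.TA "\<lambda>x. HH.pure x \<one>\<^bsub>H\<^esub>"
      by (rule UnivPoly.ring_hom_cringI[OF H.M_cring TA.M_cring alg_hom_ring_hom[OF HH.inl_alg_hom]])
    show ?thesis
      using h.hom_pow[OF T_closed_H(2), of q] alg_hom_peval[OF H_algebra HH.TA_algebra HH.inl_alg_hom T_closed_H(1) f]
      by (simp only: curve_equation_H)
  qed
  have r: "(HH.pure \<one>\<^bsub>H\<^esub> T2) [^]\<^bsub>HH.TA\<^esub> q = peval k HH.TA (HH.pure \<one>\<^bsub>H\<^esub> T1) f"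
  proof -
    interpret h: ring_hom_cring H HH.TA "\<lambda>x. HH.pure \<one>\<^bsub>H\<^esub> x"
      by (rule UnivPoly.ring_hom_cringI[OF H.M_cring TA.M_cring alg_hom_ring_hom[OF HH.inr_alg_hom]])
    show ?thesis
      using h.hom_pow[OF T_closed_H(2), of q] alg_hom_peval[OF H_algebra HH.TA_algebra HH.inr_alg_hom T_closed_H(1) f]
      by (simp only: curve_equation_H)
  qed
  have cl: "HH.pure \<one>\<^bsub>H\<^esub> t \<in> carrier HH.TA" "HH.pure t \<one>\<^bsub>H\<^esub> \<in> carrier HH.TA" if "t \<in> carrier H" for t
    using that by (simp_all del: H_fields)
  have pr: "prim t = HH.pure \<one>\<^bsub>H\<^esub> t \<oplus>\<^bsub>HH.TA\<^esub> HH.pure t \<one>\<^bsub>H\<^esub>" for t by (simp add: prim_def)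
  show ?thesis
    unfolding pr TA.frobenius_power_add[OF p ch cl[OF T_closed_H(2)]] l r
    using peval_ppoly_add[where a = a and m = m, OF HH.TA_algebra a p ch cl[OF T_closed_H(1)]] unfolding f_ppoly[symmetric] by (simp del: H_fields)
qed

lemma comult_H: "comult H = curve_lift HH.TA (prim T1) (prim T2)"
proof -
  have "comult H = curve_lift (tensor_algebra k C C)
      (pure_tensor k C C \<one>\<^bsub>C\<^esub> T1 \<oplus>\<^bsub>tensor_algebra k C C\<^esub> pure_tensor k C C T1 \<one>\<^bsub>C\<^esub>)
      (pure_tensor k C C \<one>\<^bsub>C\<^esub> T2 \<oplus>\<^bsub>tensor_algebra k C C\<^esub> pure_tensor k C C T2 \<one>\<^bsub>C\<^esub>)"
    by (simp add: curve_hopf_def Let_def hopf.defs module.defs curve_lift_def)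
  then show ?thesis unfolding HH by (simp add: prim_def)
qed

lemma antipode_H: "antipode H = curve_lift C (\<ominus>\<^bsub>C\<^esub> T1) (\<ominus>\<^bsub>C\<^esub> T2)"
  by (simp add: curve_hopf_def Let_def hopf.defs module.defs curve_lift_def)

lemma counit_H: "counit H = curve_lift (self_algebra k) \<zero>\<^bsub>k\<^esub> \<zero>\<^bsub>k\<^esub>"
  by (simp add: curve_hopf_def Let_def hopf.defs module.defs curve_lift_def)

lemma comult_alg_hom: "comult H \<in> alg_hom k H HH.TA"
  and comult_T: "comult H T1 = prim T1" "comult H T2 = prim T2"
proof -
  note 1 = HH.TA_algebra prim_closed[OF T_closed_H(1)] prim_closed[OF T_closed_H(2)] prim_eqn
  show "comult H \<in> alg_hom k H HH.TA"
    unfolding comult_H alg_hom_H by (rule curve_lift_alg_hom[OF 1])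
  show "comult H T1 = prim T1" "comult H T2 = prim T2"
    unfolding comult_H by (rule curve_lift_T[OF 1])+
qed

lemma antipode_eqn: "(\<ominus>\<^bsub>C\<^esub> T2) [^]\<^bsub>C\<^esub> q = peval k C (\<ominus>\<^bsub>C\<^esub> T1) f"
  using C.frobenius_power_minus[OF p char_algebra[OF C_algebra] T_closed(2), of n] curve_equation
    peval_ppoly_minus[OF C_algebra a p char_algebra[OF C_algebra] T_closed(1)] f_ppoly by simp

lemma antipode_alg_hom: "antipode H \<in> alg_hom k H H"
  and antipode_T: "antipode H T1 = \<ominus>\<^bsub>H\<^esub> T1" "antipode H T2 = \<ominus>\<^bsub>H\<^esub> T2"
proof -
  have cl: "\<ominus>\<^bsub>C\<^esub> T1 \<in> carrier C" "\<ominus>\<^bsub>C\<^esub> T2 \<in> carrier C" using T_closed by simp_all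
  have m: "\<ominus>\<^bsub>H\<^esub> x = \<ominus>\<^bsub>C\<^esub> x" for x by (rule a_inv_transfer) simp_all
  show "antipode H \<in> alg_hom k H H"
    unfolding antipode_H alg_hom_H by (rule curve_lift_alg_hom[OF C_algebra cl antipode_eqn])
  show "antipode H T1 = \<ominus>\<^bsub>H\<^esub> T1" "antipode H T2 = \<ominus>\<^bsub>H\<^esub> T2"
    unfolding antipode_H m by (rule curve_lift_T[OF C_algebra cl antipode_eqn])+
qed

lemma counit_eqn: "\<zero>\<^bsub>k\<^esub> [^]\<^bsub>self_algebra k\<^esub> q = peval k (self_algebra k) \<zero>\<^bsub>k\<^esub> f"
proof -
  interpret S: algebra k "self_algebra k" by (rule self_algebra_algebra[OF k])
  have z: "\<zero>\<^bsub>k\<^esub> = \<zero>\<^bsub>self_algebra k\<^esub>" by (simp add: self_algebra_def)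
  show ?thesis
    using peval_ppoly_zero[OF self_algebra_algebra[OF k] a p] S.nat_pow_zero[of q] p
    unfolding z f_ppoly by (simp add: prime_gt_0_nat del: S.nat_pow_zero)
qed

lemma counit_alg_hom: "counit H \<in> alg_hom k H (self_algebra k)"
  and counit_T: "counit H T1 = \<zero>\<^bsub>k\<^esub>" "counit H T2 = \<zero>\<^bsub>k\<^esub>"
proof -
  have z: "\<zero>\<^bsub>k\<^esub> \<in> carrier (self_algebra k)" by (simp add: self_algebra_def)
  show "counit H \<in> alg_hom k H (self_algebra k)"
    unfolding counit_H alg_hom_H by (rule curve_lift_alg_hom[OF self_algebra_algebra[OF k] z z counit_eqn])
  show "counit H T1 = \<zero>\<^bsub>k\<^esub>" "counit H T2 = \<zero>\<^bsub>k\<^esub>"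
    unfolding counit_H by (rule curve_lift_T[OF self_algebra_algebra[OF k] z z counit_eqn])+
qed

lemma H_alg_hom_eqI:
  assumes "algebra k S" "g \<in> alg_hom k H S" "h \<in> alg_hom k H S" "g T1 = h T1" "g T2 = h T2" "X \<in> carrier H"
  shows "g X = h X"
  using C_alg_hom_eqI[OF assms(1)] assms(2-) by (simp add: alg_hom_H)

text \<open>Two algebra homomorphisms are compared on generators. On a primitive \<open>t\<close>
  both yield the sum of three terms with \<open>t\<close> in one of three slots; the two sums differ
  only in their bracketing.\<close>

lemma coassoc:
  assumes "x \<in> carrier H"
  shows "tensor_assoc k H H H (tensor_map k HH.TA H (comult H) id (comult H x)) =
        tensor_map k H HH.TA id (comult H) (comult H x)"
proof -
  interpret L: tensor_prod k HH.TA H using HH.TA_algebra H_algebra by (simp add: tensor_prod_def)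
  interpret R: tensor_prod k H HH.TA using HH.TA_algebra H_algebra by (simp add: tensor_prod_def)
  note lm = tensor_map_alg_hom[OF HH.TA_algebra H_algebra H_algebra H_algebra comult_alg_hom alg_hom_id]
  note rm = tensor_map_alg_hom[OF H_algebra HH.TA_algebra H_algebra H_algebra alg_hom_id comult_alg_hom]
  note as = tensor_assoc_alg_hom[OF H_algebra H_algebra H_algebra]
  have one: "\<one>\<^bsub>H\<^esub> \<in> carrier H" by (rule H.one_closed)
  have gen: "(tensor_assoc k H H H \<circ> tensor_map k HH.TA H (comult H) id \<circ> comult H) t =
     (tensor_map k H HH.TA id (comult H) \<circ> comult H) t" if t: "t \<in> carrier H" and pt: "comult H t = prim t" for t
  proof -
    have c1: "comult H \<one>\<^bsub>H\<^esub> = HH.pure \<one>\<^bsub>H\<^esub> \<one>\<^bsub>H\<^esub>" using alg_hom_one[OF comult_alg_hom] HH.T_one by simp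
    have pc: "HH.pure x y \<in> carrier HH.TA" if "x \<in> carrier H" "y \<in> carrier H" for x y using that by (simp del: H_fields)
    have "tensor_map k HH.TA H (comult H) id (prim t) =
       L.pure (HH.pure \<one>\<^bsub>H\<^esub> \<one>\<^bsub>H\<^esub>) t \<oplus>\<^bsub>L.TA\<^esub> (L.pure (HH.pure \<one>\<^bsub>H\<^esub> t) \<one>\<^bsub>H\<^esub> \<oplus>\<^bsub>L.TA\<^esub> L.pure (HH.pure t \<one>\<^bsub>H\<^esub>) \<one>\<^bsub>H\<^esub>)"
      using alg_hom_add[OF lm(1) pc[OF one t] pc[OF t one]] lm(2)[OF one t] lm(2)[OF t one]
        L.pure_add_left[OF pc[OF one t] pc[OF t one] one]
      by (simp add: c1 pt prim_def del: H_fields)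
    moreover have "tensor_assoc k H H H (L.pure (HH.pure \<one>\<^bsub>H\<^esub> \<one>\<^bsub>H\<^esub>) t \<oplus>\<^bsub>L.TA\<^esub> (L.pure (HH.pure \<one>\<^bsub>H\<^esub> t) \<one>\<^bsub>H\<^esub> \<oplus>\<^bsub>L.TA\<^esub> L.pure (HH.pure t \<one>\<^bsub>H\<^esub>) \<one>\<^bsub>H\<^esub>)) =
       R.pure \<one>\<^bsub>H\<^esub> (HH.pure \<one>\<^bsub>H\<^esub> t) \<oplus>\<^bsub>R.TA\<^esub> (R.pure \<one>\<^bsub>H\<^esub> (HH.pure t \<one>\<^bsub>H\<^esub>) \<oplus>\<^bsub>R.TA\<^esub> R.pure t (HH.pure \<one>\<^bsub>H\<^esub> \<one>\<^bsub>H\<^esub>))"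
    proof -
      have lc: "L.pure u x \<in> carrier L.TA" if "u \<in> carrier HH.TA" "x \<in> carrier H" for u x using L.pure_closed[OF that] by simp
      have lt: "u \<oplus>\<^bsub>L.TA\<^esub> v \<in> carrier L.TA" if "u \<in> carrier L.TA" "v \<in> carrier L.TA" for u v
        using that by (simp del: H_fields)
      show ?thesis
        by (simp only: alg_hom_add[OF as(1)] lt lc pc one t as(2))
    qed
    moreover have "tensor_map k H HH.TA id (comult H) (prim t) =
       R.pure \<one>\<^bsub>H\<^esub> (HH.pure \<one>\<^bsub>H\<^esub> t) \<oplus>\<^bsub>R.TA\<^esub> R.pure \<one>\<^bsub>H\<^esub> (HH.pure t \<one>\<^bsub>H\<^esub>) \<oplus>\<^bsub>R.TA\<^esub> R.pure t (HH.pure \<one>\<^bsub>H\<^esub> \<one>\<^bsub>H\<^esub>)"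
      using alg_hom_add[OF rm(1) pc[OF one t] pc[OF t one]] rm(2)[OF one t] rm(2)[OF t one]
        R.pure_add_right[OF one pc[OF t one] pc[OF one t]]
      by (simp add: c1 pt prim_def del: H_fields)
    moreover have "R.pure x u \<in> carrier R.T" if "x \<in> carrier H" "u \<in> carrier HH.TA" for x u using R.pure_closed[OF that] .
    ultimately show ?thesis using pc one t by (simp add: pt R.T.a_assoc del: H_fields)
  qed
  have "(tensor_assoc k H H H \<circ> tensor_map k HH.TA H (comult H) id \<circ> comult H) x =
     (tensor_map k H HH.TA id (comult H) \<circ> comult H) x"
  proof (rule H_alg_hom_eqI[OF R.TA_algebra _ _ gen[OF T_closed_H(1) comult_T(1)] gen[OF T_closed_H(2) comult_T(2)] assms])
    show "tensor_assoc k H H H \<circ> tensor_map k HH.TA H (comult H) id \<circ> comult H \<in> alg_hom k H R.TA"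
      using alg_hom_comp[OF comult_alg_hom alg_hom_comp[OF lm(1) as(1)]] by (simp add: comp_assoc)
    show "tensor_map k H HH.TA id (comult H) \<circ> comult H \<in> alg_hom k H R.TA"
      by (rule alg_hom_comp[OF comult_alg_hom rm(1)])
  qed
  then show ?thesis by simp
qed

text \<open>Each of the remaining axioms compares two algebra homomorphisms that need only be evaluated on
  the two primitive generators.\<close>

lemma lift_comult:
  assumes S: "algebra k S" and g: "g \<in> alg_hom k H S" and h: "h \<in> alg_hom k H S" and e: "e \<in> alg_hom k H S"
    and P: "carrier P = carrier S" "monoid.mult P = monoid.mult S" "one P = one S" "zero P = zero S" "add P = add S"
    and \<phi>: "\<And>x y. x \<in> carrier H \<Longrightarrow> y \<in> carrier H \<Longrightarrow> \<phi> x y = g x \<otimes>\<^bsub>S\<^esub> h y"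
    and T: "e T1 = h T1 \<oplus>\<^bsub>S\<^esub> g T1" "e T2 = h T2 \<oplus>\<^bsub>S\<^esub> g T2" and x: "x \<in> carrier H"
  shows "tensor_lift P \<phi> (comult H x) = e x"
proof -
  interpret S: algebra k S by fact
  note l = HH.tensor_lift_alg_hom[OF S P g h \<phi>]
  have "(tensor_lift P \<phi> \<circ> comult H) t = h t \<oplus>\<^bsub>S\<^esub> g t" if t: "t \<in> carrier H" "comult H t = prim t" for t
    using alg_hom_add[OF l(1), of "HH.pure \<one>\<^bsub>H\<^esub> t" "HH.pure t \<one>\<^bsub>H\<^esub>"] t l(2)
      alg_hom_one[OF g] alg_hom_one[OF h] alg_hom_closed[OF g] alg_hom_closed[OF h]
    by (simp add: prim_def)
  then have "(tensor_lift P \<phi> \<circ> comult H) T1 = e T1" "(tensor_lift P \<phi> \<circ> comult H) T2 = e T2"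
    using T T_closed_H comult_T by metis+
  then have "(tensor_lift P \<phi> \<circ> comult H) x = e x"
    by (intro H_alg_hom_eqI[OF S alg_hom_comp[OF comult_alg_hom l(1)] e _ _ x])
  then show ?thesis by simp
qed

lemma unit_counit: "(\<lambda>y. counit H y \<odot>\<^bsub>H\<^esub> \<one>\<^bsub>H\<^esub>) \<in> alg_hom k H H"
  using alg_hom_comp[OF counit_alg_hom unit_alg_hom[OF H_algebra]] by (simp add: comp_def)

lemma counit_closed: "y \<in> carrier H \<Longrightarrow> counit H y \<in> carrier k"
  using alg_hom_closed[OF counit_alg_hom, of y] by (simp add: self_algebra_def)

lemma counit_axioms:
  assumes x: "x \<in> carrier H"
  shows "tensor_lift H (\<lambda>y z. counit H y \<odot>\<^bsub>H\<^esub> z) (comult H x) = x"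
    and "tensor_lift H (\<lambda>y z. counit H z \<odot>\<^bsub>H\<^esub> y) (comult H x) = x"
proof -
  have T0: "t \<oplus>\<^bsub>H\<^esub> \<zero>\<^bsub>k\<^esub> \<odot>\<^bsub>H\<^esub> \<one>\<^bsub>H\<^esub> = t" "\<zero>\<^bsub>k\<^esub> \<odot>\<^bsub>H\<^esub> \<one>\<^bsub>H\<^esub> \<oplus>\<^bsub>H\<^esub> t = t" if "t \<in> carrier H" for t
    using that H.smult_l_null[OF H.one_closed] H.M.l_zero[OF that] H.M.r_zero[OF that] by metis+
  have e1: "counit H y \<odot>\<^bsub>H\<^esub> z = (counit H y \<odot>\<^bsub>H\<^esub> \<one>\<^bsub>H\<^esub>) \<otimes>\<^bsub>H\<^esub> id z" if "y \<in> carrier H" "z \<in> carrier H" for y z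
    using algebra_smult_unit[OF H_algebra counit_closed[OF that(1)] that(2)] by simp
  have "tensor_lift H (\<lambda>y z. counit H y \<odot>\<^bsub>H\<^esub> z) (comult H x) = id x"
    by (rule lift_comult[OF H_algebra unit_counit alg_hom_id alg_hom_id _ _ _ _ _ e1 _ _ x])
       (use T0 T_closed_H in \<open>simp_all add: counit_T del: H_fields\<close>)
  then show "tensor_lift H (\<lambda>y z. counit H y \<odot>\<^bsub>H\<^esub> z) (comult H x) = x" by simp
  have e2: "counit H z \<odot>\<^bsub>H\<^esub> y = id y \<otimes>\<^bsub>H\<^esub> (counit H z \<odot>\<^bsub>H\<^esub> \<one>\<^bsub>H\<^esub>)" if "y \<in> carrier H" "z \<in> carrier H" for y z
    using algebra_smult_unit[OF H_algebra counit_closed[OF that(2)] that(1)]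
      H.m_comm[OF that(1) H.smult_closed[OF counit_closed[OF that(2)] H.one_closed]] by simp
  have "tensor_lift H (\<lambda>y z. counit H z \<odot>\<^bsub>H\<^esub> y) (comult H x) = id x"
    by (rule lift_comult[OF H_algebra alg_hom_id unit_counit alg_hom_id _ _ _ _ _ e2 _ _ x])
       (use T0 T_closed_H in \<open>simp_all add: counit_T del: H_fields\<close>)
  then show "tensor_lift H (\<lambda>y z. counit H z \<odot>\<^bsub>H\<^esub> y) (comult H x) = x" by simp
qed

lemma antipode_axioms:
  assumes x: "x \<in> carrier H"
  shows "tensor_lift H (\<lambda>y z. antipode H y \<otimes>\<^bsub>H\<^esub> z) (comult H x) = counit H x \<odot>\<^bsub>H\<^esub> \<one>\<^bsub>H\<^esub>"
    and "tensor_lift H (\<lambda>y z. y \<otimes>\<^bsub>H\<^esub> antipode H z) (comult H x) = counit H x \<odot>\<^bsub>H\<^esub> \<one>\<^bsub>H\<^esub>"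
proof -
  have T0: "\<zero>\<^bsub>k\<^esub> \<odot>\<^bsub>H\<^esub> \<one>\<^bsub>H\<^esub> = t \<oplus>\<^bsub>H\<^esub> \<ominus>\<^bsub>H\<^esub> t" "\<zero>\<^bsub>k\<^esub> \<odot>\<^bsub>H\<^esub> \<one>\<^bsub>H\<^esub> = \<ominus>\<^bsub>H\<^esub> t \<oplus>\<^bsub>H\<^esub> t" if "t \<in> carrier H" for t
    using H.smult_l_null[OF H.one_closed] H.M.l_neg[OF that] H.M.r_neg[OF that] by metis+
  have T: "counit H T1 \<odot>\<^bsub>H\<^esub> \<one>\<^bsub>H\<^esub> = id T1 \<oplus>\<^bsub>H\<^esub> antipode H T1" "counit H T2 \<odot>\<^bsub>H\<^esub> \<one>\<^bsub>H\<^esub> = id T2 \<oplus>\<^bsub>H\<^esub> antipode H T2"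
    "counit H T1 \<odot>\<^bsub>H\<^esub> \<one>\<^bsub>H\<^esub> = antipode H T1 \<oplus>\<^bsub>H\<^esub> id T1" "counit H T2 \<odot>\<^bsub>H\<^esub> \<one>\<^bsub>H\<^esub> = antipode H T2 \<oplus>\<^bsub>H\<^esub> id T2"
    unfolding counit_T antipode_T id_apply by (rule T0 T_closed_H)+
  show "tensor_lift H (\<lambda>y z. antipode H y \<otimes>\<^bsub>H\<^esub> z) (comult H x) = counit H x \<odot>\<^bsub>H\<^esub> \<one>\<^bsub>H\<^esub>"
    by (rule lift_comult[OF H_algebra antipode_alg_hom alg_hom_id unit_counit _ _ _ _ _ _ T(1,2) x]) simp_all
  show "tensor_lift H (\<lambda>y z. y \<otimes>\<^bsub>H\<^esub> antipode H z) (comult H x) = counit H x \<odot>\<^bsub>H\<^esub> \<one>\<^bsub>H\<^esub>"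
    by (rule lift_comult[OF H_algebra alg_hom_id antipode_alg_hom unit_counit _ _ _ _ _ _ T(3,4) x]) simp_all
qed

lemma alg_hom_graded: "h \<in> alg_hom k A B \<Longrightarrow> (\<And>\<gamma> x. \<gamma> > 0 \<Longrightarrow> x \<in> GA \<gamma> \<Longrightarrow> h x \<in> GB \<gamma>) \<Longrightarrow>
    h \<in> graded_algebra_hom k A GA B GB"
  by (auto simp: alg_hom_def graded_algebra_hom_def)

lemma scalar_homog:
  assumes "graded_algebra k Gk A GA" "\<gamma> > 0" "c \<in> Gk \<gamma>" shows "c \<odot>\<^bsub>A\<^esub> \<one>\<^bsub>A\<^esub> \<in> GA \<gamma>"
proof -
  interpret GA: graded A GA using assms by (intro gradedI) (simp add: graded_algebra_def)
  have "c \<odot>\<^bsub>A\<^esub> \<one>\<^bsub>A\<^esub> \<in> GA (\<gamma> * 1)"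
    using assms GA.one_homog by (auto simp: graded_algebra_def simp del: mult_1_right)
  then show ?thesis by simp
qed

lemma graded_hopf: "graded_hopf_algebra k Gk H CG"
proof -
  have p: "p ^ n > 0" using p by (simp add: prime_gt_0_nat)
  have "comult H \<in> graded_algebra_hom k H CG HH.TA HH.TG"
  proof (rule alg_hom_graded[OF comult_alg_hom])
    fix \<gamma> :: real and x assume \<gamma>: "\<gamma> > 0" and x: "x \<in> CG \<gamma>"
    have prim: "prim t \<in> HH.TG \<delta>" if "\<delta> > 0" "t \<in> CG \<delta>" for \<delta> t
      unfolding prim_def using that HH.GA.one_homog
      by (intro pregraded.G_add[OF HH.TG_pregraded] HH.pure_homog[of 1 \<delta>] HH.pure_homog[of \<delta> 1]) (simp_all del: H_fields)
    have scal: "c \<odot>\<^bsub>HH.TA\<^esub> \<one>\<^bsub>HH.TA\<^esub> \<in> HH.TG \<delta>" if "\<delta> > 0" "c \<in> Gk \<delta>" for \<delta> c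
    proof -
      have c: "c \<in> carrier k" using k.G_carrier that by auto
      have "HH.pure (c \<odot>\<^bsub>H\<^esub> \<one>\<^bsub>H\<^esub>) \<one>\<^bsub>H\<^esub> \<in> HH.TG \<delta>"
        by (rule HH.pure_homog[of \<delta> 1]) (use that scalar_homog[OF H_graded_algebra that] HH.GA.one_homog in simp_all)
      then show ?thesis using HH.TA_smult_pure[OF c H.one_closed H.one_closed] HH.T_one by simp
    qed
    show "comult H x \<in> HH.TG \<gamma>" unfolding comult_H
      by (rule curve_lift_homog[OF HH.TA_algebra prim_eqn HH.TG_pregraded_TA scal prim[OF r(1) T_homog(1)] prim[OF r(2) T_homog(2)] \<gamma> x])
  qed
  moreover have "antipode H \<in> graded_algebra_hom k H CG H CG"
  proof (rule alg_hom_graded[OF antipode_alg_hom])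
    fix \<gamma> :: real and x assume \<gamma>: "\<gamma> > 0" and x: "x \<in> CG \<gamma>"
    show "antipode H x \<in> CG \<gamma>" unfolding antipode_H
      by (rule curve_lift_homog[OF C_algebra antipode_eqn CG.pregraded_axioms CG.one_homog
            scalar_homog[OF C_graded_algebra] CG.G_minus[OF r(1) T_homog(1)] CG.G_minus[OF r(2) T_homog(2)] \<gamma> x])
  qed
  moreover have "counit H \<in> graded_algebra_hom k H CG (self_algebra k) Gk"
  proof (rule alg_hom_graded[OF counit_alg_hom])
    fix \<gamma> :: real and x assume \<gamma>: "\<gamma> > 0" and x: "x \<in> CG \<gamma>"
    have "graded_ring (self_algebra k) Gk"
      by (rule graded_ring_transfer[OF k.graded]) (simp_all add: self_algebra_def)
    then interpret S: graded "self_algebra k" Gk by (rule gradedI)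
    show "counit H x \<in> Gk \<gamma>" unfolding counit_H
      by (rule curve_lift_homog[OF self_algebra_algebra[OF k] counit_eqn S.pregraded_axioms S.one_homog _ _ _ \<gamma> x])
         (use r k.G_carrier in \<open>auto simp: self_algebra_def\<close>)
  qed
  ultimately show ?thesis
    using H_graded_algebra coassoc counit_axioms antipode_axioms by (simp add: graded_hopf_algebra_def del: H_fields)
qed

end

section \<open>The extension by \<open>p\<close>-power roots\<close>

text \<open>A nonzero element of a graded field may fail to be a unit, so the usual argument is
  applied to each homogeneous part of an element of the kernel.\<close>

lemma graded_field_unit_inj:
  assumes k: "graded_field k Gk" and A: "graded_algebra k Gk A GA" and nz: "\<one>\<^bsub>A\<^esub> \<noteq> \<zero>\<^bsub>A\<^esub>"
  shows "inj_on (\<lambda>c. c \<odot>\<^bsub>A\<^esub> \<one>\<^bsub>A\<^esub>) (carrier k)"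
proof -
  interpret k: graded k Gk using k by (intro gradedI) (simp add: graded_field_def)
  interpret GA: graded A GA using A by (intro gradedI) (simp add: graded_algebra_def)
  have A': "algebra k A" using A by (simp add: graded_algebra_def)
  interpret A: algebra k A by (rule A')
  interpret h: ring_hom_cring k A "\<lambda>c. c \<odot>\<^bsub>A\<^esub> \<one>\<^bsub>A\<^esub>"
    by (rule UnivPoly.ring_hom_cringI[OF k.cring_axioms A.M_cring algebra_unit_hom[OF A']])
  have zero: "c = \<zero>\<^bsub>k\<^esub>" if c: "c \<in> carrier k" "c \<odot>\<^bsub>A\<^esub> \<one>\<^bsub>A\<^esub> = \<zero>\<^bsub>A\<^esub>" for c
  proof (rule k.eq_hcompI[OF c(1) k.zero_closed])
    fix \<gamma>
    have "hcomp k Gk \<gamma> c \<odot>\<^bsub>A\<^esub> \<one>\<^bsub>A\<^esub> = hcomp A GA (\<gamma> * 1) (c \<odot>\<^bsub>A\<^esub> \<one>\<^bsub>A\<^esub>)"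
    proof (rule graded_map_hcomp[OF k.graded GA.graded c(1), symmetric])
      show "x \<odot>\<^bsub>A\<^esub> \<one>\<^bsub>A\<^esub> \<in> GA (\<delta> * 1)" if "\<delta> > 0" "x \<in> Gk \<delta>" for \<delta> x
        using A that GA.one_homog by (auto simp: graded_algebra_def simp del: mult_1_right)
    qed (auto simp: A.smult_l_distr)
    then have z: "hcomp k Gk \<gamma> c \<odot>\<^bsub>A\<^esub> \<one>\<^bsub>A\<^esub> = \<zero>\<^bsub>A\<^esub>" using c by simp
    have "hcomp k Gk \<gamma> c = \<zero>\<^bsub>k\<^esub>"
    proof (rule ccontr)
      assume n: "hcomp k Gk \<gamma> c \<noteq> \<zero>\<^bsub>k\<^esub>"
      then have "\<gamma> > 0" using k.hcomp_props(2)[OF c(1), of \<gamma>] by force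
      then have u: "hcomp k Gk \<gamma> c \<in> Units k"
        using k n k.hcomp_props(1)[OF c(1)] by (auto simp: graded_field_def)
      then have "\<one>\<^bsub>A\<^esub> = (inv\<^bsub>k\<^esub> hcomp k Gk \<gamma> c \<otimes>\<^bsub>k\<^esub> hcomp k Gk \<gamma> c) \<odot>\<^bsub>A\<^esub> \<one>\<^bsub>A\<^esub>" by simp
      also have "\<dots> = \<zero>\<^bsub>A\<^esub>" using u z c by (subst A.smult_assoc1) simp_all
      finally show False using nz by simp
    qed
    then show "hcomp k Gk \<gamma> c = hcomp k Gk \<gamma> \<zero>\<^bsub>k\<^esub>" by simp
  qed
  show ?thesis
  proof (rule inj_onI)
    fix c d assume cd: "c \<in> carrier k" "d \<in> carrier k" "c \<odot>\<^bsub>A\<^esub> \<one>\<^bsub>A\<^esub> = d \<odot>\<^bsub>A\<^esub> \<one>\<^bsub>A\<^esub>"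
    have "(c \<oplus>\<^bsub>k\<^esub> \<ominus>\<^bsub>k\<^esub> d) \<odot>\<^bsub>A\<^esub> \<one>\<^bsub>A\<^esub> = \<zero>\<^bsub>A\<^esub>"
      using cd h.hom_add[of c "\<ominus>\<^bsub>k\<^esub> d"] h.hom_a_inv[of d] by (simp add: GA.r_neg)
    then have "c \<oplus>\<^bsub>k\<^esub> \<ominus>\<^bsub>k\<^esub> d = \<zero>\<^bsub>k\<^esub>" using cd by (intro zero) auto
    then show "c = d" using cd by (metis a_minus_def k.r_right_minus_eq)
  qed
qed

text \<open>A factorisation of \<open>p\<close> would give zero divisors among the multiples of
  one.\<close>

lemma characteristic_prime:
  assumes k: "domain k" and p: "p > 0" and char: "has_characteristic (k\<lparr>carrier := X\<rparr>) p"
  shows "prime p" and "[p] \<cdot>\<^bsub>k\<^esub> \<one>\<^bsub>k\<^esub> = \<zero>\<^bsub>k\<^esub>" and "\<And>m. [m] \<cdot>\<^bsub>k\<^esub> \<one>\<^bsub>k\<^esub> = \<zero>\<^bsub>k\<^esub> \<Longrightarrow> p dvd m"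
proof -
  interpret k: "domain" k by (rule k)
  \<comment> \<open>Multiples of one are computed without reference to the carrier, so the degree 1
    part has the characteristic of the whole ring.\<close>
  have eq: "[m] \<cdot>\<^bsub>k\<lparr>carrier := X\<rparr>\<^esub> \<one>\<^bsub>k\<lparr>carrier := X\<rparr>\<^esub> = [m] \<cdot>\<^bsub>k\<^esub> \<one>\<^bsub>k\<^esub>" for m :: nat
    by (simp add: add_pow_def nat_pow_def)
  have ch: "[m] \<cdot>\<^bsub>k\<^esub> \<one>\<^bsub>k\<^esub> = \<zero>\<^bsub>k\<^esub> \<longleftrightarrow> p dvd m" for m :: nat
    using char unfolding has_characteristic_def eq by simp
  show "[p] \<cdot>\<^bsub>k\<^esub> \<one>\<^bsub>k\<^esub> = \<zero>\<^bsub>k\<^esub>" "\<And>m. [m] \<cdot>\<^bsub>k\<^esub> \<one>\<^bsub>k\<^esub> = \<zero>\<^bsub>k\<^esub> \<Longrightarrow> p dvd m" using ch by simp_all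
  have "p \<noteq> 1" using ch[of 1] k.one_not_zero by auto
  moreover have "m = 1 \<or> m = p" if m: "m dvd p" for m
  proof -
    obtain t where t: "p = m * t" using m by auto
    have "([m] \<cdot>\<^bsub>k\<^esub> \<one>\<^bsub>k\<^esub>) \<otimes>\<^bsub>k\<^esub> ([t] \<cdot>\<^bsub>k\<^esub> \<one>\<^bsub>k\<^esub>) = [p] \<cdot>\<^bsub>k\<^esub> \<one>\<^bsub>k\<^esub>"
      by (simp add: k.add_pow_ldistr k.add.nat_pow_pow t mult.commute)
    then have "([m] \<cdot>\<^bsub>k\<^esub> \<one>\<^bsub>k\<^esub>) = \<zero>\<^bsub>k\<^esub> \<or> ([t] \<cdot>\<^bsub>k\<^esub> \<one>\<^bsub>k\<^esub>) = \<zero>\<^bsub>k\<^esub>"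
      using ch[of p] by (intro k.integral) simp_all
    then have "p dvd m \<or> p dvd t" using ch by simp
    then show ?thesis
    proof
      assume "p dvd m" then show ?thesis using m dvd_antisym by blast
    next
      assume "p dvd t"
      moreover have "t dvd p" using t by simp
      ultimately have "t = p" by (intro dvd_antisym)
      then show ?thesis using t p by (cases "t = 0") auto
    qed
  qed
  ultimately show "prime p" using p by (auto simp: prime_nat_iff)
qed

lemma subring_cring:
  assumes R: "cring R" and sub: "X \<subseteq> carrier R" and closed: "\<zero>\<^bsub>R\<^esub> \<in> X" "\<one>\<^bsub>R\<^esub> \<in> X"
    "\<And>x y. x \<in> X \<Longrightarrow> y \<in> X \<Longrightarrow> x \<oplus>\<^bsub>R\<^esub> y \<in> X" "\<And>x y. x \<in> X \<Longrightarrow> y \<in> X \<Longrightarrow> x \<otimes>\<^bsub>R\<^esub> y \<in> X"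
    "\<And>x. x \<in> X \<Longrightarrow> \<ominus>\<^bsub>R\<^esub> x \<in> X"
  shows "cring (R\<lparr>carrier := X\<rparr>)"
proof -
  interpret R: cring R by fact
  have c: "x \<in> carrier R" if "x \<in> X" for x using that sub by auto
  show ?thesis
  proof (rule cringI)
    show "abelian_group (R\<lparr>carrier := X\<rparr>)"
    proof (rule abelian_groupI)
      fix x assume "x \<in> carrier (R\<lparr>carrier := X\<rparr>)"
      then show "\<exists>y\<in>carrier (R\<lparr>carrier := X\<rparr>). y \<oplus>\<^bsub>R\<lparr>carrier := X\<rparr>\<^esub> x = \<zero>\<^bsub>R\<lparr>carrier := X\<rparr>\<^esub>"
        using closed(5) c R.l_neg by auto
    qed (use closed c R.a_assoc R.a_comm in auto)
    show "comm_monoid (R\<lparr>carrier := X\<rparr>)"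
      by (rule comm_monoidI) (use closed c R.m_assoc R.m_comm in auto)
  qed (use c R.l_distr in auto)
qed

text \<open>What is kept of the extension by q-th roots: all q-th powers come from k, and
  homogeneous elements of k have homogeneous roots. The algebraic closure does not occur beyond this
  interface.\<close>

locale root_ext =
  fixes k :: "('k, 'm) ring_scheme" and Gk :: "real \<Rightarrow> 'k set" and L :: "('k, 'l) module" and GL :: "real \<Rightarrow> 'l set"
    and p n :: nat
  assumes kF: "graded_field k Gk" and p: "prime p" and char: "[p] \<cdot>\<^bsub>k\<^esub> \<one>\<^bsub>k\<^esub> = \<zero>\<^bsub>k\<^esub>"
    and char_dvd: "\<And>m. [m] \<cdot>\<^bsub>k\<^esub> \<one>\<^bsub>k\<^esub> = \<zero>\<^bsub>k\<^esub> \<Longrightarrow> p dvd m"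
    and LF: "graded_field L GL" and L_alg: "graded_algebra k Gk L GL"
    and pow: "\<And>x. x \<in> carrier L \<Longrightarrow> \<exists>c\<in>carrier k. x [^]\<^bsub>L\<^esub> (p ^ n) = c \<odot>\<^bsub>L\<^esub> \<one>\<^bsub>L\<^esub>"
    and root: "\<And>\<gamma> c. \<gamma> > 0 \<Longrightarrow> c \<in> Gk \<gamma> \<Longrightarrow> \<exists>\<delta>>0. \<exists>x\<in>GL \<delta>. \<delta> ^ (p ^ n) = \<gamma> \<and> x [^]\<^bsub>L\<^esub> (p ^ n) = c \<odot>\<^bsub>L\<^esub> \<one>\<^bsub>L\<^esub>"

text \<open>Frobenius is additive and raises degrees to the power \<open>p ^ n\<close>, which is
  injective on positive reals, so distinct degrees stay distinct.\<close>

lemma (in graded) hcomp_frobenius: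
  assumes p: "prime (p::nat)" "[p] \<cdot> \<one> = \<zero>" and x: "x \<in> carrier R" and \<gamma>: "\<gamma> > 0"
  shows "hcomp R G (\<gamma> ^ (p ^ n)) (x [^] (p ^ n)) = (hcomp R G \<gamma> x) [^] (p ^ n)"
  using x
proof (induction x rule: graded_induct)
  case (homog \<delta> x)
  have q: "p ^ n > 0" using p by (simp add: prime_gt_0_nat)
  have "x [^] (p ^ n) \<in> G (\<delta> ^ (p ^ n))" using homog by (intro G_pow)
  moreover have "\<gamma> ^ (p ^ n) = \<delta> ^ (p ^ n) \<longleftrightarrow> \<gamma> = \<delta>"
    using \<gamma> homog(1) q by (simp add: power_eq_iff_eq_base)
  ultimately show ?case using homog \<gamma> q
    by (simp add: hcomp_homog[of "\<delta> ^ (p ^ n)"] hcomp_homog[of \<delta>] nat_pow_zero)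
next
  case (add x y)
  then show ?case by (simp add: frobenius_power_add[OF p] hcomp_add)
qed

text \<open>Closure under the ring operations rests on additivity of Frobenius, closure under taking
  homogeneous parts on \<open>hcomp_frobenius\<close>, and the roots come from the polynomials
  \<open>T^q - a\<close> over the closure.\<close>

lemma root_subfield_root_ext:
  fixes k :: "('k, 'm) ring_scheme" and K :: "('k, 'c) module"
  assumes kF: "graded_field k Gk" and p0: "p > 0" and char: "has_characteristic (k\<lparr>carrier := Gk 1\<rparr>) p"
    and closure: "graded_algebraic_closure k Gk K GK"
  shows "root_ext k Gk (root_subfield k K (p ^ n)) (root_subfield_grading k K GK (p ^ n)) p n"
proof -
  define q where "q = p ^ n"
  let ?L = "root_subfield k K q" and ?GL = "root_subfield_grading k K GK q"
  have KA: "graded_algebra k Gk K GK" and KF: "graded_field K GK" and KC: "graded_algebraically_closed K GK"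
    using closure by (auto simp: graded_algebraic_closure_def)
  have A: "algebra k K" using KA by (simp add: graded_algebra_def)
  interpret K: algebra k K by (rule A)
  interpret GK: graded K GK using KA by (intro gradedI) (simp add: graded_algebra_def)
  interpret k: graded k Gk using kF by (intro gradedI) (simp add: graded_field_def)
  interpret kD: "domain" k by (rule graded_field_domain[OF kF])
  interpret KD: "domain" K by (rule graded_field_domain[OF KF])
  interpret u: ring_hom_cring k K "\<lambda>c. c \<odot>\<^bsub>K\<^esub> \<one>\<^bsub>K\<^esub>"
    by (rule UnivPoly.ring_hom_cringI[OF K.R_cring K.M_cring algebra_unit_hom[OF A]])
  note p = characteristic_prime[OF kD.domain_axioms p0 char]
  have chK: "[p] \<cdot>\<^bsub>K\<^esub> \<one>\<^bsub>K\<^esub> = \<zero>\<^bsub>K\<^esub>"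
    by (rule char_transfer_hom[OF K.R_cring K.M_cring algebra_unit_hom[OF A] p(2)])
  have q0: "q > 0" using p0 by (simp add: q_def)
  have scal: "c \<odot>\<^bsub>K\<^esub> \<one>\<^bsub>K\<^esub> \<in> GK \<gamma>" if "\<gamma> > 0" "c \<in> Gk \<gamma>" for \<gamma> c
  proof -
    have "c \<odot>\<^bsub>K\<^esub> \<one>\<^bsub>K\<^esub> \<in> GK (\<gamma> * 1)" using KA that GK.one_homog by (auto simp: graded_algebra_def simp del: mult_1_right)
    then show ?thesis by simp
  qed
  define X where "X = {x \<in> carrier K. \<exists>c\<in>carrier k. x [^]\<^bsub>K\<^esub> q = c \<odot>\<^bsub>K\<^esub> \<one>\<^bsub>K\<^esub>}"
  have L: "?L = K\<lparr>carrier := X\<rparr>" by (simp add: root_subfield_def X_def)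
  have GL: "?GL \<gamma> = GK \<gamma> \<inter> X" for \<gamma> by (simp add: root_subfield_grading_def L)
  have XK: "x \<in> carrier K" if "x \<in> X" for x using that by (simp add: X_def)
  have X_add: "x \<oplus>\<^bsub>K\<^esub> y \<in> X" if xy: "x \<in> X" "y \<in> X" for x y
  proof -
    obtain c d where "x \<in> carrier K" "y \<in> carrier K" "c \<in> carrier k" "d \<in> carrier k"
      "x [^]\<^bsub>K\<^esub> q = c \<odot>\<^bsub>K\<^esub> \<one>\<^bsub>K\<^esub>" "y [^]\<^bsub>K\<^esub> q = d \<odot>\<^bsub>K\<^esub> \<one>\<^bsub>K\<^esub>" using xy by (auto simp: X_def)
    then show ?thesis
      unfolding X_def q_def using K.frobenius_power_add[OF p(1) chK, of x y n]
      by (auto simp flip: u.hom_add intro!: bexI[of _ "c \<oplus>\<^bsub>k\<^esub> d"])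
  qed
  have X_mult: "x \<otimes>\<^bsub>K\<^esub> y \<in> X" if xy: "x \<in> X" "y \<in> X" for x y
  proof -
    obtain c d where "x \<in> carrier K" "y \<in> carrier K" "c \<in> carrier k" "d \<in> carrier k"
      "x [^]\<^bsub>K\<^esub> q = c \<odot>\<^bsub>K\<^esub> \<one>\<^bsub>K\<^esub>" "y [^]\<^bsub>K\<^esub> q = d \<odot>\<^bsub>K\<^esub> \<one>\<^bsub>K\<^esub>" using xy by (auto simp: X_def)
    then show ?thesis
      unfolding X_def using K.nat_pow_distrib[of x y q] u.hom_mult[of c d]
      by (auto intro!: bexI[of _ "c \<otimes>\<^bsub>k\<^esub> d"])
  qed
  have X_unit: "c \<odot>\<^bsub>K\<^esub> \<one>\<^bsub>K\<^esub> \<in> X" if "c \<in> carrier k" for c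
    unfolding X_def using that u.hom_pow[of c q] by (auto intro!: bexI[of _ "c [^]\<^bsub>k\<^esub> q"])
  have X01: "\<zero>\<^bsub>K\<^esub> \<in> X" "\<one>\<^bsub>K\<^esub> \<in> X"
    using X_unit[of "\<zero>\<^bsub>k\<^esub>"] X_unit[of "\<one>\<^bsub>k\<^esub>"] by simp_all
  have X_minus: "\<ominus>\<^bsub>K\<^esub> x \<in> X" if "x \<in> X" for x
  proof -
    \<comment> \<open>Writing the negative as a scalar multiple reduces it to closure under
      products.\<close>
    have "\<ominus>\<^bsub>K\<^esub> x = (\<ominus>\<^bsub>k\<^esub> \<one>\<^bsub>k\<^esub>) \<odot>\<^bsub>K\<^esub> \<one>\<^bsub>K\<^esub> \<otimes>\<^bsub>K\<^esub> x"
      using XK[OF that] by (simp add: K.l_minus u.hom_a_inv[simplified])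
    then show ?thesis using X_mult[OF X_unit that] by (metis K.R.a_inv_closed K.R.one_closed)
  qed
  have Lc: "cring ?L" unfolding L by (rule subring_cring[OF K.M_cring]) (use XK X01 X_add X_mult X_minus in auto)
  interpret L: cring ?L by (rule Lc)
  have Lm: "\<ominus>\<^bsub>?L\<^esub> x = \<ominus>\<^bsub>K\<^esub> x" if "x \<in> X" for x
    by (rule L.minus_equality) (use that X_minus XK K.M.l_neg in \<open>auto simp: L\<close>)
  have Lsum: "finsum ?L f I = finsum K f I" if "finite I" "\<And>i. i \<in> I \<Longrightarrow> f i \<in> X" for f :: "real \<Rightarrow> 'c" and I
    using that
  proof (induction I rule: finite_induct)
    case (insert i I)
    then have "f \<in> I \<rightarrow> carrier ?L" "f i \<in> carrier ?L" "f \<in> I \<rightarrow> carrier K" "f i \<in> carrier K" using XK by (auto simp: L)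
    then have "finsum ?L f (insert i I) = f i \<oplus>\<^bsub>?L\<^esub> finsum ?L f I" "finsum K f (insert i I) = f i \<oplus>\<^bsub>K\<^esub> finsum K f I"
      using insert(1,2) by simp_all
    then show ?case using insert by (simp add: L)
  next
    case empty
    have "finsum ?L f {} = \<zero>\<^bsub>?L\<^esub>" by simp
    then show ?case by (simp add: L)
  qed
  have Lpow: "x [^]\<^bsub>?L\<^esub> (m::nat) = x [^]\<^bsub>K\<^esub> m" for x m by (rule nat_pow_transfer) (simp_all add: L)
  have LA: "algebra k ?L"
  proof (rule algebraI[OF K.R_cring Lc])
    show "c \<odot>\<^bsub>?L\<^esub> x \<in> carrier ?L" if "c \<in> carrier k" "x \<in> carrier ?L" for c x
      using X_mult[OF X_unit[OF that(1)], of x] that XK by (simp add: L K.smult_assoc2)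
  qed (use XK in \<open>auto simp: L K.smult_l_distr K.smult_r_distr K.smult_assoc1 K.smult_assoc2\<close>)
  have inj: "inj_on (\<lambda>c. c \<odot>\<^bsub>K\<^esub> \<one>\<^bsub>K\<^esub>) (carrier k)" by (rule graded_field_unit_inj[OF kF KA KD.one_not_zero])
  \<comment> \<open>The q-th power of a part of \<open>x\<close> is a part of \<open>x^q\<close>,
    and that element already lies in k; so the parts of \<open>x\<close> are again q-th
    roots.\<close>
  have comp: "hcomp K GK \<gamma> x \<in> X" if x: "x \<in> X" for \<gamma> x
  proof (cases "\<gamma> > 0")
    case True
    obtain c where c: "c \<in> carrier k" "x [^]\<^bsub>K\<^esub> q = c \<odot>\<^bsub>K\<^esub> \<one>\<^bsub>K\<^esub>" using x by (auto simp: X_def)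
    have "(hcomp K GK \<gamma> x) [^]\<^bsub>K\<^esub> q = hcomp K GK (\<gamma> ^ q * 1) (c \<odot>\<^bsub>K\<^esub> \<one>\<^bsub>K\<^esub>)"
      using GK.hcomp_frobenius[OF p(1) chK XK[OF x] True, of n] c by (simp add: q_def)
    also have "\<dots> = hcomp k Gk (\<gamma> ^ q) c \<odot>\<^bsub>K\<^esub> \<one>\<^bsub>K\<^esub>"
      by (rule graded_map_hcomp[OF k.graded GK.graded c(1)]) (use scal in \<open>auto simp: K.smult_l_distr\<close>)
    finally show ?thesis using XK[OF x] c k.hcomp_closed by (auto simp: X_def)
  next
    case False
    then show ?thesis using GK.hcomp_props(2)[OF XK[OF x], of \<gamma>] X01 by simp
  qed
  have LG: "graded_ring ?L ?GL"
  proof (rule graded_ringI[OF Lc])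
    show "additive_subgroup (?GL \<gamma>) ?L" if "\<gamma> > 0" for \<gamma>
    proof (intro additive_subgroupI L.add.subgroupI)
      show "\<ominus>\<^bsub>?L\<^esub> x \<in> ?GL \<gamma>" if "x \<in> ?GL \<gamma>" for x
        using that Lm[of x] X_minus[of x] GK.G_minus[OF \<open>\<gamma> > 0\<close>, of x] by (simp add: GL)
      show "?GL \<gamma> \<noteq> {}" using X01 GK.G_zero[OF \<open>\<gamma> > 0\<close>] by (auto simp: GL)
    qed (use X_add GK.G_add[OF that] in \<open>auto simp: GL L\<close>)
    show "x \<otimes>\<^bsub>?L\<^esub> y \<in> ?GL (\<alpha> * \<beta>)" if "\<alpha> > 0" "\<beta> > 0" "x \<in> ?GL \<alpha>" "y \<in> ?GL \<beta>" for \<alpha> \<beta> x y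
      using that X_mult GK.G_mult by (simp add: GL) (simp add: L)
    show "\<exists>c I. hsum ?L ?GL x c I" if "x \<in> carrier ?L" for x
    proof -
      have x: "x \<in> X" using that by (simp add: L)
      have h: "hsum K GK x (\<lambda>\<gamma>. hcomp K GK \<gamma> x) {\<gamma>. hcomp K GK \<gamma> x \<noteq> \<zero>\<^bsub>K\<^esub>}"
        by (rule GK.hsum_hcomp[OF XK[OF x]])
      then have "finsum ?L (\<lambda>\<gamma>. hcomp K GK \<gamma> x) {\<gamma>. hcomp K GK \<gamma> x \<noteq> \<zero>\<^bsub>K\<^esub>} = x"
        using Lsum[of "{\<gamma>. hcomp K GK \<gamma> x \<noteq> \<zero>\<^bsub>K\<^esub>}" "\<lambda>\<gamma>. hcomp K GK \<gamma> x"] comp[OF x] unfolding hsum_def by metis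
      then have "hsum ?L ?GL x (\<lambda>\<gamma>. hcomp K GK \<gamma> x) {\<gamma>. hcomp K GK \<gamma> x \<noteq> \<zero>\<^bsub>K\<^esub>}"
        using h comp[OF x] unfolding hsum_def GL by simp
      then show ?thesis by blast
    qed
    show "c \<gamma> = \<zero>\<^bsub>?L\<^esub>" if h: "hsum ?L ?GL \<zero>\<^bsub>?L\<^esub> c I" and \<gamma>: "\<gamma> \<in> I" for c I \<gamma>
    proof -
      have I: "finite I" "I \<subseteq> {0<..}" "\<And>\<gamma>. \<gamma> \<in> I \<Longrightarrow> c \<gamma> \<in> GK \<gamma>" "\<And>\<gamma>. \<gamma> \<in> I \<Longrightarrow> c \<gamma> \<in> X" "\<zero>\<^bsub>?L\<^esub> = finsum ?L c I"
        using h by (auto simp: hsum_def GL)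
      then have "finsum K c I = \<zero>\<^bsub>K\<^esub>" using Lsum[of I c] by (simp add: L)
      then show ?thesis using GK.independent[OF I(1,2,3)] \<gamma> by (simp add: L)
    qed
  qed
  have LGA: "graded_algebra k Gk ?L ?GL"
    unfolding graded_algebra_def
  proof (intro conjI LG LA k.graded allI impI ballI)
    fix \<alpha> \<beta> :: real and c x assume h: "\<alpha> > 0" "\<beta> > 0" "c \<in> Gk \<alpha>" "x \<in> ?GL \<beta>"
    have "c \<odot>\<^bsub>K\<^esub> x = (c \<odot>\<^bsub>K\<^esub> \<one>\<^bsub>K\<^esub>) \<otimes>\<^bsub>K\<^esub> x"
      using h XK k.G_carrier by (intro algebra_smult_unit[OF A]) (auto simp: GL)
    then show "c \<odot>\<^bsub>?L\<^esub> x \<in> ?GL (\<alpha> * \<beta>)"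
      using h GK.G_mult[OF h(1,2) scal[OF h(1,3)], of x] X_mult[OF X_unit[OF k.G_carrier[OF h(1,3)]], of x] by (simp add: GL) (simp add: L)
  qed
  have LF: "graded_field ?L ?GL"
    unfolding graded_field_def
  proof (intro conjI LG allI impI ballI)
    show "\<one>\<^bsub>?L\<^esub> \<noteq> \<zero>\<^bsub>?L\<^esub>" using KD.one_not_zero by (simp add: L)
    fix \<gamma> :: real and x assume \<gamma>: "\<gamma> > 0" and x: "x \<in> ?GL \<gamma>" "x \<noteq> \<zero>\<^bsub>?L\<^esub>"
    have xK: "x \<in> carrier K" "x \<noteq> \<zero>\<^bsub>K\<^esub>" "x \<in> GK \<gamma>" using x XK by (auto simp: GL L)
    then have "x \<in> Units K" using KF \<gamma> by (auto simp: graded_field_def)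
    then obtain y where y: "y \<in> carrier K" "y \<otimes>\<^bsub>K\<^esub> x = \<one>\<^bsub>K\<^esub>" by (auto simp: Units_def)
    obtain c where c: "c \<in> carrier k" "x [^]\<^bsub>K\<^esub> q = c \<odot>\<^bsub>K\<^esub> \<one>\<^bsub>K\<^esub>" using x by (auto simp: X_def GL)
    \<comment> \<open>The inverse of \<open>x\<close> in the closure must be shown to have its q-th
      power in k. That power is the inverse of \<open>c\<close>, and \<open>c\<close> is invertible
      in k once it is known to be homogeneous.\<close>
    have "c \<in> Gk (\<gamma> ^ q)"
      by (rule graded_inj_reflects[OF k.graded GK.graded c(1) algebra_unit_hom[OF A] inj])
         (use scal \<gamma> c(2) GK.G_pow[OF \<gamma> xK(3), of q] in auto)
    moreover have "c \<noteq> \<zero>\<^bsub>k\<^esub>"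
    proof
      assume "c = \<zero>\<^bsub>k\<^esub>"
      then have "x [^]\<^bsub>K\<^esub> q = \<zero>\<^bsub>K\<^esub>" using c by simp
      then show False using KD.nat_pow_eq_zero xK by blast
    qed
    ultimately have "c \<in> Units k" using kF zero_less_power[OF \<gamma>, of q] unfolding graded_field_def by blast
    then obtain d where d: "d \<in> carrier k" "d \<otimes>\<^bsub>k\<^esub> c = \<one>\<^bsub>k\<^esub>" by (auto simp: Units_def)
    have "y [^]\<^bsub>K\<^esub> q \<otimes>\<^bsub>K\<^esub> x [^]\<^bsub>K\<^esub> q = \<one>\<^bsub>K\<^esub>"
      using K.nat_pow_distrib[OF y(1) xK(1), of q] y by simp
    moreover have "d \<odot>\<^bsub>K\<^esub> \<one>\<^bsub>K\<^esub> \<otimes>\<^bsub>K\<^esub> x [^]\<^bsub>K\<^esub> q = \<one>\<^bsub>K\<^esub>"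
      using u.hom_mult[OF d(1) c(1)] d c by simp
    ultimately have "y [^]\<^bsub>K\<^esub> q = d \<odot>\<^bsub>K\<^esub> \<one>\<^bsub>K\<^esub>"
      using y d xK KD.nat_pow_eq_zero[of x q] KD.m_rcancel[of "x [^]\<^bsub>K\<^esub> q" "y [^]\<^bsub>K\<^esub> q" "d \<odot>\<^bsub>K\<^esub> \<one>\<^bsub>K\<^esub>"] by auto
    then have "y \<in> X" using y d by (auto simp: X_def)
    then show "x \<in> Units ?L" using y x K.m_comm[OF y(1) xK(1)] by (auto simp: Units_def L GL)
  qed
  have root: "\<exists>\<delta>>0. \<exists>x\<in>?GL \<delta>. \<delta> ^ q = \<gamma> \<and> x [^]\<^bsub>?L\<^esub> q = c \<odot>\<^bsub>?L\<^esub> \<one>\<^bsub>?L\<^esub>" if \<gamma>: "\<gamma> > 0" and c: "c \<in> Gk \<gamma>" for \<gamma> c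
  proof -
    interpret U: UP_cring K "UP K" by (rule UP_cringI[OF K.M_cring]) simp
    define \<delta> where "\<delta> = root q \<gamma>"
    have \<delta>: "\<delta> > 0" "\<delta> ^ q = \<gamma>" using \<gamma> q0 by (simp_all add: \<delta>_def real_root_gt_zero)
    have ck: "c \<in> carrier k" by (rule k.G_carrier[OF \<gamma> c])
    let ?a = "c \<odot>\<^bsub>K\<^esub> \<one>\<^bsub>K\<^esub>"
    have a: "?a \<in> carrier K" "?a \<in> GK \<gamma>" using scal[OF \<gamma> c] ck by auto
    \<comment> \<open>This is \<open>T^q - a\<close>. With \<open>T\<close> of degree the real q-th
      root of \<open>\<gamma>\<close> it is homogeneous, as the definition of a graded algebraically
      closed ring demands.\<close>
    define f where "f = monom (UP K) \<one>\<^bsub>K\<^esub> q \<oplus>\<^bsub>UP K\<^esub> monom (UP K) (\<ominus>\<^bsub>K\<^esub> ?a) 0"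
    have f: "f \<in> carrier (UP K)" using a by (simp add: f_def)
    have cf: "coeff (UP K) f i = (if i = q then \<one>\<^bsub>K\<^esub> else if i = 0 then \<ominus>\<^bsub>K\<^esub> ?a else \<zero>\<^bsub>K\<^esub>)" for i
      using a q0 by (auto simp: f_def)
    have "f \<in> poly_grading K GK \<delta> \<gamma>"
      using f GK.one_homog GK.G_minus[OF \<gamma> a(2)] \<gamma> \<delta> q0 by (auto simp: poly_grading_def cf)
    moreover have "q \<le> deg K f" by (rule U.deg_belowI) (use f cf KD.one_not_zero in auto)
    ultimately obtain x where x: "x \<in> GK \<delta>" "eval K K (\<lambda>c. c) x f = \<zero>\<^bsub>K\<^esub>"
      using KC \<delta> \<gamma> q0 unfolding graded_algebraically_closed_def by (metis gr0I leD)
    have xK: "x \<in> carrier K" by (rule GK.G_carrier[OF \<delta>(1) x(1)])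
    have idh: "(\<lambda>c. c) \<in> ring_hom K K" by (simp add: ring_hom_def)
    note ev = eval_of_monom[OF K.M_cring K.M_cring idh xK]
    have "eval K K (\<lambda>c. c) x f = x [^]\<^bsub>K\<^esub> q \<oplus>\<^bsub>K\<^esub> \<ominus>\<^bsub>K\<^esub> ?a"
      using ring_hom_add[OF eval_hom[OF K.M_cring K.M_cring idh xK], of "monom (UP K) \<one>\<^bsub>K\<^esub> q" "monom (UP K) (\<ominus>\<^bsub>K\<^esub> ?a) 0"] a xK
      by (simp add: f_def ev del: U.monom_a_inv)
    then have "x [^]\<^bsub>K\<^esub> q = ?a" using x(2) a xK K.M.minus_equality[of "x [^]\<^bsub>K\<^esub> q" "\<ominus>\<^bsub>K\<^esub> ?a"] by simp
    moreover then have "x \<in> X" using xK ck by (auto simp: X_def)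
    ultimately show ?thesis using x \<delta> by (intro exI[of _ \<delta>] conjI bexI[of _ x]) (auto simp: GL L Lpow[unfolded L])
  qed
  have pw: "\<exists>c\<in>carrier k. x [^]\<^bsub>?L\<^esub> q = c \<odot>\<^bsub>?L\<^esub> \<one>\<^bsub>?L\<^esub>" if "x \<in> carrier ?L" for x
    using that by (simp add: Lpow) (simp add: L X_def)
  show ?thesis
    unfolding q_def[symmetric]
    by (unfold_locales; (fold q_def)?) (use kF p LF LGA pw root in auto)
qed

text \<open>Frobenius need not be injective in \<open>R\<close>. The root is built by induction on \<open>n\<close>: apply the induction
  hypothesis to the \<open>p\<close>-th powers of the \<open>b j\<close> and of \<open>x2\<close>, then divide by the unit \<open>b 0\<close>.\<close>

lemma (in cring) frobenius_root:
  assumes p: "prime (p::nat)" "[p] \<cdot> \<one> = \<zero>"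
    and b: "\<And>j. j \<le> m \<Longrightarrow> b j \<in> carrier R" and c: "c \<in> carrier R" "c \<otimes> b 0 = \<one>"
    and x: "x1 \<in> carrier R" "x2 \<in> carrier R"
    and eq: "x2 [^] (p ^ n) = (\<Oplus>j\<in>{..m}. b j [^] (p ^ n) \<otimes> x1 [^] (p ^ j))"
  shows "\<exists>u\<in>carrier R. u [^] (p ^ n) = x1 \<and> x2 = (\<Oplus>j\<in>{..m}. b j \<otimes> u [^] (p ^ j))"
  using b c x(2) eq
proof (induction n arbitrary: b c x2)
  case 0
  have "(\<Oplus>j\<in>{..m}. b j [^] (p ^ 0) \<otimes> x1 [^] (p ^ j)) = (\<Oplus>j\<in>{..m}. b j \<otimes> x1 [^] (p ^ j))"
    by (rule finsum_cong') (use 0 x in auto)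
  then show ?case using 0 x by (intro bexI[of _ x1]) auto
next
  case (Suc n)
  note b = Suc.prems(1) and c = Suc.prems(2,3) and x2 = Suc.prems(4) and eq = Suc.prems(5)
  have split: "(\<Oplus>j\<in>{..m}. g j) = g 0 \<oplus> (\<Oplus>j\<in>{1..m}. g j)" if "\<And>j. j \<le> m \<Longrightarrow> g j \<in> carrier R" for g
  proof -
    have "{..m} = insert 0 {1..m}" by auto
    then show ?thesis using that finsum_insert[of "{1..m}" 0 g] by (auto simp: Pi_def)
  qed
  have pw: "(y [^] p) [^] (p ^ n) = y [^] (p ^ Suc n)" if "y \<in> carrier R" for y
    using that by (simp add: nat_pow_pow)
  have "\<exists>v\<in>carrier R. v [^] (p ^ n) = x1 \<and> x2 [^] p = (\<Oplus>j\<in>{..m}. (b j [^] p) \<otimes> v [^] (p ^ j))"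
  proof (rule Suc.IH[of "\<lambda>j. b j [^] p" "c [^] p"])
    show "c [^] p \<otimes> b 0 [^] p = \<one>" using c b[of 0] by (simp flip: nat_pow_distrib)
    have "(\<Oplus>j\<in>{..m}. (b j [^] p) [^] (p ^ n) \<otimes> x1 [^] (p ^ j)) = (\<Oplus>j\<in>{..m}. b j [^] (p ^ Suc n) \<otimes> x1 [^] (p ^ j))"
      by (rule finsum_cong') (use b x pw in auto)
    then show "(x2 [^] p) [^] (p ^ n) = (\<Oplus>j\<in>{..m}. (b j [^] p) [^] (p ^ n) \<otimes> x1 [^] (p ^ j))"
      using eq pw[OF x2] by simp
  qed (use b c x2 in auto)
  then obtain v where v: "v \<in> carrier R" "v [^] (p ^ n) = x1" "x2 [^] p = (\<Oplus>j\<in>{..m}. (b j [^] p) \<otimes> v [^] (p ^ j))" by blast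
  \<comment> \<open>\<open>t\<close> is the tail of the p-polynomial at the sought root
    \<open>w\<close>. It can be written without \<open>w\<close>, since \<open>w^(p^j)\<close> is
    \<open>v^(p^(j-1))\<close> for positive \<open>j\<close>. Solving
    \<open>x2 = b 0 * w + t\<close> for \<open>w\<close> gives the next definition.\<close>
  define t where "t = (\<Oplus>j\<in>{1..m}. b j \<otimes> v [^] (p ^ (j - 1)))"
  have t: "t \<in> carrier R" unfolding t_def using b v by (intro finsum_closed) auto
  define w where "w = c \<otimes> (x2 \<ominus> t)"
  have w: "w \<in> carrier R" using c x2 t by (simp add: w_def)
  have "t [^] (p ^ 1) = (\<Oplus>j\<in>{1..m}. (b j \<otimes> v [^] (p ^ (j - 1))) [^] (p ^ 1))"
    unfolding t_def by (rule frobenius_power_sum[OF p]) (use b v in auto)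
  also have "\<dots> = (\<Oplus>j\<in>{1..m}. (b j [^] p) \<otimes> v [^] (p ^ j))"
  proof (rule finsum_cong')
    fix j assume j: "j \<in> {1..m}"
    then have "p ^ (j - 1) * p = p ^ j" by (cases j) auto
    then show "(b j \<otimes> v [^] (p ^ (j - 1))) [^] (p ^ 1) = (b j [^] p) \<otimes> v [^] (p ^ j)"
      using j b[of j] v(1) by (simp add: nat_pow_distrib nat_pow_pow)
  qed (use b v in auto)
  finally have tp: "t [^] p = (\<Oplus>j\<in>{1..m}. (b j [^] p) \<otimes> v [^] (p ^ j))" by simp
  have "x2 [^] p = b 0 [^] p \<otimes> v \<oplus> t [^] p"
    using v(3) split[of "\<lambda>j. (b j [^] p) \<otimes> v [^] (p ^ j)"] b v(1) tp by simp
  moreover have "(x2 \<ominus> t) [^] p = x2 [^] p \<ominus> t [^] p"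
    using frobenius_power_diff[OF p x2 t, of 1] by simp
  ultimately have "(x2 \<ominus> t) [^] p = b 0 [^] p \<otimes> v" using b[of 0] v(1) t
    by (simp add: minus_eq a_assoc r_neg)
  then have "w [^] p = (c [^] p \<otimes> b 0 [^] p) \<otimes> v"
    using c(1) b[of 0] v(1) x2 t by (simp add: w_def nat_pow_distrib m_assoc)
  then have wp: "w [^] p = v" using c b[of 0] v(1) by (simp flip: nat_pow_distrib)
  have "w [^] (p ^ Suc n) = x1" using pw[OF w] wp v(2) by simp
  moreover have "x2 = (\<Oplus>j\<in>{..m}. b j \<otimes> w [^] (p ^ j))"
  proof -
    have "(\<Oplus>j\<in>{1..m}. b j \<otimes> w [^] (p ^ j)) = t"
      unfolding t_def
    proof (rule finsum_cong')
      fix j assume "j \<in> {1..m}"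
      then have "w [^] (p ^ j) = (w [^] p) [^] (p ^ (j - 1))" using w by (cases j) (auto simp: nat_pow_pow)
      then show "b j \<otimes> w [^] (p ^ j) = b j \<otimes> v [^] (p ^ (j - 1))" using wp by simp
    qed (use b v in auto)
    then have "(\<Oplus>j\<in>{..m}. b j \<otimes> w [^] (p ^ j)) = b 0 \<otimes> w \<oplus> t"
      using split[of "\<lambda>j. b j \<otimes> w [^] (p ^ j)"] b w by simp
    also have "b 0 \<otimes> w = (c \<otimes> b 0) \<otimes> (x2 \<ominus> t)" using b[of 0] c(1) x2 t by (simp add: w_def m_ac)
    also have "\<dots> \<oplus> t = x2" using c(2) x2 t by (simp add: minus_eq a_assoc l_neg)
    finally show ?thesis by simp
  qed
  ultimately show ?case using w by blast
qed

lemma bij_betw_of_inverses: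
  assumes "\<And>x. x \<in> X \<Longrightarrow> f x \<in> Y" "\<And>y. y \<in> Y \<Longrightarrow> g y \<in> X"
    "\<And>x. x \<in> X \<Longrightarrow> g (f x) = x" "\<And>y. y \<in> Y \<Longrightarrow> f (g y) = y"
  shows "bij_betw f X Y"
  by (rule bij_betw_byWitness[of _ g]) (use assms in auto)

context root_ext
begin

sublocale kg: graded k Gk using kF by (intro gradedI) (simp add: graded_field_def)
sublocale Lg: graded L GL using LF by (intro gradedI) (simp add: graded_field_def)

lemma L_algebra: "algebra k L" using L_alg by (simp add: graded_algebra_def)

sublocale LA: algebra k L by (rule L_algebra)
sublocale kD: "domain" k by (rule graded_field_domain[OF kF])
sublocale LD: "domain" L by (rule graded_field_domain[OF LF])
sublocale UL: UP_cring L "UP L" by (rule UP_cringI[OF Lg.cring_axioms]) simp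

lemma UL_domain: "domain (UP L)" by (rule UP_domain_of[OF LD.domain_axioms])

sublocale ULD: "domain" "UP L" by (rule UL_domain)

abbreviation "q \<equiv> p ^ n"

lemma q_pos: "q > 0" using p by (simp add: prime_gt_0_nat)

lemma L_char: "[p] \<cdot>\<^bsub>L\<^esub> \<one>\<^bsub>L\<^esub> = \<zero>\<^bsub>L\<^esub>"
  by (rule char_transfer_hom[OF LA.R_cring Lg.cring_axioms algebra_unit_hom[OF L_algebra] char])

lemma UL_char: "[p] \<cdot>\<^bsub>UP L\<^esub> \<one>\<^bsub>UP L\<^esub> = \<zero>\<^bsub>UP L\<^esub>"
  by (rule char_transfer_hom[OF Lg.cring_axioms UL.UP_cring UL.const_ring_hom L_char])

text \<open>L[T] with scalars restricted to k, to serve as target of homomorphisms from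
  k-algebras.\<close>

definition "UPL = with_scalars (UP L) (\<lambda>c P. monom (UP L) (c \<odot>\<^bsub>L\<^esub> \<one>\<^bsub>L\<^esub>) 0 \<otimes>\<^bsub>UP L\<^esub> P)"

abbreviation "X \<equiv> monom (UP L) \<one>\<^bsub>L\<^esub> 1"

lemma UPL_simps [simp]: "carrier UPL = carrier (UP L)" "monoid.mult UPL = monoid.mult (UP L)"
  "one UPL = one (UP L)" "zero UPL = zero (UP L)" "add UPL = add (UP L)"
  by (simp_all add: UPL_def)

lemma UPL_pow [simp]: "P [^]\<^bsub>UPL\<^esub> (i::nat) = P [^]\<^bsub>UP L\<^esub> i"
  by (simp add: UPL_def)

lemma UPL_algebra: "algebra k UPL"
  unfolding UPL_def
  by (rule with_scalars_algebra[OF LA.R_cring UL.UP_cring])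
     (use ring_hom_trans[OF algebra_unit_hom[OF L_algebra] UL.const_ring_hom] in \<open>simp add: comp_def\<close>)

lemma UPL_smult: "c \<odot>\<^bsub>UPL\<^esub> P = monom (UP L) (c \<odot>\<^bsub>L\<^esub> \<one>\<^bsub>L\<^esub>) 0 \<otimes>\<^bsub>UP L\<^esub> P"
  by (simp add: UPL_def)

lemma UPL_const: "(\<lambda>x. monom (UP L) x 0) \<in> alg_hom k L UPL"
proof (rule alg_hom_unit_smult[OF L_algebra UPL_algebra])
  show "(\<lambda>x. monom (UP L) x 0) \<in> ring_hom L UPL" using UL.const_ring_hom by (simp add: ring_hom_def)
qed (simp add: UPL_smult)

end

section \<open>The affine line over L and the base change of k[T]\<close>

locale root_form = root_ext k Gk L GL p n
  for k :: "('k, 'm) ring_scheme" and Gk and L :: "('k, 'l) module" and GL p n +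
  fixes r :: real assumes r_pos: "r > 0"
begin

abbreviation "LG \<equiv> poly_grading L GL r"

lemma UL_graded: "graded_ring (UP L) LG" by (rule Lg.UP_graded[OF r_pos])

sublocale ULg: graded "UP L" LG by (rule gradedI[OF UL_graded])

lemma X_homog: "X \<in> LG r"
  using monom_homog[OF Lg.graded r_pos _ Lg.one_homog, of 1] r_pos by simp

lemma const_homog: "\<gamma> > 0 \<Longrightarrow> x \<in> GL \<gamma> \<Longrightarrow> monom (UP L) x 0 \<in> LG \<gamma>"
  using monom_homog[OF Lg.graded r_pos, of \<gamma> x 0] by simp

lemma UPL_graded: "graded_ring UPL LG"
  by (rule graded_ring_transfer[OF UL_graded]) simp_all

lemma UPL_pregraded: "pregraded UPL LG" "\<one>\<^bsub>UPL\<^esub> \<in> LG 1"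
proof -
  interpret graded UPL LG by (rule gradedI[OF UPL_graded])
  show "pregraded UPL LG" by (rule pregraded_axioms)
  show "\<one>\<^bsub>UPL\<^esub> \<in> LG 1" by (rule one_homog)
qed

lemma UPL_scalar: "\<gamma> > 0 \<Longrightarrow> c \<in> Gk \<gamma> \<Longrightarrow> c \<odot>\<^bsub>UPL\<^esub> \<one>\<^bsub>UPL\<^esub> \<in> LG \<gamma>"
proof -
  assume c: "\<gamma> > 0" "c \<in> Gk \<gamma>"
  have "c \<odot>\<^bsub>L\<^esub> \<one>\<^bsub>L\<^esub> \<in> GL (\<gamma> * 1)"
    using L_alg c Lg.one_homog by (auto simp: graded_algebra_def simp del: mult_1_right)
  then show ?thesis using const_homog[OF c(1)] kg.G_carrier[OF c] by (simp add: UPL_smult)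
qed

definition "lin_ext g = tensor_lift (UP L) (\<lambda>x y. monom (UP L) x 0 \<otimes>\<^bsub>UP L\<^esub> g y)"

context
  fixes A :: "('k, 'a, 'n) module_scheme" and GA g
  assumes A: "graded_algebra k Gk A GA" and g: "g \<in> alg_hom k A UPL"
begin

interpretation LA: graded_tensor k L A Gk GL GA by (rule graded_tensorI[OF L_alg A])

lemma lin_ext_alg_hom: "lin_ext g \<in> alg_hom k (tensor_algebra k L A) UPL"
  and lin_ext_pure: "x \<in> carrier L \<Longrightarrow> y \<in> carrier A \<Longrightarrow>
    lin_ext g (pure_tensor k L A x y) = monom (UP L) x 0 \<otimes>\<^bsub>UP L\<^esub> g y"
proof -
  note 1 = LA.tensor_lift_alg_hom[OF UPL_algebra, where P = "UP L", OF _ _ _ _ _ UPL_const g,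
      where \<phi> = "\<lambda>x y. monom (UP L) x 0 \<otimes>\<^bsub>UP L\<^esub> g y"]
  show "lin_ext g \<in> alg_hom k (tensor_algebra k L A) UPL"
    unfolding lin_ext_def by (rule 1(1)) simp_all
  show "lin_ext g (pure_tensor k L A x y) = monom (UP L) x 0 \<otimes>\<^bsub>UP L\<^esub> g y" if "x \<in> carrier L" "y \<in> carrier A"
    unfolding lin_ext_def using 1(2)[of x y] that by simp
qed

lemma lin_ext_ring_hom: "lin_ext g \<in> ring_hom (tensor_ring k L A) (UP L)"
  using alg_hom_ring_hom[OF lin_ext_alg_hom] by (simp add: ring_hom_def)

lemma lin_ext_left: "x \<in> carrier L \<Longrightarrow> lin_ext g (pure_tensor k L A x \<one>\<^bsub>A\<^esub>) = monom (UP L) x 0"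
  using lin_ext_pure[of x "\<one>\<^bsub>A\<^esub>"] alg_hom_one[OF g] by simp

lemma lin_ext_right: "y \<in> carrier A \<Longrightarrow> lin_ext g (pure_tensor k L A \<one>\<^bsub>L\<^esub> y) = g y"
  using lin_ext_pure[of "\<one>\<^bsub>L\<^esub>" y] alg_hom_closed[OF g, of y] UL.monom_one by simp

lemma lin_ext_homog:
  assumes gh: "\<And>\<gamma> y. \<gamma> > 0 \<Longrightarrow> y \<in> GA \<gamma> \<Longrightarrow> g y \<in> LG \<gamma>"
    and \<gamma>: "\<gamma> > 0" and t: "t \<in> tensor_grading k L GL A GA \<gamma>"
  shows "lin_ext g t \<in> LG \<gamma>"
  using t \<gamma>
proof (induction t rule: LA.TG_induct)
  case (pure x y \<alpha> \<beta>)
  then show ?case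
    using lin_ext_pure[of x y] Lg.G_carrier[of \<alpha> x] LA.GB.G_carrier[of \<beta> y]
      ULg.G_mult[OF _ _ const_homog gh, of \<alpha> \<beta> x y] by auto
next
  case (add s t)
  then show ?case using ring_hom_add[OF lin_ext_ring_hom, of s t] LA.TG_carrier[OF \<gamma>] ULg.G_add[OF \<gamma>] by simp
qed

end

lemma U_graded_algebra: "graded_algebra k Gk (UP k) (poly_grading k Gk r)"
proof -
  interpret U: UP_cring k "UP k" by (rule UP_cringI[OF LA.R_cring]) simp
  interpret Ug: graded "UP k" "poly_grading k Gk r" by (rule gradedI[OF kg.UP_graded[OF r_pos]])
  have "c \<odot>\<^bsub>UP k\<^esub> P \<in> poly_grading k Gk r (\<alpha> * \<beta>)"
    if h: "\<alpha> > 0" "\<beta> > 0" "c \<in> Gk \<alpha>" "P \<in> poly_grading k Gk r \<beta>" for \<alpha> \<beta> c P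
    using Ug.G_mult[OF h(1,2) _ h(4), of "monom (UP k) c 0"] monom_homog[OF kg.graded r_pos h(1,3), of 0]
      kg.G_carrier[OF h(1,3)] Ug.G_carrier[OF h(2,4)] by (simp add: U.monom_mult_is_smult)
  then show ?thesis
    using UP_algebra[OF LA.R_cring] kg.graded Ug.graded by (simp add: graded_algebra_def)
qed

sublocale TU: graded_tensor k L "UP k" Gk GL "poly_grading k Gk r"
  by (rule graded_tensorI[OF L_alg U_graded_algebra])

text \<open>\<open>flat\<close> and \<open>sharp\<close> are the mutually inverse identifications of
  L tensor k[T] with L[T]. They allow forms of the line to be studied as polynomial rings over
  L.\<close>

definition "flat = lin_ext (peval k UPL X)"
definition "sharp = eval L TU.T (\<lambda>x. TU.pure x \<one>\<^bsub>UP k\<^esub>) (TU.pure \<one>\<^bsub>L\<^esub> (monom (UP k) \<one>\<^bsub>k\<^esub> 1))"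

lemma X_closed: "X \<in> carrier UPL" by simp

lemma T_closed: "monom (UP k) \<one>\<^bsub>k\<^esub> 1 \<in> carrier (UP k)"
proof -
  interpret U: UP_cring k "UP k" by (rule UP_cringI[OF LA.R_cring]) simp
  show ?thesis by simp
qed

lemmas ext_X = peval_alg_hom[OF UPL_algebra X_closed]

lemma flat_ring_hom: "flat \<in> ring_hom TU.T (UP L)"
  unfolding flat_def by (rule lin_ext_ring_hom[OF U_graded_algebra ext_X])

lemma flat_left: "x \<in> carrier L \<Longrightarrow> flat (TU.pure x \<one>\<^bsub>UP k\<^esub>) = monom (UP L) x 0"
  unfolding flat_def by (rule lin_ext_left[OF U_graded_algebra ext_X])

lemma flat_right: "P \<in> carrier (UP k) \<Longrightarrow> flat (TU.pure \<one>\<^bsub>L\<^esub> P) = peval k UPL X P"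
  unfolding flat_def by (rule lin_ext_right[OF U_graded_algebra ext_X])

lemma sharp_ring_hom: "sharp \<in> ring_hom (UP L) TU.T"
  unfolding sharp_def by (rule eval_hom[OF Lg.cring_axioms TU.T_cring TU.inl_hom]) (use T_closed in simp)

lemma sharp_const: "x \<in> carrier L \<Longrightarrow> sharp (monom (UP L) x 0) = TU.pure x \<one>\<^bsub>UP k\<^esub>"
  unfolding sharp_def by (rule eval_of_const[OF Lg.cring_axioms TU.T_cring TU.inl_hom]) (use T_closed in simp_all)

lemma sharp_X: "sharp X = TU.pure \<one>\<^bsub>L\<^esub> (monom (UP k) \<one>\<^bsub>k\<^esub> 1)"
  unfolding sharp_def by (rule eval_of_T[OF Lg.cring_axioms TU.T_cring TU.inl_hom]) (use T_closed in simp)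

lemma flat_sharp: "P \<in> carrier (UP L) \<Longrightarrow> flat (sharp P) = P"
proof -
  assume P: "P \<in> carrier (UP L)"
  have "(flat \<circ> sharp) P = id P"
    by (rule UP_hom_eqI[OF Lg.cring_axioms UL.UP_cring ring_hom_trans[OF sharp_ring_hom flat_ring_hom] id_ring_hom _ _ P])
       (use peval_T[OF UPL_algebra X_closed] T_closed in \<open>simp_all only: comp_apply sharp_const flat_left sharp_X flat_right id_apply\<close>)
  then show ?thesis by simp
qed

lemma sharp_flat: "t \<in> carrier TU.T \<Longrightarrow> sharp (flat t) = t"
proof -
  assume t: "t \<in> carrier TU.T"
  have "(sharp \<circ> flat) t = id t"
  proof (rule TU.tensor_hom_eqI[OF ring_hom_trans[OF flat_ring_hom sharp_ring_hom] id_ring_hom _ _ t])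
    show "(sharp \<circ> flat) (TU.pure x \<one>\<^bsub>UP k\<^esub>) = id (TU.pure x \<one>\<^bsub>UP k\<^esub>)" if "x \<in> carrier L" for x
      using that by (simp add: flat_left sharp_const)
    fix P assume P: "P \<in> carrier (UP k)"
    have s: "sharp \<in> alg_hom k UPL TU.TA"
    proof (rule alg_hom_unit_smult[OF UPL_algebra TU.TA_algebra])
      show "sharp \<in> ring_hom UPL TU.TA" using sharp_ring_hom by (simp add: ring_hom_def)
      fix c assume c: "c \<in> carrier k"
      have "c \<odot>\<^bsub>UPL\<^esub> \<one>\<^bsub>UPL\<^esub> = monom (UP L) (c \<odot>\<^bsub>L\<^esub> \<one>\<^bsub>L\<^esub>) 0" using c by (simp add: UPL_smult)
      moreover have "c \<odot>\<^bsub>TU.TA\<^esub> \<one>\<^bsub>TU.TA\<^esub> = TU.pure (c \<odot>\<^bsub>L\<^esub> \<one>\<^bsub>L\<^esub>) \<one>\<^bsub>UP k\<^esub>"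
        using TU.TA_smult_pure[OF c, of "\<one>\<^bsub>L\<^esub>" "\<one>\<^bsub>UP k\<^esub>"] by (simp add: TU.T_one)
      ultimately show "sharp (c \<odot>\<^bsub>UPL\<^esub> \<one>\<^bsub>UPL\<^esub>) = c \<odot>\<^bsub>TU.TA\<^esub> \<one>\<^bsub>TU.TA\<^esub>" using c by (simp add: sharp_const)
    qed
    have "(sharp \<circ> peval k UPL X) P = TU.pure \<one>\<^bsub>L\<^esub> P"
      by (rule UP_alg_hom_eqI[OF TU.TA_algebra alg_hom_comp[OF ext_X s] TU.inr_alg_hom _ P])
         (simp only: comp_apply peval_T[OF UPL_algebra X_closed] sharp_X)
    then show "(sharp \<circ> flat) (TU.pure \<one>\<^bsub>L\<^esub> P) = id (TU.pure \<one>\<^bsub>L\<^esub> P)" using P by (simp add: flat_right)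
  qed
  then show ?thesis by simp
qed

lemma flat_homog: "\<gamma> > 0 \<Longrightarrow> t \<in> TU.TG \<gamma> \<Longrightarrow> flat t \<in> LG \<gamma>"
  unfolding flat_def
proof (rule lin_ext_homog[OF U_graded_algebra ext_X])
  show "peval k UPL X P \<in> LG \<delta>" if "\<delta> > 0" "P \<in> poly_grading k Gk r \<delta>" for \<delta> P
    by (rule eval_homog[OF kg.graded UPL_pregraded algebra_unit_hom[OF UPL_algebra] UPL_scalar r_pos X_homog that])
qed

lemma sharp_homog: "\<gamma> > 0 \<Longrightarrow> P \<in> LG \<gamma> \<Longrightarrow> sharp P \<in> TU.TG \<gamma>"
  unfolding sharp_def
proof (rule eval_homog[OF Lg.graded TU.TG_pregraded TU.TG_one TU.inl_hom _ r_pos])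
  show "TU.pure x \<one>\<^bsub>UP k\<^esub> \<in> TU.TG \<delta>" if "\<delta> > 0" "x \<in> GL \<delta>" for \<delta> x
    by (rule TU.pure_homog[of \<delta> 1]) (use that TU.GB.one_homog in simp_all)
  have "monom (UP k) \<one>\<^bsub>k\<^esub> 1 \<in> poly_grading k Gk r r"
    using monom_homog[OF kg.graded r_pos _ kg.one_homog, of 1] by simp
  then show "TU.pure \<one>\<^bsub>L\<^esub> (monom (UP k) \<one>\<^bsub>k\<^esub> 1) \<in> TU.TG r"
    by (intro TU.pure_homog[of 1 r]) (simp_all add: r_pos Lg.one_homog)
qed

end

text \<open>The degree prescribed for \<open>b j\<close> is the one that makes the p-polynomial with
  coefficients \<open>b\<close> homogeneous of degree \<open>s\<close> when its variable has degree
  \<open>r\<close>.\<close>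

locale root_curve = root_form k Gk L GL p n r
  for k :: "('k, 'm) ring_scheme" and Gk and L :: "('k, 'l) module" and GL p n r +
  fixes s :: real and a b and m :: nat
  assumes s_pos: "s > 0" and a: "\<And>j. j \<le> m \<Longrightarrow> a j \<in> carrier k"
    and b: "\<And>j. j \<le> m \<Longrightarrow> b j \<in> GL (s / r ^ (p ^ j))" and b0: "b 0 \<noteq> \<zero>\<^bsub>L\<^esub>"
    and ab: "\<And>j. j \<le> m \<Longrightarrow> b j [^]\<^bsub>L\<^esub> q = a j \<odot>\<^bsub>L\<^esub> \<one>\<^bsub>L\<^esub>"
begin

abbreviation "f \<equiv> ppoly k p a m"
abbreviation "g \<equiv> ppoly L p b m"

lemma b_carrier: "j \<le> m \<Longrightarrow> b j \<in> carrier L"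
  using Lg.G_carrier[OF _ b] s_pos r_pos by simp

lemma p2: "p \<ge> 2" using p by (rule prime_ge_2_nat)

lemma L_unit_inj: "inj_on (\<lambda>c. c \<odot>\<^bsub>L\<^esub> \<one>\<^bsub>L\<^esub>) (carrier k)"
  by (rule graded_field_unit_inj[OF kF L_alg LD.one_not_zero])

lemma L_scalar_homog: "\<gamma> > 0 \<Longrightarrow> c \<in> Gk \<gamma> \<Longrightarrow> c \<odot>\<^bsub>L\<^esub> \<one>\<^bsub>L\<^esub> \<in> GL \<gamma>"
proof -
  assume c: "\<gamma> > 0" "c \<in> Gk \<gamma>"
  have "c \<odot>\<^bsub>L\<^esub> \<one>\<^bsub>L\<^esub> \<in> GL (\<gamma> * 1)"
    using L_alg c Lg.one_homog by (auto simp: graded_algebra_def simp del: mult_1_right)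
  then show ?thesis by simp
qed

text \<open>The map from k to L is injective and hence reflects degrees; the degree of
  \<open>a j\<close> can thus be read off from \<open>b j ^ q\<close>.\<close>

lemma a_homog: "j \<le> m \<Longrightarrow> a j \<in> Gk (s ^ q / (r ^ q) ^ (p ^ j))"
proof -
  assume j: "j \<le> m"
  have d: "s / r ^ (p ^ j) > 0" using s_pos r_pos by simp
  have "a j \<in> Gk ((s / r ^ (p ^ j)) ^ q)"
    by (rule graded_inj_reflects[OF kg.graded Lg.graded a[OF j] algebra_unit_hom[OF L_algebra] L_unit_inj])
       (use L_scalar_homog d Lg.G_pow[OF d b[OF j], of q] ab[OF j] in auto)
  then show ?thesis by (simp add: power_divide mult.commute flip: power_mult)
qed

lemma f_closed: "f \<in> carrier (UP k)" by (rule ppoly_closed[OF LA.R_cring a])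
lemma g_closed: "g \<in> carrier (UP L)" by (rule ppoly_closed[OF Lg.cring_axioms b_carrier])

lemma f_homog: "f \<in> poly_grading k Gk (r ^ q) (s ^ q)"
proof -
  have "coeff (UP k) f i \<in> Gk (s ^ q / (r ^ q) ^ i)" for i
  proof (cases "i \<in> (\<lambda>j. p ^ j) ` {..m}")
    case True
    then show ?thesis using coeff_ppoly(1)[OF LA.R_cring a p2] a_homog by auto
  next
    case False
    then show ?thesis using coeff_ppoly(2)[OF LA.R_cring a p2 False] s_pos r_pos by simp
  qed
  then show ?thesis using f_closed by (simp add: poly_grading_def)
qed

lemma g_homog: "g \<in> LG s"
proof -
  have "coeff (UP L) g i \<in> GL (s / r ^ i)" for i
  proof (cases "i \<in> (\<lambda>j. p ^ j) ` {..m}")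
    case True
    then show ?thesis using coeff_ppoly(1)[OF Lg.cring_axioms b_carrier p2] b by auto
  next
    case False
    then show ?thesis using coeff_ppoly(2)[OF Lg.cring_axioms b_carrier p2 False] s_pos r_pos by simp
  qed
  then show ?thesis using g_closed by (simp add: poly_grading_def)
qed

sublocale hc: hopf_curve k Gk p n f "r ^ q" s a m
  using LA.R_cring f_closed kg.graded r_pos s_pos f_homog p char a
  by unfold_locales auto

abbreviation "Xq \<equiv> X [^]\<^bsub>UP L\<^esub> q"

lemma Xq_closed: "Xq \<in> carrier UPL" by simp

lemma monom_b: "g = (\<Oplus>\<^bsub>UP L\<^esub>j\<in>{..m}. monom (UP L) (b j) 0 \<otimes>\<^bsub>UP L\<^esub> X [^]\<^bsub>UP L\<^esub> (p ^ j))"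
  unfolding ppoly_def
proof (rule UL.P.finsum_cong')
  fix j assume "j \<in> {..m}"
  then show "monom (UP L) (b j) (p ^ j) = monom (UP L) (b j) 0 \<otimes>\<^bsub>UP L\<^esub> X [^]\<^bsub>UP L\<^esub> (p ^ j)"
    using b_carrier[of j] by (simp add: UL.monom_pow del: UL.monom_mult flip: UL.monom_mult)
qed (use b_carrier in auto)

lemma g_pow: "g [^]\<^bsub>UP L\<^esub> q = peval k UPL Xq f"
proof -
  have "g [^]\<^bsub>UP L\<^esub> q = (\<Oplus>\<^bsub>UP L\<^esub>j\<in>{..m}. monom (UP L) (b j) (p ^ j) [^]\<^bsub>UP L\<^esub> q)"
    unfolding ppoly_def by (rule UL.P.frobenius_power_sum[OF p UL_char]) (use b_carrier in auto)
  also have "\<dots> = (\<Oplus>\<^bsub>UP L\<^esub>j\<in>{..m}. a j \<odot>\<^bsub>UPL\<^esub> Xq [^]\<^bsub>UPL\<^esub> (p ^ j))"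
  proof (rule UL.P.finsum_cong')
    fix j assume "j \<in> {..m}"
    then have j: "j \<le> m" by simp
    have "a j \<odot>\<^bsub>UPL\<^esub> Xq [^]\<^bsub>UPL\<^esub> (p ^ j) = monom (UP L) (a j \<odot>\<^bsub>L\<^esub> \<one>\<^bsub>L\<^esub>) 0 \<otimes>\<^bsub>UP L\<^esub> monom (UP L) \<one>\<^bsub>L\<^esub> (q * p ^ j)"
      by (simp add: UPL_smult UL.monom_pow)
    also have "\<dots> = monom (UP L) (b j) (p ^ j) [^]\<^bsub>UP L\<^esub> q"
      using a[OF j] b_carrier[OF j] ab[OF j]
      by (simp add: UL.monom_pow mult.commute del: UL.monom_mult flip: UL.monom_mult)
    finally show "monom (UP L) (b j) (p ^ j) [^]\<^bsub>UP L\<^esub> q = a j \<odot>\<^bsub>UPL\<^esub> Xq [^]\<^bsub>UPL\<^esub> (p ^ j)" by simp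
  qed (use a in \<open>auto simp: UPL_smult\<close>)
  also have "\<dots> = peval k UPL Xq f"
    using peval_ppoly[OF UPL_algebra a Xq_closed] by (simp add: finsum_transfer[of UPL "UP L"])
  finally show ?thesis .
qed

definition "\<kappa> = hc.curve_lift UPL Xq g"

lemma kappa_eqn: "g [^]\<^bsub>UPL\<^esub> q = peval k UPL Xq f" using g_pow by simp

lemma g_closed': "g \<in> carrier UPL" using g_closed by simp

lemma kappa_alg_hom: "\<kappa> \<in> alg_hom k hc.H UPL"
  unfolding \<kappa>_def hc.alg_hom_H by (rule hc.curve_lift_alg_hom[OF UPL_algebra Xq_closed g_closed' kappa_eqn])

lemma kappa_T: "\<kappa> hc.T1 = Xq" "\<kappa> hc.T2 = g"
  unfolding \<kappa>_def by (rule hc.curve_lift_T[OF UPL_algebra Xq_closed g_closed' kappa_eqn])+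

lemma kappa_homog: "\<gamma> > 0 \<Longrightarrow> y \<in> hc.CG \<gamma> \<Longrightarrow> \<kappa> y \<in> LG \<gamma>"
  unfolding \<kappa>_def
  by (rule hc.curve_lift_homog[OF UPL_algebra kappa_eqn UPL_pregraded UPL_scalar ULg.G_pow[OF r_pos X_homog] g_homog])

sublocale TH: graded_tensor k L hc.H Gk GL hc.CG
  by (rule graded_tensorI[OF L_alg hc.H_graded_algebra])

definition "\<chi> = lin_ext \<kappa>"

lemmas chi_ring_hom = lin_ext_ring_hom[OF hc.H_graded_algebra kappa_alg_hom, folded \<chi>_def]
lemmas chi_left = lin_ext_left[OF hc.H_graded_algebra kappa_alg_hom, folded \<chi>_def]
lemmas chi_right = lin_ext_right[OF hc.H_graded_algebra kappa_alg_hom, folded \<chi>_def]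
lemmas chi_homog = lin_ext_homog[OF hc.H_graded_algebra kappa_alg_hom kappa_homog, folded \<chi>_def]

lemma TH_char: "[p] \<cdot>\<^bsub>TH.T\<^esub> \<one>\<^bsub>TH.T\<^esub> = \<zero>\<^bsub>TH.T\<^esub>"
  by (rule char_transfer_hom[OF Lg.cring_axioms TH.T_cring TH.inl_hom L_char])

text \<open>Moving \<open>a j\<close> across the tensor sign turns it into \<open>b j ^ q\<close>.
  The curve equation then has the shape required by \<open>frobenius_root\<close>, with the inverse
  of \<open>b 0\<close> available in L.\<close>

lemma TH_root:
  "\<exists>u\<in>carrier TH.T. u [^]\<^bsub>TH.T\<^esub> q = TH.pure \<one>\<^bsub>L\<^esub> hc.T1 \<and>
     TH.pure \<one>\<^bsub>L\<^esub> hc.T2 = (\<Oplus>\<^bsub>TH.T\<^esub>j\<in>{..m}. TH.pure (b j) \<one>\<^bsub>hc.H\<^esub> \<otimes>\<^bsub>TH.T\<^esub> u [^]\<^bsub>TH.T\<^esub> (p ^ j))"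
proof -
  interpret l: ring_hom_cring L TH.T "\<lambda>x. TH.pure x \<one>\<^bsub>hc.H\<^esub>"
    by (rule UnivPoly.ring_hom_cringI[OF Lg.cring_axioms TH.T_cring TH.inl_hom])
  interpret r: ring_hom_cring hc.H TH.T "\<lambda>y. TH.pure \<one>\<^bsub>L\<^esub> y"
    by (rule UnivPoly.ring_hom_cringI[OF algebra.M_cring[OF hc.H_algebra] TH.T_cring TH.inr_hom])
  have "b 0 \<in> Units L" using LF b[of 0] b0 divide_pos_pos[OF s_pos r_pos] by (simp add: graded_field_def)
  then have inv: "inv\<^bsub>L\<^esub> b 0 \<in> carrier L" "inv\<^bsub>L\<^esub> b 0 \<otimes>\<^bsub>L\<^esub> b 0 = \<one>\<^bsub>L\<^esub>" by simp_all
  note Tc = hc.T_closed_H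
  have pw: "hc.T1 [^]\<^bsub>hc.H\<^esub> i \<in> carrier hc.H" for i :: nat
    by (rule monoid.nat_pow_closed[OF ring.is_monoid[OF cring.axioms(1)[OF algebra.M_cring[OF hc.H_algebra]]] Tc(1)])
  show ?thesis
  proof (rule TH.T.frobenius_root[OF p TH_char])
    show "TH.pure (b j) \<one>\<^bsub>hc.H\<^esub> \<in> carrier TH.T" if "j \<le> m" for j
      by (rule l.hom_closed[OF b_carrier[OF that]])
    show "TH.pure (inv\<^bsub>L\<^esub> b 0) \<one>\<^bsub>hc.H\<^esub> \<in> carrier TH.T" by (rule l.hom_closed[OF inv(1)])
    show "TH.pure (inv\<^bsub>L\<^esub> b 0) \<one>\<^bsub>hc.H\<^esub> \<otimes>\<^bsub>TH.T\<^esub> TH.pure (b 0) \<one>\<^bsub>hc.H\<^esub> = \<one>\<^bsub>TH.T\<^esub>"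
      using l.hom_mult[OF inv(1) b_carrier[of 0]] inv(2) l.hom_one by simp
    show "TH.pure \<one>\<^bsub>L\<^esub> hc.T1 \<in> carrier TH.T" "TH.pure \<one>\<^bsub>L\<^esub> hc.T2 \<in> carrier TH.T"
      by (rule r.hom_closed[OF Tc(1)], rule r.hom_closed[OF Tc(2)])
    have "TH.pure \<one>\<^bsub>L\<^esub> hc.T2 [^]\<^bsub>TH.T\<^esub> q = TH.pure \<one>\<^bsub>L\<^esub> (hc.T2 [^]\<^bsub>hc.H\<^esub> q)"
      by (rule r.hom_pow[OF Tc(2), symmetric])
    also have "hc.T2 [^]\<^bsub>hc.H\<^esub> q = (\<Oplus>\<^bsub>hc.H\<^esub>j\<in>{..m}. a j \<odot>\<^bsub>hc.H\<^esub> hc.T1 [^]\<^bsub>hc.H\<^esub> (p ^ j))"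
      unfolding hc.curve_equation_H by (rule peval_ppoly[OF hc.H_algebra a Tc(1)])
    also have "TH.pure \<one>\<^bsub>L\<^esub> \<dots> = (\<Oplus>\<^bsub>TH.T\<^esub>j\<in>{..m}. TH.pure \<one>\<^bsub>L\<^esub> (a j \<odot>\<^bsub>hc.H\<^esub> hc.T1 [^]\<^bsub>hc.H\<^esub> (p ^ j)))"
      using r.hom_finsum[of "\<lambda>j. a j \<odot>\<^bsub>hc.H\<^esub> hc.T1 [^]\<^bsub>hc.H\<^esub> (p ^ j)" "{..m}"] module.smult_closed[OF algebra.axioms(1)[OF hc.H_algebra] a pw]
      by (simp add: Pi_def comp_def del: hc.H_fields)
    also have "\<dots> = (\<Oplus>\<^bsub>TH.T\<^esub>j\<in>{..m}. TH.pure (b j) \<one>\<^bsub>hc.H\<^esub> [^]\<^bsub>TH.T\<^esub> q \<otimes>\<^bsub>TH.T\<^esub> TH.pure \<one>\<^bsub>L\<^esub> hc.T1 [^]\<^bsub>TH.T\<^esub> (p ^ j))"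
    proof (rule TH.T.finsum_cong')
      fix j assume "j \<in> {..m}"
      then have j: "j \<le> m" by simp
      have "TH.pure \<one>\<^bsub>L\<^esub> (a j \<odot>\<^bsub>hc.H\<^esub> hc.T1 [^]\<^bsub>hc.H\<^esub> (p ^ j)) = TH.pure (a j \<odot>\<^bsub>L\<^esub> \<one>\<^bsub>L\<^esub>) (hc.T1 [^]\<^bsub>hc.H\<^esub> (p ^ j))"
        by (rule TH.pure_smult[OF a[OF j] Lg.one_closed pw, symmetric])
      also have "\<dots> = TH.pure (b j [^]\<^bsub>L\<^esub> q) \<one>\<^bsub>hc.H\<^esub> \<otimes>\<^bsub>TH.T\<^esub> TH.pure \<one>\<^bsub>L\<^esub> (hc.T1 [^]\<^bsub>hc.H\<^esub> (p ^ j))"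
        unfolding ab[OF j] by (rule TH.pure_split[OF LA.smult_closed[OF a[OF j] Lg.one_closed] pw])
      finally show "TH.pure \<one>\<^bsub>L\<^esub> (a j \<odot>\<^bsub>hc.H\<^esub> hc.T1 [^]\<^bsub>hc.H\<^esub> (p ^ j)) =
          TH.pure (b j) \<one>\<^bsub>hc.H\<^esub> [^]\<^bsub>TH.T\<^esub> q \<otimes>\<^bsub>TH.T\<^esub> TH.pure \<one>\<^bsub>L\<^esub> hc.T1 [^]\<^bsub>TH.T\<^esub> (p ^ j)"
        using l.hom_pow[OF b_carrier[OF j], of q] r.hom_pow[OF Tc(1), of "p ^ j"] by simp
    next
      show "(\<lambda>j. TH.pure (b j) \<one>\<^bsub>hc.H\<^esub> [^]\<^bsub>TH.T\<^esub> q \<otimes>\<^bsub>TH.T\<^esub> TH.pure \<one>\<^bsub>L\<^esub> hc.T1 [^]\<^bsub>TH.T\<^esub> (p ^ j)) \<in> {..m} \<rightarrow> carrier TH.T"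
        using l.hom_closed[OF b_carrier] r.hom_closed[OF Tc(1)] by auto
    qed simp
    finally show "TH.pure \<one>\<^bsub>L\<^esub> hc.T2 [^]\<^bsub>TH.T\<^esub> q =
      (\<Oplus>\<^bsub>TH.T\<^esub>j\<in>{..m}. TH.pure (b j) \<one>\<^bsub>hc.H\<^esub> [^]\<^bsub>TH.T\<^esub> q \<otimes>\<^bsub>TH.T\<^esub> TH.pure \<one>\<^bsub>L\<^esub> hc.T1 [^]\<^bsub>TH.T\<^esub> (p ^ j))" .
  qed
qed

text \<open>The inverse sends the coordinate of L[T] to the root \<open>u\<close> of
  \<open>T1\<close> found in L tensor A. Both composites are compared with the identity on
  generators.\<close>

lemma chi_bij: "bij_betw \<chi> (carrier TH.T) (carrier (UP L))"
proof -
  obtain u where u: "u \<in> carrier TH.T" "u [^]\<^bsub>TH.T\<^esub> q = TH.pure \<one>\<^bsub>L\<^esub> hc.T1"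
    "TH.pure \<one>\<^bsub>L\<^esub> hc.T2 = (\<Oplus>\<^bsub>TH.T\<^esub>j\<in>{..m}. TH.pure (b j) \<one>\<^bsub>hc.H\<^esub> \<otimes>\<^bsub>TH.T\<^esub> u [^]\<^bsub>TH.T\<^esub> (p ^ j))"
    using TH_root by blast
  define \<beta> where "\<beta> = eval L TH.T (\<lambda>x. TH.pure x \<one>\<^bsub>hc.H\<^esub>) u"
  have \<beta>h: "\<beta> \<in> ring_hom (UP L) TH.T"
    unfolding \<beta>_def by (rule eval_hom[OF Lg.cring_axioms TH.T_cring TH.inl_hom u(1)])
  have \<beta>c: "\<beta> (monom (UP L) x 0) = TH.pure x \<one>\<^bsub>hc.H\<^esub>" if "x \<in> carrier L" for x
    unfolding \<beta>_def by (rule eval_of_const[OF Lg.cring_axioms TH.T_cring TH.inl_hom u(1) that])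
  have \<beta>X: "\<beta> X = u"
    unfolding \<beta>_def by (rule eval_of_T[OF Lg.cring_axioms TH.T_cring TH.inl_hom u(1)])
  interpret c: ring_hom_cring TH.T "UP L" \<chi>
    by (rule UnivPoly.ring_hom_cringI[OF TH.T_cring UL.UP_cring chi_ring_hom])
  interpret B: ring_hom_cring "UP L" TH.T \<beta>
    by (rule UnivPoly.ring_hom_cringI[OF UL.UP_cring TH.T_cring \<beta>h])
  have Xc: "X \<in> carrier (UP L)" by simp
  \<comment> \<open>The image of \<open>u\<close> and the coordinate have the same q-th power, and
    Frobenius is injective on the domain L[T].\<close>
  have "\<chi> u [^]\<^bsub>UP L\<^esub> q = Xq"
    using c.hom_pow[OF u(1), of q] u(2) chi_right[OF hc.T_closed_H(1)] kappa_T(1) by simp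
  then have \<chi>u: "\<chi> u = X"
    by (rule ULD.frobenius_power_inj[OF p UL_char c.hom_closed[OF u(1)] Xc])
  show ?thesis
  proof (rule bij_betw_of_inverses[where g = \<beta>])
    fix P assume P: "P \<in> carrier (UP L)"
    have "(\<chi> \<circ> \<beta>) P = id P"
      by (rule UP_hom_eqI[OF Lg.cring_axioms UL.UP_cring ring_hom_trans[OF \<beta>h chi_ring_hom] id_ring_hom _ _ P])
         (simp_all only: comp_apply \<beta>c chi_left \<beta>X \<chi>u id_apply)
    then show "\<chi> (\<beta> P) = P" by simp
  next
    fix t assume t: "t \<in> carrier TH.T"
    have \<beta>a: "\<beta> \<in> alg_hom k UPL TH.TA"
    proof (rule alg_hom_unit_smult[OF UPL_algebra TH.TA_algebra])
      show "\<beta> \<in> ring_hom UPL TH.TA" using \<beta>h by (simp add: ring_hom_def)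
      fix c assume c: "c \<in> carrier k"
      have "c \<odot>\<^bsub>UPL\<^esub> \<one>\<^bsub>UPL\<^esub> = monom (UP L) (c \<odot>\<^bsub>L\<^esub> \<one>\<^bsub>L\<^esub>) 0" using c by (simp add: UPL_smult)
      moreover have "c \<odot>\<^bsub>TH.TA\<^esub> \<one>\<^bsub>TH.TA\<^esub> = TH.pure (c \<odot>\<^bsub>L\<^esub> \<one>\<^bsub>L\<^esub>) \<one>\<^bsub>hc.H\<^esub>"
        using TH.TA_smult_pure[OF c Lg.one_closed, of "\<one>\<^bsub>hc.H\<^esub>"] hc.H.one_closed by (simp add: TH.T_one del: hc.H_fields)
      ultimately show "\<beta> (c \<odot>\<^bsub>UPL\<^esub> \<one>\<^bsub>UPL\<^esub>) = c \<odot>\<^bsub>TH.TA\<^esub> \<one>\<^bsub>TH.TA\<^esub>" using c \<beta>c[of "c \<odot>\<^bsub>L\<^esub> \<one>\<^bsub>L\<^esub>"] by simp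
    qed
    have \<beta>g: "\<beta> g = TH.pure \<one>\<^bsub>L\<^esub> hc.T2"
    proof -
      have "\<beta> g = (\<Oplus>\<^bsub>TH.T\<^esub>j\<in>{..m}. \<beta> (monom (UP L) (b j) 0 \<otimes>\<^bsub>UP L\<^esub> X [^]\<^bsub>UP L\<^esub> (p ^ j)))"
        unfolding monom_b using b_carrier by (subst B.hom_finsum) (auto simp: comp_def)
      also have "\<dots> = (\<Oplus>\<^bsub>TH.T\<^esub>j\<in>{..m}. TH.pure (b j) \<one>\<^bsub>hc.H\<^esub> \<otimes>\<^bsub>TH.T\<^esub> u [^]\<^bsub>TH.T\<^esub> (p ^ j))"
      proof (rule TH.T.finsum_cong')
        fix j assume "j \<in> {..m}"
        then have "b j \<in> carrier L" using b_carrier by simp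
        then show "\<beta> (monom (UP L) (b j) 0 \<otimes>\<^bsub>UP L\<^esub> X [^]\<^bsub>UP L\<^esub> (p ^ j)) = TH.pure (b j) \<one>\<^bsub>hc.H\<^esub> \<otimes>\<^bsub>TH.T\<^esub> u [^]\<^bsub>TH.T\<^esub> (p ^ j)"
          using B.hom_mult[OF UL.monom_closed UL.P.nat_pow_closed[OF Xc], of "b j" 0 "p ^ j"] B.hom_pow[OF Xc, of "p ^ j"]
          by (simp only: \<beta>c \<beta>X)
      next
        show "(\<lambda>j. TH.pure (b j) \<one>\<^bsub>hc.H\<^esub> \<otimes>\<^bsub>TH.T\<^esub> u [^]\<^bsub>TH.T\<^esub> (p ^ j)) \<in> {..m} \<rightarrow> carrier TH.T"
          using TH.pure_closed[OF b_carrier hc.H.one_closed] u(1) by auto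
      qed simp
      finally show ?thesis using u(3) by simp
    qed
    have "(\<beta> \<circ> \<chi>) t = id t"
    proof (rule TH.tensor_hom_eqI[OF ring_hom_trans[OF chi_ring_hom \<beta>h] id_ring_hom _ _ t])
      show "(\<beta> \<circ> \<chi>) (TH.pure x \<one>\<^bsub>hc.H\<^esub>) = id (TH.pure x \<one>\<^bsub>hc.H\<^esub>)" if "x \<in> carrier L" for x
        using chi_left[OF that] \<beta>c[OF that] by simp
      fix y assume y: "y \<in> carrier hc.H"
      have "(\<beta> \<circ> \<kappa>) y = TH.pure \<one>\<^bsub>L\<^esub> y"
        by (rule hc.H_alg_hom_eqI[OF TH.TA_algebra alg_hom_comp[OF kappa_alg_hom \<beta>a] TH.inr_alg_hom _ _ y])
           (use B.hom_pow[OF Xc, of q] \<beta>X u(2) in \<open>simp_all only: comp_apply kappa_T \<beta>g\<close>)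
      then show "(\<beta> \<circ> \<chi>) (TH.pure \<one>\<^bsub>L\<^esub> y) = id (TH.pure \<one>\<^bsub>L\<^esub> y)" using chi_right[OF y] by simp
    qed
    then show "\<beta> (\<chi> t) = t" by simp
  qed (use c.hom_closed B.hom_closed in auto)
qed

lemma curve_graded_form: "graded_form k Gk L GL (UP k) (poly_grading k Gk r) hc.H hc.CG"
proof -
  let ?h = "sharp \<circ> \<chi>"
  have h: "?h \<in> ring_hom TH.T TU.T" by (rule ring_hom_trans[OF chi_ring_hom sharp_ring_hom])
  have "?h \<in> graded_algebra_hom L (base_change k L hc.H) TH.TG (base_change k L (UP k)) TU.TG"
    unfolding graded_algebra_hom_def
  proof (intro CollectI conjI allI impI ballI)
    show "?h \<in> ring_hom (base_change k L hc.H) (base_change k L (UP k))" using h by (simp add: ring_hom_def)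
    fix x t assume x: "x \<in> carrier L" and t: "t \<in> carrier (base_change k L hc.H)"
    have "?h (TH.pure x \<one>\<^bsub>hc.H\<^esub> \<otimes>\<^bsub>TH.T\<^esub> t) = ?h (TH.pure x \<one>\<^bsub>hc.H\<^esub>) \<otimes>\<^bsub>TU.T\<^esub> ?h t"
      by (rule ring_hom_mult[OF h TH.pure_closed[OF x hc.H.one_closed]]) (use t in simp)
    also have "?h (TH.pure x \<one>\<^bsub>hc.H\<^esub>) = TU.pure x \<one>\<^bsub>UP k\<^esub>" using chi_left[OF x] sharp_const[OF x] by simp
    finally show "?h (x \<odot>\<^bsub>base_change k L hc.H\<^esub> t) = x \<odot>\<^bsub>base_change k L (UP k)\<^esub> ?h t"
      by (simp add: base_change_def del: hc.H_fields)
  next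
    fix \<gamma> :: real assume "\<gamma> > 0"
    then show "?h ` TH.TG \<gamma> \<subseteq> TU.TG \<gamma>" using chi_homog sharp_homog by auto
  qed
  moreover have "bij_betw sharp (carrier (UP L)) (carrier TU.T)"
    by (rule bij_betw_of_inverses[where g = flat])
       (use flat_sharp sharp_flat ring_hom_closed[OF flat_ring_hom] ring_hom_closed[OF sharp_ring_hom] in auto)
  then have "bij_betw ?h (carrier TH.T) (carrier TU.T)" by (rule bij_betw_trans[OF chi_bij])
  ultimately have "?h \<in> graded_algebra_iso L (base_change k L hc.H) TH.TG (base_change k L (UP k)) TU.TG"
    by (simp add: graded_algebra_iso_def)
  then show ?thesis using hc.H_graded_algebra by (auto simp: graded_form_def)
qed

end

section \<open>Linear functionals\<close>

context root_ext
begin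

definition linear_form where
  "linear_form \<omega> \<longleftrightarrow> (\<forall>x\<in>carrier L. \<omega> x \<in> carrier k) \<and>
     (\<forall>x\<in>carrier L. \<forall>y\<in>carrier L. \<omega> (x \<oplus>\<^bsub>L\<^esub> y) = \<omega> x \<oplus>\<^bsub>k\<^esub> \<omega> y) \<and>
     (\<forall>c\<in>carrier k. \<forall>x\<in>carrier L. \<omega> (c \<odot>\<^bsub>L\<^esub> x) = c \<otimes>\<^bsub>k\<^esub> \<omega> x)"

text \<open>A submodule over k need not have a complement when k is not a field. Stability under
  homogeneous parts allows scalars to be replaced by their parts, and nonzero ones among these are
  invertible.\<close>

definition graded_subspace where
  "graded_subspace W \<longleftrightarrow> W \<subseteq> carrier L \<and> \<zero>\<^bsub>L\<^esub> \<in> W \<and> (\<forall>x\<in>W. \<forall>y\<in>W. x \<oplus>\<^bsub>L\<^esub> y \<in> W) \<and>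
     (\<forall>c\<in>carrier k. \<forall>x\<in>W. c \<odot>\<^bsub>L\<^esub> x \<in> W) \<and> (\<forall>x\<in>W. \<forall>\<gamma>. hcomp L GL \<gamma> x \<in> W)"

lemma hcomp_smult:
  assumes x: "x \<in> GL \<delta>" "\<delta> > 0" and c: "c \<in> carrier k"
  shows "hcomp L GL \<gamma> (c \<odot>\<^bsub>L\<^esub> x) = hcomp k Gk (\<gamma> / \<delta>) c \<odot>\<^bsub>L\<^esub> x"
proof -
  have xL: "x \<in> carrier L" by (rule Lg.G_carrier[OF x(2,1)])
  have "hcomp L GL (\<gamma> / \<delta> * \<delta>) (c \<odot>\<^bsub>L\<^esub> x) = hcomp k Gk (\<gamma> / \<delta>) c \<odot>\<^bsub>L\<^esub> x"
    by (rule graded_map_hcomp[OF kg.graded Lg.graded c])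
       (use x xL L_alg in \<open>auto simp: LA.smult_l_distr graded_algebra_def\<close>)
  then show ?thesis using x by simp
qed

text \<open>The scalar \<open>c\<close> need not be a unit, but it has a nonzero homogeneous part,
  and the corresponding part of the product lies in \<open>W\<close> as well.\<close>

lemma smult_cancel:
  assumes W: "graded_subspace W" and x: "x \<in> GL \<delta>" "\<delta> > 0" and c: "c \<in> carrier k" "c \<odot>\<^bsub>L\<^esub> x \<in> W" "c \<noteq> \<zero>\<^bsub>k\<^esub>"
  shows "x \<in> W"
proof -
  have xL: "x \<in> carrier L" by (rule Lg.G_carrier[OF x(2,1)])
  obtain \<gamma> where \<gamma>: "hcomp k Gk \<gamma> c \<noteq> \<zero>\<^bsub>k\<^esub>"
    using kg.eq_hcompI[OF c(1) kg.zero_closed] c(3) by (metis kg.hcomp_zero)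
  then have pos: "\<gamma> > 0" using kg.hcomp_props(2)[OF c(1), of \<gamma>] by force
  then have "hcomp k Gk \<gamma> c \<in> Units k"
    using kF kg.hcomp_props(1)[OF c(1) pos] \<gamma> by (auto simp: graded_field_def)
  then obtain d where d: "d \<in> carrier k" "d \<otimes>\<^bsub>k\<^esub> hcomp k Gk \<gamma> c = \<one>\<^bsub>k\<^esub>" by (auto simp: Units_def)
  have "hcomp L GL (\<gamma> * \<delta>) (c \<odot>\<^bsub>L\<^esub> x) \<in> W" using W c(2) by (simp add: graded_subspace_def)
  then have "hcomp k Gk \<gamma> c \<odot>\<^bsub>L\<^esub> x \<in> W" using hcomp_smult[OF x c(1), of "\<gamma> * \<delta>"] x(2) by simp
  then have "d \<odot>\<^bsub>L\<^esub> (hcomp k Gk \<gamma> c \<odot>\<^bsub>L\<^esub> x) \<in> W" using W d(1) by (simp add: graded_subspace_def)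
  then show ?thesis using d c(1) xL by (simp flip: LA.smult_assoc1)
qed

text \<open>Among the graded subspaces that contain \<open>V\<close> but not \<open>e\<close> a
  maximal one, \<open>W\<close>, is a complement of the line spanned by \<open>e\<close>. The form
  is the coordinate along \<open>e\<close> with kernel \<open>W\<close>.\<close>

lemma linear_form_exists:
  assumes V: "graded_subspace V" and e: "e \<in> GL \<epsilon>" "\<epsilon> > 0" "e \<notin> V"
  shows "\<exists>\<omega>. linear_form \<omega> \<and> (\<forall>v\<in>V. \<omega> v = \<zero>\<^bsub>k\<^esub>) \<and> \<omega> e = \<one>\<^bsub>k\<^esub>"
proof -
  have eL: "e \<in> carrier L" by (rule Lg.G_carrier[OF e(2,1)])
  define \<W> where "\<W> = {W. graded_subspace W \<and> V \<subseteq> W \<and> e \<notin> W}"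
  have "\<exists>W\<in>\<W>. \<forall>U\<in>\<W>. W \<subseteq> U \<longrightarrow> U = W"
  proof (rule subset_Zorn_nonempty)
    show "\<W> \<noteq> {}" using V e by (auto simp: \<W>_def)
    fix \<C> assume ne: "\<C> \<noteq> {}" and chain: "subset.chain \<W> \<C>"
    then have sub: "\<And>W. W \<in> \<C> \<Longrightarrow> graded_subspace W \<and> V \<subseteq> W \<and> e \<notin> W"
      by (auto simp: subset.chain_def \<W>_def)
    have "x \<oplus>\<^bsub>L\<^esub> y \<in> \<Union>\<C>" if "x \<in> \<Union>\<C>" "y \<in> \<Union>\<C>" for x y
    proof -
      from that obtain A B where "A \<in> \<C>" "x \<in> A" "B \<in> \<C>" "y \<in> B" by blast
      moreover then have "A \<subseteq> B \<or> B \<subseteq> A" using chain by (auto simp: subset.chain_def)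
      ultimately obtain C where C: "C \<in> \<C>" "x \<in> C" "y \<in> C" by blast
      then have "x \<oplus>\<^bsub>L\<^esub> y \<in> C" using sub[OF C(1)] by (simp add: graded_subspace_def)
      then show ?thesis using C(1) by blast
    qed
    moreover obtain W where "W \<in> \<C>" using ne by blast
    then have "\<zero>\<^bsub>L\<^esub> \<in> \<Union>\<C>" using sub by (auto simp: graded_subspace_def)
    moreover have "\<Union>\<C> \<subseteq> carrier L" using sub unfolding graded_subspace_def by blast
    moreover have "c \<odot>\<^bsub>L\<^esub> x \<in> \<Union>\<C>" if "c \<in> carrier k" "x \<in> \<Union>\<C>" for c x
      using that sub unfolding graded_subspace_def by blast
    moreover have "hcomp L GL \<gamma> x \<in> \<Union>\<C>" if "x \<in> \<Union>\<C>" for \<gamma> x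
      using that sub unfolding graded_subspace_def by blast
    ultimately have "graded_subspace (\<Union>\<C>)" unfolding graded_subspace_def by blast
    then show "\<Union>\<C> \<in> \<W>" using ne sub unfolding \<W>_def by blast
  qed
  then obtain W where WW: "W \<in> \<W>" "\<And>U. U \<in> \<W> \<Longrightarrow> W \<subseteq> U \<Longrightarrow> U = W" by auto
  have W: "graded_subspace W" "V \<subseteq> W" "e \<notin> W" using WW(1) by (simp_all add: \<W>_def)
  have max: "\<And>U. graded_subspace U \<Longrightarrow> V \<subseteq> U \<Longrightarrow> e \<notin> U \<Longrightarrow> W \<subseteq> U \<Longrightarrow> U = W"
    using WW(2) by (simp add: \<W>_def)
  have WL: "\<And>x. x \<in> W \<Longrightarrow> x \<in> carrier L" and W0: "\<zero>\<^bsub>L\<^esub> \<in> W"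
    and Wadd: "\<And>x y. x \<in> W \<Longrightarrow> y \<in> W \<Longrightarrow> x \<oplus>\<^bsub>L\<^esub> y \<in> W"
    and Wsm: "\<And>c x. c \<in> carrier k \<Longrightarrow> x \<in> W \<Longrightarrow> c \<odot>\<^bsub>L\<^esub> x \<in> W"
    and Wh: "\<And>x \<gamma>. x \<in> W \<Longrightarrow> hcomp L GL \<gamma> x \<in> W"
    using W(1) by (auto simp: graded_subspace_def)
  have shuffle: "(w \<oplus>\<^bsub>L\<^esub> c \<odot>\<^bsub>L\<^esub> x) \<oplus>\<^bsub>L\<^esub> (w' \<oplus>\<^bsub>L\<^esub> c' \<odot>\<^bsub>L\<^esub> x) = (w \<oplus>\<^bsub>L\<^esub> w') \<oplus>\<^bsub>L\<^esub> (c \<oplus>\<^bsub>k\<^esub> c') \<odot>\<^bsub>L\<^esub> x"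
    if "w \<in> W" "w' \<in> W" "c \<in> carrier k" "c' \<in> carrier k" "x \<in> carrier L" for w w' c c' x
    using that WL by (simp add: LA.smult_l_distr Lg.a_ac)
  have decomp: "\<exists>w\<in>W. \<exists>c\<in>carrier k. x = w \<oplus>\<^bsub>L\<^esub> c \<odot>\<^bsub>L\<^esub> e" if "x \<in> carrier L" for x
    using that
  proof (induction x rule: Lg.graded_induct)
    case (homog \<delta> x)
    have xL: "x \<in> carrier L" by (rule Lg.G_carrier[OF homog])
    show ?case
    proof (cases "x \<in> W")
      case True
      then show ?thesis using eL WL by (intro bexI[of _ x] bexI[of _ "\<zero>\<^bsub>k\<^esub>"]) auto
    next
      case False
      \<comment> \<open>Enlarging \<open>W\<close> by a homogeneous \<open>x\<close> outside it
        violates maximality, so the enlarged space contains \<open>e\<close>. The resulting equation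
        is then to be solved for \<open>x\<close>.\<close>
      define U where "U = {w \<oplus>\<^bsub>L\<^esub> c \<odot>\<^bsub>L\<^esub> x | w c. w \<in> W \<and> c \<in> carrier k}"
      have WU: "W \<subseteq> U" unfolding U_def
      proof
        fix w assume "w \<in> W"
        then have "w = w \<oplus>\<^bsub>L\<^esub> \<zero>\<^bsub>k\<^esub> \<odot>\<^bsub>L\<^esub> x" using WL xL by simp
        then show "w \<in> {w \<oplus>\<^bsub>L\<^esub> c \<odot>\<^bsub>L\<^esub> x | w c. w \<in> W \<and> c \<in> carrier k}" using \<open>w \<in> W\<close> kg.zero_closed by blast
      qed
      have "x = \<zero>\<^bsub>L\<^esub> \<oplus>\<^bsub>L\<^esub> \<one>\<^bsub>k\<^esub> \<odot>\<^bsub>L\<^esub> x" using xL by simp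
      then have "x \<in> U" unfolding U_def using W0 kg.one_closed by blast
      then have "U \<noteq> W" using False by blast
      moreover have "graded_subspace U"
        unfolding graded_subspace_def
      proof (intro conjI ballI allI)
        show "U \<subseteq> carrier L" using WL xL by (auto simp: U_def)
        show "\<zero>\<^bsub>L\<^esub> \<in> U" using W0 WU by blast
        show "y \<oplus>\<^bsub>L\<^esub> z \<in> U" if yz: "y \<in> U" "z \<in> U" for y z
        proof -
          obtain w c where h1: "w \<in> W" "c \<in> carrier k" "y = w \<oplus>\<^bsub>L\<^esub> c \<odot>\<^bsub>L\<^esub> x" using yz(1) by (auto simp: U_def)
          obtain w' c' where h2: "w' \<in> W" "c' \<in> carrier k" "z = w' \<oplus>\<^bsub>L\<^esub> c' \<odot>\<^bsub>L\<^esub> x" using yz(2) by (auto simp: U_def)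
          note h = h1(1,2) h2(1,2) h1(3) h2(3)
          then have "y \<oplus>\<^bsub>L\<^esub> z = (w \<oplus>\<^bsub>L\<^esub> w') \<oplus>\<^bsub>L\<^esub> (c \<oplus>\<^bsub>k\<^esub> c') \<odot>\<^bsub>L\<^esub> x" using shuffle xL by simp
          then show ?thesis unfolding U_def using Wadd[OF h(1,3)] kg.a_closed[OF h(2,4)] by blast
        qed
        show "c \<odot>\<^bsub>L\<^esub> y \<in> U" if c: "c \<in> carrier k" and y: "y \<in> U" for c y
        proof -
          obtain w c' where h: "w \<in> W" "c' \<in> carrier k" "y = w \<oplus>\<^bsub>L\<^esub> c' \<odot>\<^bsub>L\<^esub> x" using y unfolding U_def by blast
          then have "c \<odot>\<^bsub>L\<^esub> y = c \<odot>\<^bsub>L\<^esub> w \<oplus>\<^bsub>L\<^esub> (c \<otimes>\<^bsub>k\<^esub> c') \<odot>\<^bsub>L\<^esub> x"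
            using c WL xL by (simp add: LA.smult_r_distr LA.smult_assoc1)
          then show ?thesis unfolding U_def using Wsm[OF c h(1)] kg.m_closed[OF c h(2)] by blast
        qed
        show "hcomp L GL \<gamma> y \<in> U" if y: "y \<in> U" for y \<gamma>
        proof -
          obtain w c where h: "w \<in> W" "c \<in> carrier k" "y = w \<oplus>\<^bsub>L\<^esub> c \<odot>\<^bsub>L\<^esub> x" using y unfolding U_def by blast
          then have "hcomp L GL \<gamma> y = hcomp L GL \<gamma> w \<oplus>\<^bsub>L\<^esub> hcomp k Gk (\<gamma> / \<delta>) c \<odot>\<^bsub>L\<^esub> x"
            using WL xL by (simp add: Lg.hcomp_add hcomp_smult[OF homog(2,1)])
          then show ?thesis unfolding U_def using Wh[OF h(1)] kg.hcomp_closed[OF h(2)] by blast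
        qed
      qed
      ultimately have "e \<in> U" using max WU W(2) by blast
      then obtain w c where wc: "w \<in> W" "c \<in> carrier k" "e = w \<oplus>\<^bsub>L\<^esub> c \<odot>\<^bsub>L\<^esub> x" unfolding U_def by blast
      \<comment> \<open>Taking parts of degree \<open>\<epsilon>\<close> on both sides keeps
        \<open>e\<close> and makes the scalar in front of \<open>x\<close> homogeneous, hence
        invertible as soon as it is nonzero. Were it zero, \<open>e\<close> would lie in
        \<open>W\<close>.\<close>
      define w' c' where "w' = hcomp L GL \<epsilon> w" and "c' = hcomp k Gk (\<epsilon> / \<delta>) c"
      have w': "w' \<in> W" "c' \<in> carrier k" using Wh wc by (simp_all add: w'_def c'_def)
      have "e = hcomp L GL \<epsilon> e" using Lg.hcomp_homog[OF e(2,1), of \<epsilon>] by simp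
      also have "\<dots> = hcomp L GL \<epsilon> (w \<oplus>\<^bsub>L\<^esub> c \<odot>\<^bsub>L\<^esub> x)" using wc(3) by simp
      also have "\<dots> = w' \<oplus>\<^bsub>L\<^esub> c' \<odot>\<^bsub>L\<^esub> x"
        unfolding w'_def c'_def using wc(1,2) WL xL by (simp add: Lg.hcomp_add hcomp_smult[OF homog(2,1)])
      finally have e': "e = w' \<oplus>\<^bsub>L\<^esub> c' \<odot>\<^bsub>L\<^esub> x" .
      have "c' \<noteq> \<zero>\<^bsub>k\<^esub>" using e' w' WL xL W(3) by auto
      moreover have "c' \<in> Gk (\<epsilon> / \<delta>)" unfolding c'_def using kg.hcomp_props(1)[OF wc(2)] e(2) homog(1) by simp
      ultimately have "c' \<in> Units k" using kF divide_pos_pos[OF e(2) homog(1)] unfolding graded_field_def by blast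
      then obtain d where d: "d \<in> carrier k" "d \<otimes>\<^bsub>k\<^esub> c' = \<one>\<^bsub>k\<^esub>" by (auto simp: Units_def)
      have "d \<odot>\<^bsub>L\<^esub> e = d \<odot>\<^bsub>L\<^esub> w' \<oplus>\<^bsub>L\<^esub> x"
        using e' d w' WL xL by (simp add: LA.smult_r_distr flip: LA.smult_assoc1)
      then have "x = (\<ominus>\<^bsub>k\<^esub> d) \<odot>\<^bsub>L\<^esub> w' \<oplus>\<^bsub>L\<^esub> d \<odot>\<^bsub>L\<^esub> e"
        using d w' WL xL eL by (simp add: LA.smult_l_minus Lg.r_neg1)
      then show ?thesis using Wsm[OF kg.a_inv_closed[OF d(1)] w'(1)] d(1) by blast
    qed
  next
    case (add x y)
    obtain w c where h1: "w \<in> W" "c \<in> carrier k" "x = w \<oplus>\<^bsub>L\<^esub> c \<odot>\<^bsub>L\<^esub> e" using add(3) by auto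
    obtain w' c' where h2: "w' \<in> W" "c' \<in> carrier k" "y = w' \<oplus>\<^bsub>L\<^esub> c' \<odot>\<^bsub>L\<^esub> e" using add(4) by auto
    note h = h1(1,2) h2(1,2) h1(3) h2(3)
    then have "x \<oplus>\<^bsub>L\<^esub> y = (w \<oplus>\<^bsub>L\<^esub> w') \<oplus>\<^bsub>L\<^esub> (c \<oplus>\<^bsub>k\<^esub> c') \<odot>\<^bsub>L\<^esub> e" using shuffle eL by simp
    then show ?case using Wadd[OF h(1,3)] kg.a_closed[OF h(2,4)] by blast
  qed
  have unique: "c = c'"
    if h: "w \<in> W" "w' \<in> W" "c \<in> carrier k" "c' \<in> carrier k" "w \<oplus>\<^bsub>L\<^esub> c \<odot>\<^bsub>L\<^esub> e = w' \<oplus>\<^bsub>L\<^esub> c' \<odot>\<^bsub>L\<^esub> e" for w w' c c'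
  proof (rule ccontr)
    assume ne: "c \<noteq> c'"
    have m: "\<ominus>\<^bsub>L\<^esub> w \<in> W" using Wsm[of "\<ominus>\<^bsub>k\<^esub> \<one>\<^bsub>k\<^esub>" w] h(1) WL by (simp add: LA.smult_l_minus)
    \<comment> \<open>Two coordinates of one element differ by a scalar that carries
      \<open>e\<close> into \<open>W\<close>; if that scalar were nonzero,
      \<open>smult_cancel\<close> would put \<open>e\<close> itself into \<open>W\<close>.\<close>
    have "(c \<oplus>\<^bsub>k\<^esub> \<ominus>\<^bsub>k\<^esub> c') \<odot>\<^bsub>L\<^esub> e = \<ominus>\<^bsub>L\<^esub> w \<oplus>\<^bsub>L\<^esub> ((w \<oplus>\<^bsub>L\<^esub> c \<odot>\<^bsub>L\<^esub> e) \<oplus>\<^bsub>L\<^esub> \<ominus>\<^bsub>L\<^esub> (c' \<odot>\<^bsub>L\<^esub> e))"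
      using h(1,3,4) WL eL by (simp add: LA.smult_l_distr LA.smult_l_minus Lg.a_assoc Lg.r_neg1)
    also have "\<dots> = \<ominus>\<^bsub>L\<^esub> w \<oplus>\<^bsub>L\<^esub> w'"
      unfolding h(5) using h(1,2,4) WL eL by (simp add: Lg.a_assoc Lg.r_neg)
    finally have "(c \<oplus>\<^bsub>k\<^esub> \<ominus>\<^bsub>k\<^esub> c') \<odot>\<^bsub>L\<^esub> e \<in> W" using Wadd[OF m h(2)] by simp
    moreover have "c \<oplus>\<^bsub>k\<^esub> \<ominus>\<^bsub>k\<^esub> c' \<noteq> \<zero>\<^bsub>k\<^esub>"
      using ne h(3,4) by (metis a_minus_def kg.r_right_minus_eq)
    ultimately show False
      using smult_cancel[OF W(1) e(1,2), of "c \<oplus>\<^bsub>k\<^esub> \<ominus>\<^bsub>k\<^esub> c'"] h(3,4) W(3) by simp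
  qed
  define \<omega> where "\<omega> x = (SOME c. c \<in> carrier k \<and> (\<exists>w\<in>W. x = w \<oplus>\<^bsub>L\<^esub> c \<odot>\<^bsub>L\<^esub> e))" for x
  have \<omega>: "\<omega> x \<in> carrier k \<and> (\<exists>w\<in>W. x = w \<oplus>\<^bsub>L\<^esub> \<omega> x \<odot>\<^bsub>L\<^esub> e)" if "x \<in> carrier L" for x
    unfolding \<omega>_def by (rule someI_ex) (use decomp[OF that] in blast)
  have \<omega>I: "\<omega> (w \<oplus>\<^bsub>L\<^esub> c \<odot>\<^bsub>L\<^esub> e) = c" if "w \<in> W" "c \<in> carrier k" for w c
  proof -
    have "w \<oplus>\<^bsub>L\<^esub> c \<odot>\<^bsub>L\<^esub> e \<in> carrier L" using that WL eL by simp
    then show ?thesis using \<omega> unique that by metis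
  qed
  have "linear_form \<omega>"
    unfolding linear_form_def
  proof (intro conjI ballI)
    fix x assume x: "x \<in> carrier L"
    show "\<omega> x \<in> carrier k" using \<omega>[OF x] by simp
    obtain w where w: "w \<in> W" "x = w \<oplus>\<^bsub>L\<^esub> \<omega> x \<odot>\<^bsub>L\<^esub> e" using \<omega>[OF x] by blast
    show "\<omega> (x \<oplus>\<^bsub>L\<^esub> y) = \<omega> x \<oplus>\<^bsub>k\<^esub> \<omega> y" if y: "y \<in> carrier L" for y
    proof -
      obtain v where v: "v \<in> W" "y = v \<oplus>\<^bsub>L\<^esub> \<omega> y \<odot>\<^bsub>L\<^esub> e" using \<omega>[OF y] by blast
      have "x \<oplus>\<^bsub>L\<^esub> y = (w \<oplus>\<^bsub>L\<^esub> \<omega> x \<odot>\<^bsub>L\<^esub> e) \<oplus>\<^bsub>L\<^esub> (v \<oplus>\<^bsub>L\<^esub> \<omega> y \<odot>\<^bsub>L\<^esub> e)" using w(2) v(2) by simp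
      also have "\<dots> = (w \<oplus>\<^bsub>L\<^esub> v) \<oplus>\<^bsub>L\<^esub> (\<omega> x \<oplus>\<^bsub>k\<^esub> \<omega> y) \<odot>\<^bsub>L\<^esub> e" using w(1) v(1) \<omega> x y eL by (intro shuffle) auto
      finally show ?thesis using \<omega>I[OF Wadd[OF w(1) v(1)], of "\<omega> x \<oplus>\<^bsub>k\<^esub> \<omega> y"] \<omega> x y by simp
    qed
    show "\<omega> (c \<odot>\<^bsub>L\<^esub> x) = c \<otimes>\<^bsub>k\<^esub> \<omega> x" if c: "c \<in> carrier k" for c
    proof -
      have "c \<odot>\<^bsub>L\<^esub> x = c \<odot>\<^bsub>L\<^esub> (w \<oplus>\<^bsub>L\<^esub> \<omega> x \<odot>\<^bsub>L\<^esub> e)" using w(2) by simp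
      also have "\<dots> = c \<odot>\<^bsub>L\<^esub> w \<oplus>\<^bsub>L\<^esub> (c \<otimes>\<^bsub>k\<^esub> \<omega> x) \<odot>\<^bsub>L\<^esub> e"
        using c w(1) WL eL \<omega>[OF x] by (simp add: LA.smult_r_distr LA.smult_assoc1)
      finally show ?thesis using \<omega>I[OF Wsm[OF c w(1)], of "c \<otimes>\<^bsub>k\<^esub> \<omega> x"] \<omega>[OF x] c by simp
    qed
  qed
  moreover have "\<omega> v = \<zero>\<^bsub>k\<^esub>" if "v \<in> V" for v
  proof -
    have "v \<in> W" using that W(2) by blast
    then show ?thesis using \<omega>I[of v "\<zero>\<^bsub>k\<^esub>"] WL eL by simp
  qed
  moreover have "\<omega> e = \<one>\<^bsub>k\<^esub>" using \<omega>I[OF W0 kg.one_closed] eL by simp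
  ultimately show ?thesis by blast
qed

lemma retraction_exists: "\<exists>\<omega>. linear_form \<omega> \<and> \<omega> \<one>\<^bsub>L\<^esub> = \<one>\<^bsub>k\<^esub>"
proof -
  have "graded_subspace {\<zero>\<^bsub>L\<^esub>}" by (auto simp: graded_subspace_def)
  from linear_form_exists[OF this Lg.one_homog] show ?thesis using LD.one_not_zero by auto
qed

text \<open>The map induced by \<open>\<omega>\<close> on the left factor, followed by the
  identification of k tensor M with M.\<close>

definition contract where "contract M \<omega> = tensor_lift M (\<lambda>x y. \<omega> x \<odot>\<^bsub>M\<^esub> y)"

context
  fixes M :: "('k, 'a, 'n) module_scheme" and \<omega>
  assumes M: "algebra k M" and \<omega>: "linear_form \<omega>"
begin

interpretation M: algebra k M by (rule M)
interpretation LM: tensor_prod k L M using L_algebra M by (simp add: tensor_prod_def)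

private lemma contract_balanced: "LM.balanced M (\<lambda>x y. \<omega> x \<odot>\<^bsub>M\<^esub> y)"
  by (rule LM.balancedI)
     (use \<omega> in \<open>auto simp: linear_form_def M.smult_l_distr M.smult_r_distr M.smult_assoc1[symmetric] kg.m_comm\<close>)

lemmas contract_pure = LM.tensor_lift_pure[OF M.abelian_group_axioms contract_balanced, folded contract_def]
lemmas contract_add = LM.tensor_lift_add[OF M.abelian_group_axioms contract_balanced, folded contract_def]
lemmas contract_closed = LM.tensor_lift_closed[OF M.abelian_group_axioms contract_balanced, folded contract_def]

lemma contract_zero: "contract M \<omega> \<zero>\<^bsub>LM.T\<^esub> = \<zero>\<^bsub>M\<^esub>"
  using contract_pure[of "\<zero>\<^bsub>L\<^esub>" "\<zero>\<^bsub>M\<^esub>"] \<omega> by (simp add: LM.pure_zero_left linear_form_def)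

lemma contract_finsum:
  "finite I \<Longrightarrow> (\<And>i. i \<in> I \<Longrightarrow> h i \<in> carrier LM.T) \<Longrightarrow>
    contract M \<omega> (finsum LM.T h I) = (\<Oplus>\<^bsub>M\<^esub>i\<in>I. contract M \<omega> (h i))"
proof (induction I rule: finite_induct)
  case (insert i I)
  then have "h \<in> I \<rightarrow> carrier LM.T" "h i \<in> carrier LM.T" by auto
  moreover from this have "(\<lambda>i. contract M \<omega> (h i)) \<in> I \<rightarrow> carrier M" "contract M \<omega> (h i) \<in> carrier M"
    using contract_closed by auto
  ultimately show ?case using insert by (simp add: contract_add)
qed (simp add: contract_zero)

end

text \<open>Contraction with a linear form that takes one to one is a left inverse of the inclusion
  of M. This replaces an appeal to faithful flatness.\<close>

lemma pure_one_inj: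
  assumes M: "algebra k M" and xy: "x \<in> carrier M" "y \<in> carrier M"
    and eq: "pure_tensor k L M \<one>\<^bsub>L\<^esub> x = pure_tensor k L M \<one>\<^bsub>L\<^esub> y"
  shows "x = y"
proof -
  interpret M: algebra k M by fact
  obtain \<omega> where \<omega>: "linear_form \<omega>" "\<omega> \<one>\<^bsub>L\<^esub> = \<one>\<^bsub>k\<^esub>" using retraction_exists by blast
  have "contract M \<omega> (pure_tensor k L M \<one>\<^bsub>L\<^esub> z) = z" if "z \<in> carrier M" for z
    using contract_pure[OF M \<omega>(1) Lg.one_closed that] \<omega>(2) that by simp
  then show ?thesis using xy eq by metis
qed

lemma span_graded_subspace:
  assumes fin: "finite \<Lambda>" and hom: "\<And>x. x \<in> \<Lambda> \<Longrightarrow> \<exists>\<gamma>>0. x \<in> GL \<gamma>"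
  shows "graded_subspace {\<Oplus>\<^bsub>L\<^esub>x\<in>\<Lambda>. c x \<odot>\<^bsub>L\<^esub> x | c. \<forall>x\<in>\<Lambda>. c x \<in> carrier k}" (is "graded_subspace ?V")
  unfolding graded_subspace_def
proof (intro conjI ballI allI)
  have \<Lambda>L: "x \<in> carrier L" if "x \<in> \<Lambda>" for x using hom[OF that] Lg.G_carrier by blast
  have mem: "(\<Oplus>\<^bsub>L\<^esub>x\<in>\<Lambda>. c x \<odot>\<^bsub>L\<^esub> x) \<in> ?V" if "\<And>x. x \<in> \<Lambda> \<Longrightarrow> c x \<in> carrier k" for c using that by blast
  show "?V \<subseteq> carrier L" using \<Lambda>L by (auto intro!: Lg.finsum_closed)
  have "(\<Oplus>\<^bsub>L\<^esub>x\<in>\<Lambda>. \<zero>\<^bsub>k\<^esub> \<odot>\<^bsub>L\<^esub> x) = \<zero>\<^bsub>L\<^esub>" using \<Lambda>L by (intro Lg.add.finprod_one_eqI) auto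
  then show "\<zero>\<^bsub>L\<^esub> \<in> ?V" using mem[of "\<lambda>_. \<zero>\<^bsub>k\<^esub>"] by simp
  fix v assume v: "v \<in> ?V"
  then obtain c where c: "v = (\<Oplus>\<^bsub>L\<^esub>x\<in>\<Lambda>. c x \<odot>\<^bsub>L\<^esub> x)" "\<And>x. x \<in> \<Lambda> \<Longrightarrow> c x \<in> carrier k" by blast
  show "v \<oplus>\<^bsub>L\<^esub> w \<in> ?V" if "w \<in> ?V" for w
  proof -
    obtain d where d: "w = (\<Oplus>\<^bsub>L\<^esub>x\<in>\<Lambda>. d x \<odot>\<^bsub>L\<^esub> x)" "\<And>x. x \<in> \<Lambda> \<Longrightarrow> d x \<in> carrier k" using \<open>w \<in> ?V\<close> by blast
    have "(\<Oplus>\<^bsub>L\<^esub>x\<in>\<Lambda>. (c x \<oplus>\<^bsub>k\<^esub> d x) \<odot>\<^bsub>L\<^esub> x) = (\<Oplus>\<^bsub>L\<^esub>x\<in>\<Lambda>. c x \<odot>\<^bsub>L\<^esub> x \<oplus>\<^bsub>L\<^esub> d x \<odot>\<^bsub>L\<^esub> x)"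
      by (rule Lg.finsum_cong') (use c d \<Lambda>L in \<open>auto simp: LA.smult_l_distr\<close>)
    also have "\<dots> = v \<oplus>\<^bsub>L\<^esub> w"
      unfolding c(1) d(1) by (rule Lg.finsum_addf) (use c d \<Lambda>L in auto)
    finally show ?thesis using mem[of "\<lambda>x. c x \<oplus>\<^bsub>k\<^esub> d x"] c d by simp
  qed
  show "a \<odot>\<^bsub>L\<^esub> v \<in> ?V" if a: "a \<in> carrier k" for a
  proof -
    have "a \<odot>\<^bsub>L\<^esub> v = (\<Oplus>\<^bsub>L\<^esub>x\<in>\<Lambda>. a \<odot>\<^bsub>L\<^esub> (c x \<odot>\<^bsub>L\<^esub> x))"
      unfolding c(1) by (rule LA.finsum_smult_ldistr) (use fin a c \<Lambda>L in auto)
    also have "\<dots> = (\<Oplus>\<^bsub>L\<^esub>x\<in>\<Lambda>. (a \<otimes>\<^bsub>k\<^esub> c x) \<odot>\<^bsub>L\<^esub> x)"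
      by (rule Lg.finsum_cong') (use a c \<Lambda>L in \<open>auto simp: LA.smult_assoc1\<close>)
    finally show ?thesis using mem[of "\<lambda>x. a \<otimes>\<^bsub>k\<^esub> c x"] a c by simp
  qed
  show "hcomp L GL \<gamma> v \<in> ?V" for \<gamma>
  proof -
    obtain d where d: "\<And>x. x \<in> \<Lambda> \<Longrightarrow> d x > 0 \<and> x \<in> GL (d x)" using hom by metis
    have "hcomp L GL \<gamma> v = (\<Oplus>\<^bsub>L\<^esub>x\<in>\<Lambda>. hcomp L GL \<gamma> (c x \<odot>\<^bsub>L\<^esub> x))"
      unfolding c(1) by (rule Lg.hcomp_finsum) (use fin c \<Lambda>L in auto)
    also have "\<dots> = (\<Oplus>\<^bsub>L\<^esub>x\<in>\<Lambda>. hcomp k Gk (\<gamma> / d x) (c x) \<odot>\<^bsub>L\<^esub> x)"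
      by (rule Lg.finsum_cong') (use d c \<Lambda>L hcomp_smult in auto)
    finally show ?thesis using mem[of "\<lambda>x. hcomp k Gk (\<gamma> / d x) (c x)"] c by simp
  qed
qed

end

section \<open>Composition and additivity of polynomials\<close>

text \<open>Over a domain degrees multiply under composition, so both polynomials have degree one.
  The product of their leading coefficients is then one.\<close>

lemma (in "domain") UP_comp_eq_X:
  assumes P: "P \<in> carrier (UP R)" and Q: "Q \<in> carrier (UP R)"
    and eq: "eval R (UP R) (\<lambda>c. monom (UP R) c 0) Q P = monom (UP R) \<one> 1"
  shows "\<exists>a\<in>Units R. \<exists>b\<in>carrier R. P = monom (UP R) a 1 \<oplus>\<^bsub>UP R\<^esub> monom (UP R) b 0"
proof -
  interpret U: UP_domain R "UP R" by (simp add: UP_domain_def domain_axioms)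
  define d e where "d = deg R P" and "e = deg R Q"
  let ?p = "\<lambda>i. coeff (UP R) P i"
  have ev: "monom (UP R) \<one> 1 = (\<Oplus>\<^bsub>UP R\<^esub>i\<in>{..d}. monom (UP R) (?p i) 0 \<otimes>\<^bsub>UP R\<^esub> Q [^]\<^bsub>UP R\<^esub> i)"
    using eq P by (simp add: eval_def d_def)
  have cf: "coeff (UP R) (monom (UP R) \<one> 1) j = (\<Oplus>i\<in>{..d}. ?p i \<otimes> coeff (UP R) (Q [^]\<^bsub>UP R\<^esub> i) j)" for j
  proof -
    have "coeff (UP R) (monom (UP R) \<one> 1) j =
        (\<Oplus>i\<in>{..d}. coeff (UP R) (monom (UP R) (?p i) 0 \<otimes>\<^bsub>UP R\<^esub> Q [^]\<^bsub>UP R\<^esub> i) j)"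
      unfolding ev using P Q by (subst U.coeff_finsum) auto
    also have "\<dots> = (\<Oplus>i\<in>{..d}. ?p i \<otimes> coeff (UP R) (Q [^]\<^bsub>UP R\<^esub> i) j)"
      by (rule finsum_cong') (use P Q in \<open>auto simp: U.monom_mult_is_smult\<close>)
    finally show ?thesis .
  qed
  have X1: "coeff (UP R) (monom (UP R) \<one> 1) j = (if j = 1 then \<one> else \<zero>)" for j by simp
  have deg_pow: "deg R (Q [^]\<^bsub>UP R\<^esub> i) \<le> i * e" for i :: nat
  proof (induction i)
    case (Suc i)
    have "deg R (Q [^]\<^bsub>UP R\<^esub> i \<otimes>\<^bsub>UP R\<^esub> Q) \<le> deg R (Q [^]\<^bsub>UP R\<^esub> i) + deg R Q"
      using Q by (intro U.deg_mult_ring) auto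
    then show ?case using Suc by (simp add: e_def)
  qed simp
  have lead: "coeff (UP R) (Q [^]\<^bsub>UP R\<^esub> i) (i * e) = (coeff (UP R) Q e) [^] i" for i :: nat
  proof (induction i)
    case (Suc i)
    have "coeff (UP R) (Q [^]\<^bsub>UP R\<^esub> i \<otimes>\<^bsub>UP R\<^esub> Q) (i * e + e) =
        (\<Oplus>j\<in>{..i * e + e}. coeff (UP R) (Q [^]\<^bsub>UP R\<^esub> i) j \<otimes> coeff (UP R) Q (i * e + e - j))"
      using Q by simp
    also have "\<dots> = (\<Oplus>j\<in>{i * e}. coeff (UP R) (Q [^]\<^bsub>UP R\<^esub> i) j \<otimes> coeff (UP R) Q (i * e + e - j))"
    proof (rule add.finprod_mono_neutral_cong_right)
      fix j assume j: "j \<in> {..i * e + e} - {i * e}"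
      show "coeff (UP R) (Q [^]\<^bsub>UP R\<^esub> i) j \<otimes> coeff (UP R) Q (i * e + e - j) = \<zero>"
      proof (cases "j > i * e")
        case True
        then have "coeff (UP R) (Q [^]\<^bsub>UP R\<^esub> i) j = \<zero>" using Q deg_pow[of i] by (intro U.deg_aboveD) auto
        then show ?thesis using Q by simp
      next
        case False
        then have "coeff (UP R) Q (i * e + e - j) = \<zero>" using Q j by (intro U.deg_aboveD) (auto simp: e_def)
        then show ?thesis using Q by simp
      qed
    qed (use Q in auto)
    also have "\<dots> = (coeff (UP R) Q e) [^] Suc i" using Q Suc by simp
    finally show ?case by (simp add: add.commute)
  qed simp
  \<comment> \<open>Were \<open>Q\<close> constant, then so would be the composite.\<close>
  have e1: "e \<ge> 1"
  proof (rule ccontr)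
    assume "\<not> e \<ge> 1"
    then have "e = 0" by simp
    then have "coeff (UP R) (Q [^]\<^bsub>UP R\<^esub> i) 1 = \<zero>" for i :: nat
      using Q deg_pow[of i] by (intro U.deg_aboveD) auto
    then have "(\<Oplus>i\<in>{..d}. ?p i \<otimes> coeff (UP R) (Q [^]\<^bsub>UP R\<^esub> i) 1) = \<zero>"
      using P by (intro add.finprod_one_eqI) simp
    then show False using cf[of 1] X1[of 1] one_not_zero by simp
  qed
  have "Q \<noteq> \<zero>\<^bsub>UP R\<^esub>" using e1 by (auto simp: e_def)
  then have lq: "coeff (UP R) Q e \<noteq> \<zero>" unfolding e_def using Q U.lcoeff_nonzero by blast
  have "P \<noteq> \<zero>\<^bsub>UP R\<^esub>"
  proof
    assume "P = \<zero>\<^bsub>UP R\<^esub>"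
    then have "(\<Oplus>i\<in>{..d}. ?p i \<otimes> coeff (UP R) (Q [^]\<^bsub>UP R\<^esub> i) 1) = \<zero>"
      using Q by (intro add.finprod_one_eqI) simp
    then show False using cf[of 1] X1[of 1] one_not_zero by simp
  qed
  then have lp: "?p d \<noteq> \<zero>" unfolding d_def using P U.lcoeff_nonzero by blast
  \<comment> \<open>In degree \<open>d * e\<close> only the top power of \<open>Q\<close>
    contributes, since lower powers have smaller degree once \<open>e\<close> is positive.\<close>
  have top: "coeff (UP R) (monom (UP R) \<one> 1) (d * e) = ?p d \<otimes> (coeff (UP R) Q e) [^] d"
  proof -
    have "(\<Oplus>i\<in>{..d}. ?p i \<otimes> coeff (UP R) (Q [^]\<^bsub>UP R\<^esub> i) (d * e)) =
        (\<Oplus>i\<in>{d}. ?p i \<otimes> coeff (UP R) (Q [^]\<^bsub>UP R\<^esub> i) (d * e))"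
    proof (rule add.finprod_mono_neutral_cong_right)
      fix i assume "i \<in> {..d} - {d}"
      then have "i * e < d * e" using e1 by simp
      then have "deg R (Q [^]\<^bsub>UP R\<^esub> i) < d * e" using deg_pow[of i] by (rule le_less_trans[rotated])
      then have "coeff (UP R) (Q [^]\<^bsub>UP R\<^esub> i) (d * e) = \<zero>" using Q by (intro U.deg_aboveD) auto
      then show "?p i \<otimes> coeff (UP R) (Q [^]\<^bsub>UP R\<^esub> i) (d * e) = \<zero>" using P by simp
    qed (use P Q in auto)
    then show ?thesis using cf[of "d * e"] P Q lead[of d] by simp
  qed
  have "?p d \<otimes> (coeff (UP R) Q e) [^] d \<noteq> \<zero>"
    using lp lq P Q nat_pow_eq_zero[of "coeff (UP R) Q e" d] by (subst integral_iff) auto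
  then have "d * e = 1" unfolding top[symmetric] X1 by presburger
  then have d: "d = 1" "e = 1" by simp_all
  have "?p 1 \<otimes> coeff (UP R) Q 1 = \<one>" using top[unfolded X1 d] Q by simp
  then have u: "?p 1 \<in> Units R"
    using P Q m_comm[of "?p 1" "coeff (UP R) Q 1"] by (auto simp: Units_def intro!: bexI[of _ "coeff (UP R) Q 1"])
  moreover have "P = monom (UP R) (?p 1) 1 \<oplus>\<^bsub>UP R\<^esub> monom (UP R) (?p 0) 0"
  proof (rule U.up_eqI)
    fix i
    show "coeff (UP R) P i = coeff (UP R) (monom (UP R) (?p 1) 1 \<oplus>\<^bsub>UP R\<^esub> monom (UP R) (?p 0) 0) i"
      using P U.deg_aboveD[OF _ P, of i] d by (cases "i \<le> 1") (auto simp: d_def le_Suc_eq)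
  qed (use P in auto)
  moreover have "?p 0 \<in> carrier R" using P by simp
  ultimately show ?thesis by blast
qed

lemma (in "domain") UP_unit_const:
  assumes "a \<in> Units (UP R)" shows "\<exists>c\<in>carrier R. a = monom (UP R) c 0"
proof -
  interpret U: UP_domain R "UP R" by (simp add: UP_domain_def domain_axioms)
  obtain b where ab: "a \<in> carrier (UP R)" "b \<in> carrier (UP R)" "a \<otimes>\<^bsub>UP R\<^esub> b = \<one>\<^bsub>UP R\<^esub>"
    using assms by (auto simp: Units_def)
  have "a \<noteq> \<zero>\<^bsub>UP R\<^esub>" "b \<noteq> \<zero>\<^bsub>UP R\<^esub>" using ab U.UP_one_not_zero by auto
  then have "deg R a + deg R b = 0" using U.deg_mult[of a b] ab by simp
  then have "a = monom (UP R) (coeff (UP R) a 0) 0" using ab U.deg_zero_impl_monom[of a] by simp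
  then show ?thesis using ab by (metis U.coeff_closed)
qed

text \<open>Write \<open>i = p^v * m\<close> with \<open>m\<close> prime to \<open>p\<close>; then
  \<open>m\<close> is not one. The choice \<open>a = p^v\<close> works, because the binomial
  coefficient has the same p-adic valuation as \<open>m\<close>, namely zero.\<close>

lemma not_prime_power_choose:
  assumes p: "prime (p::nat)" and i: "i > 0" "\<And>a. i \<noteq> p ^ a"
  shows "\<exists>a b. a > 0 \<and> b > 0 \<and> a + b = i \<and> \<not> p dvd (i choose a)"
proof -
  define v where "v = multiplicity p i"
  obtain m where m: "i = p ^ v * m" "\<not> p dvd m"
    using multiplicity_decompose'[of i p] i(1) p unfolding v_def by (metis not_prime_unit less_numeral_extra(3))
  have m0: "m > 0" using m i by (cases m) auto
  have "m \<noteq> 1" using m i(2)[of v] by auto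
  then have lt: "p ^ v < i" using m m0 p by (simp add: prime_gt_0_nat)
  have "multiplicity p (p ^ v * m choose p ^ v) = multiplicity p m" by (rule const_p_fac[OF m0 p])
  also have "\<dots> = 0" using m(2) by (simp add: not_dvd_imp_multiplicity_0)
  finally have "multiplicity p (i choose p ^ v) = 0" using m(1) by simp
  moreover have "(i choose p ^ v) \<noteq> 0" using lt by (simp add: less_imp_le)
  ultimately have "\<not> p dvd (i choose p ^ v)" using p by (metis multiplicity_eq_zero_iff not_prime_unit)
  then show ?thesis using lt p by (intro exI[of _ "p ^ v"] exI[of _ "i - p ^ v"]) (auto simp: prime_gt_0_nat)
qed

section \<open>Convolution\<close>

locale ghopf =
  fixes k :: "('k, 'm) ring_scheme" and Gk and H :: "('k, 'h) hopf" and GH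
  assumes hopf: "graded_hopf_algebra k Gk H GH"
begin

lemma H_ga: "graded_algebra k Gk H GH" and H_alg: "algebra k H"
  using hopf by (simp_all add: graded_hopf_algebra_def graded_algebra_def)

sublocale H: algebra k H by (rule H_alg)
sublocale GH: graded H GH using H_ga by (intro gradedI) (simp add: graded_algebra_def)
sublocale HH: graded_tensor k H H Gk GH GH by (rule graded_tensorI[OF H_ga H_ga])

lemma graded_alg_hom: "h \<in> graded_algebra_hom k A GA B GB \<Longrightarrow> h \<in> alg_hom k A B"
  by (simp add: graded_algebra_hom_def alg_hom_def)

lemma comult_hom: "comult H \<in> alg_hom k H HH.TA" and antipode_hom: "antipode H \<in> alg_hom k H H"
  and counit_hom: "counit H \<in> alg_hom k H (self_algebra k)"
  using hopf graded_alg_hom unfolding graded_hopf_algebra_def by blast+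

lemma counit_closed: "h \<in> carrier H \<Longrightarrow> counit H h \<in> carrier k"
  using alg_hom_closed[OF counit_hom, of h] by (simp add: self_algebra_def)

lemma comult_closed: "h \<in> carrier H \<Longrightarrow> comult H h \<in> carrier HH.T"
  using alg_hom_closed[OF comult_hom, of h] by simp

definition "lift2 S \<alpha> \<beta> = tensor_lift S (\<lambda>y z. \<alpha> y \<otimes>\<^bsub>S\<^esub> \<beta> z)"
text \<open>The convolution product, that is, the multiplication of S-valued points of the group
  scheme with coordinate ring H; \<open>\<alpha>\<close> is the left factor.\<close>

definition "conv S \<alpha> \<beta> = (\<lambda>h. lift2 S \<alpha> \<beta> (comult H h))"

lemma lift2_gen:
  assumes "algebra k A" "algebra k B" "algebra k S" "\<alpha> \<in> alg_hom k A S" "\<beta> \<in> alg_hom k B S"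
  shows "lift2 S \<alpha> \<beta> \<in> alg_hom k (tensor_algebra k A B) S"
    and "\<And>y z. y \<in> carrier A \<Longrightarrow> z \<in> carrier B \<Longrightarrow> lift2 S \<alpha> \<beta> (pure_tensor k A B y z) = \<alpha> y \<otimes>\<^bsub>S\<^esub> \<beta> z"
proof -
  interpret tensor_prod k A B using assms by (simp add: tensor_prod_def)
  show "lift2 S \<alpha> \<beta> \<in> alg_hom k (tensor_algebra k A B) S"
    and "\<And>y z. y \<in> carrier A \<Longrightarrow> z \<in> carrier B \<Longrightarrow> lift2 S \<alpha> \<beta> (pure_tensor k A B y z) = \<alpha> y \<otimes>\<^bsub>S\<^esub> \<beta> z"
    unfolding lift2_def
    using tensor_lift_alg_hom[OF assms(3) refl refl refl refl refl assms(4,5)] by simp_all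
qed

context
  fixes S :: "('k, 's, 'n) module_scheme"
  assumes S: "algebra k S"
begin

interpretation S: algebra k S by (rule S)

lemmas lift2_hom = lift2_gen(1)[OF H_alg H_alg S]
lemmas lift2_pure = lift2_gen(2)[OF H_alg H_alg S]

lemma conv_hom: "\<alpha> \<in> alg_hom k H S \<Longrightarrow> \<beta> \<in> alg_hom k H S \<Longrightarrow> conv S \<alpha> \<beta> \<in> alg_hom k H S"
  using alg_hom_comp[OF comult_hom lift2_hom] by (simp add: conv_def comp_def)

lemma lift2_eqI:
  assumes \<alpha>: "\<alpha> \<in> alg_hom k H S" "\<beta> \<in> alg_hom k H S" and \<theta>: "\<theta> \<in> alg_hom k HH.TA S"
    and eq: "\<And>y z. y \<in> carrier H \<Longrightarrow> z \<in> carrier H \<Longrightarrow> \<theta> (HH.pure y z) = \<alpha> y \<otimes>\<^bsub>S\<^esub> \<beta> z"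
    and t: "t \<in> carrier HH.T"
  shows "lift2 S \<alpha> \<beta> t = \<theta> t"
  by (rule HH.tensor_alg_hom_eqI[OF lift2_hom[OF \<alpha>] \<theta> _ _ t]) (simp_all add: lift2_pure[OF \<alpha>] eq)

lemma conv_cong:
  assumes "\<alpha> \<in> alg_hom k H S" "\<beta> \<in> alg_hom k H S" "\<alpha>' \<in> alg_hom k H S" "\<beta>' \<in> alg_hom k H S"
    and "\<And>h. h \<in> carrier H \<Longrightarrow> \<alpha> h = \<alpha>' h" "\<And>h. h \<in> carrier H \<Longrightarrow> \<beta> h = \<beta>' h" and h: "h \<in> carrier H"
  shows "conv S \<alpha> \<beta> h = conv S \<alpha>' \<beta>' h"
  unfolding conv_def
  by (rule lift2_eqI[OF assms(1,2) lift2_hom[OF assms(3,4)] _ comult_closed[OF h]])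
     (simp add: assms(5,6) lift2_pure[OF assms(3,4)])

lemma conv_natural:
  assumes S': "algebra k S'" and \<theta>: "\<theta> \<in> alg_hom k S S'" and \<alpha>: "\<alpha> \<in> alg_hom k H S" "\<beta> \<in> alg_hom k H S"
    and h: "h \<in> carrier H"
  shows "\<theta> (conv S \<alpha> \<beta> h) = lift2 S' (\<theta> \<circ> \<alpha>) (\<theta> \<circ> \<beta>) (comult H h)"
proof -
  have "(\<theta> \<circ> lift2 S \<alpha> \<beta>) t = lift2 S' (\<theta> \<circ> \<alpha>) (\<theta> \<circ> \<beta>) t" if t: "t \<in> carrier HH.T" for t
  proof (rule HH.tensor_alg_hom_eqI[OF alg_hom_comp[OF lift2_hom[OF \<alpha>] \<theta>] _ _ _ t])
    note l' = lift2_gen[OF H_alg H_alg S' alg_hom_comp[OF \<alpha>(1) \<theta>] alg_hom_comp[OF \<alpha>(2) \<theta>]]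
    show "lift2 S' (\<theta> \<circ> \<alpha>) (\<theta> \<circ> \<beta>) \<in> alg_hom k HH.TA S'" by (rule l'(1))
    have "(\<theta> \<circ> lift2 S \<alpha> \<beta>) (HH.pure y z) = lift2 S' (\<theta> \<circ> \<alpha>) (\<theta> \<circ> \<beta>) (HH.pure y z)" if "y \<in> carrier H" "z \<in> carrier H" for y z
      using that l'(2)[OF that] lift2_pure[OF \<alpha> that] alg_hom_mult[OF \<theta>] alg_hom_closed[OF \<alpha>(1)] alg_hom_closed[OF \<alpha>(2)] by simp
    then show "y \<in> carrier H \<Longrightarrow> (\<theta> \<circ> lift2 S \<alpha> \<beta>) (HH.pure y \<one>\<^bsub>H\<^esub>) = lift2 S' (\<theta> \<circ> \<alpha>) (\<theta> \<circ> \<beta>) (HH.pure y \<one>\<^bsub>H\<^esub>)"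
      and "z \<in> carrier H \<Longrightarrow> (\<theta> \<circ> lift2 S \<alpha> \<beta>) (HH.pure \<one>\<^bsub>H\<^esub> z) = lift2 S' (\<theta> \<circ> \<alpha>) (\<theta> \<circ> \<beta>) (HH.pure \<one>\<^bsub>H\<^esub> z)" for y z
      by blast+
  qed
  then show ?thesis using comult_closed[OF h] by (simp add: conv_def)
qed

text \<open>Both sides are triple products in S, evaluated on the two iterated comultiplications;
  coassociativity matches the latter.\<close>

lemma conv_assoc:
  assumes \<alpha>: "\<alpha> \<in> alg_hom k H S" and \<beta>: "\<beta> \<in> alg_hom k H S" and \<gamma>: "\<gamma> \<in> alg_hom k H S" and h: "h \<in> carrier H"
  shows "conv S (conv S \<alpha> \<beta>) \<gamma> h = conv S \<alpha> (conv S \<beta> \<gamma>) h"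
proof -
  interpret L: tensor_prod k HH.TA H using HH.TA_algebra H_alg by (simp add: tensor_prod_def)
  interpret R: tensor_prod k H HH.TA using HH.TA_algebra H_alg by (simp add: tensor_prod_def)
  note as = tensor_assoc_alg_hom[OF H_alg H_alg H_alg]
  note lm = tensor_map_alg_hom[OF HH.TA_algebra H_alg H_alg H_alg comult_hom alg_hom_id]
  note rm = tensor_map_alg_hom[OF H_alg HH.TA_algebra H_alg H_alg alg_hom_id comult_hom]
  note ab = lift2_hom[OF \<alpha> \<beta>] and bc = lift2_hom[OF \<beta> \<gamma>]
  let ?M = "lift2 S (lift2 S \<alpha> \<beta>) \<gamma>" and ?N = "lift2 S \<alpha> (lift2 S \<beta> \<gamma>)"
  note M = lift2_gen[OF HH.TA_algebra H_alg S ab \<gamma>] and N = lift2_gen[OF H_alg HH.TA_algebra S \<alpha> bc]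
  note cl = alg_hom_closed[OF \<alpha>] alg_hom_closed[OF \<beta>] alg_hom_closed[OF \<gamma>]
  have pc: "HH.pure x y \<in> carrier HH.TA" if "x \<in> carrier H" "y \<in> carrier H" for x y using that by simp
  \<comment> \<open>The triple products bracketed to the left and to the right correspond under the
    associator; two uses of the generator principle reduce this to pure tensors.\<close>
  have MN: "?M t = (?N \<circ> tensor_assoc k H H H) t" if t: "t \<in> carrier L.T" for t
  proof (rule L.tensor_alg_hom_eqI[OF M(1) alg_hom_comp[OF as(1) N(1)] _ _ t])
    fix u assume u: "u \<in> carrier HH.TA"
    have "(?M \<circ> (\<lambda>u. L.pure u \<one>\<^bsub>H\<^esub>)) u = (?N \<circ> tensor_assoc k H H H \<circ> (\<lambda>u. L.pure u \<one>\<^bsub>H\<^esub>)) u"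
    proof (rule HH.tensor_alg_hom_eqI)
      show "?M \<circ> (\<lambda>u. L.pure u \<one>\<^bsub>H\<^esub>) \<in> alg_hom k HH.TA S"
        by (rule alg_hom_comp[OF L.inl_alg_hom M(1)])
      show "?N \<circ> tensor_assoc k H H H \<circ> (\<lambda>u. L.pure u \<one>\<^bsub>H\<^esub>) \<in> alg_hom k HH.TA S"
        by (rule alg_hom_comp[OF L.inl_alg_hom alg_hom_comp[OF as(1) N(1)]])
      show "u \<in> carrier HH.T" using u by simp
      have "(?M \<circ> (\<lambda>u. L.pure u \<one>\<^bsub>H\<^esub>)) (HH.pure x y) = (?N \<circ> tensor_assoc k H H H \<circ> (\<lambda>u. L.pure u \<one>\<^bsub>H\<^esub>)) (HH.pure x y)"
        if xy: "x \<in> carrier H" "y \<in> carrier H" for x y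
        using M(2)[OF pc[OF xy] H.one_closed] as(2)[OF xy H.one_closed] N(2)[OF xy(1) pc[OF xy(2) H.one_closed]]
          lift2_pure[OF \<alpha> \<beta> xy] lift2_pure[OF \<beta> \<gamma> xy(2) H.one_closed] cl xy alg_hom_one[OF \<gamma>] by simp
      then show "x \<in> carrier H \<Longrightarrow> (?M \<circ> (\<lambda>u. L.pure u \<one>\<^bsub>H\<^esub>)) (HH.pure x \<one>\<^bsub>H\<^esub>) = (?N \<circ> tensor_assoc k H H H \<circ> (\<lambda>u. L.pure u \<one>\<^bsub>H\<^esub>)) (HH.pure x \<one>\<^bsub>H\<^esub>)"
        and "y \<in> carrier H \<Longrightarrow> (?M \<circ> (\<lambda>u. L.pure u \<one>\<^bsub>H\<^esub>)) (HH.pure \<one>\<^bsub>H\<^esub> y) = (?N \<circ> tensor_assoc k H H H \<circ> (\<lambda>u. L.pure u \<one>\<^bsub>H\<^esub>)) (HH.pure \<one>\<^bsub>H\<^esub> y)" for x y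
        by blast+
    qed
    then show "?M (L.pure u \<one>\<^bsub>H\<^esub>) = (?N \<circ> tensor_assoc k H H H) (L.pure u \<one>\<^bsub>H\<^esub>)" by simp
  next
    fix z assume z: "z \<in> carrier H"
    show "?M (L.pure \<one>\<^bsub>HH.TA\<^esub> z) = (?N \<circ> tensor_assoc k H H H) (L.pure \<one>\<^bsub>HH.TA\<^esub> z)"
      using M(2)[OF pc[OF H.one_closed H.one_closed] z] as(2)[OF H.one_closed H.one_closed z]
        N(2)[OF H.one_closed pc[OF H.one_closed z]] lift2_pure[OF \<alpha> \<beta> H.one_closed H.one_closed]
        lift2_pure[OF \<beta> \<gamma> H.one_closed z] cl z alg_hom_one[OF \<alpha>] alg_hom_one[OF \<beta>] by (simp add: HH.T_one)
  qed
  have l: "lift2 S (conv S \<alpha> \<beta>) \<gamma> t = (?M \<circ> tensor_map k HH.TA H (comult H) id) t" if t: "t \<in> carrier HH.T" for t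
    by (rule lift2_eqI[OF conv_hom[OF \<alpha> \<beta>] \<gamma> alg_hom_comp[OF lm(1) M(1)] _ t])
       (use lm(2) M(2) alg_hom_closed[OF comult_hom] in \<open>simp add: conv_def\<close>)
  have r: "lift2 S \<alpha> (conv S \<beta> \<gamma>) t = (?N \<circ> tensor_map k H HH.TA id (comult H)) t" if t: "t \<in> carrier HH.T" for t
    by (rule lift2_eqI[OF \<alpha> conv_hom[OF \<beta> \<gamma>] alg_hom_comp[OF rm(1) N(1)] _ t])
       (use rm(2) N(2) alg_hom_closed[OF comult_hom] in \<open>simp add: conv_def\<close>)
  have "tensor_map k HH.TA H (comult H) id (comult H h) \<in> carrier L.T"
    using alg_hom_closed[OF lm(1), of "comult H h"] comult_closed[OF h] by simp
  then show ?thesis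
    using l[OF comult_closed[OF h]] r[OF comult_closed[OF h]] MN hopf h
    by (simp add: graded_hopf_algebra_def conv_def[of S "conv S \<alpha> \<beta>"] conv_def[of S \<alpha> "conv S \<beta> \<gamma>"])
qed

text \<open>The neutral element among the S-valued points.\<close>

abbreviation "unit_pt \<equiv> \<lambda>h. counit H h \<odot>\<^bsub>S\<^esub> \<one>\<^bsub>S\<^esub>"

lemma unit_pt_hom: "unit_pt \<in> alg_hom k H S"
  using alg_hom_comp[OF counit_hom unit_alg_hom[OF S]] by (simp add: comp_def)

lemma unit_pt_smult: "y \<in> carrier H \<Longrightarrow> x \<in> carrier S \<Longrightarrow> unit_pt y \<otimes>\<^bsub>S\<^esub> x = counit H y \<odot>\<^bsub>S\<^esub> x"
  using counit_closed[of y] by (simp add: S.smult_assoc2)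

lemma H_unit_hom: "(\<lambda>y. counit H y \<odot>\<^bsub>H\<^esub> \<one>\<^bsub>H\<^esub>) \<in> alg_hom k H H"
  using alg_hom_comp[OF counit_hom unit_alg_hom[OF H_alg]] by (simp add: comp_def)

lemma H_lift:
  assumes a: "a \<in> alg_hom k H H" and b: "b \<in> alg_hom k H H"
    and \<phi>: "\<And>y z. y \<in> carrier H \<Longrightarrow> z \<in> carrier H \<Longrightarrow> \<phi> y z = a y \<otimes>\<^bsub>H\<^esub> b z"
  shows "tensor_lift H \<phi> \<in> alg_hom k HH.TA H"
    and "\<And>y z. y \<in> carrier H \<Longrightarrow> z \<in> carrier H \<Longrightarrow> tensor_lift H \<phi> (HH.pure y z) = \<phi> y z"
  using HH.tensor_lift_alg_hom[OF H_alg refl refl refl refl refl a b \<phi>] \<phi> by simp_all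

lemma conv_unit:
  assumes \<alpha>: "\<alpha> \<in> alg_hom k H S" and h: "h \<in> carrier H"
  shows "conv S \<alpha> unit_pt h = \<alpha> h" "conv S unit_pt \<alpha> h = \<alpha> h"
proof -
  have e2: "counit H z \<odot>\<^bsub>H\<^esub> y = id y \<otimes>\<^bsub>H\<^esub> (counit H z \<odot>\<^bsub>H\<^esub> \<one>\<^bsub>H\<^esub>)" if "y \<in> carrier H" "z \<in> carrier H" for y z
    using algebra_smult_unit[OF H_alg counit_closed[OF that(2)] that(1)]
      H.m_comm[OF that(1) H.smult_closed[OF counit_closed[OF that(2)] H.one_closed]] by simp
  have e1: "counit H y \<odot>\<^bsub>H\<^esub> z = (counit H y \<odot>\<^bsub>H\<^esub> \<one>\<^bsub>H\<^esub>) \<otimes>\<^bsub>H\<^esub> id z" if "y \<in> carrier H" "z \<in> carrier H" for y z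
    using algebra_smult_unit[OF H_alg counit_closed[OF that(1)] that(2)] by simp
  have l2: "tensor_lift H (\<lambda>y z. counit H z \<odot>\<^bsub>H\<^esub> y) \<in> alg_hom k HH.TA H"
    "y \<in> carrier H \<Longrightarrow> z \<in> carrier H \<Longrightarrow> tensor_lift H (\<lambda>y z. counit H z \<odot>\<^bsub>H\<^esub> y) (HH.pure y z) = counit H z \<odot>\<^bsub>H\<^esub> y" for y z
    using H_lift[OF alg_hom_id H_unit_hom, of "\<lambda>y z. counit H z \<odot>\<^bsub>H\<^esub> y"] e2 by blast+
  have l1: "tensor_lift H (\<lambda>y z. counit H y \<odot>\<^bsub>H\<^esub> z) \<in> alg_hom k HH.TA H"
    "y \<in> carrier H \<Longrightarrow> z \<in> carrier H \<Longrightarrow> tensor_lift H (\<lambda>y z. counit H y \<odot>\<^bsub>H\<^esub> z) (HH.pure y z) = counit H y \<odot>\<^bsub>H\<^esub> z" for y z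
    using H_lift[OF H_unit_hom alg_hom_id, of "\<lambda>y z. counit H y \<odot>\<^bsub>H\<^esub> z"] e1 by blast+
  have "lift2 S \<alpha> unit_pt (comult H h) = (\<alpha> \<circ> tensor_lift H (\<lambda>y z. counit H z \<odot>\<^bsub>H\<^esub> y)) (comult H h)"
  proof (rule lift2_eqI[OF \<alpha> unit_pt_hom alg_hom_comp[OF l2(1) \<alpha>] _ comult_closed[OF h]])
    fix y z assume yz: "y \<in> carrier H" "z \<in> carrier H"
    then show "(\<alpha> \<circ> tensor_lift H (\<lambda>y z. counit H z \<odot>\<^bsub>H\<^esub> y)) (HH.pure y z) = \<alpha> y \<otimes>\<^bsub>S\<^esub> unit_pt z"
      using l2(2)[OF yz] alg_hom_smult[OF \<alpha> counit_closed[OF yz(2)] yz(1)] unit_pt_smult[OF yz(2) alg_hom_closed[OF \<alpha> yz(1)]]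
        S.m_comm[OF alg_hom_closed[OF \<alpha> yz(1)] alg_hom_closed[OF unit_pt_hom yz(2)]] by simp
  qed
  then show "conv S \<alpha> unit_pt h = \<alpha> h" using hopf h by (simp add: conv_def graded_hopf_algebra_def)
  have "lift2 S unit_pt \<alpha> (comult H h) = (\<alpha> \<circ> tensor_lift H (\<lambda>y z. counit H y \<odot>\<^bsub>H\<^esub> z)) (comult H h)"
  proof (rule lift2_eqI[OF unit_pt_hom \<alpha> alg_hom_comp[OF l1(1) \<alpha>] _ comult_closed[OF h]])
    fix y z assume yz: "y \<in> carrier H" "z \<in> carrier H"
    then show "(\<alpha> \<circ> tensor_lift H (\<lambda>y z. counit H y \<odot>\<^bsub>H\<^esub> z)) (HH.pure y z) = unit_pt y \<otimes>\<^bsub>S\<^esub> \<alpha> z"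
      using l1(2)[OF yz] alg_hom_smult[OF \<alpha> counit_closed[OF yz(1)] yz(2)] unit_pt_smult[OF yz(1) alg_hom_closed[OF \<alpha> yz(2)]] by simp
  qed
  then show "conv S unit_pt \<alpha> h = \<alpha> h" using hopf h by (simp add: conv_def graded_hopf_algebra_def)
qed

lemma conv_antipode:
  assumes \<alpha>: "\<alpha> \<in> alg_hom k H S" and h: "h \<in> carrier H"
  shows "conv S (\<alpha> \<circ> antipode H) \<alpha> h = unit_pt h"
proof -
  have l: "tensor_lift H (\<lambda>y z. antipode H y \<otimes>\<^bsub>H\<^esub> z) \<in> alg_hom k HH.TA H"
    "y \<in> carrier H \<Longrightarrow> z \<in> carrier H \<Longrightarrow> tensor_lift H (\<lambda>y z. antipode H y \<otimes>\<^bsub>H\<^esub> z) (HH.pure y z) = antipode H y \<otimes>\<^bsub>H\<^esub> z" for y z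
    using H_lift[OF antipode_hom alg_hom_id, of "\<lambda>y z. antipode H y \<otimes>\<^bsub>H\<^esub> z"] by simp_all
  have "lift2 S (\<alpha> \<circ> antipode H) \<alpha> (comult H h) = (\<alpha> \<circ> tensor_lift H (\<lambda>y z. antipode H y \<otimes>\<^bsub>H\<^esub> z)) (comult H h)"
    by (rule lift2_eqI[OF alg_hom_comp[OF antipode_hom \<alpha>] \<alpha> alg_hom_comp[OF l(1) \<alpha>] _ comult_closed[OF h]])
       (use l(2) alg_hom_mult[OF \<alpha>] alg_hom_closed[OF antipode_hom] in simp_all)
  also have "\<dots> = \<alpha> (counit H h \<odot>\<^bsub>H\<^esub> \<one>\<^bsub>H\<^esub>)" using hopf h by (simp add: graded_hopf_algebra_def)
  also have "\<dots> = unit_pt h" using alg_hom_smult[OF \<alpha> counit_closed[OF h] H.one_closed] alg_hom_one[OF \<alpha>] by simp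
  finally show ?thesis by (simp add: conv_def)
qed

end

end

section \<open>Graded Hopf algebras that become a polynomial ring\<close>

text \<open>\<open>\<psi>\<close> is the isomorphism belonging to a graded form, followed by the
  identification of L tensor k[T] with L[T]. Compatibility with degrees is demanded in this one
  direction only, on the generated pieces of the tensor product.\<close>

locale hopf_form = root_form k Gk L GL p n r + ghopf k Gk H GH
  for k :: "('k, 'm) ring_scheme" and Gk and L :: "('k, 'l) module" and GL p n r
    and H :: "('k, 'h) hopf" and GH +
  fixes \<psi> :: "('l \<times> 'h \<Rightarrow>\<^sub>0 int) set \<Rightarrow> nat \<Rightarrow> 'l"
  assumes psi_hom: "\<psi> \<in> ring_hom (tensor_ring k L H) (UP L)"
    and psi_bij: "bij_betw \<psi> (carrier (tensor_ring k L H)) (carrier (UP L))"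
    and psi_left: "\<And>x. x \<in> carrier L \<Longrightarrow> \<psi> (pure_tensor k L H x \<one>\<^bsub>H\<^esub>) = monom (UP L) x 0"
    and psi_homog: "\<And>\<gamma> t. \<gamma> > 0 \<Longrightarrow> t \<in> tensor_grading k L GL H GH \<gamma> \<Longrightarrow> \<psi> t \<in> LG \<gamma>"
begin

sublocale TL: graded_tensor k L H Gk GL GH by (rule graded_tensorI[OF L_alg H_ga])

definition "\<tau> = inv_into (carrier TL.T) \<psi>"

lemma tau_closed: "P \<in> carrier (UP L) \<Longrightarrow> \<tau> P \<in> carrier TL.T"
  and psi_tau: "P \<in> carrier (UP L) \<Longrightarrow> \<psi> (\<tau> P) = P"
  and tau_psi: "t \<in> carrier TL.T \<Longrightarrow> \<tau> (\<psi> t) = t"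
  using psi_bij bij_betw_imp_surj_on[OF psi_bij] bij_betw_imp_inj_on[OF psi_bij]
  by (auto simp: \<tau>_def inv_into_into f_inv_into_f inv_into_f_f)

lemma tau_hom: "\<tau> \<in> ring_hom (UP L) TL.T"
proof (rule ring_hom_memI)
  show "\<tau> \<one>\<^bsub>UP L\<^esub> = \<one>\<^bsub>TL.T\<^esub>" using tau_psi[OF TL.T.one_closed] ring_hom_one[OF psi_hom] by simp
  fix P Q assume PQ: "P \<in> carrier (UP L)" "Q \<in> carrier (UP L)"
  note c = tau_closed[OF PQ(1)] tau_closed[OF PQ(2)]
  show "\<tau> (P \<otimes>\<^bsub>UP L\<^esub> Q) = \<tau> P \<otimes>\<^bsub>TL.T\<^esub> \<tau> Q"
    using tau_psi[OF TL.T.m_closed[OF c]] ring_hom_mult[OF psi_hom c] psi_tau PQ by simp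
  show "\<tau> (P \<oplus>\<^bsub>UP L\<^esub> Q) = \<tau> P \<oplus>\<^bsub>TL.T\<^esub> \<tau> Q"
    using tau_psi[OF TL.T.a_closed[OF c]] ring_hom_add[OF psi_hom c] psi_tau PQ by simp
qed (use tau_closed in auto)

lemma tau_const: "x \<in> carrier L \<Longrightarrow> \<tau> (monom (UP L) x 0) = TL.pure x \<one>\<^bsub>H\<^esub>"
  using tau_psi[of "TL.pure x \<one>\<^bsub>H\<^esub>"] psi_left[of x] by simp

text \<open>Through \<open>j\<close> the elements of H are treated as polynomials over L; it is
  injective because k is a direct summand of L.\<close>

definition "j h = \<psi> (TL.pure \<one>\<^bsub>L\<^esub> h)"

lemma j_ring_hom: "j \<in> ring_hom H (UP L)"
  using ring_hom_trans[OF TL.inr_hom psi_hom] by (simp add: j_def[abs_def] comp_def)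

lemma j_smult: "c \<in> carrier k \<Longrightarrow> h \<in> carrier H \<Longrightarrow> j (c \<odot>\<^bsub>H\<^esub> h) = monom (UP L) (c \<odot>\<^bsub>L\<^esub> \<one>\<^bsub>L\<^esub>) 0 \<otimes>\<^bsub>UP L\<^esub> j h"
proof -
  assume c: "c \<in> carrier k" and h: "h \<in> carrier H"
  have "TL.pure \<one>\<^bsub>L\<^esub> (c \<odot>\<^bsub>H\<^esub> h) = TL.pure (c \<odot>\<^bsub>L\<^esub> \<one>\<^bsub>L\<^esub>) \<one>\<^bsub>H\<^esub> \<otimes>\<^bsub>TL.T\<^esub> TL.pure \<one>\<^bsub>L\<^esub> h"
    using c h by (simp add: TL.pure_mult TL.pure_smult H.smult_assoc2)
  then show ?thesis
    using ring_hom_mult[OF psi_hom, of "TL.pure (c \<odot>\<^bsub>L\<^esub> \<one>\<^bsub>L\<^esub>) \<one>\<^bsub>H\<^esub>" "TL.pure \<one>\<^bsub>L\<^esub> h"] psi_left[of "c \<odot>\<^bsub>L\<^esub> \<one>\<^bsub>L\<^esub>"] c h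
    by (simp add: j_def)
qed

lemma j_closed: "h \<in> carrier H \<Longrightarrow> j h \<in> carrier (UP L)"
  by (rule ring_hom_closed[OF j_ring_hom])

lemma j_alg_hom: "j \<in> alg_hom k H UPL"
  by (rule alg_homI) (use j_ring_hom j_smult in \<open>auto simp: ring_hom_def UPL_smult\<close>)

lemma psi_pure: "x \<in> carrier L \<Longrightarrow> h \<in> carrier H \<Longrightarrow> \<psi> (TL.pure x h) = monom (UP L) x 0 \<otimes>\<^bsub>UP L\<^esub> j h"
  using ring_hom_mult[OF psi_hom, of "TL.pure x \<one>\<^bsub>H\<^esub>" "TL.pure \<one>\<^bsub>L\<^esub> h"] psi_left[of x]
  by (simp add: j_def flip: TL.pure_split)

lemma j_inj: "inj_on j (carrier H)"
proof (rule inj_onI)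
  fix x y assume xy: "x \<in> carrier H" "y \<in> carrier H" "j x = j y"
  then have "TL.pure \<one>\<^bsub>L\<^esub> x = TL.pure \<one>\<^bsub>L\<^esub> y"
    using inj_onD[OF bij_betw_imp_inj_on[OF psi_bij]] by (simp add: j_def)
  then show "x = y" by (rule pure_one_inj[OF H_alg xy(1,2)])
qed

lemma j_homog: "\<gamma> > 0 \<Longrightarrow> h \<in> GH \<gamma> \<Longrightarrow> j h \<in> LG \<gamma>"
  unfolding j_def by (rule psi_homog) (auto intro!: TL.pure_homog[of 1 \<gamma>] simp: Lg.one_homog)

text \<open>Restriction of scalars from L to k. Points of H are k-algebra maps, whereas polynomials
  over L are evaluated in L-algebras.\<close>

definition "res S = with_scalars S (\<lambda>c x. (c \<odot>\<^bsub>L\<^esub> \<one>\<^bsub>L\<^esub>) \<odot>\<^bsub>S\<^esub> x)"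

lemma res_simps [simp]:
  "carrier (res S) = carrier S" "monoid.mult (res S) = monoid.mult S" "one (res S) = one S"
  "zero (res S) = zero S" "add (res S) = add S" "c \<odot>\<^bsub>res S\<^esub> x = (c \<odot>\<^bsub>L\<^esub> \<one>\<^bsub>L\<^esub>) \<odot>\<^bsub>S\<^esub> x"
  by (simp_all add: res_def)

text \<open>Since \<open>L \<otimes> H\<close> is \<open>L[T]\<close>, the \<open>k\<close>-homomorphisms from \<open>H\<close> to an \<open>L\<close>-algebra \<open>S\<close> correspond to the
  elements of \<open>S\<close>; \<open>val S\<close> and \<open>pt S\<close> are the two directions. The group law becomes the polynomial \<open>F\<close>.\<close>

definition "val S x = (\<lambda>h. peval L S x (j h))"
definition "pt S \<alpha> = tensor_lift S (\<lambda>x h. (x \<odot>\<^bsub>S\<^esub> \<one>\<^bsub>S\<^esub>) \<otimes>\<^bsub>S\<^esub> \<alpha> h) (\<tau> X)"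

context
  fixes S :: "('l, 's, 'o) module_scheme"
  assumes S: "algebra L S"
begin

interpretation S: algebra L S by (rule S)

lemma res_algebra: "algebra k (res S)"
proof (rule algebra_transfer)
  show "algebra k (with_scalars S (\<lambda>c x. ((c \<odot>\<^bsub>L\<^esub> \<one>\<^bsub>L\<^esub>) \<odot>\<^bsub>S\<^esub> \<one>\<^bsub>S\<^esub>) \<otimes>\<^bsub>S\<^esub> x))"
    by (rule with_scalars_algebra[OF LA.R_cring S.M_cring])
       (use ring_hom_trans[OF algebra_unit_hom[OF L_algebra] algebra_unit_hom[OF S]] in \<open>simp add: comp_def\<close>)
qed (simp_all add: S.smult_assoc2)

lemma val_hom: "x \<in> carrier S \<Longrightarrow> val S x \<in> alg_hom k H (res S)"
proof (rule alg_homI)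
  assume x: "x \<in> carrier S"
  note e = peval_alg_hom[OF S x]
  show "val S x \<in> ring_hom H (res S)"
    using ring_hom_trans[OF j_ring_hom alg_hom_ring_hom[OF e]] by (simp add: val_def comp_def ring_hom_def)
  fix c h assume c: "c \<in> carrier k" and h: "h \<in> carrier H"
  have "peval L S x (monom (UP L) (c \<odot>\<^bsub>L\<^esub> \<one>\<^bsub>L\<^esub>) 0) = (c \<odot>\<^bsub>L\<^esub> \<one>\<^bsub>L\<^esub>) \<odot>\<^bsub>S\<^esub> \<one>\<^bsub>S\<^esub>"
    using peval_monom[OF S x, of "c \<odot>\<^bsub>L\<^esub> \<one>\<^bsub>L\<^esub>" 0] c by simp
  then show "val S x (c \<odot>\<^bsub>H\<^esub> h) = c \<odot>\<^bsub>res S\<^esub> val S x h"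
    using c h alg_hom_mult[OF e, of "monom (UP L) (c \<odot>\<^bsub>L\<^esub> \<one>\<^bsub>L\<^esub>) 0" "j h"] j_closed[OF h] alg_hom_closed[OF e]
    by (simp add: val_def j_smult S.smult_assoc2)
qed

private lemma ext:
  assumes \<alpha>: "\<alpha> \<in> alg_hom k H (res S)"
  shows "tensor_lift S (\<lambda>x h. (x \<odot>\<^bsub>S\<^esub> \<one>\<^bsub>S\<^esub>) \<otimes>\<^bsub>S\<^esub> \<alpha> h) \<in> ring_hom TL.T S"
    and "x \<in> carrier L \<Longrightarrow> h \<in> carrier H \<Longrightarrow>
      tensor_lift S (\<lambda>x h. (x \<odot>\<^bsub>S\<^esub> \<one>\<^bsub>S\<^esub>) \<otimes>\<^bsub>S\<^esub> \<alpha> h) (TL.pure x h) = (x \<odot>\<^bsub>S\<^esub> \<one>\<^bsub>S\<^esub>) \<otimes>\<^bsub>S\<^esub> \<alpha> h"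
proof -
  have u: "(\<lambda>x. x \<odot>\<^bsub>S\<^esub> \<one>\<^bsub>S\<^esub>) \<in> alg_hom k L (res S)"
    by (rule alg_hom_unit_smult[OF L_algebra res_algebra])
       (use algebra_unit_hom[OF S] in \<open>auto simp: ring_hom_def\<close>)
  note l = TL.tensor_lift_alg_hom[OF res_algebra, where P = S, OF _ _ _ _ _ u \<alpha>,
      where \<phi> = "\<lambda>x h. (x \<odot>\<^bsub>S\<^esub> \<one>\<^bsub>S\<^esub>) \<otimes>\<^bsub>S\<^esub> \<alpha> h"]
  have "tensor_lift S (\<lambda>x h. (x \<odot>\<^bsub>S\<^esub> \<one>\<^bsub>S\<^esub>) \<otimes>\<^bsub>S\<^esub> \<alpha> h) \<in> alg_hom k TL.TA (res S)" by (rule l(1)) simp_all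
  then show "tensor_lift S (\<lambda>x h. (x \<odot>\<^bsub>S\<^esub> \<one>\<^bsub>S\<^esub>) \<otimes>\<^bsub>S\<^esub> \<alpha> h) \<in> ring_hom TL.T S"
    by (simp add: alg_hom_def ring_hom_def)
  show "x \<in> carrier L \<Longrightarrow> h \<in> carrier H \<Longrightarrow>
      tensor_lift S (\<lambda>x h. (x \<odot>\<^bsub>S\<^esub> \<one>\<^bsub>S\<^esub>) \<otimes>\<^bsub>S\<^esub> \<alpha> h) (TL.pure x h) = (x \<odot>\<^bsub>S\<^esub> \<one>\<^bsub>S\<^esub>) \<otimes>\<^bsub>S\<^esub> \<alpha> h"
    using l(2)[of x h] by simp
qed

lemma pt_closed: "\<alpha> \<in> alg_hom k H (res S) \<Longrightarrow> pt S \<alpha> \<in> carrier S"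
  unfolding pt_def by (rule ring_hom_closed[OF ext(1) tau_closed]) simp_all

lemma val_pt:
  assumes \<alpha>: "\<alpha> \<in> alg_hom k H (res S)" and h: "h \<in> carrier H" shows "val S (pt S \<alpha>) h = \<alpha> h"
proof -
  let ?e = "tensor_lift S (\<lambda>x h. (x \<odot>\<^bsub>S\<^esub> \<one>\<^bsub>S\<^esub>) \<otimes>\<^bsub>S\<^esub> \<alpha> h)"
  note p = pt_closed[OF \<alpha>]
  have "(?e \<circ> \<tau>) (j h) = peval L S (pt S \<alpha>) (j h)"
  proof (rule UP_hom_eqI[OF Lg.cring_axioms S.M_cring ring_hom_trans[OF tau_hom ext(1)[OF \<alpha>]]
        alg_hom_ring_hom[OF peval_alg_hom[OF S p]] _ _ j_closed[OF h]])
    show "(?e \<circ> \<tau>) X = peval L S (pt S \<alpha>) X" using peval_T[OF S p] by (simp add: pt_def)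
    show "(?e \<circ> \<tau>) (monom (UP L) c 0) = peval L S (pt S \<alpha>) (monom (UP L) c 0)" if "c \<in> carrier L" for c
      using peval_monom[OF S p that, of 0] ext(2)[OF \<alpha> that H.one_closed] alg_hom_one[OF \<alpha>] that by (simp add: tau_const)
  qed
  moreover have "(?e \<circ> \<tau>) (j h) = \<alpha> h"
    using ext(2)[OF \<alpha> Lg.one_closed h] alg_hom_closed[OF \<alpha> h] h by (simp add: j_def tau_psi)
  ultimately show ?thesis by (simp add: val_def)
qed

text \<open>L tensor H is generated by L and H, so a homomorphism from L[T] over L is determined by
  its values on H; the point is recovered as the image of the coordinate.\<close>

lemma val_unique:
  assumes x: "x \<in> carrier S" and y: "y \<in> carrier S" and eq: "\<And>h. h \<in> carrier H \<Longrightarrow> val S x h = val S y h"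
  shows "x = y"
proof -
  note ex = alg_hom_ring_hom[OF peval_alg_hom[OF S x]] and ey = alg_hom_ring_hom[OF peval_alg_hom[OF S y]]
  have "(peval L S x \<circ> \<psi>) (\<tau> X) = (peval L S y \<circ> \<psi>) (\<tau> X)"
  proof (rule TL.tensor_hom_eqI[OF ring_hom_trans[OF psi_hom ex] ring_hom_trans[OF psi_hom ey]])
    show "(peval L S x \<circ> \<psi>) (TL.pure c \<one>\<^bsub>H\<^esub>) = (peval L S y \<circ> \<psi>) (TL.pure c \<one>\<^bsub>H\<^esub>)" if "c \<in> carrier L" for c
      using peval_monom[OF S x that, of 0] peval_monom[OF S y that, of 0] that by (simp add: psi_left)
  qed (use eq tau_closed in \<open>simp_all add: val_def j_def\<close>)
  then show ?thesis using peval_T[OF S x] peval_T[OF S y] by (simp add: psi_tau)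
qed

lemma val_natural:
  assumes S': "algebra L S'" and \<theta>: "\<theta> \<in> alg_hom L S S'" and x: "x \<in> carrier S" and h: "h \<in> carrier H"
  shows "\<theta> (val S x h) = val S' (\<theta> x) h"
  unfolding val_def by (rule alg_hom_peval[OF S S' \<theta> x j_closed[OF h]])

lemma res_hom: "\<theta> \<in> alg_hom L S S' \<Longrightarrow> \<theta> \<in> alg_hom k (res S) (res S')"
  by (auto simp: alg_hom_def ring_hom_def)

end

section \<open>The group law as a polynomial in two variables\<close>

abbreviation "\<A> \<equiv> plane L"

lemma plane_alg: "algebra L \<A>" by (rule plane_algebra[OF Lg.cring_axioms])

lemmas T12 = plane_T_closed[OF Lg.cring_axioms]

text \<open>The product of the universal pair of points. As \<open>T2\<close> is the left factor and
  the outer variable, \<open>F\<close> is right translation by \<open>T1\<close>, written as a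
  polynomial over L[T1].\<close>

definition "F = pt \<A> (conv (res \<A>) (val \<A> (plane_T2 L)) (val \<A> (plane_T1 L)))"

lemma F_closed: "F \<in> carrier \<A>"
  unfolding F_def
  by (rule pt_closed[OF plane_alg conv_hom[OF res_algebra[OF plane_alg] val_hom[OF plane_alg T12(2)] val_hom[OF plane_alg T12(1)]]])

text \<open>Every pair of points is the image of the universal pair under the evaluation
  \<open>T2\<close> to \<open>x\<close>, \<open>T1\<close> to \<open>y\<close>, and convolution is
  natural.\<close>

lemma conv_val:
  assumes S: "algebra L S" and x: "x \<in> carrier S" and y: "y \<in> carrier S" and h: "h \<in> carrier H"
  shows "conv (res S) (val S x) (val S y) h = val S (plane_eval L S y x F) h"
proof -
  let ?\<theta> = "plane_eval L S y x"
  note \<theta> = plane_eval_alg_hom[OF Lg.cring_axioms S y x]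
  note \<theta>k = res_hom[OF plane_alg \<theta>]
  note a = val_hom[OF plane_alg T12(2)] val_hom[OF plane_alg T12(1)]
  note rS = res_algebra[OF S] and rA = res_algebra[OF plane_alg]
  have "val S (?\<theta> F) h = ?\<theta> (val \<A> F h)"
    by (rule val_natural[OF plane_alg S \<theta> F_closed h, symmetric])
  also have "val \<A> F h = conv (res \<A>) (val \<A> (plane_T2 L)) (val \<A> (plane_T1 L)) h"
    unfolding F_def by (rule val_pt[OF plane_alg conv_hom[OF rA a] h])
  also have "?\<theta> \<dots> = lift2 (res S) (?\<theta> \<circ> val \<A> (plane_T2 L)) (?\<theta> \<circ> val \<A> (plane_T1 L)) (comult H h)"
    by (rule conv_natural[OF rA rS \<theta>k a h])
  also have "\<dots> = conv (res S) (?\<theta> \<circ> val \<A> (plane_T2 L)) (?\<theta> \<circ> val \<A> (plane_T1 L)) h" by (simp add: conv_def)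
  also have "\<dots> = conv (res S) (val S x) (val S y) h"
    by (rule conv_cong[OF rS alg_hom_comp[OF a(1) \<theta>k] alg_hom_comp[OF a(2) \<theta>k] val_hom[OF S x] val_hom[OF S y] _ _ h])
       (use val_natural[OF plane_alg S \<theta> T12(2)] val_natural[OF plane_alg S \<theta> T12(1)]
         plane_eval_T1[OF Lg.cring_axioms S y x] plane_eval_T2[OF Lg.cring_axioms S y x] in simp_all)
  finally show ?thesis by simp
qed

lemma val_UP_X: "h \<in> carrier H \<Longrightarrow> val (UP L) X h = j h"
proof -
  assume h: "h \<in> carrier H"
  have UA: "algebra L (UP L)" by (rule UP_algebra[OF Lg.cring_axioms])
  have X: "X \<in> carrier (UP L)" by simp
  have "peval L (UP L) X (j h) = id (j h)"
    by (rule UP_alg_hom_eqI[OF UA peval_alg_hom[OF UA X] alg_hom_id _ j_closed[OF h]]) (use peval_T[OF UA X] in simp)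
  then show ?thesis by (simp add: val_def)
qed

text \<open>In terms of the coordinate, right translation by the generic point \<open>T\<^sub>1\<close> composed with right
  translation by its inverse is the identity. So right translation is a polynomial of degree one,
  whose leading coefficient is a unit of \<open>L[T\<^sub>1]\<close>.\<close>

lemma F_affine: "\<exists>a\<in>carrier L. \<exists>b\<in>carrier (UP L). F = monom (UP (UP L)) (monom (UP L) a 0) 1 \<oplus>\<^bsub>UP (UP L)\<^esub> monom (UP (UP L)) b 0"
proof -
  have UA: "algebra L (UP L)" by (rule UP_algebra[OF Lg.cring_axioms])
  note rA = res_algebra[OF plane_alg] and rU = res_algebra[OF UA]
  let ?c = "\<lambda>P. monom (UP (UP L)) P 0"
  note c = plane_const_alg_hom[OF Lg.cring_axioms]
  have X: "X \<in> carrier (UP L)" by simp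
  have cX: "?c X = plane_T1 L" by (simp add: plane_T1_def)
  have jS: "val (UP L) X \<circ> antipode H \<in> alg_hom k H (res (UP L))"
    by (rule alg_hom_comp[OF antipode_hom val_hom[OF UA X]])
  \<comment> \<open>The inverse of the generic point \<open>T1\<close>; being a point over L[T1], it
    is a polynomial in \<open>T1\<close> alone.\<close>
  define i where "i = pt (UP L) (val (UP L) X \<circ> antipode H)"
  have i: "i \<in> carrier (UP L)" unfolding i_def by (rule pt_closed[OF UA jS])
  have ci: "?c i \<in> carrier \<A>" by (rule alg_hom_closed[OF c i])
  note aT2 = val_hom[OF plane_alg T12(2)] and aT1 = val_hom[OF plane_alg T12(1)] and aci = val_hom[OF plane_alg ci]
  \<comment> \<open>The product of \<open>T2\<close> with the inverse of \<open>T1\<close>, that is,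
    the translation inverse to \<open>F\<close>.\<close>
  define Q where "Q = plane_eval L \<A> (?c i) (plane_T2 L) F"
  have Q: "Q \<in> carrier \<A>"
    unfolding Q_def by (rule alg_hom_closed[OF plane_eval_alg_hom[OF Lg.cring_axioms plane_alg ci T12(2)] F_closed])
  have inv: "val \<A> (?c i) h = (val \<A> (plane_T1 L) \<circ> antipode H) h" if h: "h \<in> carrier H" for h
  proof -
    have Sh: "antipode H h \<in> carrier H" by (rule alg_hom_closed[OF antipode_hom h])
    have "val \<A> (?c i) h = ?c (val (UP L) i h)" by (rule val_natural[OF UA plane_alg c i h, symmetric])
    also have "val (UP L) i h = val (UP L) X (antipode H h)"
      unfolding i_def using val_pt[OF UA jS h] by simp
    also have "?c \<dots> = val \<A> (?c X) (antipode H h)" by (rule val_natural[OF UA plane_alg c X Sh])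
    finally show ?thesis by (simp only: cX comp_apply)
  qed
  \<comment> \<open>Multiplying \<open>Q\<close> on the right by \<open>T1\<close> returns
    \<open>T2\<close>: reassociate, cancel the inverse, and drop the unit.\<close>
  have "val \<A> (plane_eval L \<A> (plane_T1 L) Q F) h = val \<A> (plane_T2 L) h" if h: "h \<in> carrier H" for h
  proof -
    let ?u = "\<lambda>h. counit H h \<odot>\<^bsub>res \<A>\<^esub> \<one>\<^bsub>res \<A>\<^esub>"
    have "val \<A> (plane_eval L \<A> (plane_T1 L) Q F) h = conv (res \<A>) (val \<A> Q) (val \<A> (plane_T1 L)) h"
      by (rule conv_val[OF plane_alg Q T12(1) h, symmetric])
    also have "\<dots> = conv (res \<A>) (conv (res \<A>) (val \<A> (plane_T2 L)) (val \<A> (?c i))) (val \<A> (plane_T1 L)) h"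
      by (rule conv_cong[OF rA val_hom[OF plane_alg Q] aT1 conv_hom[OF rA aT2 aci] aT1 _ refl h])
         (use conv_val[OF plane_alg T12(2) ci] in \<open>simp add: Q_def\<close>)
    also have "\<dots> = conv (res \<A>) (val \<A> (plane_T2 L)) (conv (res \<A>) (val \<A> (?c i)) (val \<A> (plane_T1 L))) h"
      by (rule conv_assoc[OF rA aT2 aci aT1 h])
    also have "\<dots> = conv (res \<A>) (val \<A> (plane_T2 L)) ?u h"
    proof (rule conv_cong[OF rA aT2 conv_hom[OF rA aci aT1] aT2 unit_pt_hom[OF rA] refl _ h])
      fix h assume h: "h \<in> carrier H"
      have "conv (res \<A>) (val \<A> (?c i)) (val \<A> (plane_T1 L)) h =
          conv (res \<A>) (val \<A> (plane_T1 L) \<circ> antipode H) (val \<A> (plane_T1 L)) h"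
        by (rule conv_cong[OF rA aci aT1 alg_hom_comp[OF antipode_hom aT1] aT1 inv refl h])
      also have "\<dots> = ?u h" by (rule conv_antipode[OF rA aT1 h])
      finally show "conv (res \<A>) (val \<A> (?c i)) (val \<A> (plane_T1 L)) h = ?u h" .
    qed
    also have "\<dots> = val \<A> (plane_T2 L) h" by (rule conv_unit(1)[OF rA aT2 h])
    finally show ?thesis .
  qed
  then have comp: "plane_eval L \<A> (plane_T1 L) Q F = plane_T2 L"
    by (rule val_unique[OF plane_alg alg_hom_closed[OF plane_eval_alg_hom[OF Lg.cring_axioms plane_alg T12(1) Q] F_closed] T12(2)])
  have Q': "Q \<in> carrier (UP (UP L))" and F': "F \<in> carrier (UP (UP L))" using Q F_closed by simp_all
  interpret UU: UP_cring "UP L" "UP (UP L)" by (rule UP_cringI[OF UL.UP_cring]) simp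
  \<comment> \<open>Since \<open>T1\<close> is kept fixed, the evaluation in two variables is
    composition of polynomials in the outer variable over L[T1], as \<open>UP_comp_eq_X\<close>
    requires.\<close>
  have "eval (UP L) (UP (UP L)) ?c Q F = plane_eval L \<A> (plane_T1 L) Q F"
  proof (rule UP_hom_eqI[OF UL.UP_cring UU.UP_cring eval_hom[OF UL.UP_cring UU.UP_cring UU.const_ring_hom Q'] _ _ _ F'])
    note pe = plane_eval_alg_hom[OF Lg.cring_axioms plane_alg T12(1) Q]
    show "plane_eval L \<A> (plane_T1 L) Q \<in> ring_hom (UP (UP L)) (UP (UP L))"
      using alg_hom_ring_hom[OF pe] by (simp add: ring_hom_def)
    show "eval (UP L) (UP (UP L)) ?c Q (?c P) = plane_eval L \<A> (plane_T1 L) Q (?c P)" if P: "P \<in> carrier (UP L)" for P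
      using eval_of_const[OF UL.UP_cring UU.UP_cring UU.const_ring_hom Q' P]
        plane_eval_const[OF Lg.cring_axioms plane_alg T12(1) Q P] plane_const_peval[OF Lg.cring_axioms P] by simp
    show "eval (UP L) (UP (UP L)) ?c Q (monom (UP (UP L)) \<one>\<^bsub>UP L\<^esub> 1) = plane_eval L \<A> (plane_T1 L) Q (monom (UP (UP L)) \<one>\<^bsub>UP L\<^esub> 1)"
      using eval_of_T[OF UL.UP_cring UU.UP_cring UU.const_ring_hom Q'] plane_eval_T2[OF Lg.cring_axioms plane_alg T12(1) Q]
      by (simp add: plane_T2_def)
  qed
  then have "eval (UP L) (UP (UP L)) ?c Q F = monom (UP (UP L)) \<one>\<^bsub>UP L\<^esub> 1" using comp by (simp add: plane_T2_def)
  from ULD.UP_comp_eq_X[OF F' Q' this] obtain a b where ab: "a \<in> Units (UP L)" "b \<in> carrier (UP L)"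
    "F = monom (UP (UP L)) a 1 \<oplus>\<^bsub>UP (UP L)\<^esub> monom (UP (UP L)) b 0" by blast
  from LD.UP_unit_const[OF ab(1)] show ?thesis using ab by blast
qed

end

text \<open>The coordinate vanishes at the unit element: the counit is evaluation at zero.\<close>

locale centered_hopf_form = hopf_form k Gk L GL p n r H GH \<psi>
  for k :: "('k, 'm) ring_scheme" and Gk and L :: "('k, 'l) module" and GL p n r
    and H :: "('k, 'h) hopf" and GH \<psi> +
  assumes centered: "\<And>h. h \<in> carrier H \<Longrightarrow> coeff (UP L) (j h) 0 = counit H h \<odot>\<^bsub>L\<^esub> \<one>\<^bsub>L\<^esub>"
begin

lemma val_zero:
  assumes S: "algebra L S" and h: "h \<in> carrier H"
  shows "val S \<zero>\<^bsub>S\<^esub> h = counit H h \<odot>\<^bsub>res S\<^esub> \<one>\<^bsub>res S\<^esub>"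
proof -
  interpret S: algebra L S by (rule S)
  have "peval L S \<zero>\<^bsub>S\<^esub> P = coeff (UP L) P 0 \<odot>\<^bsub>S\<^esub> \<one>\<^bsub>S\<^esub>" if P: "P \<in> carrier (UP L)" for P
    using Lg.cring_axioms P
  proof (induction P rule: UP_induct)
    case (monom c i)
    then show ?case using peval_monom[OF S S.M.zero_closed, of c i] by (cases i) (auto simp: S.nat_pow_zero)
  next
    case (add f g)
    then show ?case using alg_hom_add[OF peval_alg_hom[OF S S.M.zero_closed], of f g] by (simp add: S.smult_l_distr)
  qed
  then show ?thesis using j_closed[OF h] centered[OF h] by (simp add: val_def)
qed

text \<open>\<open>F\<close> has the form \<open>a * T2 + b(T1)\<close>. Multiplying the neutral
  point by \<open>T1\<close> gives \<open>b(T1) = T1\<close>; multiplying \<open>T2\<close> by the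
  neutral point then gives \<open>a * T2 = T2\<close>.\<close>

lemma F_eq: "F = plane_T2 L \<oplus>\<^bsub>\<A>\<^esub> plane_T1 L"
proof -
  interpret UU: UP_cring "UP L" "UP (UP L)" by (rule UP_cringI[OF UL.UP_cring]) simp
  interpret A: algebra L \<A> by (rule plane_alg)
  note rA = res_algebra[OF plane_alg]
  note aT2 = val_hom[OF plane_alg T12(2)] and aT1 = val_hom[OF plane_alg T12(1)]
  have z: "\<zero>\<^bsub>\<A>\<^esub> \<in> carrier \<A>" by (rule A.M.zero_closed)
  obtain a b where ab: "a \<in> carrier L" "b \<in> carrier (UP L)"
    and F: "F = monom (UP (UP L)) (monom (UP L) a 0) 1 \<oplus>\<^bsub>UP (UP L)\<^esub> monom (UP (UP L)) b 0" using F_affine by blast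
  have ev: "plane_eval L \<A> y x F = a \<odot>\<^bsub>\<A>\<^esub> x \<oplus>\<^bsub>\<A>\<^esub> peval L \<A> y b" if xy: "x \<in> carrier \<A>" "y \<in> carrier \<A>" for x y
  proof -
    note pe = plane_eval_alg_hom[OF Lg.cring_axioms plane_alg xy(2,1)]
    have "monom (UP (UP L)) (monom (UP L) a 0) 1 = a \<odot>\<^bsub>\<A>\<^esub> plane_T2 L"
      using ab by (simp add: plane_T2_def plane_smult[OF Lg.cring_axioms] del: UU.monom_mult flip: UU.monom_mult)
    then have "plane_eval L \<A> y x (monom (UP (UP L)) (monom (UP L) a 0) 1) = a \<odot>\<^bsub>\<A>\<^esub> x"
      using alg_hom_smult[OF pe ab(1) T12(2)] plane_eval_T2[OF Lg.cring_axioms plane_alg xy(2,1)] by simp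
    then show ?thesis
      using alg_hom_add[OF pe, of "monom (UP (UP L)) (monom (UP L) a 0) 1" "monom (UP (UP L)) b 0"] ab
        plane_eval_const[OF Lg.cring_axioms plane_alg xy(2,1) ab(2)] by (simp add: F)
  qed
  have c: "plane_eval L \<A> y x F \<in> carrier \<A>" if xy: "x \<in> carrier \<A>" "y \<in> carrier \<A>" for x y
    by (rule alg_hom_closed[OF plane_eval_alg_hom[OF Lg.cring_axioms plane_alg xy(2,1)] F_closed])
  have u: "val \<A> \<zero>\<^bsub>\<A>\<^esub> h = counit H h \<odot>\<^bsub>res \<A>\<^esub> \<one>\<^bsub>res \<A>\<^esub>" if "h \<in> carrier H" for h
    by (rule val_zero[OF plane_alg that])
  have "plane_eval L \<A> (plane_T1 L) \<zero>\<^bsub>\<A>\<^esub> F = plane_T1 L"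
  proof (rule val_unique[OF plane_alg c[OF z T12(1)] T12(1)])
    fix h assume h: "h \<in> carrier H"
    have "conv (res \<A>) (val \<A> \<zero>\<^bsub>\<A>\<^esub>) (val \<A> (plane_T1 L)) h =
        conv (res \<A>) (\<lambda>h. counit H h \<odot>\<^bsub>res \<A>\<^esub> \<one>\<^bsub>res \<A>\<^esub>) (val \<A> (plane_T1 L)) h"
      by (rule conv_cong[OF rA val_hom[OF plane_alg z] aT1 unit_pt_hom[OF rA] aT1 u refl h])
    then show "val \<A> (plane_eval L \<A> (plane_T1 L) \<zero>\<^bsub>\<A>\<^esub> F) h = val \<A> (plane_T1 L) h"
      using conv_val[OF plane_alg z T12(1) h] conv_unit(2)[OF rA aT1 h] by simp
  qed
  then have "peval L \<A> (plane_T1 L) b = plane_T1 L"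
    using ev[OF z T12(1)] ab alg_hom_closed[OF peval_alg_hom[OF plane_alg T12(1)] ab(2)] A.smult_r_null[OF ab(1)] by simp
  then have "monom (UP (UP L)) b 0 = plane_T1 L" using plane_const_peval[OF Lg.cring_axioms ab(2)] by simp
  then have b: "b = X" unfolding plane_T1_def using UU.monom_inj[of 0] ab(2) by (auto simp: inj_on_def)
  have "plane_eval L \<A> \<zero>\<^bsub>\<A>\<^esub> (plane_T2 L) F = plane_T2 L"
  proof (rule val_unique[OF plane_alg c[OF T12(2) z] T12(2)])
    fix h assume h: "h \<in> carrier H"
    have "conv (res \<A>) (val \<A> (plane_T2 L)) (val \<A> \<zero>\<^bsub>\<A>\<^esub>) h =
        conv (res \<A>) (val \<A> (plane_T2 L)) (\<lambda>h. counit H h \<odot>\<^bsub>res \<A>\<^esub> \<one>\<^bsub>res \<A>\<^esub>) h"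
      by (rule conv_cong[OF rA aT2 val_hom[OF plane_alg z] aT2 unit_pt_hom[OF rA] refl u h])
    then show "val \<A> (plane_eval L \<A> \<zero>\<^bsub>\<A>\<^esub> (plane_T2 L) F) h = val \<A> (plane_T2 L) h"
      using conv_val[OF plane_alg T12(2) z h] conv_unit(1)[OF rA aT2 h] by simp
  qed
  then have "a \<odot>\<^bsub>\<A>\<^esub> plane_T2 L = plane_T2 L"
    using ev[OF T12(2) z] ab(1) T12(2) peval_T[OF plane_alg z] A.smult_closed[OF ab(1) T12(2)] unfolding b by simp
  then have "monom (UP (UP L)) (monom (UP L) a 0) 1 = plane_T2 L"
    using ab by (simp add: plane_T2_def plane_smult[OF Lg.cring_axioms] del: UU.monom_mult flip: UU.monom_mult)
  then show ?thesis using F b by (simp add: plane_T1_def)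
qed

lemma conv_val_add:
  assumes S: "algebra L S" and x: "x \<in> carrier S" and y: "y \<in> carrier S" and h: "h \<in> carrier H"
  shows "conv (res S) (val S x) (val S y) h = val S (x \<oplus>\<^bsub>S\<^esub> y) h"
  using conv_val[OF S x y h] alg_hom_add[OF plane_eval_alg_hom[OF Lg.cring_axioms S y x] T12(2,1)]
    plane_eval_T1[OF Lg.cring_axioms S y x] plane_eval_T2[OF Lg.cring_axioms S y x] by (simp add: F_eq)

end

lemma (in abelian_group) add_absorbD: "x = a \<oplus> x \<Longrightarrow> x \<in> carrier G \<Longrightarrow> a \<in> carrier G \<Longrightarrow> a = \<zero>"
  using add.r_cancel_one' by blast

section \<open>Additive polynomials in characteristic p\<close>

context root_ext
begin

lemma coeff_add_pow: "P \<in> carrier (UP L) \<Longrightarrow> coeff (UP L) ([N] \<cdot>\<^bsub>UP L\<^esub> P) i = [(N::nat)] \<cdot>\<^bsub>L\<^esub> coeff (UP L) P i"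
  by (induction N) auto

text \<open>Comparing coefficients of mixed monomials shows that every inner binomial coefficient of
  \<open>i\<close> annihilates the i-th coefficient. If \<open>i\<close> is positive and not a power
  of \<open>p\<close>, one of these binomials is prime to \<open>p\<close>.\<close>

lemma additive_coeff:
  assumes P: "P \<in> carrier (UP L)"
    and add: "peval L (plane L) (plane_T2 L \<oplus>\<^bsub>plane L\<^esub> plane_T1 L) P =
      peval L (plane L) (plane_T2 L) P \<oplus>\<^bsub>plane L\<^esub> peval L (plane L) (plane_T1 L) P"
    and i: "coeff (UP L) P i \<noteq> \<zero>\<^bsub>L\<^esub>"
  shows "\<exists>a. i = p ^ a"
proof -
  interpret UU: UP_cring "UP L" "UP (UP L)" by (rule UP_cringI[OF UL.UP_cring]) simp
  have PA: "algebra L (plane L)" by (rule plane_algebra[OF Lg.cring_axioms])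
  interpret A: algebra L "plane L" by (rule PA)
  note T12 = plane_T_closed[OF Lg.cring_axioms]
  let ?T = "plane_T2 L \<oplus>\<^bsub>plane L\<^esub> plane_T1 L"
  have T: "?T \<in> carrier (plane L)" using T12 by (rule A.M.a_closed[rotated])
  \<comment> \<open>\<open>K a b\<close> extracts the coefficient of
    \<open>T2^a * T1^b\<close>.\<close>
  define K where "K a b Q = coeff (UP L) (coeff (UP (UP L)) Q a) b" for a b Q
  have K_add: "K a b (Q \<oplus>\<^bsub>plane L\<^esub> Q') = K a b Q \<oplus>\<^bsub>L\<^esub> K a b Q'"
    if "Q \<in> carrier (plane L)" "Q' \<in> carrier (plane L)" for a b Q Q' using that by (simp add: K_def)
  have K_closed: "K a b Q \<in> carrier L" if "Q \<in> carrier (plane L)" for a b Q using that by (simp add: K_def)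
  have K_sum: "K a b (finsum (plane L) g I) = (\<Oplus>\<^bsub>L\<^esub>x\<in>I. K a b (g x))"
    if "finite I" "\<And>x. x \<in> I \<Longrightarrow> g x \<in> carrier (plane L)" for a b and I :: "nat set" and g
    using that
  proof (induction I rule: finite_induct)
    case empty
    then show ?case by (simp add: K_def)
  next
    case (insert x I)
    have "finsum (plane L) g (insert x I) = g x \<oplus>\<^bsub>plane L\<^esub> finsum (plane L) g I"
      by (rule A.M.finsum_insert) (use insert in auto)
    moreover have "finsum (plane L) g I \<in> carrier (plane L)" by (rule A.M.finsum_closed) (use insert in auto)
    moreover have "(\<Oplus>\<^bsub>L\<^esub>x\<in>insert x I. K a b (g x)) = K a b (g x) \<oplus>\<^bsub>L\<^esub> (\<Oplus>\<^bsub>L\<^esub>x\<in>I. K a b (g x))"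
      by (rule Lg.finsum_insert) (use insert K_closed in auto)
    ultimately show ?case using insert K_add by simp
  qed
  have coeff_pow: "coeff (UP (UP L)) ([N] \<cdot>\<^bsub>UP (UP L)\<^esub> Q) a = [N] \<cdot>\<^bsub>UP L\<^esub> coeff (UP (UP L)) Q a"
    if "Q \<in> carrier (UP (UP L))" for N :: nat and Q a using that by (induction N) auto
  have K_term: "K a b (c \<odot>\<^bsub>plane L\<^esub> ([N] \<cdot>\<^bsub>plane L\<^esub> (plane_T2 L [^]\<^bsub>plane L\<^esub> l \<otimes>\<^bsub>plane L\<^esub> plane_T1 L [^]\<^bsub>plane L\<^esub> l'))) =
      (if l = a \<and> l' = b then [N] \<cdot>\<^bsub>L\<^esub> c else \<zero>\<^bsub>L\<^esub>)" if c: "c \<in> carrier L" for a b c l l' and N :: nat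
  proof -
    have pw: "Q [^]\<^bsub>plane L\<^esub> (d::nat) = Q [^]\<^bsub>UP (UP L)\<^esub> d" for Q d by (rule nat_pow_transfer) simp_all
    have ap: "[N] \<cdot>\<^bsub>plane L\<^esub> Q = [N] \<cdot>\<^bsub>UP (UP L)\<^esub> Q" for Q
      by (simp add: add_pow_def nat_pow_def)
    have m: "plane_T2 L [^]\<^bsub>plane L\<^esub> l \<otimes>\<^bsub>plane L\<^esub> plane_T1 L [^]\<^bsub>plane L\<^esub> l' = monom (UP (UP L)) (monom (UP L) \<one>\<^bsub>L\<^esub> l') l"
      unfolding pw by (simp add: plane_T1_def plane_T2_def UU.monom_pow UL.monom_pow del: UU.monom_mult flip: UU.monom_mult)
    have "c \<odot>\<^bsub>plane L\<^esub> Q = monom (UP (UP L)) (monom (UP L) c 0) 0 \<otimes>\<^bsub>UP (UP L)\<^esub> Q" if "Q \<in> carrier (UP (UP L))" for Q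
      by (rule plane_smult[OF Lg.cring_axioms c that])
    then have "K a b (c \<odot>\<^bsub>plane L\<^esub> ([N] \<cdot>\<^bsub>plane L\<^esub> monom (UP (UP L)) (monom (UP L) \<one>\<^bsub>L\<^esub> l') l)) =
        c \<otimes>\<^bsub>L\<^esub> K a b ([N] \<cdot>\<^bsub>UP (UP L)\<^esub> monom (UP (UP L)) (monom (UP L) \<one>\<^bsub>L\<^esub> l') l)"
      using c by (simp add: ap K_def UU.monom_mult_is_smult UL.monom_mult_is_smult)
    also have "K a b ([N] \<cdot>\<^bsub>UP (UP L)\<^esub> monom (UP (UP L)) (monom (UP L) \<one>\<^bsub>L\<^esub> l') l) = [N] \<cdot>\<^bsub>L\<^esub> (if l = a \<and> l' = b then \<one>\<^bsub>L\<^esub> else \<zero>\<^bsub>L\<^esub>)"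
      by (simp add: K_def coeff_pow coeff_add_pow)
    also have "c \<otimes>\<^bsub>L\<^esub> \<dots> = (if l = a \<and> l' = b then [N] \<cdot>\<^bsub>L\<^esub> c else \<zero>\<^bsub>L\<^esub>)"
      using c Lg.add_pow_rdistr[of c "\<one>\<^bsub>L\<^esub>" N] by simp
    finally show ?thesis by (simp only: m)
  qed
  have K1: "K a b (peval L (plane L) ?T Q) = [((a + b) choose a)] \<cdot>\<^bsub>L\<^esub> coeff (UP L) Q (a + b)"
    if Q: "Q \<in> carrier (UP L)" for a b Q
    using Lg.cring_axioms Q
  proof (induction Q rule: UP_induct)
    case (monom c i)
    let ?t = "\<lambda>l. [(i choose l)] \<cdot>\<^bsub>plane L\<^esub> (plane_T2 L [^]\<^bsub>plane L\<^esub> l \<otimes>\<^bsub>plane L\<^esub> plane_T1 L [^]\<^bsub>plane L\<^esub> (i - l))"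
    have tc: "?t l \<in> carrier (plane L)" for l using T12 by (intro A.add.nat_pow_closed A.m_closed A.nat_pow_closed)
    have "peval L (plane L) ?T (monom (UP L) c i) = c \<odot>\<^bsub>plane L\<^esub> (\<Oplus>\<^bsub>plane L\<^esub>l\<in>{..i}. ?t l)"
      unfolding peval_monom[OF PA T monom] A.binomial[OF T12(2,1)] ..
    then have pv: "peval L (plane L) ?T (monom (UP L) c i) = (\<Oplus>\<^bsub>plane L\<^esub>l\<in>{..i}. c \<odot>\<^bsub>plane L\<^esub> ?t l)"
      using A.finsum_smult_ldistr[of "{..i}" c ?t] monom tc by simp
    have "K a b (peval L (plane L) ?T (monom (UP L) c i)) = (\<Oplus>\<^bsub>L\<^esub>l\<in>{..i}. K a b (c \<odot>\<^bsub>plane L\<^esub> ?t l))"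
      unfolding pv by (rule K_sum) (use A.smult_closed[OF monom tc] in auto)
    also have "\<dots> = (\<Oplus>\<^bsub>L\<^esub>l\<in>{..i}. if a = l then (if i - a = b then [(i choose a)] \<cdot>\<^bsub>L\<^esub> c else \<zero>\<^bsub>L\<^esub>) else \<zero>\<^bsub>L\<^esub>)"
      by (rule Lg.finsum_cong') (use monom K_term in auto)
    also have "\<dots> = (if i = a + b then [(i choose a)] \<cdot>\<^bsub>L\<^esub> c else \<zero>\<^bsub>L\<^esub>)"
    proof (cases "a \<le> i")
      case True
      then show ?thesis
        using monom Lg.finsum_singleton[of a "{..i}" "\<lambda>_. if i - a = b then [(i choose a)] \<cdot>\<^bsub>L\<^esub> c else \<zero>\<^bsub>L\<^esub>"] by auto
    next
      case False
      then show ?thesis by (auto intro!: Lg.add.finprod_one_eqI)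
    qed
    finally show ?case using monom by simp
  next
    case (add f g)
    note pe = peval_alg_hom[OF PA T]
    have "coeff (UP L) f (a + b) \<in> carrier L" "coeff (UP L) g (a + b) \<in> carrier L" using add by auto
    from Lg.add.nat_pow_distrib[OF this] show ?case
      using add alg_hom_add[OF pe add(1,2)] K_add[OF alg_hom_closed[OF pe add(1)] alg_hom_closed[OF pe add(2)]] by simp
  qed
  have K2: "K a b (peval L (plane L) (plane_T2 L) Q) = (if b = 0 then coeff (UP L) Q a else \<zero>\<^bsub>L\<^esub>)"
    if Q: "Q \<in> carrier (UP L)" for a b Q
    using Lg.cring_axioms Q
  proof (induction Q rule: UP_induct)
    case (monom c i)
    have one: "plane_T2 L [^]\<^bsub>plane L\<^esub> i = [(1::nat)] \<cdot>\<^bsub>plane L\<^esub> (plane_T2 L [^]\<^bsub>plane L\<^esub> i \<otimes>\<^bsub>plane L\<^esub> plane_T1 L [^]\<^bsub>plane L\<^esub> (0::nat))"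
      using A.nat_pow_closed[OF T12(2), of i] A.r_one[OF A.nat_pow_closed[OF T12(2), of i]] by simp
    show ?case
      unfolding peval_monom[OF PA T12(2) monom] by (subst one, subst K_term[OF monom]) (use monom in auto)
  next
    case (add f g)
    note pe = peval_alg_hom[OF PA T12(2)]
    show ?case
      using add alg_hom_add[OF pe add(1,2)] K_add[OF alg_hom_closed[OF pe add(1)] alg_hom_closed[OF pe add(2)]] by simp
  qed
  have K3: "K a b (peval L (plane L) (plane_T1 L) Q) = (if a = 0 then coeff (UP L) Q b else \<zero>\<^bsub>L\<^esub>)"
    if Q: "Q \<in> carrier (UP L)" for a b Q
    using Q unfolding plane_const_peval[OF Lg.cring_axioms Q, symmetric] by (simp add: K_def)
  have eq: "[((a + b) choose a)] \<cdot>\<^bsub>L\<^esub> coeff (UP L) P (a + b) =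
      (if b = 0 then coeff (UP L) P a else \<zero>\<^bsub>L\<^esub>) \<oplus>\<^bsub>L\<^esub> (if a = 0 then coeff (UP L) P b else \<zero>\<^bsub>L\<^esub>)" for a b
    using K1[OF P, of a b] K2[OF P, of a b] K3[OF P, of a b] add
      K_add[OF alg_hom_closed[OF peval_alg_hom[OF PA T12(2)] P] alg_hom_closed[OF peval_alg_hom[OF PA T12(1)] P], of a b] by simp
  have c: "coeff (UP L) P l \<in> carrier L" for l using P by simp
  show ?thesis
  proof (rule ccontr)
    assume n: "\<nexists>a. i = p ^ a"
    show False
    proof (cases "i = 0")
      case True
      \<comment> \<open>The exponent zero is excluded separately: at \<open>a = b = 0\<close>
        additivity says that the constant term equals its double.\<close>
      have "coeff (UP L) P 0 = coeff (UP L) P 0 \<oplus>\<^bsub>L\<^esub> coeff (UP L) P 0" using eq[of 0 0] c[of 0] by simp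
      then show False using i True c[of 0] Lg.add.l_cancel_one[of "coeff (UP L) P 0" "coeff (UP L) P 0"] by simp
    next
      case False
      then obtain a b where ab: "a > 0" "b > 0" "a + b = i" "\<not> p dvd (i choose a)"
        using not_prime_power_choose[OF p, of i] n by auto
      then have "[(i choose a)] \<cdot>\<^bsub>L\<^esub> coeff (UP L) P i = \<zero>\<^bsub>L\<^esub>" using eq[of a b] by simp
      then have "([(i choose a)] \<cdot>\<^bsub>L\<^esub> \<one>\<^bsub>L\<^esub>) \<otimes>\<^bsub>L\<^esub> coeff (UP L) P i = \<zero>\<^bsub>L\<^esub>" using c by (simp add: Lg.add_pow_ldistr)
      then have z: "[(i choose a)] \<cdot>\<^bsub>L\<^esub> \<one>\<^bsub>L\<^esub> = \<zero>\<^bsub>L\<^esub>" 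
        using i LD.integral[OF _ Lg.add.nat_pow_closed[OF Lg.one_closed] c] by blast
      \<comment> \<open>The divisibility assumption concerns k, so multiples of one in L are pulled
        back along the injection of k.\<close>
      have "[(N::nat)] \<cdot>\<^bsub>L\<^esub> \<one>\<^bsub>L\<^esub> = ([N] \<cdot>\<^bsub>k\<^esub> \<one>\<^bsub>k\<^esub>) \<odot>\<^bsub>L\<^esub> \<one>\<^bsub>L\<^esub>" for N
        by (induction N) (simp_all add: LA.smult_l_distr)
      then have "([(i choose a)] \<cdot>\<^bsub>k\<^esub> \<one>\<^bsub>k\<^esub>) \<odot>\<^bsub>L\<^esub> \<one>\<^bsub>L\<^esub> = \<zero>\<^bsub>k\<^esub> \<odot>\<^bsub>L\<^esub> \<one>\<^bsub>L\<^esub>" using z by simp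
      then have "[(i choose a)] \<cdot>\<^bsub>k\<^esub> \<one>\<^bsub>k\<^esub> = \<zero>\<^bsub>k\<^esub>"
        by (rule inj_onD[OF graded_field_unit_inj[OF kF L_alg LD.one_not_zero]]) simp_all
      then show False using char_dvd ab by blast
    qed
  qed
qed

end

section \<open>Expansions of the coordinate and its q-th power\<close>

context hopf_form
begin

text \<open>The left factors themselves serve as indices: terms with the same left factor are merged
  by adding the right factors, and the number of terms is the cardinality of a set.\<close>

definition "expansion t \<Lambda> h \<longleftrightarrow> finite \<Lambda> \<and> (\<forall>x\<in>\<Lambda>. \<exists>\<gamma>>0. x \<in> GL \<gamma>) \<and> (\<forall>x\<in>\<Lambda>. h x \<in> carrier H) \<and>
   t = (\<Oplus>\<^bsub>TL.T\<^esub>x\<in>\<Lambda>. TL.pure x (h x))"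

lemma expansionD:
  assumes "expansion t \<Lambda> h"
  shows "finite \<Lambda>" "\<And>x. x \<in> \<Lambda> \<Longrightarrow> \<exists>\<gamma>>0. x \<in> GL \<gamma>" "\<And>x. x \<in> \<Lambda> \<Longrightarrow> h x \<in> carrier H"
    "t = (\<Oplus>\<^bsub>TL.T\<^esub>x\<in>\<Lambda>. TL.pure x (h x))" "\<And>x. x \<in> \<Lambda> \<Longrightarrow> x \<in> carrier L"
  using assms Lg.G_carrier by (auto simp: expansion_def)

lemma expansion_exists: "t \<in> carrier TL.T \<Longrightarrow> \<exists>\<Lambda> h. expansion t \<Lambda> h"
proof (induction t rule: TL.tensor_graded_induct)
  case (pure x y \<alpha> \<beta>)
  then have "expansion (TL.pure x y) {x} (\<lambda>_. y)"
    using Lg.G_carrier[of \<alpha> x] GH.G_carrier[of \<beta> y] by (auto simp: expansion_def)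
  then show ?case by blast
next
  case (add s t)
  then obtain \<Lambda> h \<Lambda>' h' where e: "expansion s \<Lambda> h" "expansion t \<Lambda>' h'" by blast
  note E = expansionD[OF e(1)] and E' = expansionD[OF e(2)]
  \<comment> \<open>Padding by zero brings both expansions to the union of the index sets.\<close>
  let ?h = "\<lambda>x. if x \<in> \<Lambda> then h x else \<zero>\<^bsub>H\<^esub>" and ?h' = "\<lambda>x. if x \<in> \<Lambda>' then h' x else \<zero>\<^bsub>H\<^esub>"
  have hc: "?h x \<in> carrier H" "?h' x \<in> carrier H" for x using E(3) E'(3) by auto
  have L: "x \<in> carrier L" if "x \<in> \<Lambda> \<union> \<Lambda>'" for x using that E(5) E'(5) by auto
  have "s = (\<Oplus>\<^bsub>TL.T\<^esub>x\<in>\<Lambda> \<union> \<Lambda>'. TL.pure x (?h x))"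
    unfolding E(4) by (rule TL.T.add.finprod_mono_neutral_cong_left) (use E E' L in \<open>auto simp: TL.pure_zero_right\<close>)
  moreover have "t = (\<Oplus>\<^bsub>TL.T\<^esub>x\<in>\<Lambda> \<union> \<Lambda>'. TL.pure x (?h' x))"
    unfolding E'(4) by (rule TL.T.add.finprod_mono_neutral_cong_left) (use E E' L in \<open>auto simp: TL.pure_zero_right\<close>)
  moreover have "(\<Oplus>\<^bsub>TL.T\<^esub>x\<in>\<Lambda> \<union> \<Lambda>'. TL.pure x (?h x) \<oplus>\<^bsub>TL.T\<^esub> TL.pure x (?h' x)) =
      (\<Oplus>\<^bsub>TL.T\<^esub>x\<in>\<Lambda> \<union> \<Lambda>'. TL.pure x (?h x)) \<oplus>\<^bsub>TL.T\<^esub> (\<Oplus>\<^bsub>TL.T\<^esub>x\<in>\<Lambda> \<union> \<Lambda>'. TL.pure x (?h' x))"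
    by (rule TL.T.finsum_addf) (use hc L in blast)+
  moreover have "(\<Oplus>\<^bsub>TL.T\<^esub>x\<in>\<Lambda> \<union> \<Lambda>'. TL.pure x (?h x \<oplus>\<^bsub>H\<^esub> ?h' x)) =
      (\<Oplus>\<^bsub>TL.T\<^esub>x\<in>\<Lambda> \<union> \<Lambda>'. TL.pure x (?h x) \<oplus>\<^bsub>TL.T\<^esub> TL.pure x (?h' x))"
  proof (rule TL.T.finsum_cong')
    show "TL.pure x (?h x \<oplus>\<^bsub>H\<^esub> ?h' x) = TL.pure x (?h x) \<oplus>\<^bsub>TL.T\<^esub> TL.pure x (?h' x)" if "x \<in> \<Lambda> \<union> \<Lambda>'" for x
      by (rule TL.pure_add_right[OF L[OF that] hc(2) hc(1)])
    show "(\<lambda>x. TL.pure x (?h x) \<oplus>\<^bsub>TL.T\<^esub> TL.pure x (?h' x)) \<in> \<Lambda> \<union> \<Lambda>' \<rightarrow> carrier TL.T"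
      by (intro Pi_I TL.T.a_closed TL.pure_closed L hc)
  qed simp
  ultimately have "s \<oplus>\<^bsub>TL.T\<^esub> t = (\<Oplus>\<^bsub>TL.T\<^esub>x\<in>\<Lambda> \<union> \<Lambda>'. TL.pure x (?h x \<oplus>\<^bsub>H\<^esub> ?h' x))" by simp
  moreover have "\<forall>x\<in>\<Lambda> \<union> \<Lambda>'. ?h x \<oplus>\<^bsub>H\<^esub> ?h' x \<in> carrier H" using hc by (intro ballI H.M.a_closed)
  moreover have "finite (\<Lambda> \<union> \<Lambda>')" "\<forall>x\<in>\<Lambda> \<union> \<Lambda>'. \<exists>\<gamma>>0. x \<in> GL \<gamma>" using E(1,2) E'(1,2) by auto
  ultimately have "expansion (s \<oplus>\<^bsub>TL.T\<^esub> t) (\<Lambda> \<union> \<Lambda>') (\<lambda>x. ?h x \<oplus>\<^bsub>H\<^esub> ?h' x)" by (simp only: expansion_def)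
  then show ?case by blast
qed

text \<open>The L-algebra map from L[T] that sends the coordinate to \<open>y\<close> is applied to
  the expansion of the coordinate. This recovers a point linearly from its values on finitely many
  elements of H.\<close>

lemma expansion_val:
  assumes S: "algebra L S" and y: "y \<in> carrier S" and e: "expansion (\<tau> X) \<Lambda> h"
  shows "y = (\<Oplus>\<^bsub>S\<^esub>x\<in>\<Lambda>. x \<odot>\<^bsub>S\<^esub> val S y (h x))"
proof -
  interpret S: algebra L S by (rule S)
  note E = expansionD[OF e] and pe = peval_alg_hom[OF S y]
  interpret g: ring_hom_cring TL.T S "peval L S y \<circ> \<psi>"
    by (rule UnivPoly.ring_hom_cringI[OF TL.T_cring S.M_cring ring_hom_trans[OF psi_hom alg_hom_ring_hom[OF pe]]])
  have "y = (peval L S y \<circ> \<psi>) (\<tau> X)" using peval_T[OF S y] by (simp add: psi_tau)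
  also have "\<dots> = (\<Oplus>\<^bsub>S\<^esub>x\<in>\<Lambda>. (peval L S y \<circ> \<psi>) (TL.pure x (h x)))"
    unfolding E(4) by (subst g.hom_finsum) (use E in \<open>auto simp: comp_def\<close>)
  also have "\<dots> = (\<Oplus>\<^bsub>S\<^esub>x\<in>\<Lambda>. x \<odot>\<^bsub>S\<^esub> val S y (h x))"
  proof (rule S.M.finsum_cong')
    fix x assume x: "x \<in> \<Lambda>"
    note j = j_closed[OF E(3)[OF x]]
    have "peval L S y (x \<odot>\<^bsub>UP L\<^esub> j (h x)) = x \<odot>\<^bsub>S\<^esub> peval L S y (j (h x))"
      by (rule alg_hom_smult[OF pe E(5)[OF x] j])
    then show "(peval L S y \<circ> \<psi>) (TL.pure x (h x)) = x \<odot>\<^bsub>S\<^esub> val S y (h x)"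
      using E(3,5)[OF x] j by (simp add: val_def psi_pure UL.monom_mult_is_smult)
  qed (use E alg_hom_closed[OF val_hom[OF S y]] in auto)
  finally show ?thesis .
qed

text \<open>Frobenius distributes over the expansion of the coordinate; after it the left factors
  are scalars from k and can be absorbed into H.\<close>

lemma Xq_in_image: "\<exists>t\<in>carrier H. j t = X [^]\<^bsub>UP L\<^esub> q"
proof -
  obtain \<Lambda> h where e: "expansion (\<tau> X) \<Lambda> h" using expansion_exists[OF tau_closed] by force
  note E = expansionD[OF e]
  have UA: "algebra L (UP L)" by (rule UP_algebra[OF Lg.cring_axioms])
  have "X = (\<Oplus>\<^bsub>UP L\<^esub>x\<in>\<Lambda>. x \<odot>\<^bsub>UP L\<^esub> val (UP L) X (h x))" by (rule expansion_val[OF UA _ e]) simp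
  also have "\<dots> = (\<Oplus>\<^bsub>UP L\<^esub>x\<in>\<Lambda>. monom (UP L) x 0 \<otimes>\<^bsub>UP L\<^esub> j (h x))"
    by (rule UL.P.finsum_cong') (use E j_closed val_UP_X in \<open>auto simp: UL.monom_mult_is_smult\<close>)
  finally have "X [^]\<^bsub>UP L\<^esub> q = (\<Oplus>\<^bsub>UP L\<^esub>x\<in>\<Lambda>. monom (UP L) x 0 \<otimes>\<^bsub>UP L\<^esub> j (h x)) [^]\<^bsub>UP L\<^esub> q" by simp
  also have "\<dots> = (\<Oplus>\<^bsub>UP L\<^esub>x\<in>\<Lambda>. (monom (UP L) x 0 \<otimes>\<^bsub>UP L\<^esub> j (h x)) [^]\<^bsub>UP L\<^esub> q)"
    by (rule UL.P.frobenius_power_sum[OF p UL_char]) (use E j_closed in auto)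
  finally have Xq: "X [^]\<^bsub>UP L\<^esub> q = (\<Oplus>\<^bsub>UP L\<^esub>x\<in>\<Lambda>. (monom (UP L) x 0 \<otimes>\<^bsub>UP L\<^esub> j (h x)) [^]\<^bsub>UP L\<^esub> q)" .
  have "\<forall>x\<in>\<Lambda>. \<exists>c\<in>carrier k. x [^]\<^bsub>L\<^esub> q = c \<odot>\<^bsub>L\<^esub> \<one>\<^bsub>L\<^esub>" using pow E(5) by blast
  then obtain c where c: "\<And>x. x \<in> \<Lambda> \<Longrightarrow> c x \<in> carrier k" "\<And>x. x \<in> \<Lambda> \<Longrightarrow> x [^]\<^bsub>L\<^esub> q = c x \<odot>\<^bsub>L\<^esub> \<one>\<^bsub>L\<^esub>" by metis
  interpret j: ring_hom_cring H "UP L" j by (rule UnivPoly.ring_hom_cringI[OF H.M_cring UL.UP_cring j_ring_hom])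
  define t where "t = (\<Oplus>\<^bsub>H\<^esub>x\<in>\<Lambda>. c x \<odot>\<^bsub>H\<^esub> h x [^]\<^bsub>H\<^esub> q)"
  have tc: "c x \<odot>\<^bsub>H\<^esub> h x [^]\<^bsub>H\<^esub> q \<in> carrier H" if "x \<in> \<Lambda>" for x using that c E by simp
  have "j t = (\<Oplus>\<^bsub>UP L\<^esub>x\<in>\<Lambda>. j (c x \<odot>\<^bsub>H\<^esub> h x [^]\<^bsub>H\<^esub> q))"
    unfolding t_def by (subst j.hom_finsum) (use tc in \<open>auto simp: comp_def\<close>)
  also have "\<dots> = (\<Oplus>\<^bsub>UP L\<^esub>x\<in>\<Lambda>. (monom (UP L) x 0 \<otimes>\<^bsub>UP L\<^esub> j (h x)) [^]\<^bsub>UP L\<^esub> q)"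
  proof (rule UL.P.finsum_cong')
    fix x assume x: "x \<in> \<Lambda>"
    have "(monom (UP L) x 0 \<otimes>\<^bsub>UP L\<^esub> j (h x)) [^]\<^bsub>UP L\<^esub> q = monom (UP L) (x [^]\<^bsub>L\<^esub> q) 0 \<otimes>\<^bsub>UP L\<^esub> j (h x) [^]\<^bsub>UP L\<^esub> q"
      using E(3,5)[OF x] j_closed by (simp add: UL.P.nat_pow_distrib UL.monom_pow)
    then show "j (c x \<odot>\<^bsub>H\<^esub> h x [^]\<^bsub>H\<^esub> q) = (monom (UP L) x 0 \<otimes>\<^bsub>UP L\<^esub> j (h x)) [^]\<^bsub>UP L\<^esub> q"
      using c[OF x] E(3)[OF x] j.hom_pow[of "h x" q] by (simp add: j_smult)
  qed (use E j_closed in auto)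
  finally have "j t = X [^]\<^bsub>UP L\<^esub> q" using Xq by simp
  moreover have "t \<in> carrier H" unfolding t_def using tc by (intro H.M.finsum_closed) auto
  ultimately show ?thesis by blast
qed

end

section \<open>Primitive elements of H\<close>

context centered_hopf_form
begin

abbreviation "\<T>\<^sub>1 \<equiv> plane_T1 L"
abbreviation "\<T>\<^sub>2 \<equiv> plane_T2 L"

text \<open>Embeds the tensor square of H into polynomials in two variables: the left factor is
  written in \<open>T2\<close>, the right one in \<open>T1\<close>. The comultiplication becomes
  substitution of \<open>T2 + T1\<close>.\<close>

definition "\<Phi> = lift2 (res \<A>) (val \<A> \<T>\<^sub>2) (val \<A> \<T>\<^sub>1)"

lemma Phi_hom: "\<Phi> \<in> alg_hom k HH.TA (res \<A>)"
  and Phi_pure: "y \<in> carrier H \<Longrightarrow> z \<in> carrier H \<Longrightarrow> \<Phi> (HH.pure y z) = val \<A> \<T>\<^sub>2 y \<otimes>\<^bsub>\<A>\<^esub> val \<A> \<T>\<^sub>1 z"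
  unfolding \<Phi>_def
  using lift2_hom[OF res_algebra[OF plane_alg] val_hom[OF plane_alg T12(2)] val_hom[OF plane_alg T12(1)]]
    lift2_pure[OF res_algebra[OF plane_alg] val_hom[OF plane_alg T12(2)] val_hom[OF plane_alg T12(1)]] by simp_all

lemma Phi_comult: "h \<in> carrier H \<Longrightarrow> \<Phi> (comult H h) = val \<A> (\<T>\<^sub>2 \<oplus>\<^bsub>\<A>\<^esub> \<T>\<^sub>1) h"
  using conv_val_add[OF plane_alg T12(2,1)] by (simp add: \<Phi>_def conv_def)

lemma val_plane_closed: "x \<in> carrier \<A> \<Longrightarrow> h \<in> carrier H \<Longrightarrow> val \<A> x h \<in> carrier \<A>"
  using alg_hom_closed[OF val_hom[OF plane_alg]] by simp

lemma Phi_left: "h \<in> carrier H \<Longrightarrow> \<Phi> (HH.pure h \<one>\<^bsub>H\<^esub>) = val \<A> \<T>\<^sub>2 h"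
  and Phi_right: "h \<in> carrier H \<Longrightarrow> \<Phi> (HH.pure \<one>\<^bsub>H\<^esub> h) = val \<A> \<T>\<^sub>1 h"
proof -
  interpret A: algebra L \<A> by (rule plane_alg)
  assume h: "h \<in> carrier H"
  show "\<Phi> (HH.pure h \<one>\<^bsub>H\<^esub>) = val \<A> \<T>\<^sub>2 h"
    using Phi_pure[OF h H.one_closed] alg_hom_one[OF val_hom[OF plane_alg T12(1)]] A.r_one[OF val_plane_closed[OF T12(2) h]] by simp
  show "\<Phi> (HH.pure \<one>\<^bsub>H\<^esub> h) = val \<A> \<T>\<^sub>1 h"
    using Phi_pure[OF H.one_closed h] alg_hom_one[OF val_hom[OF plane_alg T12(2)]] A.l_one[OF val_plane_closed[OF T12(1) h]] by simp
qed

abbreviation "Z \<equiv> base_change k L HH.TA"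

sublocale LZ: tensor_prod k L HH.TA
  using L_algebra HH.TA_algebra by (simp add: tensor_prod_def)

lemma Z_algebra: "algebra L Z" by (rule LZ.base_change_algebra)

lemma Z_smult: "x \<odot>\<^bsub>Z\<^esub> t = LZ.pure x \<one>\<^bsub>HH.TA\<^esub> \<otimes>\<^bsub>LZ.T\<^esub> t"
  by (simp add: base_change_def)

text \<open>\<open>\<Theta>\<close> sends \<open>T2\<close> and \<open>T1\<close> to the points
  given by the two inclusions of H. Composing it with \<open>\<Phi>\<close> gives the inclusion of
  the tensor square into its base change, which is injective; so \<open>\<Phi>\<close> is
  injective.\<close>

lemma Theta_exists: "\<exists>\<Theta>\<in>alg_hom L \<A> Z. \<forall>t\<in>carrier HH.T. \<Theta> (\<Phi> t) = LZ.pure \<one>\<^bsub>L\<^esub> t"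
proof -
  have eq: "alg_hom k H LZ.TA = alg_hom k H (res Z)" "alg_hom k HH.TA LZ.TA = alg_hom k HH.TA (res Z)"
    by (auto simp: alg_hom_def ring_hom_def LZ.TA_smult Z_smult)
  let ?a = "\<lambda>h. LZ.pure \<one>\<^bsub>L\<^esub> (HH.pure h \<one>\<^bsub>H\<^esub>)" and ?b = "\<lambda>h. LZ.pure \<one>\<^bsub>L\<^esub> (HH.pure \<one>\<^bsub>H\<^esub> h)"
  have a: "?a \<in> alg_hom k H (res Z)" and b: "?b \<in> alg_hom k H (res Z)"
    using alg_hom_comp[OF HH.inl_alg_hom LZ.inr_alg_hom] alg_hom_comp[OF HH.inr_alg_hom LZ.inr_alg_hom] by (simp_all add: comp_def flip: eq)
  note u = pt_closed[OF Z_algebra a] and v = pt_closed[OF Z_algebra b]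
  define \<Theta> where "\<Theta> = plane_eval L Z (pt Z ?b) (pt Z ?a)"
  have \<Theta>: "\<Theta> \<in> alg_hom L \<A> Z" unfolding \<Theta>_def by (rule plane_eval_alg_hom[OF Lg.cring_axioms Z_algebra v u])
  have Ta: "\<Theta> (val \<A> \<T>\<^sub>2 h) = ?a h" if h: "h \<in> carrier H" for h
    using val_natural[OF plane_alg Z_algebra \<Theta> T12(2) h] val_pt[OF Z_algebra a h]
      plane_eval_T2[OF Lg.cring_axioms Z_algebra v u] by (simp add: \<Theta>_def)
  have Tb: "\<Theta> (val \<A> \<T>\<^sub>1 h) = ?b h" if h: "h \<in> carrier H" for h
    using val_natural[OF plane_alg Z_algebra \<Theta> T12(1) h] val_pt[OF Z_algebra b h]
      plane_eval_T1[OF Lg.cring_axioms Z_algebra v u] by (simp add: \<Theta>_def)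
  have "(\<Theta> \<circ> \<Phi>) t = LZ.pure \<one>\<^bsub>L\<^esub> t" if t: "t \<in> carrier HH.T" for t
  proof (rule HH.tensor_alg_hom_eqI[OF alg_hom_comp[OF Phi_hom res_hom[OF plane_alg \<Theta>]] _ _ _ t])
    show "(\<lambda>t. LZ.pure \<one>\<^bsub>L\<^esub> t) \<in> alg_hom k HH.TA (res Z)" using LZ.inr_alg_hom eq by blast
  qed (simp_all add: Phi_left Phi_right Ta Tb)
  then show ?thesis using \<Theta> by auto
qed

lemma Phi_inj: "s \<in> carrier HH.T \<Longrightarrow> t \<in> carrier HH.T \<Longrightarrow> \<Phi> s = \<Phi> t \<Longrightarrow> s = t"
proof -
  assume s: "s \<in> carrier HH.T" and t: "t \<in> carrier HH.T" and eq: "\<Phi> s = \<Phi> t"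
  obtain \<Theta> where "\<forall>t\<in>carrier HH.T. \<Theta> (\<Phi> t) = LZ.pure \<one>\<^bsub>L\<^esub> t" using Theta_exists by blast
  then have "LZ.pure \<one>\<^bsub>L\<^esub> s = LZ.pure \<one>\<^bsub>L\<^esub> t" using s t eq by metis
  then show "s = t" by (rule pure_one_inj[OF HH.TA_algebra, simplified, OF s t])
qed

definition "prim h = HH.pure \<one>\<^bsub>H\<^esub> h \<oplus>\<^bsub>HH.T\<^esub> HH.pure h \<one>\<^bsub>H\<^esub>"

lemma prim_closed: "h \<in> carrier H \<Longrightarrow> prim h \<in> carrier HH.T"
  by (simp add: prim_def)

lemma Phi_prim:
  assumes h: "h \<in> carrier H" shows "\<Phi> (prim h) = val \<A> \<T>\<^sub>2 h \<oplus>\<^bsub>\<A>\<^esub> val \<A> \<T>\<^sub>1 h"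
proof -
  interpret A: algebra L \<A> by (rule plane_alg)
  have "\<Phi> (prim h) = val \<A> \<T>\<^sub>1 h \<oplus>\<^bsub>\<A>\<^esub> val \<A> \<T>\<^sub>2 h"
    using alg_hom_add[OF Phi_hom, of "HH.pure \<one>\<^bsub>H\<^esub> h" "HH.pure h \<one>\<^bsub>H\<^esub>"] h by (simp add: prim_def Phi_left Phi_right)
  then show ?thesis using A.M.a_comm[OF val_plane_closed[OF T12(1) h] val_plane_closed[OF T12(2) h]] by simp
qed

text \<open>Injectivity of \<open>\<Phi>\<close> turns an equation in the tensor square of H into a
  polynomial identity.\<close>

lemma primitive_iff:
  assumes h: "h \<in> carrier H"
  shows "comult H h = prim h \<longleftrightarrow> val \<A> (\<T>\<^sub>2 \<oplus>\<^bsub>\<A>\<^esub> \<T>\<^sub>1) h = val \<A> \<T>\<^sub>2 h \<oplus>\<^bsub>\<A>\<^esub> val \<A> \<T>\<^sub>1 h"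
  using Phi_comult[OF h] Phi_prim[OF h] Phi_inj[OF comult_closed[OF h] prim_closed[OF h]] by auto

text \<open>In an expansion \<open>\<Sum> x \<otimes> h x\<close> of the coordinate with the fewest terms the elements \<open>x\<close> are linearly
  independent over \<open>k\<close>. Additivity of the coordinate gives \<open>\<Sum> x \<otimes> (comult (h x) - prim (h x)) = 0\<close>, and
  a linear functional isolating one \<open>x\<close> shows that \<open>h x\<close> is primitive.\<close>

lemma primitive_exists: "\<exists>h\<in>carrier H. comult H h = prim h \<and> coeff (UP L) (j h) 1 \<noteq> \<zero>\<^bsub>L\<^esub>"
proof -
  interpret A: algebra L \<A> by (rule plane_alg)
  interpret Z: algebra L Z by (rule Z_algebra)
  have UA: "algebra L (UP L)" by (rule UP_algebra[OF Lg.cring_axioms])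
  define N where "N = (LEAST N. \<exists>\<Lambda> h. expansion (\<tau> X) \<Lambda> h \<and> card \<Lambda> = N)"
  have ex: "\<exists>N \<Lambda> h. expansion (\<tau> X) \<Lambda> h \<and> card \<Lambda> = N" using expansion_exists[OF tau_closed, of X] by auto
  obtain \<Lambda> h where e: "expansion (\<tau> X) \<Lambda> h" and card: "card \<Lambda> = N"
    using LeastI_ex[OF ex] unfolding N_def by blast
  have min: "N \<le> card \<Lambda>'" if "expansion (\<tau> X) \<Lambda>' h'" for \<Lambda>' h'
    unfolding N_def by (rule Least_le) (use that in blast)
  note E = expansionD[OF e]
  \<comment> \<open>The deviation of \<open>y\<close> from being primitive.\<close>
  define d where "d y = comult H y \<ominus>\<^bsub>HH.T\<^esub> prim y" for y
  have d_closed: "d y \<in> carrier HH.T" if "y \<in> carrier H" for y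
    using comult_closed[OF that] prim_closed[OF that] by (simp add: d_def)
  note v2 = val_plane_closed[OF T12(2)] and v1 = val_plane_closed[OF T12(1)]
  have T: "\<T>\<^sub>2 \<oplus>\<^bsub>\<A>\<^esub> \<T>\<^sub>1 \<in> carrier \<A>" by (rule A.M.a_closed[OF T12(2,1)])
  note vT = val_plane_closed[OF T]
  interpret Ph: ring_hom_cring HH.TA "res \<A>" \<Phi>
    by (rule UnivPoly.ring_hom_cringI[OF LZ.B.M_cring algebra.M_cring[OF res_algebra[OF plane_alg]] alg_hom_ring_hom[OF Phi_hom]])
  have Phi_d: "\<Phi> (d y) \<oplus>\<^bsub>\<A>\<^esub> (val \<A> \<T>\<^sub>2 y \<oplus>\<^bsub>\<A>\<^esub> val \<A> \<T>\<^sub>1 y) = val \<A> (\<T>\<^sub>2 \<oplus>\<^bsub>\<A>\<^esub> \<T>\<^sub>1) y" if y: "y \<in> carrier H" for y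
  proof -
    have "d y \<oplus>\<^bsub>HH.T\<^esub> prim y = comult H y"
      using comult_closed[OF y] prim_closed[OF y] by (simp add: d_def HH.T.minus_eq HH.T.a_assoc HH.T.l_neg)
    then have "\<Phi> (comult H y) = \<Phi> (d y) \<oplus>\<^bsub>\<A>\<^esub> \<Phi> (prim y)"
      using Ph.hom_add[of "d y" "prim y"] d_closed[OF y] prim_closed[OF y] by simp
    then show ?thesis using Phi_prim[OF y] Phi_comult[OF y] by simp
  qed
  have Phi_d_closed: "\<Phi> (d y) \<in> carrier \<A>" if "y \<in> carrier H" for y
    using Ph.hom_closed d_closed[OF that] by simp
  have sum0: "(\<Oplus>\<^bsub>\<A>\<^esub>x\<in>\<Lambda>. x \<odot>\<^bsub>\<A>\<^esub> \<Phi> (d (h x))) = \<zero>\<^bsub>\<A>\<^esub>"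
  proof -
    let ?s = "\<lambda>g. \<Oplus>\<^bsub>\<A>\<^esub>x\<in>\<Lambda>. x \<odot>\<^bsub>\<A>\<^esub> g (h x)"
    have sc: "?s g \<in> carrier \<A>" if "\<And>y. y \<in> carrier H \<Longrightarrow> g y \<in> carrier \<A>" for g
      by (rule A.M.finsum_closed) (intro Pi_I A.smult_closed that E(3,5))
    have sadd: "?s (\<lambda>y. g y \<oplus>\<^bsub>\<A>\<^esub> g' y) = ?s g \<oplus>\<^bsub>\<A>\<^esub> ?s g'"
      if g: "\<And>y. y \<in> carrier H \<Longrightarrow> g y \<in> carrier \<A>" "\<And>y. y \<in> carrier H \<Longrightarrow> g' y \<in> carrier \<A>" for g g'
    proof -
      have c: "x \<odot>\<^bsub>\<A>\<^esub> g (h x) \<in> carrier \<A>" "x \<odot>\<^bsub>\<A>\<^esub> g' (h x) \<in> carrier \<A>" if "x \<in> \<Lambda>" for x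
        by (intro A.smult_closed g E(3,5) that)+
      have "?s (\<lambda>y. g y \<oplus>\<^bsub>\<A>\<^esub> g' y) = (\<Oplus>\<^bsub>\<A>\<^esub>x\<in>\<Lambda>. x \<odot>\<^bsub>\<A>\<^esub> g (h x) \<oplus>\<^bsub>\<A>\<^esub> x \<odot>\<^bsub>\<A>\<^esub> g' (h x))"
      proof (rule A.M.finsum_cong'[OF refl])
        show "x \<odot>\<^bsub>\<A>\<^esub> (g (h x) \<oplus>\<^bsub>\<A>\<^esub> g' (h x)) = x \<odot>\<^bsub>\<A>\<^esub> g (h x) \<oplus>\<^bsub>\<A>\<^esub> x \<odot>\<^bsub>\<A>\<^esub> g' (h x)" if "x \<in> \<Lambda>" for x
          by (rule A.smult_r_distr[OF E(5)[OF that] g(1)[OF E(3)[OF that]] g(2)[OF E(3)[OF that]]])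
        show "(\<lambda>x. x \<odot>\<^bsub>\<A>\<^esub> g (h x) \<oplus>\<^bsub>\<A>\<^esub> x \<odot>\<^bsub>\<A>\<^esub> g' (h x)) \<in> \<Lambda> \<rightarrow> carrier \<A>" by (intro Pi_I A.M.a_closed c)
      qed
      also have "\<dots> = ?s g \<oplus>\<^bsub>\<A>\<^esub> ?s g'" by (rule A.M.finsum_addf) (intro Pi_I c, assumption)+
      finally show ?thesis .
    qed
    \<comment> \<open>The expansion of the coordinate is evaluated at \<open>T2 + T1\<close>, at
      \<open>T2\<close> and at \<open>T1\<close>. The contributions of the last two cancel against
      the first, which leaves only the deviations.\<close>
    have "\<T>\<^sub>2 \<oplus>\<^bsub>\<A>\<^esub> \<T>\<^sub>1 = ?s (val \<A> (\<T>\<^sub>2 \<oplus>\<^bsub>\<A>\<^esub> \<T>\<^sub>1))" by (rule expansion_val[OF plane_alg T e])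
    also have "\<dots> = ?s (\<lambda>y. \<Phi> (d y) \<oplus>\<^bsub>\<A>\<^esub> (val \<A> \<T>\<^sub>2 y \<oplus>\<^bsub>\<A>\<^esub> val \<A> \<T>\<^sub>1 y))"
    proof (rule A.M.finsum_cong'[OF refl])
      fix x assume "x \<in> \<Lambda>"
      then show "x \<odot>\<^bsub>\<A>\<^esub> val \<A> (\<T>\<^sub>2 \<oplus>\<^bsub>\<A>\<^esub> \<T>\<^sub>1) (h x) = x \<odot>\<^bsub>\<A>\<^esub> (\<Phi> (d (h x)) \<oplus>\<^bsub>\<A>\<^esub> (val \<A> \<T>\<^sub>2 (h x) \<oplus>\<^bsub>\<A>\<^esub> val \<A> \<T>\<^sub>1 (h x)))"
        using Phi_d[OF E(3)] by simp
    next
      show "(\<lambda>x. x \<odot>\<^bsub>\<A>\<^esub> (\<Phi> (d (h x)) \<oplus>\<^bsub>\<A>\<^esub> (val \<A> \<T>\<^sub>2 (h x) \<oplus>\<^bsub>\<A>\<^esub> val \<A> \<T>\<^sub>1 (h x)))) \<in> \<Lambda> \<rightarrow> carrier \<A>"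
        by (intro Pi_I A.smult_closed A.M.a_closed Phi_d_closed v1 v2 E(3,5))
    qed
    also have "\<dots> = ?s (\<lambda>y. \<Phi> (d y)) \<oplus>\<^bsub>\<A>\<^esub> ?s (\<lambda>y. val \<A> \<T>\<^sub>2 y \<oplus>\<^bsub>\<A>\<^esub> val \<A> \<T>\<^sub>1 y)"
      by (rule sadd) (intro Phi_d_closed v1 v2 A.M.a_closed, assumption+)+
    also have "?s (\<lambda>y. val \<A> \<T>\<^sub>2 y \<oplus>\<^bsub>\<A>\<^esub> val \<A> \<T>\<^sub>1 y) = ?s (val \<A> \<T>\<^sub>2) \<oplus>\<^bsub>\<A>\<^esub> ?s (val \<A> \<T>\<^sub>1)"
      by (rule sadd[OF v2 v1])
    also have "\<dots> = \<T>\<^sub>2 \<oplus>\<^bsub>\<A>\<^esub> \<T>\<^sub>1"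
      using expansion_val[OF plane_alg T12(2) e] expansion_val[OF plane_alg T12(1) e] by simp
    finally have "\<T>\<^sub>2 \<oplus>\<^bsub>\<A>\<^esub> \<T>\<^sub>1 = ?s (\<lambda>y. \<Phi> (d y)) \<oplus>\<^bsub>\<A>\<^esub> (\<T>\<^sub>2 \<oplus>\<^bsub>\<A>\<^esub> \<T>\<^sub>1)" .
    then show ?thesis by (rule A.M.add_absorbD[OF _ T sc[OF Phi_d_closed]])
  qed
  obtain \<Theta> where \<Theta>: "\<Theta> \<in> alg_hom L \<A> Z" "\<And>t. t \<in> carrier HH.T \<Longrightarrow> \<Theta> (\<Phi> t) = LZ.pure \<one>\<^bsub>L\<^esub> t" using Theta_exists by blast
  interpret Th: ring_hom_cring \<A> Z \<Theta>
    by (rule UnivPoly.ring_hom_cringI[OF A.M_cring Z.M_cring alg_hom_ring_hom[OF \<Theta>(1)]])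
  have sumZ: "(\<Oplus>\<^bsub>LZ.T\<^esub>x\<in>\<Lambda>. LZ.pure x (d (h x))) = \<zero>\<^bsub>LZ.T\<^esub>"
  proof -
    have c: "x \<odot>\<^bsub>\<A>\<^esub> \<Phi> (d (h x)) \<in> carrier \<A>" if "x \<in> \<Lambda>" for x
      by (rule A.smult_closed[OF E(5)[OF that] Phi_d_closed[OF E(3)[OF that]]])
    have "\<zero>\<^bsub>Z\<^esub> = \<Theta> (\<Oplus>\<^bsub>\<A>\<^esub>x\<in>\<Lambda>. x \<odot>\<^bsub>\<A>\<^esub> \<Phi> (d (h x)))" unfolding sum0 by (rule Th.hom_zero[symmetric])
    also have "\<dots> = (\<Oplus>\<^bsub>Z\<^esub>x\<in>\<Lambda>. \<Theta> (x \<odot>\<^bsub>\<A>\<^esub> \<Phi> (d (h x))))"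
      using Th.hom_finsum[of "\<lambda>x. x \<odot>\<^bsub>\<A>\<^esub> \<Phi> (d (h x))" \<Lambda>] c by (simp add: Pi_def comp_def del: plane_simps base_change_simps)
    also have "\<dots> = (\<Oplus>\<^bsub>Z\<^esub>x\<in>\<Lambda>. LZ.pure x (d (h x)))"
    proof (rule Z.M.finsum_cong'[OF refl])
      fix x assume x: "x \<in> \<Lambda>"
      note dc = d_closed[OF E(3)[OF x]]
      have "\<Theta> (x \<odot>\<^bsub>\<A>\<^esub> \<Phi> (d (h x))) = x \<odot>\<^bsub>Z\<^esub> LZ.pure \<one>\<^bsub>L\<^esub> (d (h x))"
        using alg_hom_smult[OF \<Theta>(1) E(5)[OF x] Phi_d_closed[OF E(3)[OF x]]] \<Theta>(2)[OF dc] by simp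
      then show "\<Theta> (x \<odot>\<^bsub>\<A>\<^esub> \<Phi> (d (h x))) = LZ.pure x (d (h x))"
        using LZ.pure_split[of x "d (h x)"] E(5)[OF x] dc by (simp add: Z_smult)
    qed (use E(5) d_closed[OF E(3)] in auto)
    also have "\<dots> = (\<Oplus>\<^bsub>LZ.T\<^esub>x\<in>\<Lambda>. LZ.pure x (d (h x)))" by (rule finsum_transfer) simp_all
    finally show ?thesis by simp
  qed
  have prim: "comult H (h e) = prim (h e)" if eL: "e \<in> \<Lambda>" for e
  proof -
    let ?\<Lambda> = "\<Lambda> - {e}"
    have fin: "finite ?\<Lambda>" using E(1) by simp
    let ?V = "{\<Oplus>\<^bsub>L\<^esub>x\<in>?\<Lambda>. c x \<odot>\<^bsub>L\<^esub> x | c. \<forall>x\<in>?\<Lambda>. c x \<in> carrier k}"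
    have V: "graded_subspace ?V" by (rule span_graded_subspace[OF fin]) (use E(2) in auto)
    \<comment> \<open>If \<open>e\<close> were a combination of the other left factors, its term
      could be distributed among the remaining ones, giving a shorter expansion.\<close>
    have "e \<notin> ?V"
    proof
      assume "e \<in> ?V"
      then obtain c where c: "e = (\<Oplus>\<^bsub>L\<^esub>x\<in>?\<Lambda>. c x \<odot>\<^bsub>L\<^esub> x)" "\<And>x. x \<in> ?\<Lambda> \<Longrightarrow> c x \<in> carrier k" by blast
      let ?h = "\<lambda>x. h x \<oplus>\<^bsub>H\<^esub> c x \<odot>\<^bsub>H\<^esub> h e"
      have he: "h e \<in> carrier H" by (rule E(3)[OF eL])
      have hc: "h x \<in> carrier H" "c x \<odot>\<^bsub>H\<^esub> h e \<in> carrier H" "x \<in> carrier L" "c x \<odot>\<^bsub>L\<^esub> x \<in> carrier L" if "x \<in> ?\<Lambda>" for x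
        using that E(3,5) c(2) he by auto
      have lin: "TL.pure (finsum L g I) y = (\<Oplus>\<^bsub>TL.T\<^esub>x\<in>I. TL.pure (g x) y)"
        if "finite I" "\<And>x. x \<in> I \<Longrightarrow> g x \<in> carrier L" "y \<in> carrier H" for g y and I :: "'l set"
        using that
      proof (induction I rule: finite_induct)
        case (insert x I)
        then have "g \<in> I \<rightarrow> carrier L" "g x \<in> carrier L" by auto
        then show ?case using insert by (simp add: TL.pure_add_left Pi_def)
      qed (simp add: TL.pure_zero_left)
      have "TL.pure e (h e) = (\<Oplus>\<^bsub>TL.T\<^esub>x\<in>?\<Lambda>. TL.pure (c x \<odot>\<^bsub>L\<^esub> x) (h e))"
        using lin[OF fin _ he, of "\<lambda>x. c x \<odot>\<^bsub>L\<^esub> x"] hc(4) unfolding c(1)[symmetric] by blast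
      also have "\<dots> = (\<Oplus>\<^bsub>TL.T\<^esub>x\<in>?\<Lambda>. TL.pure x (c x \<odot>\<^bsub>H\<^esub> h e))"
      proof (rule TL.T.finsum_cong'[OF refl])
        show "TL.pure (c x \<odot>\<^bsub>L\<^esub> x) (h e) = TL.pure x (c x \<odot>\<^bsub>H\<^esub> h e)" if "x \<in> ?\<Lambda>" for x
          by (rule TL.pure_smult[OF c(2)[OF that] hc(3)[OF that] he])
        show "(\<lambda>x. TL.pure x (c x \<odot>\<^bsub>H\<^esub> h e)) \<in> ?\<Lambda> \<rightarrow> carrier TL.T" using hc by (intro Pi_I TL.pure_closed)
      qed
      finally have pe: "TL.pure e (h e) = (\<Oplus>\<^bsub>TL.T\<^esub>x\<in>?\<Lambda>. TL.pure x (c x \<odot>\<^bsub>H\<^esub> h e))" .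
      have "\<tau> X = (\<Oplus>\<^bsub>TL.T\<^esub>x\<in>insert e ?\<Lambda>. TL.pure x (h x))" using E(4) insert_Diff[OF eL] by simp
      also have "\<dots> = TL.pure e (h e) \<oplus>\<^bsub>TL.T\<^esub> (\<Oplus>\<^bsub>TL.T\<^esub>x\<in>?\<Lambda>. TL.pure x (h x))"
        by (rule TL.T.finsum_insert[OF fin]) (use hc(1,3) he E(5)[OF eL] in auto)
      also have "\<dots> = (\<Oplus>\<^bsub>TL.T\<^esub>x\<in>?\<Lambda>. TL.pure x (c x \<odot>\<^bsub>H\<^esub> h e)) \<oplus>\<^bsub>TL.T\<^esub> (\<Oplus>\<^bsub>TL.T\<^esub>x\<in>?\<Lambda>. TL.pure x (h x))"
        unfolding pe ..
      also have "\<dots> = (\<Oplus>\<^bsub>TL.T\<^esub>x\<in>?\<Lambda>. TL.pure x (c x \<odot>\<^bsub>H\<^esub> h e) \<oplus>\<^bsub>TL.T\<^esub> TL.pure x (h x))"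
        by (rule TL.T.finsum_addf[symmetric]) (use hc in blast)+
      also have "\<dots> = (\<Oplus>\<^bsub>TL.T\<^esub>x\<in>?\<Lambda>. TL.pure x (?h x))"
      proof (rule TL.T.finsum_cong'[OF refl])
        fix x assume x: "x \<in> ?\<Lambda>"
        show "TL.pure x (c x \<odot>\<^bsub>H\<^esub> h e) \<oplus>\<^bsub>TL.T\<^esub> TL.pure x (h x) = TL.pure x (?h x)"
          using TL.pure_add_right[OF hc(3)[OF x] hc(2)[OF x] hc(1)[OF x]]
            TL.T.a_comm[OF TL.pure_closed[OF hc(3)[OF x] hc(2)[OF x]] TL.pure_closed[OF hc(3)[OF x] hc(1)[OF x]]] by simp
      next
        show "(\<lambda>x. TL.pure x (?h x)) \<in> ?\<Lambda> \<rightarrow> carrier TL.T" using hc by (intro Pi_I TL.pure_closed H.M.a_closed)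
      qed
      finally have "expansion (\<tau> X) ?\<Lambda> ?h"
        unfolding expansion_def using fin E(2) hc(1,2) H.M.a_closed by simp
      from min[OF this] have "card \<Lambda> \<le> card ?\<Lambda>" using card by simp
      then show False using card_Diff1_less[OF E(1) eL] by simp
    qed
    moreover obtain \<epsilon> where "\<epsilon> > 0" "e \<in> GL \<epsilon>" using E(2)[OF eL] by blast
    ultimately obtain \<omega> where \<omega>: "linear_form \<omega>" "\<forall>v\<in>?V. \<omega> v = \<zero>\<^bsub>k\<^esub>" "\<omega> e = \<one>\<^bsub>k\<^esub>"
      using linear_form_exists[OF V] by blast
    \<comment> \<open>The form vanishes on the span of the other left factors, in particular on each
      of them, so contraction of the relation leaves only the deviation of
      \<open>h e\<close>.\<close>
    have \<omega>0: "\<omega> x = \<zero>\<^bsub>k\<^esub>" if x: "x \<in> ?\<Lambda>" for x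
    proof -
      let ?c = "\<lambda>y. if x = y then \<one>\<^bsub>k\<^esub> else \<zero>\<^bsub>k\<^esub>"
      have "(\<Oplus>\<^bsub>L\<^esub>y\<in>?\<Lambda>. ?c y \<odot>\<^bsub>L\<^esub> y) = (\<Oplus>\<^bsub>L\<^esub>y\<in>?\<Lambda>. if x = y then y else \<zero>\<^bsub>L\<^esub>)"
        by (rule Lg.finsum_cong'[OF refl]) (use E(5) in auto)
      also have "\<dots> = x" using Lg.finsum_singleton[OF x fin, of "\<lambda>y. y"] E(5) by auto
      finally have "x \<in> ?V" by (intro CollectI exI[of _ ?c]) auto
      then show ?thesis using \<omega>(2) by blast
    qed
    have cp: "contract HH.TA \<omega> (LZ.pure x (d (h x))) = (if e = x then d (h x) else \<zero>\<^bsub>HH.TA\<^esub>)" if x: "x \<in> \<Lambda>" for x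
    proof -
      have dc: "d (h x) \<in> carrier HH.TA" using d_closed[OF E(3)[OF x]] by simp
      show ?thesis
        using contract_pure[OF HH.TA_algebra \<omega>(1) E(5)[OF x] dc] \<omega>(3) \<omega>0[of x] x LZ.B.smult_one[OF dc] LZ.B.smult_l_null[OF dc] by auto
    qed
    have "\<zero>\<^bsub>HH.TA\<^esub> = contract HH.TA \<omega> (\<Oplus>\<^bsub>LZ.T\<^esub>x\<in>\<Lambda>. LZ.pure x (d (h x)))"
      unfolding sumZ by (rule contract_zero[OF HH.TA_algebra \<omega>(1), symmetric])
    also have "\<dots> = (\<Oplus>\<^bsub>HH.TA\<^esub>x\<in>\<Lambda>. contract HH.TA \<omega> (LZ.pure x (d (h x))))"
      by (rule contract_finsum[OF HH.TA_algebra \<omega>(1) E(1)]) (use E(5) d_closed[OF E(3)] in simp)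
    also have "\<dots> = (\<Oplus>\<^bsub>HH.TA\<^esub>x\<in>\<Lambda>. if e = x then d (h x) else \<zero>\<^bsub>HH.TA\<^esub>)"
      by (rule LZ.B.M.finsum_cong'[OF refl]) (use cp d_closed[OF E(3)] in auto)
    also have "\<dots> = d (h e)"
      by (rule LZ.B.M.finsum_singleton[OF eL E(1)]) (use d_closed[OF E(3)] in auto)
    finally have "comult H (h e) \<ominus>\<^bsub>HH.T\<^esub> prim (h e) = \<zero>\<^bsub>HH.T\<^esub>" by (simp add: d_def)
    then show ?thesis using comult_closed[OF E(3)[OF eL]] prim_closed[OF E(3)[OF eL]] by simp
  qed
  \<comment> \<open>The linear coefficient of the coordinate is one, and it is a combination of the
    linear coefficients of the polynomials \<open>j (h x)\<close>.\<close>
  have "\<exists>e\<in>\<Lambda>. coeff (UP L) (j (h e)) 1 \<noteq> \<zero>\<^bsub>L\<^esub>"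
  proof (rule ccontr)
    assume "\<not> ?thesis"
    then have z: "coeff (UP L) (j (h x)) 1 = \<zero>\<^bsub>L\<^esub>" if "x \<in> \<Lambda>" for x using that by blast
    have "X = (\<Oplus>\<^bsub>UP L\<^esub>x\<in>\<Lambda>. x \<odot>\<^bsub>UP L\<^esub> val (UP L) X (h x))" by (rule expansion_val[OF UA _ e]) simp
    then have "coeff (UP L) X 1 = coeff (UP L) (\<Oplus>\<^bsub>UP L\<^esub>x\<in>\<Lambda>. x \<odot>\<^bsub>UP L\<^esub> val (UP L) X (h x)) 1" by simp
    also have "\<dots> = (\<Oplus>\<^bsub>L\<^esub>x\<in>\<Lambda>. coeff (UP L) (x \<odot>\<^bsub>UP L\<^esub> val (UP L) X (h x)) 1)"
      by (rule UL.coeff_finsum[OF E(1)]) (use E val_UP_X j_closed in auto)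
    also have "\<dots> = \<zero>\<^bsub>L\<^esub>"
      by (rule Lg.add.finprod_one_eqI) (use E val_UP_X j_closed z in auto)
    finally show False using LD.one_not_zero by simp
  qed
  then show ?thesis using prim E(3) by blast
qed

text \<open>The coefficients of a homogeneous part of \<open>j h\<close> are parts of the
  coefficients of \<open>j h\<close>. So exponents outside the powers of \<open>p\<close> remain
  absent, and it suffices to choose the degree such that the linear term survives.\<close>

lemma homogeneous_primitive_exists:
  "\<exists>s>0. \<exists>g\<in>GH s. coeff (UP L) (j g) 1 \<noteq> \<zero>\<^bsub>L\<^esub> \<and> (\<forall>i. coeff (UP L) (j g) i \<noteq> \<zero>\<^bsub>L\<^esub> \<longrightarrow> (\<exists>a. i = p ^ a))"
proof -
  obtain h where h: "h \<in> carrier H" "comult H h = prim h" "coeff (UP L) (j h) 1 \<noteq> \<zero>\<^bsub>L\<^esub>" using primitive_exists by blast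
  have pp: "\<exists>a. i = p ^ a" if "coeff (UP L) (j h) i \<noteq> \<zero>\<^bsub>L\<^esub>" for i
    by (rule additive_coeff[OF j_closed[OF h(1)] _ that]) (use primitive_iff[OF h(1), THEN iffD1, OF h(2)] in \<open>simp only: val_def\<close>)
  have hc: "coeff (UP L) (j (hcomp H GH \<gamma> h)) i = hcomp L GL (\<gamma> * (1 / r ^ i)) (coeff (UP L) (j h) i)" for \<gamma> i
  proof -
    have "hcomp L GL (\<gamma> * (1 / r ^ i)) (coeff (UP L) (j h) i) = coeff (UP L) (hcomp (UP L) LG \<gamma> (j h)) i"
      by (rule graded_map_hcomp[OF UL_graded Lg.graded j_closed[OF h(1)]])
         (use r_pos in \<open>auto simp: poly_grading_def\<close>)
    moreover have "hcomp (UP L) LG (\<gamma> * 1) (j h) = j (hcomp H GH \<gamma> h)"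
      by (rule graded_map_hcomp[OF GH.graded UL_graded h(1) j_closed ring_hom_add[OF j_ring_hom]]) (use j_homog in auto)
    ultimately show ?thesis by simp
  qed
  \<comment> \<open>A degree in which the linear coefficient has a nonzero part. Multiplying it by
    \<open>r\<close>, the degree of the variable, gives the degree of the desired part of
    \<open>h\<close>.\<close>
  obtain \<delta> where \<delta>: "hcomp L GL \<delta> (coeff (UP L) (j h) 1) \<noteq> \<zero>\<^bsub>L\<^esub>"
    using Lg.eq_hcompI[of "coeff (UP L) (j h) 1" "\<zero>\<^bsub>L\<^esub>"] h j_closed by (metis Lg.hcomp_zero Lg.zero_closed UL.coeff_closed)
  then have \<delta>0: "\<delta> > 0" using Lg.hcomp_props(2)[of "coeff (UP L) (j h) 1" \<delta>] j_closed[OF h(1)] by force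
  let ?s = "\<delta> * r" and ?g = "hcomp H GH (\<delta> * r) h"
  have s: "?s > 0" using \<delta>0 r_pos by simp
  have "?g \<in> GH ?s" by (rule GH.hcomp_props(1)[OF h(1) s])
  moreover have "coeff (UP L) (j ?g) 1 \<noteq> \<zero>\<^bsub>L\<^esub>" using hc[of ?s 1] \<delta> r_pos by simp
  moreover have "\<exists>a. i = p ^ a" if "coeff (UP L) (j ?g) i \<noteq> \<zero>\<^bsub>L\<^esub>" for i
    using that hc[of ?s i] pp[of i] Lg.hcomp_zero[of "?s * (1 / r ^ i)"] by metis
  ultimately show ?thesis using s by blast
qed

end

section \<open>Comparison of H with a curve\<close>

lemma alg_hom_inv_into:
  assumes A: "algebra k A" and f: "f \<in> alg_hom k A B" and bij: "bij_betw f (carrier A) (carrier B)"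
  shows "inv_into (carrier A) f \<in> alg_hom k B A"
proof (rule alg_homI)
  interpret A: algebra k A by (rule A)
  have "f \<in> ring_iso A B" using alg_hom_ring_hom[OF f] bij by (simp add: ring_iso_def)
  then show "inv_into (carrier A) f \<in> ring_hom B A"
    using ring_iso_set_sym[OF cring.axioms(1)[OF A.M_cring], of f B] by (simp add: ring_iso_def)
  fix c y assume c: "c \<in> carrier k" and y: "y \<in> carrier B"
  let ?x = "inv_into (carrier A) f y"
  have x: "?x \<in> carrier A" "f ?x = y" using bij y by (auto simp: bij_betw_def inv_into_into f_inv_into_f)
  have "f (c \<odot>\<^bsub>A\<^esub> ?x) = c \<odot>\<^bsub>B\<^esub> y" using alg_hom_smult[OF f c x(1)] x(2) by simp
  then show "inv_into (carrier A) f (c \<odot>\<^bsub>B\<^esub> y) = c \<odot>\<^bsub>A\<^esub> ?x"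
    using inv_into_f_f[OF bij_betw_imp_inj_on[OF bij] A.smult_closed[OF c x(1)]] by simp
qed

text \<open>\<open>t1\<close> and \<open>t2\<close> are the elements of H that the generators of the
  curve algebra are to hit; over L they become the q-th power of the coordinate and an additive
  polynomial.\<close>

locale presented_hopf_form = centered_hopf_form k Gk L GL p n r H GH \<psi> + root_curve k Gk L GL p n r s a b m
  for k :: "('k, 'm) ring_scheme" and Gk and L :: "('k, 'l) module" and GL p n r
    and H :: "('k, 'h) hopf" and GH \<psi> s a b m +
  fixes t1 t2
  assumes t1: "t1 \<in> carrier H" and j_t1: "j t1 = X [^]\<^bsub>UP L\<^esub> (p ^ n)"
    and t2: "t2 \<in> carrier H" and j_t2: "j t2 = ppoly L p b m"
begin

lemma t1_homog: "t1 \<in> GH (r ^ q)"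
  by (rule graded_inj_reflects[OF GH.graded UL_graded t1 j_ring_hom j_inj j_homog])
     (use r_pos j_t1 ULg.G_pow[OF r_pos X_homog] in auto)

lemma t2_homog: "t2 \<in> GH s"
  by (rule graded_inj_reflects[OF GH.graded UL_graded t2 j_ring_hom j_inj j_homog])
     (use s_pos j_t2 g_homog in auto)

lemma t_eqn: "t2 [^]\<^bsub>H\<^esub> q = peval k H t1 f"
proof (rule inj_onD[OF j_inj])
  interpret j: ring_hom_cring H "UP L" j by (rule UnivPoly.ring_hom_cringI[OF H.M_cring UL.UP_cring j_ring_hom])
  show "j (t2 [^]\<^bsub>H\<^esub> q) = j (peval k H t1 f)"
    using alg_hom_peval[OF H_alg UPL_algebra j_alg_hom t1 f_closed] g_pow by (simp add: j.hom_pow t2 j_t1 j_t2)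
  show "peval k H t1 f \<in> carrier H" by (rule alg_hom_closed[OF peval_alg_hom[OF H_alg t1] f_closed])
qed (use t2 in simp)

definition "\<phi> = hc.curve_lift H t1 t2"

lemma phi_hom: "\<phi> \<in> alg_hom k hc.H H"
  unfolding \<phi>_def hc.alg_hom_H by (rule hc.curve_lift_alg_hom[OF H_alg t1 t2 t_eqn])

lemma phi_T: "\<phi> hc.T1 = t1" "\<phi> hc.T2 = t2"
  unfolding \<phi>_def by (rule hc.curve_lift_T[OF H_alg t1 t2 t_eqn])+

lemma phi_homog: "\<gamma> > 0 \<Longrightarrow> x \<in> hc.CG \<gamma> \<Longrightarrow> \<phi> x \<in> GH \<gamma>"
  unfolding \<phi>_def
  by (rule hc.curve_lift_homog[OF H_alg t_eqn GH.pregraded_axioms GH.one_homog hc.scalar_homog[OF H_ga] t1_homog t2_homog])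

lemma j_phi: "x \<in> carrier hc.H \<Longrightarrow> j (\<phi> x) = \<kappa> x"
  using hc.H_alg_hom_eqI[OF UPL_algebra alg_hom_comp[OF phi_hom j_alg_hom] kappa_alg_hom]
  by (simp add: phi_T kappa_T j_t1 j_t2)

lemma chi_pure: "x \<in> carrier L \<Longrightarrow> y \<in> carrier hc.H \<Longrightarrow> \<chi> (TH.pure x y) = \<psi> (TL.pure x (\<phi> y))"
  using ring_hom_mult[OF chi_ring_hom, of "TH.pure x \<one>\<^bsub>hc.H\<^esub>" "TH.pure \<one>\<^bsub>L\<^esub> y"] chi_left[of x]
  by (simp add: psi_pure alg_hom_closed[OF phi_hom] chi_right j_phi TH.pure_split[of x y])

lemma phi_inj: "inj_on \<phi> (carrier hc.H)"
proof (rule inj_onI)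
  fix x y assume xy: "x \<in> carrier hc.H" "y \<in> carrier hc.H" "\<phi> x = \<phi> y"
  then have "\<chi> (TH.pure \<one>\<^bsub>L\<^esub> x) = \<chi> (TH.pure \<one>\<^bsub>L\<^esub> y)" using chi_pure by simp
  then have "TH.pure \<one>\<^bsub>L\<^esub> x = TH.pure \<one>\<^bsub>L\<^esub> y"
    using inj_onD[OF bij_betw_imp_inj_on[OF chi_bij]] TH.pure_closed[OF Lg.one_closed] xy by metis
  then show "x = y" by (rule pure_one_inj[OF hc.H_algebra xy(1,2)])
qed

text \<open>After base change \<open>\<phi>\<close> is bijective, so \<open>1 tensor y\<close> has a
  preimage \<open>t\<close>. A retraction of L onto k, applied to the left factor of
  \<open>t\<close>, yields a preimage of \<open>y\<close>.\<close>

lemma phi_surj: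
  assumes y: "y \<in> carrier H" shows "\<exists>x\<in>carrier hc.H. \<phi> x = y"
proof -
  obtain \<omega> where \<omega>: "linear_form \<omega>" "\<omega> \<one>\<^bsub>L\<^esub> = \<one>\<^bsub>k\<^esub>" using retraction_exists by blast
  note cH = contract_pure[OF H_alg \<omega>(1)] contract_add[OF H_alg \<omega>(1)]
  note cC = contract_pure[OF hc.H_algebra \<omega>(1)] contract_add[OF hc.H_algebra \<omega>(1)]
    contract_closed[OF hc.H_algebra \<omega>(1)]
  \<comment> \<open>\<open>\<tau> (\<chi> t)\<close> is the image of \<open>t\<close> under the base
    change of \<open>\<phi>\<close>; contracting the left factor commutes with \<open>\<phi>\<close>
    on the right one.\<close>
  have claim: "contract H \<omega> (\<tau> (\<chi> t)) = \<phi> (contract hc.H \<omega> t)" if "t \<in> carrier TH.T" for t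
    using that
  proof (induction t rule: TH.tensor_graded_induct)
    case (pure x y \<alpha> \<beta>)
    then have xy: "x \<in> carrier L" "y \<in> carrier hc.H"
      using Lg.G_carrier[of \<alpha> x] hc.CG.G_carrier[of \<beta> y] by auto
    note py = alg_hom_closed[OF phi_hom xy(2)]
    have \<omega>x: "\<omega> x \<in> carrier k" using \<omega>(1) xy by (simp add: linear_form_def)
    show ?case
      using alg_hom_smult[OF phi_hom \<omega>x xy(2)] cH(1)[OF xy(1) py] cC(1)[OF xy]
      by (simp only: chi_pure[OF xy] tau_psi[OF TL.pure_closed[OF xy(1) py]])
  next
    case (add s t)
    note c = ring_hom_closed[OF chi_ring_hom add(1)] ring_hom_closed[OF chi_ring_hom add(2)]
    have "\<tau> (\<chi> (s \<oplus>\<^bsub>TH.T\<^esub> t)) = \<tau> (\<chi> s) \<oplus>\<^bsub>TL.T\<^esub> \<tau> (\<chi> t)"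
      unfolding ring_hom_add[OF chi_ring_hom add(1,2)] by (rule ring_hom_add[OF tau_hom c])
    then show ?case
      using add cH(2)[OF tau_closed[OF c(1)] tau_closed[OF c(2)]] cC(2)[OF add(1,2)]
        alg_hom_add[OF phi_hom cC(3)[OF add(1)] cC(3)[OF add(2)]] by simp
  qed
  have "j y \<in> \<chi> ` carrier TH.T" unfolding bij_betw_imp_surj_on[OF chi_bij] by (rule j_closed[OF y])
  then obtain t where t: "j y = \<chi> t" "t \<in> carrier TH.T" by (rule imageE)
  have "\<tau> (j y) = TL.pure \<one>\<^bsub>L\<^esub> y" unfolding j_def by (rule tau_psi[OF TL.pure_closed[OF Lg.one_closed y]])
  then have "contract H \<omega> (\<tau> (\<chi> t)) = y"
    unfolding t(1)[symmetric] by (simp only: cH(1)[OF Lg.one_closed y] \<omega>(2) H.smult_one[OF y])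
  then have "\<phi> (contract hc.H \<omega> t) = y" by (simp only: claim[OF t(2)])
  then show ?thesis using cC(3)[OF t(2)] by blast
qed

lemma phi_bij: "bij_betw \<phi> (carrier hc.H) (carrier H)"
  using phi_inj phi_surj alg_hom_closed[OF phi_hom] by (auto simp: bij_betw_def)

lemma A_char: "[p] \<cdot>\<^bsub>\<A>\<^esub> \<one>\<^bsub>\<A>\<^esub> = \<zero>\<^bsub>\<A>\<^esub>"
proof -
  interpret A: algebra L \<A> by (rule plane_alg)
  show ?thesis by (rule char_transfer_hom[OF Lg.cring_axioms A.M_cring algebra_unit_hom[OF plane_alg] L_char])
qed

lemma t1_prim: "comult H t1 = prim t1"
proof -
  interpret A: algebra L \<A> by (rule plane_alg)
  note T12' = A.M.a_closed[OF T12(2,1)]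
  have "X [^]\<^bsub>UP L\<^esub> q = monom (UP L) \<one>\<^bsub>L\<^esub> q" by (simp add: UL.monom_pow)
  then have "val \<A> y t1 = y [^]\<^bsub>\<A>\<^esub> q" if y: "y \<in> carrier \<A>" for y
    using peval_monom[OF plane_alg y Lg.one_closed, of q] A.smult_one[OF A.nat_pow_closed[OF y, of q]]
    by (simp add: val_def j_t1)
  then show ?thesis
    unfolding primitive_iff[OF t1] using A.frobenius_power_add[OF p A_char T12(2,1)] T12' T12 by metis
qed

lemma t2_prim: "comult H t2 = prim t2"
  unfolding primitive_iff[OF t2] val_def j_t2
  by (rule peval_ppoly_add[OF plane_alg b_carrier p A_char T12(2,1)])

lemma counit_t: "counit H t1 = \<zero>\<^bsub>k\<^esub>" "counit H t2 = \<zero>\<^bsub>k\<^esub>"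
proof -
  have z: "counit H t = \<zero>\<^bsub>k\<^esub>" if t: "t \<in> carrier H" and c: "coeff (UP L) (j t) 0 = \<zero>\<^bsub>L\<^esub>" for t
    by (rule inj_onD[OF L_unit_inj]) (use centered[OF t] c counit_closed[OF t] in simp_all)
  show "counit H t1 = \<zero>\<^bsub>k\<^esub>" by (rule z[OF t1]) (use q_pos in \<open>simp add: j_t1 UL.monom_pow\<close>)
  have "0 \<notin> (\<lambda>j. p ^ j) ` {..m}" using p2 by auto
  then show "counit H t2 = \<zero>\<^bsub>k\<^esub>"
    by (intro z[OF t2]) (simp only: j_t2, rule coeff_ppoly(2)[OF Lg.cring_axioms b_carrier p2])
qed

text \<open>On a primitive element the antipode axiom reads
  \<open>t + antipode t = counit t\<close>.\<close>

lemma antipode_prim: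
  assumes t: "t \<in> carrier H" "comult H t = prim t" "counit H t = \<zero>\<^bsub>k\<^esub>"
  shows "antipode H t = \<ominus>\<^bsub>H\<^esub> t"
proof -
  note S = antipode_hom and c = alg_hom_closed[OF antipode_hom t(1)]
  note l = lift2_hom[OF H_alg S alg_hom_id] and lp = lift2_pure[OF H_alg S alg_hom_id]
  have "lift2 H (antipode H) id (prim t) = t \<oplus>\<^bsub>H\<^esub> antipode H t"
    using alg_hom_add[OF l, of "HH.pure \<one>\<^bsub>H\<^esub> t" "HH.pure t \<one>\<^bsub>H\<^esub>"] lp[OF H.one_closed t(1)] lp[OF t(1) H.one_closed]
      alg_hom_one[OF S] t(1) c by (simp add: prim_def)
  moreover have "lift2 H (antipode H) id (prim t) = \<zero>\<^bsub>H\<^esub>"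
    using conv_antipode[OF H_alg alg_hom_id t(1)] t by (simp add: conv_def)
  ultimately show ?thesis using H.M.minus_equality[of "antipode H t" t] c t(1) H.M.a_comm[OF t(1) c] by simp
qed

text \<open>\<open>\<phi>\<close> starts at the curve algebra because it comes from the universal
  property; the theorem asks for the opposite direction.\<close>

definition "\<theta> = inv_into (carrier hc.H) \<phi>"

lemma theta_hom: "\<theta> \<in> alg_hom k H hc.H"
  unfolding \<theta>_def by (rule alg_hom_inv_into[OF hc.H_algebra phi_hom phi_bij])

lemma theta_phi: "x \<in> carrier hc.H \<Longrightarrow> \<theta> (\<phi> x) = x"
  unfolding \<theta>_def by (rule inv_into_f_f[OF phi_inj])

lemma theta_t: "\<theta> t1 = hc.T1" "\<theta> t2 = hc.T2"
  using theta_phi[OF hc.T_closed_H(1)] theta_phi[OF hc.T_closed_H(2)] by (simp_all only: phi_T)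

lemma theta_homog:
  assumes "\<gamma> > 0" "y \<in> GH \<gamma>" shows "\<theta> y \<in> hc.CG \<gamma>"
proof -
  have y: "y \<in> carrier H" using assms by (rule GH.G_carrier)
  obtain x where x: "x \<in> carrier hc.H" "\<phi> x = y" using phi_surj[OF y] by blast
  have "x \<in> hc.CG \<gamma>"
    by (rule graded_inj_reflects[OF hc.H_graded GH.graded x(1) alg_hom_ring_hom[OF phi_hom] phi_inj phi_homog])
       (use assms x in auto)
  then show ?thesis using theta_phi[OF x(1)] x(2) by simp
qed

text \<open>An equality of algebra homomorphisms on the curve algebra, tested on \<open>T1\<close>
  and \<open>T2\<close>, whose images in H are primitive.\<close>

lemma theta_comult:
  assumes x: "x \<in> carrier hc.H"
  shows "comult hc.H x = tensor_map k hc.H hc.H \<theta> \<theta> (comult H (\<phi> x))"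
proof -
  note m = tensor_map_alg_hom[OF hc.H_algebra hc.H_algebra H_alg H_alg theta_hom theta_hom]
  have pr: "tensor_map k hc.H hc.H \<theta> \<theta> (prim t) = hc.prim (\<theta> t)" if "t \<in> carrier H" for t
    using alg_hom_add[OF m(1), of "HH.pure \<one>\<^bsub>H\<^esub> t" "HH.pure t \<one>\<^bsub>H\<^esub>"] m(2)[OF H.one_closed that] m(2)[OF that H.one_closed]
      alg_hom_one[OF theta_hom] that unfolding prim_def hc.prim_def by simp
  show ?thesis
    using hc.H_alg_hom_eqI[OF hc.HH.TA_algebra hc.comult_alg_hom alg_hom_comp[OF phi_hom alg_hom_comp[OF comult_hom m(1)]] _ _ x]
    by (simp only: comp_apply phi_T t1_prim t2_prim pr[OF t1] pr[OF t2] theta_t hc.comult_T simp_thms)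
qed

lemma theta_antipode:
  assumes x: "x \<in> carrier hc.H"
  shows "antipode hc.H x = \<theta> (antipode H (\<phi> x))"
proof -
  interpret th: ring_hom_cring H hc.H \<theta>
    by (rule UnivPoly.ring_hom_cringI[OF H.M_cring hc.H.M_cring alg_hom_ring_hom[OF theta_hom]])
  have "\<theta> (antipode H t1) = \<ominus>\<^bsub>hc.H\<^esub> hc.T1" "\<theta> (antipode H t2) = \<ominus>\<^bsub>hc.H\<^esub> hc.T2"
    using antipode_prim[OF t1 t1_prim counit_t(1)] antipode_prim[OF t2 t2_prim counit_t(2)]
      th.hom_a_inv[OF t1] th.hom_a_inv[OF t2] theta_t by simp_all
  then show ?thesis
    using hc.H_alg_hom_eqI[OF hc.H_algebra hc.antipode_alg_hom alg_hom_comp[OF phi_hom alg_hom_comp[OF antipode_hom theta_hom]] _ _ x]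
    by (simp only: comp_apply phi_T hc.antipode_T simp_thms)
qed

lemma theta_counit:
  assumes x: "x \<in> carrier hc.H"
  shows "counit hc.H x = counit H (\<phi> x)"
  using hc.H_alg_hom_eqI[OF self_algebra_algebra[OF LA.R_cring] hc.counit_alg_hom alg_hom_comp[OF phi_hom counit_hom] _ _ x]
  by (simp only: comp_apply phi_T counit_t hc.counit_T simp_thms)

lemma theta_iso: "\<theta> \<in> graded_hopf_iso k H GH hc.H hc.CG"
proof -
  have "bij_betw \<theta> (carrier H) (carrier hc.H)" unfolding \<theta>_def by (rule bij_betw_inv_into[OF phi_bij])
  moreover have "\<theta> \<in> graded_algebra_hom k H GH hc.H hc.CG" by (rule hc.alg_hom_graded[OF theta_hom theta_homog])
  moreover have "comult hc.H (\<theta> y) = tensor_map k hc.H hc.H \<theta> \<theta> (comult H y) \<and>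
      antipode hc.H (\<theta> y) = \<theta> (antipode H y) \<and> counit hc.H (\<theta> y) = counit H y" if y: "y \<in> carrier H" for y
  proof -
    obtain x where x: "x \<in> carrier hc.H" "\<phi> x = y" using phi_surj[OF y] by blast
    show ?thesis
      using theta_comult[OF x(1)] theta_antipode[OF x(1)] theta_counit[OF x(1)] theta_phi[OF x(1)] unfolding x(2) by simp
  qed
  ultimately show ?thesis unfolding graded_hopf_iso_def graded_algebra_iso_def by blast
qed

end

lemma (in centered_hopf_form) presentation_exists:
  "\<exists>s a b m t1 t2. presented_hopf_form k Gk L GL p n r H GH \<psi> s a b m t1 t2"
proof -
  obtain s t where s: "s > 0" and t: "t \<in> GH s" and t1: "coeff (UP L) (j t) 1 \<noteq> \<zero>\<^bsub>L\<^esub>"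
    and pp: "\<And>i. coeff (UP L) (j t) i \<noteq> \<zero>\<^bsub>L\<^esub> \<Longrightarrow> \<exists>a. i = p ^ a" using homogeneous_primitive_exists by blast
  have tc: "t \<in> carrier H" using GH.G_carrier[OF s t] .
  note jt = j_closed[OF tc]
  have p2: "p \<ge> 2" using p by (rule prime_ge_2_nat)
  \<comment> \<open>The degree of the polynomial is a safe bound for the number of terms: an
    exponent \<open>p ^ l\<close> that occurs is at most \<open>m\<close>, and
    \<open>l < p ^ l\<close>. Coefficients \<open>b i\<close> beyond the support are zero.\<close>
  define m where "m = deg L (j t)"
  define b where "b i = coeff (UP L) (j t) (p ^ i)" for i
  have b: "b i \<in> GL (s / r ^ (p ^ i))" for i using j_homog[OF s t] by (simp add: b_def poly_grading_def)
  have bc: "b i \<in> carrier L" for i using jt by (simp add: b_def)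
  have "\<forall>i. \<exists>c\<in>carrier k. b i [^]\<^bsub>L\<^esub> q = c \<odot>\<^bsub>L\<^esub> \<one>\<^bsub>L\<^esub>" using pow[OF bc] by blast
  then obtain a where a: "\<And>i. a i \<in> carrier k" "\<And>i. b i [^]\<^bsub>L\<^esub> q = a i \<odot>\<^bsub>L\<^esub> \<one>\<^bsub>L\<^esub>" by metis
  obtain t1 where t1H: "t1 \<in> carrier H" "j t1 = X [^]\<^bsub>UP L\<^esub> q" using Xq_in_image by blast
  have "j t = ppoly L p b m"
  proof (rule UL.up_eqI)
    show "ppoly L p b m \<in> carrier (UP L)" by (rule ppoly_closed[OF Lg.cring_axioms bc])
    fix i
    show "coeff (UP L) (j t) i = coeff (UP L) (ppoly L p b m) i"
    proof (cases "i \<in> (\<lambda>j. p ^ j) ` {..m}")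
      case True
      then obtain l where "l \<le> m" "i = p ^ l" by auto
      then show ?thesis using coeff_ppoly(1)[where k = L and a = b and j = l and m = m, OF Lg.cring_axioms bc p2] by (simp add: b_def)
    next
      case False
      have "coeff (UP L) (j t) i = \<zero>\<^bsub>L\<^esub>"
      proof (rule ccontr)
        assume nz: "coeff (UP L) (j t) i \<noteq> \<zero>\<^bsub>L\<^esub>"
        from pp[OF nz] obtain l where l: "i = p ^ l" ..
        with False have "m < l" by (metis atMost_iff imageI not_le)
        also have "l < p ^ l" by (rule power_gt_expt) (use p2 in simp)
        finally show False using nz UL.deg_aboveD[OF _ jt] l by (simp add: m_def)
      qed
      then show ?thesis using coeff_ppoly(2)[where k = L and a = b and m = m, OF Lg.cring_axioms bc p2 False] by simp
    qed
  qed (rule jt)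
  moreover have "b 0 \<noteq> \<zero>\<^bsub>L\<^esub>" using t1 by (simp add: b_def)
  ultimately have "presented_hopf_form k Gk L GL p n r H GH \<psi> s a b m t1 t"
    using s a b t1H tc
    by (intro presented_hopf_form.intro centered_hopf_form_axioms root_curve.intro root_form_axioms
        root_curve_axioms.intro presented_hopf_form_axioms.intro)
  then show ?thesis by blast
qed

text \<open>The nonzero homogeneous \<open>b 0\<close> is a unit of L of degree
  \<open>s / r\<close>.\<close>

lemma (in root_curve) type_degree: "s \<in> (\<lambda>\<gamma>. \<gamma> * r) ` unit_degrees L GL"
proof
  show "s = s / r * r" using r_pos by simp
  have b0': "b 0 \<in> GL (s / r)" "s / r > 0" using b[of 0] s_pos r_pos by simp_all
  then have "b 0 \<in> Units L" using LF b0 by (simp add: graded_field_def)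
  then show "s / r \<in> unit_degrees L GL" using b0' by (auto simp: unit_degrees_def)
qed

lemma (in root_curve) type_polynomial: "f \<in> homogeneous_p_polys k Gk p (r ^ q) (s ^ q)"
proof -
  have "a 0 \<noteq> \<zero>\<^bsub>k\<^esub>"
  proof
    assume "a 0 = \<zero>\<^bsub>k\<^esub>"
    then have "b 0 [^]\<^bsub>L\<^esub> q = \<zero>\<^bsub>L\<^esub>" using ab[of 0] by simp
    then show False using LD.nat_pow_eq_zero[of "b 0"] b_carrier[of 0] b0 by blast
  qed
  then show ?thesis using f_homog a unfolding homogeneous_p_polys_def ppoly_def by blast
qed

section \<open>From the data s and f to roots, and from a form to a centred coordinate\<close>

context root_form
begin

text \<open>Homogeneity of \<open>f\<close> fixes the degree of each \<open>a j\<close>, so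
  homogeneous q-th roots exist in L, and \<open>a 0\<close> nonzero forces \<open>b 0\<close>
  nonzero.\<close>

lemma root_curve_exists:
  assumes s: "s \<in> (\<lambda>\<gamma>. \<gamma> * r) ` unit_degrees L GL" and f: "f \<in> homogeneous_p_polys k Gk p (r ^ q) (s ^ q)"
  shows "\<exists>a b m. root_curve k Gk L GL p n r s a b m \<and> f = ppoly k p a m"
proof -
  have s0: "s > 0" using s r_pos by (auto simp: unit_degrees_def)
  obtain m a where a: "\<And>j. j \<le> m \<Longrightarrow> a j \<in> carrier k" "a 0 \<noteq> \<zero>\<^bsub>k\<^esub>" and fa: "f = ppoly k p a m"
    and fg: "f \<in> poly_grading k Gk (r ^ q) (s ^ q)"
    using f by (auto simp: homogeneous_p_polys_def ppoly_def)
  have p2: "p \<ge> 2" using p by (rule prime_ge_2_nat)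
  have "\<exists>b. b \<in> GL (s / r ^ (p ^ j)) \<and> b [^]\<^bsub>L\<^esub> q = a j \<odot>\<^bsub>L\<^esub> \<one>\<^bsub>L\<^esub>" if j: "j \<le> m" for j
  proof -
    have "coeff (UP k) (ppoly k p a m) (p ^ j) = a j" by (rule coeff_ppoly(1)[OF LA.R_cring a(1) p2 j])
    moreover have "coeff (UP k) f (p ^ j) \<in> Gk (s ^ q / (r ^ q) ^ (p ^ j))" using fg by (simp add: poly_grading_def)
    ultimately have "a j \<in> Gk (s ^ q / (r ^ q) ^ (p ^ j))" by (simp only: fa)
    moreover have "s ^ q / (r ^ q) ^ (p ^ j) > 0" using s0 r_pos by simp
    ultimately obtain \<delta> x where \<delta>: "\<delta> > 0" "x \<in> GL \<delta>" "\<delta> ^ q = s ^ q / (r ^ q) ^ (p ^ j)"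
      "x [^]\<^bsub>L\<^esub> q = a j \<odot>\<^bsub>L\<^esub> \<one>\<^bsub>L\<^esub>" using root by blast
    \<comment> \<open>The root comes with some degree of which only the q-th power is known;
      positive reals have unique q-th roots.\<close>
    have "\<delta> ^ q = (s / r ^ (p ^ j)) ^ q" by (simp add: \<delta>(3) power_divide mult.commute flip: power_mult)
    then have "\<delta> = s / r ^ (p ^ j)"
      using power_eq_iff_eq_base[OF q_pos, of \<delta> "s / r ^ (p ^ j)"] \<delta>(1) s0 r_pos by simp
    then show ?thesis using \<delta> by blast
  qed
  then obtain b where b: "\<And>j. j \<le> m \<Longrightarrow> b j \<in> GL (s / r ^ (p ^ j))" "\<And>j. j \<le> m \<Longrightarrow> b j [^]\<^bsub>L\<^esub> q = a j \<odot>\<^bsub>L\<^esub> \<one>\<^bsub>L\<^esub>"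
    by metis
  have "b 0 \<noteq> \<zero>\<^bsub>L\<^esub>"
  proof
    assume "b 0 = \<zero>\<^bsub>L\<^esub>"
    then have "a 0 \<odot>\<^bsub>L\<^esub> \<one>\<^bsub>L\<^esub> = \<zero>\<^bsub>k\<^esub> \<odot>\<^bsub>L\<^esub> \<one>\<^bsub>L\<^esub>" using b(2)[of 0] Lg.nat_pow_zero[of q] q_pos by simp
    then have "a 0 = \<zero>\<^bsub>k\<^esub>"
      by (rule inj_onD[OF graded_field_unit_inj[OF kF L_alg LD.one_not_zero]]) (use a in simp_all)
    then show False using a by simp
  qed
  then have "root_curve k Gk L GL p n r s a b m"
    using s0 a(1) b by (intro root_curve.intro root_form_axioms root_curve_axioms.intro)
  then show ?thesis using fa by blast
qed

lemma hopf_form_exists: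
  assumes H: "graded_hopf_algebra k Gk H GH"
    and form: "graded_form k Gk L GL (UP k) (poly_grading k Gk r) H GH"
  shows "\<exists>\<psi>. hopf_form k Gk L GL p n r H GH \<psi>"
proof -
  interpret ghopf k Gk H GH by (rule ghopf.intro[OF H])
  interpret TL: graded_tensor k L H Gk GL GH by (rule graded_tensorI[OF L_alg H_ga])
  obtain \<Psi> where \<Psi>: "\<Psi> \<in> ring_hom (base_change k L H) (base_change k L (UP k))"
    "\<And>x t. x \<in> carrier L \<Longrightarrow> t \<in> carrier TL.T \<Longrightarrow> \<Psi> (x \<odot>\<^bsub>base_change k L H\<^esub> t) = x \<odot>\<^bsub>base_change k L (UP k)\<^esub> \<Psi> t"
    "\<And>\<gamma> t. \<gamma> > 0 \<Longrightarrow> t \<in> TL.TG \<gamma> \<Longrightarrow> \<Psi> t \<in> TU.TG \<gamma>"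
    "bij_betw \<Psi> (carrier TL.T) (carrier TU.T)"
    using form unfolding graded_form_def graded_algebra_iso_def graded_algebra_hom_def by fastforce
  have hom: "\<Psi> \<in> ring_hom TL.T TU.T" using \<Psi>(1) by (simp add: ring_hom_def)
  have flat_bij: "bij_betw flat (carrier TU.T) (carrier (UP L))"
    by (rule bij_betw_of_inverses[OF ring_hom_closed[OF flat_ring_hom] ring_hom_closed[OF sharp_ring_hom] sharp_flat flat_sharp])
  have left: "\<Psi> (TL.pure x \<one>\<^bsub>H\<^esub>) = TU.pure x \<one>\<^bsub>UP k\<^esub>" if x: "x \<in> carrier L" for x
  proof -
    have "x \<odot>\<^bsub>base_change k L H\<^esub> \<one>\<^bsub>TL.T\<^esub> = TL.pure x \<one>\<^bsub>H\<^esub>"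
      "x \<odot>\<^bsub>base_change k L (UP k)\<^esub> \<one>\<^bsub>TU.T\<^esub> = TU.pure x \<one>\<^bsub>UP k\<^esub>"
      using x by (simp_all add: base_change_def)
    then show ?thesis using \<Psi>(2)[OF x TL.T.one_closed] ring_hom_one[OF hom] by simp
  qed
  have "hopf_form k Gk L GL p n r H GH (flat \<circ> \<Psi>)"
  proof (intro hopf_form.intro root_form_axioms ghopf_axioms hopf_form_axioms.intro)
    show "flat \<circ> \<Psi> \<in> ring_hom TL.T (UP L)" by (rule ring_hom_trans[OF hom flat_ring_hom])
    show "bij_betw (flat \<circ> \<Psi>) (carrier TL.T) (carrier (UP L))" by (rule bij_betw_trans[OF \<Psi>(4) flat_bij])
    show "(flat \<circ> \<Psi>) (TL.pure x \<one>\<^bsub>H\<^esub>) = monom (UP L) x 0" if "x \<in> carrier L" for x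
      using left[OF that] flat_left[OF that] by simp
    show "(flat \<circ> \<Psi>) t \<in> LG \<gamma>" if "\<gamma> > 0" "t \<in> TL.TG \<gamma>" for \<gamma> t
      using flat_homog[OF that(1) \<Psi>(3)[OF that]] by simp
  qed
  then show ?thesis by blast
qed

text \<open>Translation of the line, the substitution of \<open>T + d\<close> for \<open>T\<close>;
  it is graded when \<open>d\<close> has the degree \<open>r\<close> of the coordinate.\<close>

definition "shift d = peval L (UP L) (X \<oplus>\<^bsub>UP L\<^esub> monom (UP L) d 0)"

lemma UL_algebra: "algebra L (UP L)" by (rule UP_algebra[OF Lg.cring_axioms])

lemma shift_alg_hom: "d \<in> carrier L \<Longrightarrow> shift d \<in> alg_hom L (UP L) (UP L)"
  unfolding shift_def by (rule peval_alg_hom[OF UL_algebra]) simp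

lemma shift_const: "d \<in> carrier L \<Longrightarrow> x \<in> carrier L \<Longrightarrow> shift d (monom (UP L) x 0) = monom (UP L) x 0"
  using alg_hom_smult[OF shift_alg_hom, of d x "\<one>\<^bsub>UP L\<^esub>"] alg_hom_one[OF shift_alg_hom, of d]
  by (simp add: UP_smult_unit[OF Lg.cring_axioms])

lemma shift_X: "d \<in> carrier L \<Longrightarrow> shift d X = X \<oplus>\<^bsub>UP L\<^esub> monom (UP L) d 0"
  unfolding shift_def by (rule peval_T[OF UL_algebra]) simp

lemma shift_shift:
  assumes d: "d \<in> carrier L" "e \<in> carrier L" "d \<oplus>\<^bsub>L\<^esub> e = \<zero>\<^bsub>L\<^esub>" and P: "P \<in> carrier (UP L)"
  shows "shift d (shift e P) = P"
proof -
  have "monom (UP L) d 0 \<oplus>\<^bsub>UP L\<^esub> monom (UP L) e 0 = \<zero>\<^bsub>UP L\<^esub>"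
    using d UL.monom_add[of d e 0] by simp
  then have "shift d (shift e X) = X"
    using alg_hom_add[OF shift_alg_hom[OF d(1)], of X "monom (UP L) e 0"] d
    by (simp add: shift_X shift_const UL.P.a_assoc del: One_nat_def)
  then show ?thesis
    using UP_alg_hom_eqI[OF UL_algebra alg_hom_comp[OF shift_alg_hom[OF d(2)] shift_alg_hom[OF d(1)]] alg_hom_id _ P] by (simp del: One_nat_def)
qed

lemma shift_homog: "d \<in> GL r \<Longrightarrow> \<gamma> > 0 \<Longrightarrow> P \<in> LG \<gamma> \<Longrightarrow> shift d P \<in> LG \<gamma>"
  unfolding shift_def
  by (rule eval_homog[OF Lg.graded ULg.pregraded_axioms ULg.one_homog algebra_unit_hom[OF UL_algebra] _ r_pos])
     (auto intro!: ULg.G_add[OF r_pos X_homog] const_homog r_pos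
        simp: UP_smult_unit[OF Lg.cring_axioms] Lg.G_carrier simp del: One_nat_def)

text \<open>Taking constant terms is an algebra homomorphism to L, so both sides are determined by
  the image of the coordinate, which is \<open>d\<close> in either case.\<close>

lemma coeff_zero_shift:
  assumes d: "d \<in> carrier L" and P: "P \<in> carrier (UP L)"
  shows "coeff (UP L) (shift d P) 0 = peval L (self_algebra L) d P"
proof -
  let ?c = "\<lambda>P. coeff (UP L) P 0"
  have S: "algebra L (self_algebra L)" by (rule self_algebra_algebra[OF Lg.cring_axioms])
  have dS: "d \<in> carrier (self_algebra L)" using d by (simp add: self_algebra_def)
  have "?c \<in> alg_hom L (UP L) (self_algebra L)"
    by (rule alg_homI) (auto intro!: ring_hom_memI simp: self_algebra_def)
  from UP_alg_hom_eqI[OF S alg_hom_comp[OF shift_alg_hom[OF d] this] peval_alg_hom[OF S dS] _ P]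
  show ?thesis using d peval_T[OF S dS] by (simp add: shift_X del: One_nat_def)
qed

end

section \<open>The unit element as a point of the line\<close>

context hopf_form
begin

text \<open>The point of the affine line that corresponds to the unit element of the group.\<close>

definition "origin = pt (self_algebra L) (\<lambda>h. counit H h \<odot>\<^bsub>res (self_algebra L)\<^esub> \<one>\<^bsub>res (self_algebra L)\<^esub>)"

lemma S_algebra: "algebra L (self_algebra L)" by (rule self_algebra_algebra[OF Lg.cring_axioms])

lemma origin_closed: "origin \<in> carrier L"
  using pt_closed[OF S_algebra unit_pt_hom[OF res_algebra[OF S_algebra]]] by (simp add: origin_def self_algebra_def)

lemma origin_closed': "origin \<in> carrier (self_algebra L)"
  using origin_closed by (simp add: self_algebra_def)

lemma val_origin: "h \<in> carrier H \<Longrightarrow> peval L (self_algebra L) origin (j h) = counit H h \<odot>\<^bsub>L\<^esub> \<one>\<^bsub>L\<^esub>"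
  using val_pt[OF S_algebra unit_pt_hom[OF res_algebra[OF S_algebra]], of h] counit_closed[of h]
  by (simp add: origin_def val_def) (simp add: self_algebra_def)

lemma counit_homog: "\<gamma> > 0 \<Longrightarrow> h \<in> GH \<gamma> \<Longrightarrow> counit H h \<in> Gk \<gamma>"
  using hopf unfolding graded_hopf_algebra_def graded_algebra_hom_def by blast

text \<open>Translation by the origin respects degrees only if the origin has degree
  \<open>r\<close>. It is the value of the coordinate at the unit element, so one has to see that
  this evaluation preserves degrees.\<close>

lemma origin_homog: "origin \<in> GL r"
proof -
  let ?E = "peval L (self_algebra L) origin"
  note E = peval_alg_hom[OF S_algebra origin_closed']
  have Ec: "?E P \<in> carrier L" if "P \<in> carrier (UP L)" for P
    using alg_hom_closed[OF E that] by (simp add: self_algebra_def)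
  have Ea: "?E (P \<oplus>\<^bsub>UP L\<^esub> Q) = ?E P \<oplus>\<^bsub>L\<^esub> ?E Q" if "P \<in> carrier (UP L)" "Q \<in> carrier (UP L)" for P Q
    using alg_hom_add[OF E that] by (simp add: self_algebra_def)
  \<comment> \<open>Under \<open>\<psi>\<close> the evaluation sends a pure tensor of
    \<open>x\<close> and \<open>h\<close> to \<open>x\<close> times the counit of \<open>h\<close>,
    which preserves degrees. Arguing on pure homogeneous tensors uses only that
    \<open>\<psi>\<close> preserves degrees in the forward direction.\<close>
  have claim: "hcomp L GL \<gamma> (?E (\<psi> t)) = ?E (hcomp (UP L) LG \<gamma> (\<psi> t))" if "t \<in> carrier TL.T" for \<gamma> t
    using that
  proof (induction t rule: TL.tensor_graded_induct)
    case (pure x y \<alpha> \<beta>)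
    then have xy: "x \<in> carrier L" "y \<in> carrier H" using Lg.G_carrier[of \<alpha> x] GH.G_carrier[of \<beta> y] by auto
    have pos: "\<alpha> * \<beta> > 0" using pure by simp
    have 1: "\<psi> (TL.pure x y) \<in> LG (\<alpha> * \<beta>)"
      by (rule psi_homog[OF pos TL.pure_homog[OF pure refl]])
    have "\<psi> (TL.pure x y) = x \<odot>\<^bsub>UP L\<^esub> j y" using psi_pure[OF xy] xy j_closed by (simp add: UL.monom_mult_is_smult)
    then have "?E (\<psi> (TL.pure x y)) = x \<otimes>\<^bsub>L\<^esub> (counit H y \<odot>\<^bsub>L\<^esub> \<one>\<^bsub>L\<^esub>)"
      using alg_hom_smult[OF E xy(1) j_closed[OF xy(2)]] val_origin[OF xy(2)] by (simp add: self_algebra_def)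
    moreover have "counit H y \<odot>\<^bsub>L\<^esub> \<one>\<^bsub>L\<^esub> \<in> GL (\<beta> * 1)"
      using L_alg counit_homog[OF pure(2,4)] pure(2) Lg.one_homog unfolding graded_algebra_def by (metis zero_less_one)
    ultimately have 2: "?E (\<psi> (TL.pure x y)) \<in> GL (\<alpha> * \<beta>)" using Lg.G_mult[OF pure(1,2,3)] by simp
    have "?E \<zero>\<^bsub>UP L\<^esub> = \<zero>\<^bsub>L\<^esub>"
      using peval_monom[OF S_algebra origin_closed' Lg.zero_closed, of 0] by (simp add: self_algebra_def)
    then show ?case using Lg.hcomp_homog[OF pos 2, of \<gamma>] ULg.hcomp_homog[OF pos 1, of \<gamma>] by simp
  next
    case (add s t)
    note c = ring_hom_closed[OF psi_hom add(1)] ring_hom_closed[OF psi_hom add(2)]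
    show ?case
      using add(3,4) c by (simp add: ring_hom_add[OF psi_hom add(1,2)] Ea Lg.hcomp_add[OF Ec[OF c(1)] Ec[OF c(2)]] ULg.hcomp_add[OF c])
  qed
  have "?E X = origin" by (rule peval_T[OF S_algebra origin_closed'])
  moreover have "?E \<zero>\<^bsub>UP L\<^esub> = \<zero>\<^bsub>L\<^esub>"
    using peval_monom[OF S_algebra origin_closed' Lg.zero_closed, of 0] by (simp add: self_algebra_def)
  ultimately have "hcomp L GL \<gamma> origin = (if \<gamma> = r then origin else \<zero>\<^bsub>L\<^esub>)" for \<gamma>
    using claim[OF tau_closed, of X \<gamma>] ULg.hcomp_homog[OF r_pos X_homog, of \<gamma>] by (simp add: psi_tau)
  then show ?thesis using Lg.homog_iff_hcomp[OF r_pos origin_closed] by simp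
qed

text \<open>Substituting \<open>T + origin\<close> turns evaluation at the origin into taking the
  constant term, and translation by the negative of the origin inverts this.\<close>

lemma centered_hopf_form_exists: "\<exists>\<psi>'. centered_hopf_form k Gk L GL p n r H GH \<psi>'"
proof -
  let ?\<psi> = "shift origin \<circ> \<psi>" and ?m = "\<ominus>\<^bsub>L\<^esub> origin"
  note o = origin_closed and m = Lg.a_inv_closed[OF origin_closed]
  note sh = shift_alg_hom[OF o] and sh' = shift_alg_hom[OF m]
  have bij: "bij_betw (shift origin) (carrier (UP L)) (carrier (UP L))"
    by (rule bij_betw_of_inverses[where g = "shift ?m"])
       (rule alg_hom_closed[OF sh] alg_hom_closed[OF sh'] shift_shift[OF m o Lg.l_neg[OF o]] shift_shift[OF o m Lg.r_neg[OF o]];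
        assumption)+
  interpret c: hopf_form k Gk L GL p n r H GH ?\<psi>
  proof (intro hopf_form.intro root_form_axioms ghopf_axioms hopf_form_axioms.intro)
    show "?\<psi> \<in> ring_hom TL.T (UP L)" by (rule ring_hom_trans[OF psi_hom alg_hom_ring_hom[OF sh]])
    show "bij_betw ?\<psi> (carrier TL.T) (carrier (UP L))" by (rule bij_betw_trans[OF psi_bij bij])
    show "?\<psi> (TL.pure x \<one>\<^bsub>H\<^esub>) = monom (UP L) x 0" if "x \<in> carrier L" for x
      using that o by (simp add: psi_left shift_const)
    show "?\<psi> t \<in> LG \<gamma>" if "\<gamma> > 0" "t \<in> TL.TG \<gamma>" for \<gamma> t
      using shift_homog[OF origin_homog that(1) psi_homog[OF that]] by simp
  qed
  have "centered_hopf_form k Gk L GL p n r H GH ?\<psi>"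
  proof (intro centered_hopf_form.intro c.hopf_form_axioms centered_hopf_form_axioms.intro)
    fix h assume h: "h \<in> carrier H"
    have "c.j h = shift origin (j h)" by (simp add: c.j_def j_def)
    then show "coeff (UP L) (c.j h) 0 = counit H h \<odot>\<^bsub>L\<^esub> \<one>\<^bsub>L\<^esub>"
      using coeff_zero_shift[OF o j_closed[OF h]] val_origin[OF h] by simp
  qed
  then show ?thesis by blast
qed

end

theorem theorem3p10:
  fixes k :: "'k ring" and Gk :: "real \<Rightarrow> 'k set"
    and kbar :: "('k, 'c) module" and Gbar :: "real \<Rightarrow> 'c set"
    and p n :: nat and r :: real
    and H :: "('k, 'h) hopf" and GH :: "real \<Rightarrow> 'h set"
  assumes "graded_field k Gk"
    and "p > 0" and "has_characteristic (k\<lparr>carrier := Gk 1\<rparr>) p"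
    and "graded_algebraic_closure k Gk kbar Gbar"
    and "n \<ge> 1" and "r > 0"
  shows "let q = p ^ n;
             L = root_subfield k kbar q;
             GL = root_subfield_grading k kbar Gbar q;
             B = UP k;
             GB = poly_grading k Gk r
         in
           (\<forall>s f. s \<in> (\<lambda>\<gamma>. \<gamma> * r) ` unit_degrees L GL \<longrightarrow>
              f \<in> homogeneous_p_polys k Gk p (r ^ q) (s ^ q) \<longrightarrow>
              graded_hopf_algebra k Gk (curve_hopf k q f) (curve_grading k Gk q f (r ^ q) s) \<and>
              graded_form k Gk L GL B GB
                (curve_hopf k q f) (curve_grading k Gk q f (r ^ q) s)) \<and>
           (graded_hopf_algebra k Gk H GH \<and> graded_form k Gk L GL B GB H GH \<longrightarrow>
              (\<exists>s f. s \<in> (\<lambda>\<gamma>. \<gamma> * r) ` unit_degrees L GL \<and>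
                 f \<in> homogeneous_p_polys k Gk p (r ^ q) (s ^ q) \<and>
                 graded_hopf_iso k H GH
                   (curve_hopf k q f) (curve_grading k Gk q f (r ^ q) s) \<noteq> {}))"

proof -
  interpret root_ext k Gk "root_subfield k kbar (p ^ n)" "root_subfield_grading k kbar Gbar (p ^ n)" p n
    by (rule root_subfield_root_ext[OF assms(1-4)])
  interpret root_form k Gk "root_subfield k kbar (p ^ n)" "root_subfield_grading k kbar Gbar (p ^ n)" p n r
    by (intro root_form.intro root_ext_axioms root_form_axioms.intro) (rule assms)
  let ?L = "root_subfield k kbar (p ^ n)" and ?GL = "root_subfield_grading k kbar Gbar (p ^ n)"
  have "graded_hopf_algebra k Gk (curve_hopf k (p ^ n) f) (curve_grading k Gk (p ^ n) f (r ^ (p ^ n)) s) \<and>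
      graded_form k Gk ?L ?GL (UP k) (poly_grading k Gk r)
        (curve_hopf k (p ^ n) f) (curve_grading k Gk (p ^ n) f (r ^ (p ^ n)) s)"
    if s: "s \<in> (\<lambda>\<gamma>. \<gamma> * r) ` unit_degrees ?L ?GL"
      and f: "f \<in> homogeneous_p_polys k Gk p (r ^ (p ^ n)) (s ^ (p ^ n))" for s f
  proof -
    obtain a b m where rc: "root_curve k Gk ?L ?GL p n r s a b m" and fa: "f = ppoly k p a m"
      using root_curve_exists[OF s f] by blast
    interpret rc: root_curve k Gk ?L ?GL p n r s a b m by (rule rc)
    show ?thesis unfolding fa using rc.hc.graded_hopf rc.curve_graded_form by (rule conjI)
  qed
  moreover have "\<exists>s f. s \<in> (\<lambda>\<gamma>. \<gamma> * r) ` unit_degrees ?L ?GL \<and>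
      f \<in> homogeneous_p_polys k Gk p (r ^ (p ^ n)) (s ^ (p ^ n)) \<and>
      graded_hopf_iso k H GH (curve_hopf k (p ^ n) f) (curve_grading k Gk (p ^ n) f (r ^ (p ^ n)) s) \<noteq> {}"
    if H: "graded_hopf_algebra k Gk H GH" "graded_form k Gk ?L ?GL (UP k) (poly_grading k Gk r) H GH"
  proof -
    obtain \<psi> where "hopf_form k Gk ?L ?GL p n r H GH \<psi>" using hopf_form_exists[OF H] by blast
    then obtain \<psi>' where ch: "centered_hopf_form k Gk ?L ?GL p n r H GH \<psi>'"
      using hopf_form.centered_hopf_form_exists by blast
    obtain s a b m t1 t2 where ph: "presented_hopf_form k Gk ?L ?GL p n r H GH \<psi>' s a b m t1 t2"
      using centered_hopf_form.presentation_exists[OF ch] by blast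
    interpret rc: presented_hopf_form k Gk ?L ?GL p n r H GH \<psi>' s a b m t1 t2 by (rule ph)
    show ?thesis using rc.type_degree rc.type_polynomial rc.theta_iso by blast
  qed
  ultimately show ?thesis unfolding Let_def by blast
qed

end
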